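(* Let $\mathrm{Diag}_n=\{(\mathbf z,\tau)\in\mathbb C^n\times\mathfrak H: z_i-z_j\in\mathbb Z+\mathbb Z\tau\text{ for some }i\neq j\}$. On $(\mathbb C^n\times\mathfrak H)\setminus\mathrm{Diag}_n$ the connection $d-\bar\Delta(\mathbf z|\tau)d\tau-\sum_i\bar K_i(\mathbf z|\tau)dz_i$ is flat, i.e. for all $i$, $$\Big[\frac{\partial}{\partial\tau}-\bar\Delta(\mathbf z|\tau),\ \frac{\partial}{\partial z_i}-\bar K_i(\mathbf z|\tau)\Big]=0,$$ (and $[\partial_{z_i}-\bar K_i,\partial_{z_j}-\bar K_j]=0$), and moreover for all $i$ and $u\in\mathbb C$: $\bar\Delta(\mathbf z+\delta_i|\tau)=\bar\Delta(\mathbf z+u\textstyle\sum_j\delta_j|\tau)=\bar\Delta(\mathbf z|\tau)$ and $\bar\Delta(\mathbf z+\tau\delta_i|\tau)=e^{-2\pi\sqrt{-1}\,\mathrm{ad}\bar x_i}\big(\bar\Delta(\mathbf z|\tau)-\bar K_i(\mathbf z|\tau)\big)$.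
   Context: $\mathfrak t_{1,n}$ (over $\mathbb C$): generators $x_i,y_i$ ($1\le i\le n$), $t_{ij}$ ($i\ne j$); relations $t_{ij}=t_{ji}$, $[t_{ij},t_{ik}+t_{jk}]=0$, $[t_{ij},t_{kl}]=0$, $[x_i,y_j]=t_{ij}$ ($i\ne j$), $[x_i,x_j]=[y_i,y_j]=0$, $[x_i,y_i]=-\sum_{j\ne i}t_{ij}$, $[x_i,t_{jk}]=[y_i,t_{jk}]=0$, $[x_i+x_j,t_{ij}]=[y_i+y_j,t_{ij}]=0$ ($i,j,k,l$ distinct). $\bar{\mathfrak t}_{1,n}=\mathfrak t_{1,n}/(\sum x_i,\sum y_i)$, with images $\bar x_i,\bar y_i,\bar t_{ij}$. $\mathfrak d$: generators $\Delta_0,d,X,\delta_{2m}$ ($m\ge1$), relations $[d,X]=2X$, $[d,\Delta_0]=-2\Delta_0$, $[X,\Delta_0]=d$, $[\delta_{2m},X]=0$, $[d,\delta_{2m}]=2m\delta_{2m}$, $\mathrm{ad}(\Delta_0)^{2m+1}(\delta_{2m})=0$; it acts on $\bar{\mathfrak t}_{1,n}$ by derivations: $d(x_i)=x_i,d(y_i)=-y_i$, $X(y_i)=x_i$, $X(x_i)=0$, $\Delta_0(x_i)=y_i$, $\Delta_0(y_i)=0$, $d,X,\Delta_0$ kill $t_{ij}$, $\delta_{2m}(x_i)=0$, $\delta_{2m}(t_{ij})=[t_{ij},(\mathrm{ad}x_i)^{2m}t_{ij}]$, $\delta_{2m}(y_i)=\sum_{j\ne i}\frac12\sum_{p+q=2m-1}[(\mathrm{ad}x_i)^pt_{ij},(-\mathrm{ad}x_i)^qt_{ij}]$.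 Brackets are computed in the (degree-completed) semidirect product $\bar{\mathfrak t}_{1,n}\rtimes\mathfrak d$. $\theta(z|\tau)$: holomorphic on $\mathbb C\times\mathfrak H$, zero set $\mathbb Z+\mathbb Z\tau$, $\theta(z+1|\tau)=-\theta(z|\tau)=\theta(-z|\tau)$, $\theta(z+\tau|\tau)=-e^{-\pi\sqrt{-1}\tau}e^{-2\pi\sqrt{-1}z}\theta(z|\tau)$, $\theta'(0|\tau)=1$ (primes are $\partial_z$). $k(z,x|\tau)=\frac{\theta(z+x|\tau)}{\theta(z|\tau)\theta(x|\tau)}-\frac1x$, $g(z,x|\tau)=\partial_xk(z,x|\tau)$. $\bar K_i(\mathbf z|\tau)=-\bar y_i+\sum_{j\ne i}k(z_{ij},\mathrm{ad}\bar x_i|\tau)(\bar t_{ij})$, $z_{ij}=z_i-z_j$; $g(\mathbf z|\tau)=\sum_{i<j}g(z_{ij},\mathrm{ad}\bar x_i|\tau)(\bar t_{ij})$. Let $\varphi(x|\tau)=-x^{-2}-(\theta'/\theta)'(x|\tau)+\big(x^{-2}+(\theta'/\theta)'(x|\tau)\big)|_{x=0}=\sum_{m\ge1}b_{2m}(\tau)x^{2m}$ (equivalently $b_{2m}(\tau)=a_{2m}E_{2m+2}(\tau)$ with $a_{2m}=-(2m+1)B_{2m+2}(2\pi\sqrt{-1})^{2m+2}/(2m+2)!$, $B_r$ Bernoulli numbers, $E_{2m+2}$ Eisenstein series with constant term $1$). Set $\bar\Delta(\mathbf z|\tau)=-\frac1{2\pi\sqrt{-1}}\big(\Delta_0+\sum_{m\ge1}b_{2m}(\tau)\delta_{2m}\big)+\frac1{2\pi\sqrt{-1}}g(\mathbf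 z|\tau)$. *)

theory Defs
  imports "HOL-Complex_Analysis.Complex_Analysis"
begin

text \<open>Gx i, Gy i, Gt i j (i,j in 1..n), GD0 = Delta_0, Gd = d, GX = X, Gdel m = delta_{2m} (m >= 1).\<close>
datatype gen = Gx nat | Gy nat | Gt nat nat | GD0 | Gd | GX | Gdel nat

fun valid_gen :: "nat \<Rightarrow> gen \<Rightarrow> bool" where
  "valid_gen n (Gx i) = (i \<in> {1..n})"
| "valid_gen n (Gy i) = (i \<in> {1..n})"
| "valid_gen n (Gt i j) = (i \<in> {1..n} \<and> j \<in> {1..n} \<and> i \<noteq> j)"
| "valid_gen n GD0 = True"
| "valid_gen n Gd = True"
| "valid_gen n GX = True"
| "valid_gen n (Gdel m) = (m \<ge> 1)"

text \<open>Degree: x,y have degree 1, t degree 2, d,X,Delta_0 degree 0, delta_{2m} degree 2m+2.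
  All defining relations are homogeneous for this grading.\<close>
fun gdeg :: "gen \<Rightarrow> nat" where
  "gdeg (Gx i) = 1"
| "gdeg (Gy i) = 1"
| "gdeg (Gt i j) = 2"
| "gdeg GD0 = 0"
| "gdeg Gd = 0"
| "gdeg GX = 0"
| "gdeg (Gdel m) = 2 * m + 2"

definition wdeg :: "gen list \<Rightarrow> nat" where
  "wdeg w = sum_list (map gdeg w)"

section \<open>Degree-completed free associative algebra: formal noncommutative series\<close>

type_synonym ser = "gen list \<Rightarrow> complex"

definition sadd :: "ser \<Rightarrow> ser \<Rightarrow> ser" where "sadd a b = (\<lambda>w. a w + b w)"
definition sscale :: "complex \<Rightarrow> ser \<Rightarrow> ser" where "sscale c a = (\<lambda>w. c * a w)"
definition sneg :: "ser \<Rightarrow> ser" where "sneg a = (\<lambda>w. - a w)"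
definition ssub :: "ser \<Rightarrow> ser \<Rightarrow> ser" where "ssub a b = (\<lambda>w. a w - b w)"
definition smult :: "ser \<Rightarrow> ser \<Rightarrow> ser" where
  "smult a b = (\<lambda>w. \<Sum>k\<le>length w. a (take k w) * b (drop k w))"
definition sbr :: "ser \<Rightarrow> ser \<Rightarrow> ser" where "sbr a b = ssub (smult a b) (smult b a)"
definition sgen :: "gen \<Rightarrow> ser" where "sgen g = (\<lambda>w. if w = [g] then 1 else 0)"
definition sfin :: "('i \<Rightarrow> ser) \<Rightarrow> 'i set \<Rightarrow> ser" where
  "sfin f A = (\<lambda>w. \<Sum>j\<in>A. f j w)"
text \<open>Infinite sums, coefficientwise (each coefficient receives only finitely many nonzero terms
  in all uses below).\<close>
definition ssuminf :: "(nat \<Rightarrow> ser) \<Rightarrow> ser" where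
  "ssuminf f = (\<lambda>w. \<Sum>m. f m w)"
definition ad_pow :: "ser \<Rightarrow> nat \<Rightarrow> ser \<Rightarrow> ser" where
  "ad_pow a m b = ((sbr a) ^^ m) b"

abbreviation xx :: "nat \<Rightarrow> ser" where "xx i \<equiv> sgen (Gx i)"
abbreviation yy :: "nat \<Rightarrow> ser" where "yy i \<equiv> sgen (Gy i)"
abbreviation tt :: "nat \<Rightarrow> nat \<Rightarrow> ser" where "tt i j \<equiv> sgen (Gt i j)"
abbreviation sD0 :: ser where "sD0 \<equiv> sgen GD0"
abbreviation sdd :: ser where "sdd \<equiv> sgen Gd"
abbreviation sXX :: ser where "sXX \<equiv> sgen GX"
abbreviation sdel :: "nat \<Rightarrow> ser" where "sdel m \<equiv> sgen (Gdel m)"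

definition delta_y :: "nat \<Rightarrow> nat \<Rightarrow> nat \<Rightarrow> ser" where
  "delta_y n m i = sfin (\<lambda>j. sscale (1/2)
      (sfin (\<lambda>p. sbr (ad_pow (xx i) p (tt i j))
                     (sscale ((-1) ^ (2*m - 1 - p)) (ad_pow (xx i) (2*m - 1 - p) (tt i j))))
            {0..2*m - 1})) ({1..n} - {i})"

definition rels :: "nat \<Rightarrow> ser set" where
  "rels n =
     \<comment> \<open>relations of t_{1,n}\<close>
     {ssub (tt i j) (tt j i) | i j. distinct [i,j] \<and> set [i,j] \<subseteq> {1..n}}
   \<union> {sbr (tt i j) (sadd (tt i k) (tt j k)) | i j k. distinct [i,j,k] \<and> set [i,j,k] \<subseteq> {1..n}}
   \<union> {sbr (tt i j) (tt k l) | i j k l. distinct [i,j,k,l] \<and> set [i,j,k,l] \<subseteq> {1..n}}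
   \<union> {ssub (sbr (xx i) (yy j)) (tt i j) | i j. distinct [i,j] \<and> set [i,j] \<subseteq> {1..n}}
   \<union> {sbr (xx i) (xx j) | i j. distinct [i,j] \<and> set [i,j] \<subseteq> {1..n}}
   \<union> {sbr (yy i) (yy j) | i j. distinct [i,j] \<and> set [i,j] \<subseteq> {1..n}}
   \<union> {sadd (sbr (xx i) (yy i)) (sfin (\<lambda>j. tt i j) ({1..n} - {i})) | i. i \<in> {1..n}}
   \<union> {sbr (xx i) (tt j k) | i j k. distinct [i,j,k] \<and> set [i,j,k] \<subseteq> {1..n}}
   \<union> {sbr (yy i) (tt j k) | i j k. distinct [i,j,k] \<and> set [i,j,k] \<subseteq> {1..n}}
   \<union> {sbr (sadd (xx i) (xx j)) (tt i j) | i j. distinct [i,j] \<and> set [i,j] \<subseteq> {1..n}}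
   \<union> {sbr (sadd (yy i) (yy j)) (tt i j) | i j. distinct [i,j] \<and> set [i,j] \<subseteq> {1..n}}
     \<comment> \<open>passing to the quotient t_{1,n}-bar\<close>
   \<union> {sfin xx {1..n}, sfin yy {1..n}}
     \<comment> \<open>relations of d\<close>
   \<union> {ssub (sbr sdd sXX) (sscale 2 sXX), sadd (sbr sdd sD0) (sscale 2 sD0), ssub (sbr sXX sD0) sdd}
   \<union> {sbr (sdel m) sXX | m. m \<ge> 1}
   \<union> {ssub (sbr sdd (sdel m)) (sscale (of_nat (2*m)) (sdel m)) | m. m \<ge> 1}
   \<union> {ad_pow sD0 (2*m+1) (sdel m) | m. m \<ge> 1}
     \<comment> \<open>action of d on t_{1,n}-bar by derivations: [D,a] = D(a)\<close>
   \<union> {ssub (sbr sdd (xx i)) (xx i) | i. i \<in> {1..n}}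
   \<union> {sadd (sbr sdd (yy i)) (yy i) | i. i \<in> {1..n}}
   \<union> {ssub (sbr sXX (yy i)) (xx i) | i. i \<in> {1..n}}
   \<union> {sbr sXX (xx i) | i. i \<in> {1..n}}
   \<union> {ssub (sbr sD0 (xx i)) (yy i) | i. i \<in> {1..n}}
   \<union> {sbr sD0 (yy i) | i. i \<in> {1..n}}
   \<union> {sbr sdd (tt i j) | i j. distinct [i,j] \<and> set [i,j] \<subseteq> {1..n}}
   \<union> {sbr sXX (tt i j) | i j. distinct [i,j] \<and> set [i,j] \<subseteq> {1..n}}
   \<union> {sbr sD0 (tt i j) | i j. distinct [i,j] \<and> set [i,j] \<subseteq> {1..n}}
   \<union> {sbr (sdel m) (xx i) | m i. m \<ge> 1 \<and> i \<in> {1..n}}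
   \<union> {ssub (sbr (sdel m) (tt i j)) (sbr (tt i j) (ad_pow (xx i) (2*m) (tt i j)))
        | m i j. m \<ge> 1 \<and> distinct [i,j] \<and> set [i,j] \<subseteq> {1..n}}
   \<union> {ssub (sbr (sdel m) (yy i)) (delta_y n m i) | m i. m \<ge> 1 \<and> i \<in> {1..n}}"

text \<open>The Lie ideal generated by the relations inside the free Lie algebra (= Lie elements of the
  free associative algebra on the valid generators).\<close>
inductive_set lideal :: "nat \<Rightarrow> ser set" for n :: nat where
  rel: "r \<in> rels n \<Longrightarrow> r \<in> lideal n"
| zero: "(\<lambda>w. 0) \<in> lideal n"
| add: "a \<in> lideal n \<Longrightarrow> b \<in> lideal n \<Longrightarrow> sadd a b \<in> lideal n"
| scale: "a \<in> lideal n \<Longrightarrow> sscale c a \<in> lideal n"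
| brk: "valid_gen n g \<Longrightarrow> a \<in> lideal n \<Longrightarrow> sbr (sgen g) a \<in> lideal n"

text \<open>A (Lie) series represents zero in the degree-completed Lie algebra
  t_{1,n}-bar semidirect d iff each homogeneous component lies in the ideal.\<close>
definition lzero :: "nat \<Rightarrow> ser \<Rightarrow> bool" where
  "lzero n a \<longleftrightarrow> (\<forall>N. (\<lambda>w. if wdeg w = N then a w else 0) \<in> lideal n)"

definition leq :: "nat \<Rightarrow> ser \<Rightarrow> ser \<Rightarrow> bool" where
  "leq n a b \<longleftrightarrow> lzero n (ssub a b)"

definition lattice :: "complex \<Rightarrow> complex set" where
  "lattice \<tau> = {of_int a + of_int b * \<tau> | a b. True}"

definition taylor0 :: "(complex \<Rightarrow> complex) \<Rightarrow> nat \<Rightarrow> complex" where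
  "taylor0 f m = (deriv ^^ m) (\<lambda>x. if x = 0 then Lim (at 0) f else f x) 0 / fact m"

definition kfun :: "(complex \<Rightarrow> complex \<Rightarrow> complex) \<Rightarrow> complex \<Rightarrow> complex \<Rightarrow> complex \<Rightarrow> complex" where
  "kfun \<theta> z x \<tau> = \<theta> (z + x) \<tau> / (\<theta> z \<tau> * \<theta> x \<tau>) - 1 / x"

definition kcoef :: "(complex \<Rightarrow> complex \<Rightarrow> complex) \<Rightarrow> nat \<Rightarrow> complex \<Rightarrow> complex \<Rightarrow> complex" where
  "kcoef \<theta> m z \<tau> = taylor0 (\<lambda>x. kfun \<theta> z x \<tau>) m"

definition gcoef :: "(complex \<Rightarrow> complex \<Rightarrow> complex) \<Rightarrow> nat \<Rightarrow> complex \<Rightarrow> complex \<Rightarrow> complex" where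
  "gcoef \<theta> m z \<tau> = taylor0 (\<lambda>x. deriv (\<lambda>y. kfun \<theta> z y \<tau>) x) m"

definition logder2 :: "(complex \<Rightarrow> complex \<Rightarrow> complex) \<Rightarrow> complex \<Rightarrow> complex \<Rightarrow> complex" where
  "logder2 \<theta> x \<tau> = deriv (\<lambda>w. deriv (\<lambda>v. \<theta> v \<tau>) w / \<theta> w \<tau>) x"

definition phi :: "(complex \<Rightarrow> complex \<Rightarrow> complex) \<Rightarrow> complex \<Rightarrow> complex \<Rightarrow> complex" where
  "phi \<theta> x \<tau> = - 1 / x^2 - logder2 \<theta> x \<tau> + Lim (at 0) (\<lambda>y. 1 / y^2 + logder2 \<theta> y \<tau>)"

definition bcoef :: "(complex \<Rightarrow> complex \<Rightarrow> complex) \<Rightarrow> nat \<Rightarrow> complex \<Rightarrow> complex" where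
  "bcoef \<theta> m \<tau> = taylor0 (\<lambda>x. phi \<theta> x \<tau>) (2 * m)"

definition Kbar :: "(complex \<Rightarrow> complex \<Rightarrow> complex) \<Rightarrow> nat \<Rightarrow> nat \<Rightarrow> (nat \<Rightarrow> complex) \<Rightarrow> complex \<Rightarrow> ser" where
  "Kbar \<theta> n i z \<tau> = sadd (sneg (yy i))
     (sfin (\<lambda>j. ssuminf (\<lambda>m. sscale (kcoef \<theta> m (z i - z j) \<tau>) (ad_pow (xx i) m (tt i j))))
           ({1..n} - {i}))"

definition gsum :: "(complex \<Rightarrow> complex \<Rightarrow> complex) \<Rightarrow> nat \<Rightarrow> (nat \<Rightarrow> complex) \<Rightarrow> complex \<Rightarrow> ser" where
  "gsum \<theta> n z \<tau> =
     sfin (\<lambda>(i,j). ssuminf (\<lambda>m. sscale (gcoef \<theta> m (z i - z j) \<tau>) (ad_pow (xx i) m (tt i j))))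
          {(i,j). i \<in> {1..n} \<and> j \<in> {1..n} \<and> i < j}"

definition Deltabar :: "(complex \<Rightarrow> complex \<Rightarrow> complex) \<Rightarrow> nat \<Rightarrow> (nat \<Rightarrow> complex) \<Rightarrow> complex \<Rightarrow> ser" where
  "Deltabar \<theta> n z \<tau> =
     sadd (sscale (- 1 / (2 * of_real pi * \<i>))
             (sadd sD0 (ssuminf (\<lambda>m. sscale (bcoef \<theta> (Suc m) \<tau>) (sdel (Suc m))))))
          (sscale (1 / (2 * of_real pi * \<i>)) (gsum \<theta> n z \<tau>))"

definition dtau :: "((nat \<Rightarrow> complex) \<Rightarrow> complex \<Rightarrow> ser) \<Rightarrow> (nat \<Rightarrow> complex) \<Rightarrow> complex \<Rightarrow> ser" where
  "dtau F z \<tau> = (\<lambda>w. deriv (\<lambda>\<sigma>. F z \<sigma> w) \<tau>)"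

definition dz :: "nat \<Rightarrow> ((nat \<Rightarrow> complex) \<Rightarrow> complex \<Rightarrow> ser) \<Rightarrow> (nat \<Rightarrow> complex) \<Rightarrow> complex \<Rightarrow> ser" where
  "dz i F z \<tau> = (\<lambda>w. deriv (\<lambda>v. F (z(i := v)) \<tau> w) (z i))"

definition exp_ad :: "complex \<Rightarrow> ser \<Rightarrow> ser \<Rightarrow> ser" where
  "exp_ad c a b = ssuminf (\<lambda>m. sscale (c ^ m / fact m) (ad_pow a m b))"

end

theory Submission
  imports Defs
begin

text \<open>
  Both curvature equations are homogeneous for the degree, and in each degree they are identities
  between brackets of \<open>x\<close>, \<open>y\<close>, \<open>t\<close>, \<open>\<Delta>\<^sub>0\<close> and \<open>\<delta>\<close>. For three distinct indices all the brackets
  \<open>[ad x\<^sub>i\<^sup>p t\<^sub>i\<^sub>j, ad x\<^sub>j\<^sup>q t\<^sub>j\<^sub>l]\<close> are images of the single element \<open>[t\<^sub>i\<^sub>j, t\<^sub>j\<^sub>l]\<close> under polynomials in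
  \<open>ad x\<^sub>i, ad x\<^sub>j, ad x\<^sub>l\<close>, whose sum acts by zero; so the degree \<open>d\<close> part becomes an identity between
  polynomials in one variable \<open>u\<close>, and this is the coefficient of \<open>x\<^sup>d\<close> of the Fay identity for
  \<open>\<theta>(z + x)/(\<theta>(z)\<theta>(x))\<close> (or of its derivative) along the line \<open>(ux, x)\<close>. The terms with two
  indices reduce likewise to the addition theorem of the Weierstrass function, the derivatives in \<open>\<tau>\<close>
  and \<open>z\<close> match by the mixed heat equation, and the shift by \<open>\<tau>\<close> is the quasi-periodicity of \<open>\<theta>\<close>.
  The zeros and the quasi-periodicity force \<open>\<theta>\<close> to be, for each \<open>\<tau>\<close>, a multiple of the classical
  theta series, and this supplies the heat equation.
\<close>

section \<open>The associative algebra of formal noncommutative series\<close>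

text \<open>The curvature vanishes in two independent pieces: the bracket of the two connection
  forms is zero by itself, and so is the combination of their derivatives. The algebra therefore
  needs only identities between Taylor coefficients at one point, the derivatives only parity and
  the equation \<open>2 pi i dk/dtau = d^2 k/(dz dx)\<close>. What shapes the identities is the pole
  \<open>1/x\<close> subtracted in \<open>k\<close>: clearing it at the arguments \<open>x\<close>,
  \<open>ux\<close> and \<open>(u + 1)x\<close> produces the factors \<open>u\<close>,
  \<open>u + 1\<close> and the terms linear in \<open>k\<close>, which are what the brackets with
  \<open>y i\<close> and \<open>\<Delta>\<^sub>0\<close> contribute. With two indices the brackets
  of \<open>ad x\<^sup>p t\<close> and \<open>ad x\<^sup>q t\<close> are antisymmetric, so a
  polynomial matters only up to mirror images; the identity shows that it equals its mirror image,
  hence that the element equals its own negative. The normalisation \<open>\<theta>'(0) = 1\<close>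
  adds a term with \<open>\<theta>'''(0)\<close> to the classical heat equation. The same constant
  appears when the Fay identity is differentiated three times, and the two cancel.\<close>

lemma smult_assoc: "smult (smult a b) c = smult a (smult b c)"
proof
  fix w :: "gen list"
  define n where "n = length w"
  \<comment> \<open>\<open>h j i\<close> belongs to the cut of \<open>w\<close> into words of
    lengths \<open>j\<close>, \<open>i\<close> and the rest; both bracketings sum it over all such
    cuts.\<close>
  define h where "h = (\<lambda>j i. a (take j w) * b (take i (drop j w)) * c (drop (j + i) w))"
  have "smult (smult a b) c w = (\<Sum>k\<le>n. \<Sum>j\<le>k. h j (k - j))"
    unfolding smult_def n_def h_def
    by (intro sum.cong refl)
      (auto simp: sum_distrib_right min_def drop_take intro!: sum.cong)
  also have "\<dots> = (\<Sum>(j,i)\<in>{(j,i). j + i \<le> n}. h j i)"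
    by (rule sum.triangle_reindex_eq [symmetric])
  also have "{(j,i). j + i \<le> n} = (SIGMA j:{..n}. {..n - j})" by auto
  also have "(\<Sum>(j,i)\<in>(SIGMA j:{..n}. {..n - j}). h j i) = (\<Sum>j\<le>n. \<Sum>i\<le>n - j. h j i)"
    by (rule sum.Sigma [symmetric]) auto
  also have "\<dots> = smult a (smult b c) w"
    unfolding smult_def n_def h_def
    by (intro sum.cong refl)
      (auto simp: sum_distrib_left mult.assoc add.commute intro!: sum.cong)
  finally show "smult (smult a b) c w = smult a (smult b c) w" .
qed

lemma smult_linear:
  "smult (sadd a b) c = sadd (smult a c) (smult b c)"
  "smult c (sadd a b) = sadd (smult c a) (smult c b)"
  "smult (ssub a b) c = ssub (smult a c) (smult b c)"
  "smult c (ssub a b) = ssub (smult c a) (smult c b)"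
  "smult (sscale s a) c = sscale s (smult a c)"
  "smult c (sscale s a) = sscale s (smult c a)"
  "smult (\<lambda>w. 0) c = (\<lambda>w. 0)"
  "smult c (\<lambda>w. 0) = (\<lambda>w. 0)"
  by (auto simp: smult_def sadd_def ssub_def sscale_def fun_eq_iff algebra_simps sum.distrib
      sum_subtractf sum_distrib_left)

lemma sbr_linear:
  "sbr (sadd a b) c = sadd (sbr a c) (sbr b c)"
  "sbr c (sadd a b) = sadd (sbr c a) (sbr c b)"
  "sbr (ssub a b) c = ssub (sbr a c) (sbr b c)"
  "sbr c (ssub a b) = ssub (sbr c a) (sbr c b)"
  "sbr (sscale s a) c = sscale s (sbr a c)"
  "sbr c (sscale s a) = sscale s (sbr c a)"
  "sbr (\<lambda>w. 0) c = (\<lambda>w. 0)"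
  "sbr c (\<lambda>w. 0) = (\<lambda>w. 0)"
  unfolding sbr_def smult_linear
  by (auto simp: sadd_def ssub_def sscale_def fun_eq_iff algebra_simps)

lemma sbr_jacobi: "sbr (sbr a b) c = ssub (sbr a (sbr b c)) (sbr b (sbr a c))"
  unfolding sbr_def smult_linear smult_assoc
  by (simp add: ssub_def fun_eq_iff)

lemma sbr_antisym: "sbr a b = sscale (-1) (sbr b a)"
  by (simp add: sbr_def ssub_def sscale_def fun_eq_iff)

lemma sbr_self: "sbr a a = (\<lambda>w. 0)"
  by (simp add: sbr_def ssub_def)

definition wcomp :: "nat \<Rightarrow> ser \<Rightarrow> ser" where
  "wcomp N a = (\<lambda>w. if wdeg w = N then a w else 0)"

lemma wcomp_linear:
  "wcomp N (sadd a b) = sadd (wcomp N a) (wcomp N b)"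
  "wcomp N (ssub a b) = ssub (wcomp N a) (wcomp N b)"
  "wcomp N (sscale s a) = sscale s (wcomp N a)"
  "wcomp N (sneg a) = sneg (wcomp N a)"
  "wcomp N (sfin f A) = sfin (\<lambda>j. wcomp N (f j)) A"
  "wcomp N (\<lambda>w. 0) = (\<lambda>w. 0)"
  by (auto simp: wcomp_def sadd_def ssub_def sscale_def sneg_def sfin_def fun_eq_iff)

lemma wdeg_append: "wdeg (u @ v) = wdeg u + wdeg v"
  by (simp add: wdeg_def)

lemma wdeg_take_drop: "wdeg (take k w) + wdeg (drop k w) = wdeg w"
  by (metis append_take_drop_id wdeg_append)

text \<open>Degrees add when a word is cut, so each cut of a word of degree \<open>N\<close>
  survives for exactly one \<open>p\<close>, the degree of its first piece.\<close>

lemma comp_smult: "wcomp N (smult a b) = sfin (\<lambda>p. smult (wcomp p a) (wcomp (N - p) b)) {..N}"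
proof
  fix w
  have "sfin (\<lambda>p. smult (wcomp p a) (wcomp (N - p) b)) {..N} w
      = (\<Sum>k\<le>length w. \<Sum>p\<le>N. wcomp p a (take k w) * wcomp (N - p) b (drop k w))"
    unfolding sfin_def smult_def by (rule sum.swap)
  also have "\<dots> = (\<Sum>k\<le>length w. if wdeg w = N then a (take k w) * b (drop k w) else 0)"
  proof (intro sum.cong refl)
    fix k
    let ?q = "wdeg (take k w)"
    have "(\<Sum>p\<le>N. wcomp p a (take k w) * wcomp (N - p) b (drop k w))
        = (\<Sum>p\<le>N. if p = ?q then a (take k w) * wcomp (N - ?q) b (drop k w) else 0)"
      by (intro sum.cong) (auto simp: wcomp_def)
    also have "\<dots> = (if ?q \<le> N then a (take k w) * wcomp (N - ?q) b (drop k w) else 0)"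
      by (subst sum.delta) auto
    also have "\<dots> = (if wdeg w = N then a (take k w) * b (drop k w) else 0)"
      using wdeg_take_drop[of k w] by (auto simp: wcomp_def)
    finally show "(\<Sum>p\<le>N. wcomp p a (take k w) * wcomp (N - p) b (drop k w)) = \<dots>" .
  qed
  also have "\<dots> = wcomp N (smult a b) w" by (simp add: wcomp_def smult_def)
  finally show "wcomp N (smult a b) w = sfin (\<lambda>p. smult (wcomp p a) (wcomp (N - p) b)) {..N} w" ..
qed

lemma wcomp_sbr: "wcomp N (sbr a b) = sfin (\<lambda>p. sbr (wcomp p a) (wcomp (N - p) b)) {..N}"
proof -
  have "sfin (\<lambda>p. smult (wcomp p b) (wcomp (N - p) a)) {..N}
      = sfin (\<lambda>p. smult (wcomp (N - p) b) (wcomp p a)) {..N}"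
    unfolding sfin_def fun_eq_iff
    by (intro allI sum.reindex_bij_witness[of _ "\<lambda>p. N - p" "\<lambda>p. N - p"]) auto
  then show ?thesis
    unfolding sbr_def wcomp_linear comp_smult
    by (simp add: ssub_def sfin_def fun_eq_iff sum_subtractf)
qed

section \<open>The Lie algebra as a quotient type\<close>

text \<open>\<open>lideal\<close> is closed by definition only under brackets with single
  generators. Closure under brackets with arbitrary elements, without which the quotient has no
  bracket, holds for the elements of this set.\<close>

inductive_set LieP :: "nat \<Rightarrow> ser set" for n :: nat where
  gen: "valid_gen n g \<Longrightarrow> sgen g \<in> LieP n"
| zero: "(\<lambda>w. 0) \<in> LieP n"
| add: "a \<in> LieP n \<Longrightarrow> b \<in> LieP n \<Longrightarrow> sadd a b \<in> LieP n"
| scale: "a \<in> LieP n \<Longrightarrow> sscale c a \<in> LieP n"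
| brk: "a \<in> LieP n \<Longrightarrow> b \<in> LieP n \<Longrightarrow> sbr a b \<in> LieP n"

lemma ssub_eq: "ssub a b = sadd a (sscale (-1) b)"
  and sneg_eq: "sneg a = sscale (-1) a"
  by (auto simp: ssub_def sadd_def sscale_def sneg_def)

lemma sfin_insert: "finite A \<Longrightarrow> x \<notin> A \<Longrightarrow> sfin f (insert x A) = sadd (f x) (sfin f A)"
  and sfin_empty: "sfin f {} = (\<lambda>w. 0)"
  by (auto simp: sfin_def sadd_def)

lemma LieP_sub: "a \<in> LieP n \<Longrightarrow> b \<in> LieP n \<Longrightarrow> ssub a b \<in> LieP n"
  unfolding ssub_eq by (intro LieP.intros)

lemma LieP_neg: "a \<in> LieP n \<Longrightarrow> sneg a \<in> LieP n"
  unfolding sneg_eq by (intro LieP.intros)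

lemmas LieP_closed = LieP.zero LieP.add LieP.scale LieP.brk LieP_sub LieP_neg

lemma LieP_fin: "(\<And>j. j \<in> A \<Longrightarrow> f j \<in> LieP n) \<Longrightarrow> sfin f A \<in> LieP n"
proof (induction A rule: infinite_finite_induct)
  case (infinite A)
  then show ?case using LieP.zero[of n] by (simp add: sfin_def)
qed (auto simp: sfin_insert sfin_empty intro: LieP.intros)

lemma lideal_sub: "a \<in> lideal n \<Longrightarrow> b \<in> lideal n \<Longrightarrow> ssub a b \<in> lideal n"
  unfolding ssub_eq by (intro lideal.add lideal.scale)

text \<open>Induction on the Lie element: by the Jacobi identity a bracket with
  \<open>sbr b c\<close> is a difference of iterated brackets with \<open>b\<close> and
  \<open>c\<close>.\<close>

lemma lideal_brk:
  assumes "l \<in> LieP n" "a \<in> lideal n"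
  shows "sbr l a \<in> lideal n"
  using assms
proof (induction arbitrary: a)
  case (brk b c)
  then show ?case by (simp add: sbr_jacobi lideal_sub)
qed (auto simp: sbr_linear intro: lideal.intros)

lemma lideal_brk':
  assumes "l \<in> LieP n" "a \<in> lideal n"
  shows "sbr a l \<in> lideal n"
  using lideal_brk[OF assms] sbr_antisym[of a l] by (simp add: lideal.scale)

text \<open>The relations depend on \<open>n\<close>, so one type serves all \<open>n\<close> at once: its elements are
  families indexed by \<open>n\<close>, and the Lie algebra for a fixed \<open>n\<close> is embedded as the \<open>n\<close>-th factor.\<close>

definition lrel :: "(nat \<Rightarrow> ser) \<Rightarrow> (nat \<Rightarrow> ser) \<Rightarrow> bool" where
  "lrel f g \<longleftrightarrow> (\<forall>m. f m \<in> LieP m \<and> g m \<in> LieP m \<and> ssub (f m) (g m) \<in> lideal m)"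

\<comment> \<open>A partial quotient, since \<open>lrel\<close> is reflexive only on families of Lie
  elements.\<close>
quotient_type lie = "nat \<Rightarrow> ser" / partial: lrel
proof (rule part_equivpI)
  show "\<exists>x. lrel x x"
    by (rule exI[of _ "\<lambda>_ _. 0"]) (auto simp: lrel_def ssub_def intro: LieP.zero lideal.zero)
  show "symp lrel"
  proof (rule sympI)
    fix f g assume "lrel f g"
    moreover have "ssub (g m) (f m) = sscale (-1) (ssub (f m) (g m))" for m
      by (simp add: ssub_def sscale_def)
    ultimately show "lrel g f" by (simp add: lrel_def lideal.scale)
  qed
  show "transp lrel"
  proof (rule transpI)
    fix f g h assume "lrel f g" "lrel g h"
    moreover have "ssub (f m) (h m) = sadd (ssub (f m) (g m)) (ssub (g m) (h m))" for m
      by (simp add: ssub_def sadd_def)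
    ultimately show "lrel f h" by (simp add: lrel_def lideal.add)
  qed
qed

lemma lrel_eqI: "(\<And>m. f m = g m) \<Longrightarrow> (\<And>m. f m \<in> LieP m) \<Longrightarrow> lrel f g"
  by (auto simp: lrel_def ssub_def intro: lideal.zero)

lemma lrel_self: "lrel f f \<longleftrightarrow> (\<forall>m. f m \<in> LieP m)"
  by (auto simp: lrel_def ssub_def intro: lideal.zero)

lemma lrel_lin: "lrel f f' \<Longrightarrow> lrel g g' \<Longrightarrow>
   lrel (\<lambda>m. sadd (sscale c (f m)) (sscale d (g m))) (\<lambda>m. sadd (sscale c (f' m)) (sscale d (g' m)))"
proof -
  assume A: "lrel f f'" "lrel g g'"
  have "ssub (sadd (sscale c (f m)) (sscale d (g m))) (sadd (sscale c (f' m)) (sscale d (g' m)))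
     = sadd (sscale c (ssub (f m) (f' m))) (sscale d (ssub (g m) (g' m)))" for m
    by (simp add: ssub_def sadd_def sscale_def algebra_simps)
  with A show ?thesis by (simp add: lrel_def LieP.add LieP.scale lideal.add lideal.scale)
qed

lemma lrel_brk:
  assumes "lrel f f'" "lrel g g'"
  shows "lrel (\<lambda>m. sbr (f m) (g m)) (\<lambda>m. sbr (f' m) (g' m))"
proof -
  have "ssub (sbr (f m) (g m)) (sbr (f' m) (g' m))
     = sadd (sbr (ssub (f m) (f' m)) (g m)) (sbr (f' m) (ssub (g m) (g' m)))" for m
    unfolding sbr_linear by (simp add: ssub_def sadd_def)
  with assms show ?thesis
    by (simp add: lrel_def LieP.brk lideal.add lideal_brk lideal_brk')
qed

lemma lin_eqs:
  "sadd (sscale 1 a) (sscale 1 b) = sadd a b"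
  "sadd (sscale 1 a) (sscale (-1) b) = ssub a b"
  "sadd (sscale c a) (sscale 0 b) = sscale c a"
  by (auto simp: ssub_def sadd_def sscale_def)

instantiation lie :: ab_group_add
begin

lift_definition zero_lie :: lie is "\<lambda>m w. 0"
  by (rule lrel_eqI) (auto intro: LieP.zero)
lift_definition plus_lie :: "lie \<Rightarrow> lie \<Rightarrow> lie" is "\<lambda>f g m. sadd (f m) (g m)"
  using lrel_lin[of _ _ _ _ 1 1] by (simp add: lin_eqs)
lift_definition minus_lie :: "lie \<Rightarrow> lie \<Rightarrow> lie" is "\<lambda>f g m. ssub (f m) (g m)"
  using lrel_lin[of _ _ _ _ 1 "-1"] by (simp add: lin_eqs)
lift_definition uminus_lie :: "lie \<Rightarrow> lie" is "\<lambda>f m. sscale (-1) (f m)"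
  using lrel_lin[of _ _ _ _ "-1" 0] by (simp add: lin_eqs)

instance
proof
  fix a b c :: lie
  show "a + b + c = a + (b + c)"
    by transfer (rule lrel_eqI, simp add: sadd_def add.assoc, simp add: lrel_self LieP_closed)
  show "a + b = b + a"
    by transfer (rule lrel_eqI, simp add: sadd_def add.commute, simp add: lrel_self LieP_closed)
  show "0 + a = a"
    by transfer (rule lrel_eqI, simp add: sadd_def, simp add: lrel_self LieP_closed)
  show "-a + a = 0"
    by transfer (rule lrel_eqI, simp add: sadd_def sscale_def, simp add: lrel_self LieP_closed)
  show "a - b = a + - b"
    by transfer (rule lrel_eqI, simp add: ssub_eq, simp add: lrel_self LieP_closed)
qed

end

lift_definition cscale :: "complex \<Rightarrow> lie \<Rightarrow> lie" is "\<lambda>c f m. sscale c (f m)"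
  using lrel_lin[of _ _ _ _ _ 0] by (simp add: lin_eqs)

lift_definition br :: "lie \<Rightarrow> lie \<Rightarrow> lie" is "\<lambda>f g m. sbr (f m) (g m)"
  by (rule lrel_brk)

text \<open>The default 0 off the \<open>n\<close>-th factor and outside \<open>LieP n\<close> makes
  the map total. The homomorphism rules below therefore assume membership in
  \<open>LieP n\<close>.\<close>

lift_definition inL :: "nat \<Rightarrow> ser \<Rightarrow> lie" is
  "\<lambda>n a m. if m = n \<and> a \<in> LieP n then a else (\<lambda>w. 0)"
  by (rule lrel_eqI) (auto intro: LieP.zero)

global_interpretation cvec: vector_space cscale
proof
  fix a b and x y :: lie
  show "cscale a (x + y) = cscale a x + cscale a y"
    by transfer (rule lrel_eqI, simp add: sadd_def sscale_def algebra_simps, simp add: lrel_self LieP_closed)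
  show "cscale (a + b) x = cscale a x + cscale b x"
    by transfer (rule lrel_eqI, simp add: sadd_def sscale_def algebra_simps, simp add: lrel_self LieP_closed)
  show "cscale a (cscale b x) = cscale (a * b) x"
    by transfer (rule lrel_eqI, simp add: sscale_def algebra_simps, simp add: lrel_self LieP_closed)
  show "cscale 1 x = x"
    by transfer (rule lrel_eqI, simp add: sscale_def, simp add: lrel_self LieP_closed)
qed

lemma br_add_left: "br (a + b) c = br a c + br b c"
  by transfer (rule lrel_eqI, simp add: sbr_linear, simp add: lrel_self LieP_closed)

lemma br_scale_left: "br (cscale s a) c = cscale s (br a c)"
  by transfer (rule lrel_eqI, simp add: sbr_linear, simp add: lrel_self LieP_closed)

lemma br_self [simp]: "br a a = 0"
  by transfer (rule lrel_eqI, simp add: sbr_self, simp add: lrel_self LieP_closed)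

lemma br_antisym: "br a b = - br b a"
  by transfer (rule lrel_eqI, rule sbr_antisym, simp add: lrel_self LieP_closed)

lemma br_jacobi: "br (br a b) c = br a (br b c) - br b (br a c)"
  by transfer (rule lrel_eqI, rule sbr_jacobi, simp add: lrel_self LieP_closed)

lemma br_add_right: "br c (a + b) = br c a + br c b"
  using br_add_left[of a b c] br_antisym[of c] by simp

lemma br_scale_right: "br c (cscale s a) = cscale s (br c a)"
  using br_scale_left[of s a c] br_antisym[of c] by (simp add: cvec.scale_minus_right)

lemma br_zero [simp]: "br 0 a = 0" "br a 0 = 0"
  using br_scale_left[of 0 0 a] br_scale_right[of a 0 0] by simp_all

lemma br_minus_left: "br (- a) c = - br a c"
  using br_scale_left[of "-1" a c] by simp

lemma br_minus_right: "br c (- a) = - br c a"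
  using br_scale_right[of c "-1" a] by simp

lemma br_diff_left: "br (a - b) c = br a c - br b c"
  using br_add_left[of a "-b" c] by (simp add: br_minus_left)

lemma br_diff_right: "br c (a - b) = br c a - br c b"
  using br_add_right[of c a "-b"] by (simp add: br_minus_right)

lemma br_sum_left: "br (\<Sum>j\<in>A. f j) c = (\<Sum>j\<in>A. br (f j) c)"
  by (induction A rule: infinite_finite_induct) (auto simp: br_add_left)

lemma br_sum_right: "br c (\<Sum>j\<in>A. f j) = (\<Sum>j\<in>A. br c (f j))"
  by (induction A rule: infinite_finite_induct) (auto simp: br_add_right)

lemma inL_add: "a \<in> LieP n \<Longrightarrow> b \<in> LieP n \<Longrightarrow> inL n (sadd a b) = inL n a + inL n b"
  by transfer (rule lrel_eqI, simp_all add: LieP_closed, simp add: sadd_def)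

lemma inL_scale: "a \<in> LieP n \<Longrightarrow> inL n (sscale s a) = cscale s (inL n a)"
  by transfer (rule lrel_eqI, simp_all add: LieP_closed, simp add: sscale_def)

lemma inL_br: "a \<in> LieP n \<Longrightarrow> b \<in> LieP n \<Longrightarrow> inL n (sbr a b) = br (inL n a) (inL n b)"
  by transfer (rule lrel_eqI, simp_all add: LieP_closed sbr_linear)

lemma inL_zero [simp]: "inL n (\<lambda>w. 0) = 0"
  by transfer (rule lrel_eqI, simp_all add: LieP_closed)

lemma inL_neg: "a \<in> LieP n \<Longrightarrow> inL n (sneg a) = - inL n a"
  by (simp add: sneg_eq inL_scale)

lemma inL_sub: "a \<in> LieP n \<Longrightarrow> b \<in> LieP n \<Longrightarrow> inL n (ssub a b) = inL n a - inL n b"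
  by (simp add: ssub_eq inL_add inL_scale LieP.scale)

lemma inL_fin:
  "(\<And>j. j \<in> A \<Longrightarrow> f j \<in> LieP n) \<Longrightarrow> inL n (sfin f A) = (\<Sum>j\<in>A. inL n (f j))"
proof (induction A rule: infinite_finite_induct)
  case (infinite A)
  then show ?case by (simp add: sfin_def)
qed (auto simp: sfin_insert sfin_empty inL_add LieP_fin)

text \<open>The way back from \<open>lie\<close> to series: here an equation in the quotient becomes
  membership in the ideal.\<close>

lemma inL_zeroD: "a \<in> LieP n \<Longrightarrow> inL n a = 0 \<Longrightarrow> a \<in> lideal n"
proof (transfer)
  fix a :: ser and n
  assume "a \<in> LieP n" and "lrel (\<lambda>m. if m = n \<and> a \<in> LieP n then a else (\<lambda>w. 0)) (\<lambda>m w. 0)"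
  then show "a \<in> lideal n" unfolding lrel_def by (auto simp: ssub_def dest: spec[of _ n])
qed

lemma inL_ideal: "a \<in> LieP n \<Longrightarrow> a \<in> lideal n \<Longrightarrow> inL n a = 0"
  by transfer (auto simp: lrel_def ssub_def intro: LieP.zero lideal.zero)

section \<open>Series and their homogeneous components in the Lie algebra\<close>

text \<open>An infinite series has no single image in \<open>lie\<close>, whose elements come from
  Lie polynomials. It is described by the sequence of the images of its homogeneous parts.\<close>

definition rep :: "nat \<Rightarrow> ser \<Rightarrow> (nat \<Rightarrow> lie) \<Rightarrow> bool" where
  "rep n A a \<longleftrightarrow> (\<forall>N. wcomp N A \<in> LieP n \<and> inL n (wcomp N A) = a N)"

lemma rep_lzero: "rep n A (\<lambda>_. 0) \<Longrightarrow> lzero n A"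
  by (auto simp: rep_def lzero_def wcomp_def[symmetric] intro: inL_zeroD)

lemma rep_cong: "rep n A a \<Longrightarrow> (\<And>N. a N = b N) \<Longrightarrow> rep n A b"
  by (auto simp: rep_def)

lemma rep_add: "rep n A a \<Longrightarrow> rep n B b \<Longrightarrow> rep n (sadd A B) (\<lambda>N. a N + b N)"
  by (auto simp: rep_def wcomp_linear inL_add intro: LieP.intros)

lemma rep_sub: "rep n A a \<Longrightarrow> rep n B b \<Longrightarrow> rep n (ssub A B) (\<lambda>N. a N - b N)"
  by (auto simp: rep_def wcomp_linear inL_sub intro: LieP_sub)

lemma rep_neg: "rep n A a \<Longrightarrow> rep n (sneg A) (\<lambda>N. - a N)"
  by (auto simp: rep_def wcomp_linear inL_neg intro: LieP_neg)

lemma rep_scale: "rep n A a \<Longrightarrow> rep n (sscale s A) (\<lambda>N. cscale s (a N))"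
  by (auto simp: rep_def wcomp_linear inL_scale intro: LieP.intros)

lemma rep_fin: "(\<And>j. j \<in> S \<Longrightarrow> rep n (A j) (a j)) \<Longrightarrow> rep n (sfin A S) (\<lambda>N. \<Sum>j\<in>S. a j N)"
  by (auto simp: rep_def wcomp_linear inL_fin intro!: LieP_fin)

lemma rep_br: "rep n A a \<Longrightarrow> rep n B b \<Longrightarrow> rep n (sbr A B) (\<lambda>N. \<Sum>p\<le>N. br (a p) (b (N - p)))"
  unfolding rep_def wcomp_sbr
  by (subst inL_fin) (auto simp: inL_br intro!: LieP_fin intro: LieP.brk)

lemma rep_gen: "valid_gen n g \<Longrightarrow> rep n (sgen g) (\<lambda>N. if N = gdeg g then inL n (sgen g) else 0)"
proof -
  assume "valid_gen n g"
  moreover have "wcomp N (sgen g) = (if N = gdeg g then sgen g else (\<lambda>w. 0))" for N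
    by (auto simp: wcomp_def sgen_def wdeg_def)
  ultimately show ?thesis by (auto simp: rep_def intro: LieP.intros)
qed

text \<open>This makes coefficientwise infinite sums finite: if the \<open>m\<close>-th term
  vanishes below degree \<open>m\<close>, a word of degree \<open>D\<close> receives contributions
  only from \<open>m\<close> up to \<open>D\<close>.\<close>

definition vanishes_below :: "nat \<Rightarrow> ser \<Rightarrow> bool" where
  "vanishes_below m A \<longleftrightarrow> (\<forall>w. wdeg w < m \<longrightarrow> A w = 0)"

lemma vanishes_below_suminf: "(\<And>m. vanishes_below m (f m)) \<Longrightarrow> ssuminf f w = (\<Sum>m\<le>wdeg w. f m w)"
  unfolding ssuminf_def by (intro suminf_finite) (auto simp: vanishes_below_def not_le)

lemma rep_suminf:
  assumes "\<And>m. rep n (f m) (a m)" "\<And>m. vanishes_below m (f m)"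
  shows "rep n (ssuminf f) (\<lambda>N. \<Sum>m\<le>N. a m N)"
proof -
  have "wcomp N (ssuminf f) = sfin (\<lambda>m. wcomp N (f m)) {..N}" for N
    by (auto simp: wcomp_def sfin_def fun_eq_iff vanishes_below_suminf[OF assms(2)])
  then show ?thesis using assms(1)
    by (auto simp: rep_def inL_fin intro!: LieP_fin)
qed

lemma vanishes_below_smult: "vanishes_below k a \<Longrightarrow> vanishes_below l b \<Longrightarrow> vanishes_below (k + l) (smult a b)"
  unfolding vanishes_below_def smult_def
proof (intro allI impI sum.neutral ballI)
  fix w i assume *: "\<forall>w. wdeg w < k \<longrightarrow> a w = 0" "\<forall>w. wdeg w < l \<longrightarrow> b w = 0" "wdeg w < k + l"
  with wdeg_take_drop[of i w] have "wdeg (take i w) < k \<or> wdeg (drop i w) < l" by linarith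
  with * show "a (take i w) * b (drop i w) = 0" by auto
qed

lemma vanishes_below_br: "vanishes_below k a \<Longrightarrow> vanishes_below l b \<Longrightarrow> vanishes_below (k + l) (sbr a b)"
  using vanishes_below_smult[of k a l b] vanishes_below_smult[of l b k a]
  by (simp add: sbr_def ssub_def vanishes_below_def add.commute)

lemma vanishes_below_scale: "vanishes_below k a \<Longrightarrow> vanishes_below k (sscale c a)" by (simp add: vanishes_below_def sscale_def)

lemma vanishes_below_gen: "vanishes_below (gdeg g) (sgen g)" by (simp add: vanishes_below_def sgen_def wdeg_def)

lemma vanishes_below_mono: "vanishes_below k a \<Longrightarrow> l \<le> k \<Longrightarrow> vanishes_below l a" by (simp add: vanishes_below_def)

lemma vanishes_below_ad_pow: "vanishes_below 1 a \<Longrightarrow> vanishes_below k b \<Longrightarrow> vanishes_below (m + k) (ad_pow a m b)"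
proof (induction m)
  case (Suc m)
  then show ?case using vanishes_below_br[of 1 a "m + k" "ad_pow a m b"] by (simp add: ad_pow_def)
qed (simp add: ad_pow_def)

section \<open>Iterated brackets and polynomial actions\<close>

definition adp :: "lie \<Rightarrow> nat \<Rightarrow> lie \<Rightarrow> lie" where "adp a m v = (br a ^^ m) v"

lemma adp_0 [simp]: "adp a 0 v = v" by (simp add: adp_def)
lemma adp_Suc: "adp a (Suc m) v = br a (adp a m v)" by (simp add: adp_def)
lemma adp_Suc2: "adp a (Suc m) v = adp a m (br a v)" by (simp add: adp_def funpow_swap1)
lemma adp_add: "adp a (m + k) v = adp a m (adp a k v)" by (simp add: adp_def funpow_add)

lemma adp_zero [simp]: "adp a m 0 = 0"
  by (induction m) (auto simp: adp_Suc)
lemma adp_plus: "adp a m (v + w) = adp a m v + adp a m w"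
  by (induction m) (auto simp: adp_Suc br_add_right)
lemma adp_minus: "adp a m (- v) = - adp a m v"
  by (induction m) (auto simp: adp_Suc br_minus_right)
lemma adp_diff: "adp a m (v - w) = adp a m v - adp a m w"
  by (induction m) (auto simp: adp_Suc br_diff_right)
lemma adp_scale: "adp a m (cscale c v) = cscale c (adp a m v)"
  by (induction m) (auto simp: adp_Suc br_scale_right)
lemma adp_sum: "adp a m (\<Sum>j\<in>S. f j) = (\<Sum>j\<in>S. adp a m (f j))"
  by (induction m) (auto simp: adp_Suc br_sum_right)
lemma adp_neg: "adp (- a) m v = cscale ((-1) ^ m) (adp a m v)"
  by (induction m) (auto simp: adp_Suc br_scale_right br_minus_left)

lemma br_zero_sym: "br a b = 0 \<longleftrightarrow> br b a = 0"
  using br_antisym[of a b] by simp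

lemma br_commute: "br a b = 0 \<Longrightarrow> br a (br b v) = br b (br a v)"
  using br_jacobi[of a b v] by simp

lemma br_adp_comm: "br a b = 0 \<Longrightarrow> br a (adp b m v) = adp b m (br a v)"
  using br_commute[of a b] by (induction m) (simp_all add: adp_Suc)

lemma adp_adp_comm: "br a b = 0 \<Longrightarrow> adp a k (adp b m v) = adp b m (adp a k v)"
  by (induction k) (auto simp: adp_Suc br_adp_comm)

text \<open>Since \<open>c\<close> and \<open>c'\<close> commute, \<open>br c\<close> passes through
  the powers of \<open>br c'\<close> until it meets \<open>v\<close>, where it may be exchanged for
  \<open>br c'\<close>.\<close>

lemma adp_cong: "br c v = br c' v \<Longrightarrow> br c c' = 0 \<Longrightarrow> adp c m v = adp c' m v"
proof (induction m)
  case (Suc m)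
  then have "adp c (Suc m) v = adp c' m (br c v)"
    using br_adp_comm[of c c'] by (simp add: adp_Suc)
  with Suc.prems show ?case by (simp add: adp_Suc2)
qed simp

text \<open>\<open>br c\<close> is a derivation that kills the second entry
  \<open>v\<close>.\<close>

lemma br_adp_left: "br c v = 0 \<Longrightarrow> br (adp c p u) v = adp c p (br u v)"
  by (induction p) (auto simp: adp_Suc br_jacobi)

text \<open>Leibniz rule for the derivation \<open>br D\<close>: it acts on \<open>v\<close> and on
  each of the \<open>d\<close> letters \<open>a\<close>, and \<open>p\<close> counts the letters in
  front of the one hit.\<close>

lemma br_adp_deriv:
  "br D (adp a d v) = adp a d (br D v) + (\<Sum>p<d. adp a p (br (br D a) (adp a (d - 1 - p) v)))"
proof (induction d)
  case (Suc d)
  have "br D (adp a (Suc d) v) = br (br D a) (adp a d v) + br a (br D (adp a d v))"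
    using br_jacobi[of D a "adp a d v"] by (simp add: adp_Suc)
  also have "\<dots> = br (br D a) (adp a d v) + adp a (Suc d) (br D v)
      + (\<Sum>p<d. adp a (Suc p) (br (br D a) (adp a (d - 1 - p) v)))"
    by (simp add: Suc adp_Suc br_add_right br_sum_right)
  also have "\<dots> = adp a (Suc d) (br D v)
      + (\<Sum>p<Suc d. adp a p (br (br D a) (adp a (Suc d - 1 - p) v)))"
    unfolding sum.lessThan_Suc_shift by simp
  finally show ?case .
qed simp

text \<open>\<open>act a b d p\<close> is the homogenisation of \<open>p\<close> to degree \<open>d\<close>, evaluated at \<open>(ad a, ad b)\<close>;
  coefficients of \<open>p\<close> beyond \<open>d\<close> are ignored.\<close>
definition act :: "lie \<Rightarrow> lie \<Rightarrow> nat \<Rightarrow> complex poly \<Rightarrow> lie \<Rightarrow> lie" where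
  "act a b d p v = (\<Sum>k\<le>d. cscale (coeff p k) (adp a k (adp b (d - k) v)))"

lemma act_sum: "act a b d (\<Sum>k\<in>S. p k) v = (\<Sum>k\<in>S. act a b d (p k) v)"
  unfolding act_def coeff_sum cvec.scale_sum_left by (rule sum.swap)

lemma act_add: "act a b d (p + q) v = act a b d p v + act a b d q v"
  by (simp add: act_def cvec.scale_left_distrib sum.distrib)

lemma act_smult: "act a b d (Polynomial.smult c p) v = cscale c (act a b d p v)"
  by (simp add: act_def cvec.scale_sum_right)

lemma act_0 [simp]: "act a b d 0 v = 0"
  by (simp add: act_def)

lemma act_left: "br a (act a b d p v) = act a b (Suc d) ([:0, 1:] * p) v"
  by (simp add: act_def br_sum_right br_scale_right adp_Suc[symmetric] sum.atMost_Suc_shift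
      del: sum.atMost_Suc)

text \<open>Passing from degree \<open>d\<close> to \<open>Suc d\<close> exposes one more
  coefficient of \<open>p\<close>. The degree bound makes it zero.\<close>

lemma act_right:
  assumes "br a b = 0" "degree p \<le> d"
  shows "br b (act a b d p v) = act a b (Suc d) p v"
  using assms br_zero_sym[of a b]
  by (simp add: act_def br_sum_right br_scale_right br_adp_comm coeff_eq_0 Suc_diff_le
      adp_Suc[symmetric])

lemma act_both:
  assumes "br a b = 0" "degree p \<le> d"
  shows "br (a + b) (act a b d p v) = act a b (Suc d) ([:1, 1:] * p) v"
  using assms by (simp add: br_add_left act_left act_right act_add add.commute)

lemma degree_linear_power: "degree ([:c, 1:] ^ k :: complex poly) = k"
  by (simp add: degree_power_eq)

text \<open>The three operators commute and the third is the sum of the other two, so a monomial in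
  them is a homogeneous polynomial in two variables.\<close>

lemma act_mono:
  assumes ab: "br a b = 0"
  shows "adp a i (adp b j (adp (a + b) k v)) = act a b (i + j + k) ([:0, 1:] ^ i * [:1, 1:] ^ k) v"
proof -
  have 1: "adp (a + b) k v = act a b k ([:1, 1:] ^ k) v"
  proof (induction k)
    case 0 then show ?case by (simp add: act_def)
  next
    case (Suc k) then show ?case
      by (simp add: adp_Suc act_both ab degree_linear_power)
  qed
  have 2: "adp b j (act a b k ([:1, 1:] ^ k) v) = act a b (j + k) ([:1, 1:] ^ k) v"
    by (induction j) (simp_all add: adp_Suc act_right ab degree_linear_power)
  have "adp a i (act a b (j + k) ([:1, 1:] ^ k) v) = act a b (i + j + k) ([:0, 1:] ^ i * [:1, 1:] ^ k) v"
    by (induction i) (simp_all add: adp_Suc act_left mult.assoc)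
  with 1 2 show ?thesis by simp
qed

text \<open>Allows polynomial identities to be checked after multiplication by \<open>u\<close> and
  \<open>u + 1\<close>, at points where both are invertible.\<close>

lemma poly_zeroI_cofinite:
  fixes p :: "complex poly"
  assumes "finite S" "\<And>u. u \<notin> S \<Longrightarrow> poly p u = 0"
  shows "p = 0"
proof (rule ccontr)
  assume "p \<noteq> 0"
  then have "finite {u. poly p u = 0}" by (rule poly_roots_finite)
  moreover have "- S \<subseteq> {u. poly p u = 0}" using assms(2) by auto
  ultimately have "finite (- S)" by (rule finite_subset[rotated])
  then show False using assms(1) infinite_UNIV_char_0[where 'a=complex] by (simp add: Compl_eq_Diff_UNIV)
qed

section \<open>The relations\<close>

text \<open>Separates the computations with brackets from series and quotients;
  \<open>kzb_algebra_inL\<close> supplies the model.\<close>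

locale kzb_algebra =
  fixes A :: "nat set" and x y :: "nat \<Rightarrow> lie" and t :: "nat \<Rightarrow> nat \<Rightarrow> lie"
    and D0 :: lie and dl :: "nat \<Rightarrow> lie"
  assumes finite_A: "finite A"
    and t_sym: "\<And>i j. distinct [i,j] \<Longrightarrow> {i,j} \<subseteq> A \<Longrightarrow> t i j = t j i"
    and t_t: "\<And>i j k. distinct [i,j,k] \<Longrightarrow> {i,j,k} \<subseteq> A \<Longrightarrow> br (t i j) (t i k + t j k) = 0"
    and t_disj: "\<And>i j k l. distinct [i,j,k,l] \<Longrightarrow> {i,j,k,l} \<subseteq> A \<Longrightarrow> br (t i j) (t k l) = 0"
    and x_y: "\<And>i j. distinct [i,j] \<Longrightarrow> {i,j} \<subseteq> A \<Longrightarrow> br (x i) (y j) = t i j"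
    and x_x: "\<And>i j. {i,j} \<subseteq> A \<Longrightarrow> br (x i) (x j) = 0"
    and y_y: "\<And>i j. {i,j} \<subseteq> A \<Longrightarrow> br (y i) (y j) = 0"
    and x_yi: "\<And>i. i \<in> A \<Longrightarrow> br (x i) (y i) = - (\<Sum>j\<in>A - {i}. t i j)"
    and x_t: "\<And>i j k. distinct [i,j,k] \<Longrightarrow> {i,j,k} \<subseteq> A \<Longrightarrow> br (x i) (t j k) = 0"
    and y_t: "\<And>i j k. distinct [i,j,k] \<Longrightarrow> {i,j,k} \<subseteq> A \<Longrightarrow> br (y i) (t j k) = 0"
    and xx_t: "\<And>i j. distinct [i,j] \<Longrightarrow> {i,j} \<subseteq> A \<Longrightarrow> br (x i + x j) (t i j) = 0"
    and yy_t: "\<And>i j. distinct [i,j] \<Longrightarrow> {i,j} \<subseteq> A \<Longrightarrow> br (y i + y j) (t i j) = 0"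
    and D0_x: "\<And>i. i \<in> A \<Longrightarrow> br D0 (x i) = y i"
    and D0_y: "\<And>i. i \<in> A \<Longrightarrow> br D0 (y i) = 0"
    and D0_t: "\<And>i j. distinct [i,j] \<Longrightarrow> {i,j} \<subseteq> A \<Longrightarrow> br D0 (t i j) = 0"
    and dl_x: "\<And>m i. m \<ge> 1 \<Longrightarrow> i \<in> A \<Longrightarrow> br (dl m) (x i) = 0"
    and dl_t: "\<And>m i j. m \<ge> 1 \<Longrightarrow> distinct [i,j] \<Longrightarrow> {i,j} \<subseteq> A \<Longrightarrow>
        br (dl m) (t i j) = br (t i j) (adp (x i) (2 * m) (t i j))"
    and dl_y: "\<And>m i. m \<ge> 1 \<Longrightarrow> i \<in> A \<Longrightarrow> br (dl m) (y i) =
        (\<Sum>j\<in>A - {i}. cscale (1/2) (\<Sum>p\<in>{0..2*m-1}.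
           br (adp (x i) p (t i j)) (cscale ((-1) ^ (2*m-1-p)) (adp (x i) (2*m-1-p) (t i j)))))"
begin

definition tm :: "nat \<Rightarrow> nat \<Rightarrow> nat \<Rightarrow> lie" where
  "tm i j m = adp (x i) m (t i j)"

lemma tm_0 [simp]: "tm i j 0 = t i j" by (simp add: tm_def)

lemma adp_tm: "adp (x i) p (tm i j m) = tm i j (p + m)"
  by (simp add: tm_def adp_add)

lemma x_x' [simp]: "i \<in> A \<Longrightarrow> j \<in> A \<Longrightarrow> br (x i) (x j) = 0"
  using x_x[of i j] by simp

text \<open>On \<open>t i j\<close> the elements \<open>x i\<close> and \<open>- x j\<close> act
  alike, because their difference \<open>x i + x j\<close> kills it.\<close>

lemma tm_neg:
  assumes "i \<noteq> j" "i \<in> A" "j \<in> A"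
  shows "tm i j m = adp (- x j) m (t i j)"
  unfolding tm_def
proof (rule adp_cong)
  have "br (x i) (t i j) + br (x j) (t i j) = 0"
    using xx_t[of i j] assms by (simp add: br_add_left)
  then show "br (x i) (t i j) = br (- x j) (t i j)"
    by (simp add: br_minus_left eq_neg_iff_add_eq_0)
qed (use assms in \<open>simp add: br_minus_right\<close>)

lemma tm_swap:
  assumes "i \<noteq> j" "i \<in> A" "j \<in> A"
  shows "tm i j m = cscale ((-1) ^ m) (tm j i m)"
  using tm_neg[OF assms] t_sym[of i j] assms by (simp add: adp_neg tm_def)

lemma x_tm:
  assumes "distinct [i,j,l]" "i \<in> A" "j \<in> A" "l \<in> A"
  shows "br (x l) (tm i j m) = 0"
  using assms x_t[of l i j] by (simp add: tm_def br_adp_comm)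

lemma tm_disj:
  assumes "distinct [i,j,k,l]" "i \<in> A" "j \<in> A" "k \<in> A" "l \<in> A"
  shows "br (tm i j p) (tm k l q) = 0"
proof -
  have "br (t i j) (x k) = 0"
    using assms x_t[of k i j] br_zero_sym[of "t i j" "x k"] by simp
  then have "br (t i j) (tm k l q) = adp (x k) q (br (t i j) (t k l))"
    unfolding tm_def by (rule br_adp_comm)
  also have "\<dots> = 0" using assms t_disj[of i j k l] by simp
  finally have "br (t i j) (tm k l q) = 0" .
  then show ?thesis
    using assms x_tm[of k l i q] by (simp add: tm_def[of i j] br_adp_left)
qed

section \<open>Brackets with three distinct indices\<close>

definition T :: "nat \<Rightarrow> nat \<Rightarrow> nat \<Rightarrow> lie" where
  "T i j l = br (t i j) (t j l)"

text \<open>The relation \<open>[t l j, t l i + t j i] = 0\<close> trades one commutator for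
  another. Up to sign there is thus a single commutator on three indices, and it carries all triple
  terms.\<close>

lemma T_cyc:
  assumes "distinct [i,j,l]" "i \<in> A" "j \<in> A" "l \<in> A"
  shows "T j l i = T i j l"
proof -
  have "br (t l j) (t l i) + br (t l j) (t j i) = 0"
    using t_t[of l j i] assms by (simp add: br_add_right)
  moreover have "br (t i j) (t j l) + br (t j l) (t i j) = 0"
    using br_antisym[of "t i j" "t j l"] by simp
  moreover have "t l j = t j l" "t j i = t i j" using assms t_sym[of l j] t_sym[of j i] by auto
  ultimately show ?thesis unfolding T_def by (metis add_right_cancel)
qed

text \<open>\<open>x i + x j + x l\<close> acts by zero on \<open>T i j l\<close>, so every bracket of two of the elements \<open>tm\<close> on
  \<open>{i, j, l}\<close> is of the form \<open>E i j l d p\<close>. In \<open>p\<close>, \<open>U\<close> stands for \<open>- x j\<close>,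
  1 for \<open>- x l\<close>, hence \<open>S = U + 1\<close> for \<open>x i\<close>.\<close>
definition E :: "nat \<Rightarrow> nat \<Rightarrow> nat \<Rightarrow> nat \<Rightarrow> complex poly \<Rightarrow> lie" where
  "E i j l d p = act (- x j) (- x l) d p (T i j l)"

lemma E_add: "E i j l d (p + q) = E i j l d p + E i j l d q"
  by (simp add: E_def act_add)
lemma E_smult: "E i j l d (Polynomial.smult c p) = cscale c (E i j l d p)"
  by (simp add: E_def act_smult)
lemma E_minus: "E i j l d (- p) = - (E i j l d p)"
  using E_smult[of i j l d "-1" p] by simp
lemma E_diff: "E i j l d (p - q) = E i j l d p - E i j l d q"
  using E_add[of i j l d p "-q"] by (simp add: E_minus)
lemma E_sum: "E i j l d (\<Sum>k\<in>S. p k) = (\<Sum>k\<in>S. E i j l d (p k))"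
  by (simp add: E_def act_sum)
lemma E_0 [simp]: "E i j l d 0 = 0"
  by (simp add: E_def)

abbreviation U :: "complex poly" where "U \<equiv> [:0, 1:]"
abbreviation S :: "complex poly" where "S \<equiv> [:1, 1:]"

context
  fixes i j l
  assumes dist: "distinct [i,j,l]" and inA: "i \<in> A" "j \<in> A" "l \<in> A"
begin

lemma x_T: "br (x i) (T i j l) = br (- x j + - x l) (T i j l)"
proof -
  have "br (x i + x j) (t i j) = 0" "br (x l) (t i j) = 0" "br (x j + x l) (t j l) = 0" "br (x i) (t j l) = 0"
    using xx_t[of i j] xx_t[of j l] x_t[of l i j] x_t[of i j l] dist inA by auto
  then have "br (x i + x j + x l) (t i j) = 0" "br (x i + x j + x l) (t j l) = 0"
    by (simp_all add: br_add_left add.assoc)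
  then have "br (x i + x j + x l) (T i j l) = 0"
    unfolding T_def using br_commute[of "x i + x j + x l" "t i j"] by simp
  then show ?thesis
    by (simp add: br_add_left br_minus_left br_diff_left algebra_simps eq_neg_iff_add_eq_0)
qed

text \<open>All three operators commute, so \<open>x i\<close> can be made to act on
  \<open>T i j l\<close> first, where it agrees with \<open>- x j - x l\<close>.\<close>

lemma E_mono:
  "adp (x i) e (adp (- x j) f (adp (- x l) g (T i j l))) = E i j l (e + f + g) (S ^ e * U ^ f)"
proof -
  let ?a = "- x j" and ?b = "- x l"
  have c: "br ?a ?b = 0" "br (x i) ?a = 0" "br (x i) ?b = 0" "br (?a + ?b) ?a = 0" "br (?a + ?b) ?b = 0"
    "br (x i) (?a + ?b) = 0"
    using inA by (simp_all add: br_minus_left br_minus_right br_add_left br_add_right br_diff_left br_diff_right)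
  have "adp (x i) e (adp ?a f (adp ?b g (T i j l))) = adp ?a f (adp ?b g (adp (x i) e (T i j l)))"
    by (simp only: adp_adp_comm[OF c(2)] adp_adp_comm[OF c(3)])
  also have "adp (x i) e (T i j l) = adp (?a + ?b) e (T i j l)"
    by (rule adp_cong[OF x_T c(6)])
  also have "adp ?a f (adp ?b g (adp (?a + ?b) e (T i j l))) = E i j l (e + f + g) (S ^ e * U ^ f)"
    unfolding act_mono[OF c(1)] E_def by (simp add: add_ac mult.commute)
  finally show ?thesis .
qed

lemma T_eqs: "br (t i l) (t i j) = T i j l" "br (t i j) (t i l) = - T i j l"
  "br (t j l) (t i l) = T i j l" "br (t i l) (t j l) = - T i j l"
proof -
  have s: "t l i = t i l" using t_sym[of l i] dist inA by auto
  show 1: "br (t i l) (t i j) = T i j l"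
    using T_cyc[of i j l] T_cyc[of j l i] dist inA s by (simp add: T_def)
  show 2: "br (t j l) (t i l) = T i j l"
    using T_cyc[of i j l] dist inA s by (simp add: T_def)
  show "br (t i j) (t i l) = - T i j l" "br (t i l) (t j l) = - T i j l"
    using 1 2 br_antisym by metis+
qed

lemma x_t_inst: "br (x l) (t i j) = 0" "br (x i) (t j l) = 0" "br (x j) (t i l) = 0"
  using x_t[of l i j] x_t[of i j l] x_t[of j i l] dist inA by auto

lemma t_x_inst: "br (t i j) (- x l) = 0" "br (t j l) (- x i) = 0" "br (t i l) (- x j) = 0" "br (t i l) (x j) = 0"
  using x_t_inst br_antisym[of "t i j" "x l"] br_antisym[of "t j l" "x i"] br_antisym[of "t i l" "x j"]
  by (simp_all add: br_minus_right)

lemma xm_tm: "br (x i) (tm j l m) = 0" "br (x j) (tm i l m) = 0" "br (x l) (tm i j m) = 0"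
  using x_tm[of j l i] x_tm[of i l j] x_tm[of i j l] dist inA by auto

lemma tm_negs: "tm i j m = adp (- x j) m (t i j)" "tm j l m = adp (- x l) m (t j l)" "tm i l m = adp (- x l) m (t i l)"
  using tm_neg[of i j] tm_neg[of j l] tm_neg[of i l] dist inA by auto

text \<open>Each entry is written, by means of \<open>tm_negs\<close>, with powers of that
  \<open>x\<close> which kills the other entry. The powers can then be pulled out of the bracket,
  and only \<open>T i j l\<close> remains inside. The next two lemmas use the same device.\<close>

lemma br_ij_jl: "br (tm i j p) (tm j l q) = E i j l (p + q) (S ^ p)"
proof -
  have "br (tm i j p) (tm j l q) = adp (x i) p (br (t i j) (tm j l q))"
    unfolding tm_def[of i j] by (rule br_adp_left) (rule xm_tm)
  also have "br (t i j) (tm j l q) = adp (- x l) q (T i j l)"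
    unfolding tm_negs T_def by (rule br_adp_comm) (rule t_x_inst)
  finally show ?thesis using E_mono[of p 0 q] by simp
qed

lemma br_il_ij: "br (tm i l p) (tm i j q) = E i j l (p + q) (U ^ q)"
proof -
  have "br (tm i l p) (tm i j q) = adp (- x l) p (br (t i l) (tm i j q))"
    unfolding tm_negs(3) by (rule br_adp_left) (simp add: br_minus_left xm_tm)
  also have "br (t i l) (tm i j q) = adp (- x j) q (T i j l)"
    unfolding tm_negs T_eqs(1)[symmetric] by (rule br_adp_comm) (rule t_x_inst)
  also have "adp (- x l) p (adp (- x j) q (T i j l)) = adp (- x j) q (adp (- x l) p (T i j l))"
    using inA by (intro adp_adp_comm) (simp add: br_minus_left br_minus_right)
  finally show ?thesis using E_mono[of 0 q p] by (simp add: add.commute)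
qed

text \<open>The second entry has to be written with \<open>x j\<close>, which kills
  \<open>t i l\<close>. As \<open>U\<close> stands for \<open>- x j\<close>, this costs the sign
  \<open>(-1) ^ q\<close>.\<close>

lemma br_il_jl: "br (tm i l p) (tm j l q) = cscale (- ((-1) ^ q)) (E i j l (p + q) (S ^ p * U ^ q))"
proof -
  have "br (tm i l p) (tm j l q) = adp (x i) p (br (t i l) (tm j l q))"
    unfolding tm_def[of i l] by (rule br_adp_left) (rule xm_tm)
  also have "br (t i l) (tm j l q) = adp (x j) q (- T i j l)"
    unfolding tm_def T_eqs(4)[symmetric] by (rule br_adp_comm) (rule t_x_inst)
  also have "\<dots> = - (cscale ((-1) ^ q) (adp (- x j) q (T i j l)))"
    using adp_neg[of "- x j" q "T i j l"] by (simp add: adp_minus)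
  finally show ?thesis using E_mono[of p q 0] by (simp add: adp_minus adp_scale)
qed

lemma x_br_til_tij: "adp (x i) p (br (t i l) (tm i j q)) = E i j l (p + q) (S ^ p * U ^ q)"
proof -
  have "br (t i l) (tm i j q) = adp (- x j) q (T i j l)"
    unfolding tm_negs T_eqs(1)[symmetric] by (rule br_adp_comm) (rule t_x_inst)
  then show ?thesis using E_mono[of p q 0] by simp
qed

lemma x_br_tij_tjl: "adp (x j) p (br (t i j) (tm j l q)) = cscale ((-1) ^ p) (E i j l (p + q) (U ^ p))"
proof -
  have "br (t i j) (tm j l q) = adp (- x l) q (T i j l)"
    unfolding tm_negs T_def by (rule br_adp_comm) (rule t_x_inst)
  then show ?thesis using E_mono[of 0 p q] adp_neg[of "- x j" p] by simp
qed

lemma x_br_tij_til: "adp (x i) p (br (t i j) (tm i l q)) = - E i j l (p + q) (S ^ p)"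
proof -
  have "br (t i j) (tm i l q) = adp (- x l) q (- T i j l)"
    unfolding tm_negs T_eqs(2)[symmetric] by (rule br_adp_comm) (rule t_x_inst)
  then show ?thesis using E_mono[of p 0 q] by (simp add: adp_minus)
qed

text \<open>\<open>y i\<close> kills \<open>t j l\<close>, so only the Leibniz terms from
  \<open>[y i, x j] = - t i j\<close> remain.\<close>

lemma y_tm_jl: "br (y i) (tm j l d) = - (\<Sum>p<d. cscale ((-1) ^ p) (E i j l (d - 1) (U ^ p)))"
proof -
  have "br (y i) (x j) = - t i j"
    using br_antisym[of "y i" "x j"] x_y[of j i] t_sym[of i j] dist inA by simp
  moreover have "br (y i) (t j l) = 0" using y_t[of i j l] dist inA by simp
  ultimately have "br (y i) (tm j l d) = - (\<Sum>p<d. adp (x j) p (br (t i j) (tm j l (d - 1 - p))))"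
    unfolding tm_def[of j l d] br_adp_deriv[of "y i"]
    by (simp add: br_minus_left adp_minus sum_negf tm_def)
  also have "\<dots> = - (\<Sum>p<d. cscale ((-1) ^ p) (E i j l (d - 1) (U ^ p)))"
    unfolding x_br_tij_tjl by (intro arg_cong[of _ _ uminus] sum.cong) auto
  finally show ?thesis .
qed

lemma y_tm_il: "br (y j) (tm i l d) = (\<Sum>p<d. E i j l (d - 1) (S ^ p))"
proof -
  have "br (y j) (x i) = - t i j"
    using br_antisym[of "y j" "x i"] x_y[of i j] dist inA by simp
  moreover have "br (y j) (t i l) = 0" using y_t[of j i l] dist inA by simp
  ultimately have "br (y j) (tm i l d) = - (\<Sum>p<d. adp (x i) p (br (t i j) (tm i l (d - 1 - p))))"
    unfolding tm_def[of i l d] br_adp_deriv[of "y j"]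
    by (simp add: br_minus_left adp_minus sum_negf tm_def)
  also have "\<dots> = (\<Sum>p<d. E i j l (d - 1) (S ^ p))"
    unfolding x_br_tij_til sum_negf minus_minus by (intro sum.cong) auto
  finally show ?thesis .
qed

end

text \<open>\<open>y i + y j\<close> kills \<open>t i j\<close>. In its bracket with
  \<open>x i\<close> the term \<open>t i j\<close> cancels between the two summands, which leaves
  only third indices \<open>l\<close>.\<close>

lemma yy_tm:
  assumes "i \<noteq> j" "i \<in> A" "j \<in> A"
  shows "br (y i + y j) (tm i j d) =
    (\<Sum>l\<in>A - {i,j}. \<Sum>p<d. E i j l (d - 1) (S ^ p * U ^ (d - 1 - p)))"
proof -
  have "A - {i} = insert j (A - {i,j})" using assms by auto
  then have "(\<Sum>l\<in>A - {i}. t i l) = t i j + (\<Sum>l\<in>A - {i,j}. t i l)"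
    using finite_A by simp
  then have y: "br (y i + y j) (x i) = (\<Sum>l\<in>A - {i,j}. t i l)"
    using x_yi[of i] x_y[of i j] br_antisym[of "y i" "x i"] br_antisym[of "y j" "x i"] assms
    by (simp add: br_add_left)
  have "br (y i + y j) (tm i j d)
      = (\<Sum>p<d. \<Sum>l\<in>A - {i,j}. adp (x i) p (br (t i l) (tm i j (d - 1 - p))))"
    unfolding tm_def[of i j d] br_adp_deriv[of "y i + y j"] y
    using yy_t[of i j] assms by (simp add: br_sum_left adp_sum tm_def)
  also have "\<dots> = (\<Sum>l\<in>A - {i,j}. \<Sum>p<d. adp (x i) p (br (t i l) (tm i j (d - 1 - p))))"
    by (rule sum.swap)
  also have "\<dots> = (\<Sum>l\<in>A - {i,j}. \<Sum>p<d. E i j l (d - 1) (S ^ p * U ^ (d - 1 - p)))"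
    using assms by (intro sum.cong refl, subst x_br_til_tij) auto
  finally show ?thesis .
qed

end

section \<open>Vanishing of the bracket of two forms K\<close>

lemma conv_split:
  fixes F :: "nat \<Rightarrow> 'a::comm_monoid_add"
  shows "(\<Sum>p\<le>d + 3. F p) = F 0 + F 1 + (\<Sum>p<d. F (p + 2)) + F (d + 2) + F (d + 3)"
proof -
  have "(\<Sum>p\<le>d + 3. F p) = (\<Sum>p<Suc (Suc d). F p) + F (d + 2) + F (d + 3)"
  proof -
    have "{..d + 3} = insert (d + 3) (insert (d + 2) {..<Suc (Suc d)})" by auto
    then show ?thesis by (simp add: ac_simps del: sum.lessThan_Suc)
  qed
  also have "(\<Sum>p<Suc (Suc d). F p) = F 0 + F 1 + (\<Sum>p<d. F (p + 2))"
    by (simp only: sum.lessThan_Suc_shift) (simp add: add.assoc)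
  finally show ?thesis .
qed

lemma lie_eq_neg:
  fixes v :: lie
  assumes "v = - v"
  shows "v = 0"
proof -
  have "v + v = 0" using assms by (metis add.right_inverse)
  then have "cscale 2 v = 0"
    using cvec.scale_left_distrib[of 1 1 v] by simp
  then show ?thesis by simp
qed

text \<open>Reversing the order of summation changes the sign of every bracket.\<close>

lemma br_conv_self: "(\<Sum>p<(d::nat). br (f p) (f (d - 1 - p))) = 0"
proof (rule lie_eq_neg)
  have *: "d - 1 - (d - Suc p) = p" if "p < d" for p :: nat using that by arith
  have "(\<Sum>p<d. br (f p) (f (d - 1 - p))) = (\<Sum>p<d. br (f (d - Suc p)) (f (d - 1 - (d - Suc p))))"
    by (rule sum.nat_diff_reindex [symmetric])
  also have "\<dots> = (\<Sum>p<d. br (f (d - 1 - p)) (f p))"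
    by (intro sum.cong refl) (simp only: * lessThan_iff, simp)
  also have "\<dots> = - (\<Sum>p<d. br (f p) (f (d - 1 - p)))"
    unfolding sum_negf[symmetric] by (intro sum.cong refl br_antisym)
  finally show "(\<Sum>p<d. br (f p) (f (d - 1 - p))) = - (\<Sum>p<d. br (f p) (f (d - 1 - p)))" .
qed

lemma cscale_2: "cscale 2 v = v + v"
  using cvec.scale_left_distrib[of 1 1 v] by simp

text \<open>\<open>\<kappa> i j m\<close> is to be the \<open>m\<close>-th Taylor coefficient in
  \<open>x\<close> of \<open>k(z\<^sub>i - z\<^sub>j, x)\<close>. In \<open>fay\<close> the sum
  collects products of two \<open>k\<close>, the three terms before it products of one
  \<open>k\<close> with a pole; the factor \<open>u * (u + 1)\<close> clears the denominators of
  \<open>1/(u x)\<close> and \<open>1/((u + 1) x)\<close>.\<close>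

locale kzb_flat = kzb_algebra +
  fixes \<kappa> :: "nat \<Rightarrow> nat \<Rightarrow> nat \<Rightarrow> complex" and \<phi> :: "nat \<Rightarrow> complex"
  assumes kappa_sym: "\<And>i j m. distinct [i,j] \<Longrightarrow> {i,j} \<subseteq> A \<Longrightarrow> \<kappa> j i m = - ((-1) ^ m) * \<kappa> i j m"
    and fay: "\<And>i j l d u. distinct [i,j,l] \<Longrightarrow> {i,j,l} \<subseteq> A \<Longrightarrow>
      u * (u + 1) * (\<kappa> i j d * ((u + 1) ^ d - u ^ d))
      + (u + 1) * (\<kappa> i l d * ((u + 1) ^ d - 1)) + u * (\<kappa> j l d * (1 - (- u) ^ d))
      + u * (u + 1) * (\<Sum>p<d. \<kappa> i j p * \<kappa> j l (d - 1 - p) * (u + 1) ^ p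
          - \<kappa> i l p * \<kappa> i j (d - 1 - p) * u ^ (d - 1 - p)
          - \<kappa> i l p * \<kappa> j l (d - 1 - p) * (-1) ^ (d - 1 - p) * ((u + 1) ^ p * u ^ (d - 1 - p))) = 0"
begin

definition kt :: "nat \<Rightarrow> nat \<Rightarrow> nat \<Rightarrow> lie" where
  "kt i j m = cscale (\<kappa> i j m) (tm i j m)"

definition Kt :: "nat \<Rightarrow> nat \<Rightarrow> lie" where
  "Kt i m = (\<Sum>j\<in>A - {i}. kt i j m)"

text \<open>The part of degree \<open>N\<close> of \<open>Kbar\<close>.\<close>
definition Kc :: "nat \<Rightarrow> nat \<Rightarrow> lie" where
  "Kc i N = (if N = 1 then - y i else if N \<ge> 2 then Kt i (N - 2) else 0)"

lemma kt_swap: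
  assumes "i \<noteq> j" "i \<in> A" "j \<in> A"
  shows "kt j i m = - kt i j m"
proof -
  have "(-1) ^ m * (-1) ^ m = (1::complex)" by (simp add: power_mult_distrib[symmetric])
  then have "\<kappa> j i m * (-1) ^ m = - \<kappa> i j m"
    using kappa_sym[of i j m] assms by (simp add: mult.assoc mult.left_commute)
  then show ?thesis
    using tm_swap[of j i m] assms by (simp add: kt_def)
qed

lemma Kt_split:
  assumes "i \<noteq> j" "j \<in> A"
  shows "Kt i m = kt i j m + (\<Sum>l\<in>A - {i,j}. kt i l m)"
proof -
  have "A - {i} = insert j (A - {i,j})" using assms by auto
  then show ?thesis using finite_A by (simp add: Kt_def)
qed

lemma kt_disj:
  assumes "distinct [i,j,k,l]" "i \<in> A" "j \<in> A" "k \<in> A" "l \<in> A"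
  shows "br (kt i j p) (kt k l q) = 0"
  using tm_disj[OF assms] by (simp add: kt_def br_scale_left br_scale_right)

text \<open>In the double sum over further indices only equal ones survive, since elements on
  disjoint pairs commute. The brackets of two terms on the pair \<open>i, j\<close> cancel after
  summation over \<open>p\<close>.\<close>

lemma br_Kt_Kt:
  assumes ij: "i \<noteq> j" "i \<in> A" "j \<in> A"
  shows "(\<Sum>p<d. br (Kt i p) (Kt j (d - 1 - p))) =
    (\<Sum>l\<in>A - {i,j}. \<Sum>p<d. br (kt i j p) (kt j l (d - 1 - p)) - br (kt i l p) (kt i j (d - 1 - p))
        + br (kt i l p) (kt j l (d - 1 - p)))"
proof -
  have fin: "finite (A - {i,j})" using finite_A by simp
  have 1: "br (Kt i p) (Kt j q) = - br (kt i j p) (kt i j q)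
    + (\<Sum>l\<in>A - {i,j}. br (kt i j p) (kt j l q) - br (kt i l p) (kt i j q) + br (kt i l p) (kt j l q))" for p q
  proof -
    have "(\<Sum>l\<in>A - {i,j}. \<Sum>k\<in>A - {i,j}. br (kt i l p) (kt j k q))
        = (\<Sum>l\<in>A - {i,j}. \<Sum>k\<in>A - {i,j}. if k = l then br (kt i l p) (kt j l q) else 0)"
      using ij by (intro sum.cong refl) (auto intro: kt_disj)
    also have "\<dots> = (\<Sum>l\<in>A - {i,j}. br (kt i l p) (kt j l q))"
      using fin by (intro sum.cong refl) (subst sum.delta, auto)
    finally have d: "(\<Sum>l\<in>A - {i,j}. \<Sum>k\<in>A - {i,j}. br (kt i l p) (kt j k q))
       = (\<Sum>l\<in>A - {i,j}. br (kt i l p) (kt j l q))" .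
    have Kj: "Kt j q = - kt i j q + (\<Sum>l\<in>A - {i,j}. kt j l q)"
      using Kt_split[of j i q] kt_swap[of i j q] ij by (simp add: insert_commute)
    have Ki: "Kt i p = kt i j p + (\<Sum>l\<in>A - {i,j}. kt i l p)"
      using Kt_split[of i j p] ij by simp
    show ?thesis
      apply (simp only: Ki Kj br_add_left br_add_right br_minus_right)
      apply (simp only: br_sum_left)
      apply (simp only: br_sum_right d)
      apply (simp add: sum.distrib sum_subtractf algebra_simps)
      done
  qed
  have "(\<Sum>p<d. br (Kt i p) (Kt j (d - 1 - p))) =
     - (\<Sum>p<d. br (kt i j p) (kt i j (d - 1 - p))) +
     (\<Sum>p<d. \<Sum>l\<in>A - {i,j}. br (kt i j p) (kt j l (d - 1 - p)) - br (kt i l p) (kt i j (d - 1 - p))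
        + br (kt i l p) (kt j l (d - 1 - p)))"
    unfolding 1 sum.distrib sum_negf ..
  then show ?thesis
    unfolding br_conv_self[of "kt i j"] by (subst (asm) sum.swap) simp
qed

text \<open>A geometric sum, in the shape in which \<open>triple_zero\<close> presents it, the zero
  summand included.\<close>

lemma sum_SU: "u * 0 + (\<Sum>p<d. (u + 1) ^ p * u ^ (d - 1 - p)) = (u + 1) ^ d - (u::complex) ^ d"
  using power_diff_sumr2[of "u + 1" d u] by (simp add: mult.commute)

lemma sum_S: "u * (\<Sum>p<d. (u + 1) ^ p) = (u + 1) ^ d - (1::complex)"
  using power_diff_1_eq[of "u + 1" d] by simp

lemma sum_U: "(u + 1) * (\<Sum>p<d. (-1) ^ p * u ^ p) = 1 - (- u :: complex) ^ d"
  using one_diff_power_eq[of "- u" d] by (simp add: power_minus[of u] algebra_simps)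

text \<open>Every term on the indices \<open>i, j, l\<close> has the form
  \<open>E i j l (d - 1)\<close>. The polynomials add up to \<open>P\<close>, and
  \<open>u * (u + 1) * poly P u\<close> is the left side of \<open>fay\<close>.\<close>

lemma triple_zero:
  assumes "distinct [i,j,l]" "i \<in> A" "j \<in> A" "l \<in> A"
  shows "cscale (\<kappa> i j d) (\<Sum>p<d. E i j l (d - 1) (S ^ p * U ^ (d - 1 - p)))
     - br (y i) (kt j l d) + br (y j) (kt i l d)
     + (\<Sum>p<d. br (kt i j p) (kt j l (d - 1 - p)) - br (kt i l p) (kt i j (d - 1 - p))
        + br (kt i l p) (kt j l (d - 1 - p))) = 0"
proof -
  define P where "P = Polynomial.smult (\<kappa> i j d) (\<Sum>p<d. S ^ p * U ^ (d - 1 - p))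
     + Polynomial.smult (\<kappa> j l d) (\<Sum>p<d. Polynomial.smult ((-1) ^ p) (U ^ p))
     + Polynomial.smult (\<kappa> i l d) (\<Sum>p<d. S ^ p)
     + (\<Sum>p<d. Polynomial.smult (\<kappa> i j p * \<kappa> j l (d - 1 - p)) (S ^ p)
          - Polynomial.smult (\<kappa> i l p * \<kappa> i j (d - 1 - p)) (U ^ (d - 1 - p))
          - Polynomial.smult (\<kappa> i l p * \<kappa> j l (d - 1 - p) * (-1) ^ (d - 1 - p)) (S ^ p * U ^ (d - 1 - p)))"
  have "P = 0"
  proof (rule poly_zeroI_cofinite[of "{0, -1}"])
    fix u :: complex assume u: "u \<notin> {0, -1}"
    have "u * (u + 1) * poly P u = u * (u + 1) * (\<kappa> i j d * (u * 0 + (\<Sum>p<d. (u + 1) ^ p * u ^ (d - 1 - p))))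
      + (u + 1) * (\<kappa> i l d * (u * (\<Sum>p<d. (u + 1) ^ p))) + u * (\<kappa> j l d * ((u + 1) * (\<Sum>p<d. (-1) ^ p * u ^ p)))
      + u * (u + 1) * (\<Sum>p<d. \<kappa> i j p * \<kappa> j l (d - 1 - p) * (u + 1) ^ p
          - \<kappa> i l p * \<kappa> i j (d - 1 - p) * u ^ (d - 1 - p)
          - \<kappa> i l p * \<kappa> j l (d - 1 - p) * (-1) ^ (d - 1 - p) * ((u + 1) ^ p * u ^ (d - 1 - p)))"
      unfolding P_def by (simp add: poly_sum add.commute[of 1] distrib_left distrib_right mult_ac)
    also have "\<dots> = 0"
      unfolding sum_SU sum_S sum_U using assms by (intro fay) auto
    finally show "poly P u = 0" using u by (auto simp: eq_neg_iff_add_eq_0)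
  qed simp
  moreover have "E i j l (d - 1) P = cscale (\<kappa> i j d) (\<Sum>p<d. E i j l (d - 1) (S ^ p * U ^ (d - 1 - p)))
     - br (y i) (kt j l d) + br (y j) (kt i l d)
     + (\<Sum>p<d. br (kt i j p) (kt j l (d - 1 - p)) - br (kt i l p) (kt i j (d - 1 - p))
        + br (kt i l p) (kt j l (d - 1 - p)))"
  proof -
    have "br (kt i j p) (kt j l (d - 1 - p)) - br (kt i l p) (kt i j (d - 1 - p))
        + br (kt i l p) (kt j l (d - 1 - p)) =
      E i j l (d - 1) (Polynomial.smult (\<kappa> i j p * \<kappa> j l (d - 1 - p)) (S ^ p)
          - Polynomial.smult (\<kappa> i l p * \<kappa> i j (d - 1 - p)) (U ^ (d - 1 - p))
          - Polynomial.smult (\<kappa> i l p * \<kappa> j l (d - 1 - p) * (-1) ^ (d - 1 - p)) (S ^ p * U ^ (d - 1 - p)))"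
      if "p < d" for p
      using that br_ij_jl[OF assms, of p "d - 1 - p"] br_il_ij[OF assms, of p "d - 1 - p"] br_il_jl[OF assms, of p "d - 1 - p"]
      by (simp add: kt_def br_scale_left br_scale_right E_diff E_smult mult.commute)
    then show ?thesis
      unfolding P_def E_add E_smult E_sum
      by (simp add: kt_def br_scale_right y_tm_jl[OF assms] y_tm_il[OF assms] E_smult)
  qed
  ultimately show ?thesis by simp
qed

theorem Kc_flat:
  assumes i: "i \<in> A" and j: "j \<in> A"
  shows "(\<Sum>p\<le>N. br (Kc i p) (Kc j (N - p))) = 0"
proof (cases "i = j")
  case True
  then show ?thesis
    using br_conv_self[of "Kc i" "Suc N"] by (simp add: lessThan_Suc_atMost)
next
  case ij: False
  have "N = 0 \<or> N = 1 \<or> N = 2 \<or> (\<exists>d. N = d + 3)" by presburger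
  then consider "N = 0" | "N = 1" | "N = 2" | d where "N = d + 3" by blast
  then show ?thesis
  proof cases
    \<comment> \<open>In total degree \<open>d + 3\<close> a \<open>y\<close> of degree 1 meets a
      \<open>Kt\<close> of degree \<open>d + 2\<close>, and \<open>Kt i p\<close> meets
      \<open>Kt j q\<close> with \<open>p + q = d - 1\<close>.\<close>
    case (4 d)
    have "(\<Sum>p\<le>N. br (Kc i p) (Kc j (N - p)))
      = - br (y i) (Kt j d) + br (y j) (Kt i d) + (\<Sum>p<d. br (Kt i p) (Kt j (d - 1 - p)))"
    proof -
      have "(\<Sum>p<d. br (Kc i (p + 2)) (Kc j (d + 3 - (p + 2)))) = (\<Sum>p<d. br (Kt i p) (Kt j (d - 1 - p)))"
        by (intro sum.cong refl) (auto simp: Kc_def intro!: arg_cong2[of _ _ _ _ br] arg_cong[of _ _ "Kt j"])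
      then show ?thesis
        unfolding 4 conv_split
        by (simp add: Kc_def br_minus_left br_minus_right br_antisym[of "Kt i d"])
    qed
    \<comment> \<open>Because \<open>kt\<close> is antisymmetric in its indices, the terms on the
      pair \<open>i, j\<close> combine \<open>y i\<close> and \<open>y j\<close> into their sum,
      which \<open>yy_tm\<close> evaluates.\<close>
    also have "- br (y i) (Kt j d) + br (y j) (Kt i d) =
       cscale (\<kappa> i j d) (br (y i + y j) (tm i j d))
       + (\<Sum>l\<in>A - {i,j}. - br (y i) (kt j l d) + br (y j) (kt i l d))"
    proof -
      have Kj: "Kt j d = - kt i j d + (\<Sum>l\<in>A - {i,j}. kt j l d)"
        using Kt_split[of j i d] kt_swap[of i j d] ij i j by (simp add: insert_commute)
      have Ki: "Kt i d = kt i j d + (\<Sum>l\<in>A - {i,j}. kt i l d)"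
        using Kt_split[of i j d] ij j by simp
      show ?thesis
        unfolding Ki Kj br_add_left br_add_right br_minus_right br_sum_right
        by (simp add: kt_def br_scale_right sum.distrib sum_negf sum_subtractf cvec.scale_right_distrib)
    qed
    also have "br (y i + y j) (tm i j d) =
       (\<Sum>l\<in>A - {i,j}. \<Sum>p<d. E i j l (d - 1) (S ^ p * U ^ (d - 1 - p)))"
      using ij i j by (rule yy_tm)
    finally have "(\<Sum>p\<le>N. br (Kc i p) (Kc j (N - p))) = (\<Sum>l\<in>A - {i,j}.
      cscale (\<kappa> i j d) (\<Sum>p<d. E i j l (d - 1) (S ^ p * U ^ (d - 1 - p)))
     - br (y i) (kt j l d) + br (y j) (kt i l d)
     + (\<Sum>p<d. br (kt i j p) (kt j l (d - 1 - p)) - br (kt i l p) (kt i j (d - 1 - p))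
        + br (kt i l p) (kt j l (d - 1 - p))))"
      unfolding br_Kt_Kt[OF ij i j] cvec.scale_sum_right sum.distrib[symmetric]
      by (simp add: algebra_simps)
    also have "\<dots> = 0"
      using ij i j by (intro sum.neutral ballI triple_zero) auto
    finally show ?thesis .
  qed (use y_y[of i j] i j in \<open>auto simp: Kc_def numeral_2_eq_2 br_minus_left br_minus_right\<close>)
qed

text \<open>The homogenisation of \<open>p\<close>, with \<open>U\<close> and 1 standing for \<open>ad (x i)\<close> on the first and the second
  entry of \<open>br (t i j) (t i j)\<close>, so that \<open>x i\<close> acts on the bracket as \<open>S = U + 1\<close>.\<close>
definition E2 :: "nat \<Rightarrow> nat \<Rightarrow> nat \<Rightarrow> complex poly \<Rightarrow> lie" where
  "E2 i j d p = (\<Sum>a\<le>d. cscale (coeff p a) (br (tm i j a) (tm i j (d - a))))"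

lemma E2_add: "E2 i j d (p + q) = E2 i j d p + E2 i j d q"
  by (simp add: E2_def cvec.scale_left_distrib sum.distrib)
lemma E2_smult: "E2 i j d (Polynomial.smult c p) = cscale c (E2 i j d p)"
  by (simp add: E2_def cvec.scale_sum_right)
lemma E2_diff: "E2 i j d (p - q) = E2 i j d p - E2 i j d q"
  using E2_add[of i j d p "-q"] E2_smult[of i j d "-1" q] by simp
lemma E2_sum: "E2 i j d (\<Sum>k\<in>B. p k) = (\<Sum>k\<in>B. E2 i j d (p k))"
  unfolding E2_def coeff_sum cvec.scale_sum_left by (rule sum.swap)
lemma x_E2:
  assumes "degree p \<le> d"
  shows "br (x i) (E2 i j d p) = E2 i j (Suc d) (S * p)"
proof -
  have 1: "br (x i) (br (tm i j a) (tm i j b)) = br (tm i j (Suc a)) (tm i j b) + br (tm i j a) (tm i j (Suc b))" for a b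
    using br_jacobi[of "x i" "tm i j a" "tm i j b"] by (simp add: tm_def adp_Suc)
  have "br (x i) (E2 i j d p) = (\<Sum>a\<le>d. cscale (coeff p a) (br (tm i j (Suc a)) (tm i j (d - a))))
     + (\<Sum>a\<le>d. cscale (coeff p a) (br (tm i j a) (tm i j (Suc (d - a)))))"
    by (simp add: E2_def br_sum_right br_scale_right 1 cvec.scale_right_distrib sum.distrib)
  also have "(\<Sum>a\<le>d. cscale (coeff p a) (br (tm i j (Suc a)) (tm i j (d - a)))) = E2 i j (Suc d) (U * p)"
    by (simp add: E2_def sum.atMost_Suc_shift del: sum.atMost_Suc)
  also have "(\<Sum>a\<le>d. cscale (coeff p a) (br (tm i j a) (tm i j (Suc (d - a))))) = E2 i j (Suc d) p"
    using assms by (simp add: E2_def coeff_eq_0 Suc_diff_le)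
  also have "E2 i j (Suc d) (U * p) + E2 i j (Suc d) p = E2 i j (Suc d) (S * p)"
    by (simp add: E2_add[symmetric] add.commute)
  finally show ?thesis .
qed

lemma E2_mono: "adp (x i) e (br (tm i j p) (tm i j q)) = E2 i j (e + p + q) (S ^ e * U ^ p)"
proof (induction e)
  case 0
  have "U ^ p = monom 1 p" by (simp add: monom_altdef)
  then have "E2 i j (p + q) (U ^ p) = (\<Sum>a\<le>p + q. if a = p then br (tm i j p) (tm i j q) else 0)"
    unfolding E2_def by (intro sum.cong) auto
  then show ?case by simp
next
  case (Suc e)
  have "degree (S ^ e * U ^ p) \<le> e + p + q"
    using degree_mult_le[of "S ^ e" "U ^ p"] by (simp add: degree_linear_power)
  with Suc show ?case by (simp add: adp_Suc x_E2 mult.assoc del: mult_pCons_left)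
qed

text \<open>Antisymmetry of the bracket: the element does not determine its polynomial, and
  exchanging the exponents \<open>p\<close> and \<open>q\<close> only changes the sign.
  \<open>pair_zero\<close> rests on this.\<close>

lemma E2_mirror: "E2 i j (e + p + q) (S ^ e * U ^ p) = - E2 i j (e + p + q) (S ^ e * U ^ q)"
  using E2_mono[of i e j p q] E2_mono[of i e j q p] br_antisym[of "tm i j p" "tm i j q"]
  by (simp add: adp_minus add_ac)

text \<open>\<open>D0\<close> turns one of the letters \<open>x i\<close> into \<open>y i\<close>.
  Moving this \<open>y i\<close> to the front past an \<open>x i\<close> leaves the commutator
  \<open>[x i, y i]\<close>, minus the sum of the \<open>t i l\<close>. A commutator with
  \<open>c\<close> letters behind it arises from each of the \<open>Suc c\<close> positions with at
  most \<open>c\<close> letters behind, hence the weight.\<close>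

lemma D0_tm:
  assumes "i \<noteq> j" "i \<in> A" "j \<in> A"
  shows "br D0 (tm i j (Suc d)) = cscale (of_nat (Suc d)) (br (y i) (tm i j d))
    - (\<Sum>c<d. cscale (of_nat (Suc c)) (adp (x i) (d - 1 - c) (br (\<Sum>l\<in>A - {i}. t i l) (tm i j c))))"
proof (induction d)
  case 0
  have "br D0 (br (x i) (t i j)) = br (y i) (t i j)"
    using br_jacobi[of D0 "x i" "t i j"] D0_x[of i] D0_t[of i j] assms by simp
  then show ?case by (simp add: tm_def adp_Suc)
next
  case (Suc d)
  let ?s = "\<Sum>l\<in>A - {i}. t i l"
  have "br D0 (tm i j (Suc (Suc d))) = br (y i) (tm i j (Suc d)) + br (x i) (br D0 (tm i j (Suc d)))"
    using br_jacobi[of D0 "x i" "tm i j (Suc d)"] D0_x[of i] assms by (simp add: tm_def adp_Suc)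
  also have "br (x i) (br D0 (tm i j (Suc d))) = cscale (of_nat (Suc d)) (br (x i) (br (y i) (tm i j d)))
    - (\<Sum>c<d. cscale (of_nat (Suc c)) (adp (x i) (Suc d - 1 - c) (br ?s (tm i j c))))"
    unfolding Suc.IH br_diff_right br_scale_right br_sum_right adp_Suc[symmetric]
    by (intro arg_cong2[of _ _ _ _ minus] sum.cong refl) (simp add: Suc_diff_Suc)
  also have "br (x i) (br (y i) (tm i j d)) = br (y i) (tm i j (Suc d)) - br ?s (tm i j d)"
    using br_jacobi[of "x i" "y i" "tm i j d"] x_yi[of i] assms
    by (simp add: tm_def adp_Suc br_minus_left algebra_simps)
  finally show ?case
    by (simp add: cvec.scale_right_diff_distrib cvec.scale_left_distrib cscale_2 algebra_simps)
qed

end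

section \<open>Vanishing of the bracket of Delta with K\<close>

definition upairs :: "nat set \<Rightarrow> (nat \<times> nat) set" where
  "upairs B = {(j, l). j \<in> B \<and> l \<in> B \<and> j < l}"

lemma finite_upairs: "finite B \<Longrightarrow> finite (upairs B)"
  by (rule finite_subset[of _ "B \<times> B"]) (auto simp: upairs_def)

lemma sum_upairs:
  fixes f :: "nat \<Rightarrow> nat \<Rightarrow> 'a::comm_monoid_add"
  assumes "finite B"
  shows "(\<Sum>j\<in>B. \<Sum>l\<in>B - {j}. f j l) = (\<Sum>(j,l)\<in>upairs B. f j l + f l j)"
proof -
  have "(\<Sum>j\<in>B. \<Sum>l\<in>B - {j}. f j l) = (\<Sum>(j,l)\<in>(SIGMA j:B. B - {j}). f j l)"
    using assms by (intro sum.Sigma) auto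
  also have "(SIGMA j:B. B - {j}) = upairs B \<union> prod.swap ` upairs B"
    by (force simp: upairs_def image_iff)
  also have "(\<Sum>(j,l)\<in>upairs B \<union> prod.swap ` upairs B. f j l)
     = (\<Sum>(j,l)\<in>upairs B. f j l) + (\<Sum>(j,l)\<in>prod.swap ` upairs B. f j l)"
    using finite_upairs[OF assms] by (intro sum.union_disjoint) (auto simp: upairs_def)
  also have "(\<Sum>(j,l)\<in>prod.swap ` upairs B. f j l) = (\<Sum>(j,l)\<in>upairs B. f l j)"
    by (subst sum.reindex) (auto simp: inj_on_def intro!: sum.cong)
  finally show ?thesis by (simp add: sum.distrib case_prod_beta)
qed

lemma sum_upairs_remove:
  fixes f :: "nat \<Rightarrow> nat \<Rightarrow> 'a::comm_monoid_add"
  assumes "finite B" "i \<in> B" "\<And>j. j \<in> B \<Longrightarrow> j \<noteq> i \<Longrightarrow> f j i = f i j"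
  shows "(\<Sum>(j,l)\<in>upairs B. f j l) = (\<Sum>j\<in>B - {i}. f i j) + (\<Sum>(j,l)\<in>upairs (B - {i}). f j l)"
proof -
  \<comment> \<open>The pairs containing \<open>i\<close>, listed by their other member; symmetry of
    \<open>f\<close> at \<open>i\<close> allows the order of the two entries to be ignored.\<close>
  let ?g = "\<lambda>j. (min i j, max i j)"
  have "upairs B = ?g ` (B - {i}) \<union> upairs (B - {i})"
    using assms(2) by (auto simp: upairs_def image_iff min_def max_def split: if_splits)
      (metis Diff_iff insertE less_imp_le not_less singletonD empty_iff insert_iff nat_neq_iff order.asym)+
  moreover have "?g ` (B - {i}) \<inter> upairs (B - {i}) = {}"
    by (auto simp: upairs_def min_def max_def split: if_splits)
  ultimately have "(\<Sum>(j,l)\<in>upairs B. f j l)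
     = (\<Sum>(j,l)\<in>?g ` (B - {i}). f j l) + (\<Sum>(j,l)\<in>upairs (B - {i}). f j l)"
    using assms(1) finite_upairs[of "B - {i}"] by (simp add: sum.union_disjoint)
  also have "(\<Sum>(j,l)\<in>?g ` (B - {i}). f j l) = (\<Sum>j\<in>B - {i}. f i j)"
    using assms(3) by (subst sum.reindex) (auto simp: inj_on_def min_def max_def split: if_splits intro!: sum.cong)
  finally show ?thesis .
qed

text \<open>Stated with variables so that \<open>pair_zero\<close> can use it with
  \<open>w = u^2\<close>, \<open>v = u + 1\<close> and with long sums left untouched.\<close>

lemma scaled_combination:
  fixes p :: complex
  assumes "p = k * (s - s') + f / 2 * (a - b) + r"
  shows "w * v * p = v * (k * (w * s)) - w * v * (k * s') + w * (f * (v * (a - b))) / 2 + w * v * r"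
  unfolding assms by (simp add: field_simps)

text \<open>\<open>\<gamma>\<close> and \<open>\<phi>\<close> are to be the coefficients of
  \<open>dk/dx\<close> and of the function \<open>\<phi>\<close>. \<open>fay'\<close> combines the
  Fay identity in arguments \<open>p, r\<close> with its derivative along
  \<open>(p - e, r + e)\<close>: factors at \<open>p + r\<close> stay undifferentiated, which yields
  just the products that occur in the bracket. \<open>weierstrass\<close> is its analogue for two
  equal points.\<close>

locale kzb_tau = kzb_flat +
  fixes \<gamma> :: "nat \<Rightarrow> nat \<Rightarrow> nat \<Rightarrow> complex"
  assumes gamma_kappa: "\<And>i j m. distinct [i,j] \<Longrightarrow> {i,j} \<subseteq> A \<Longrightarrow> \<gamma> i j m = of_nat (Suc m) * \<kappa> i j (Suc m)"
    and phi_0: "\<phi> 0 = 0" and phi_odd: "\<And>m. odd m \<Longrightarrow> \<phi> m = 0"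
    and fay': "\<And>i j l d u. distinct [i,j,l] \<Longrightarrow> {i,j,l} \<subseteq> A \<Longrightarrow>
      u^2 * (u + 1) * (\<kappa> i j (Suc d) * ((u + 1) ^ Suc d - u ^ Suc d - of_nat (Suc d) * u ^ d))
      - (u + 1) * (\<kappa> i l (Suc d) * ((u + 1) ^ Suc d - 1 - of_nat (Suc d) * u))
      - u^2 * (\<gamma> j l d * (1 - (- u) ^ d))
      + u^2 * (u + 1) * (\<Sum>p<d. \<gamma> i l p * \<kappa> i j (d - 1 - p) * u ^ (d - 1 - p)
          - \<gamma> i j p * \<kappa> i l (d - 1 - p) * u ^ p
          - \<gamma> j l p * \<kappa> i j (d - 1 - p) * (u + 1) ^ (d - 1 - p)
          + \<gamma> j l p * \<kappa> i l (d - 1 - p) * (-1) ^ p * ((u + 1) ^ (d - 1 - p) * u ^ p)) = 0"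
    and weierstrass: "\<And>i j d u. distinct [i,j] \<Longrightarrow> {i,j} \<subseteq> A \<Longrightarrow>
      (u + 1) * (\<kappa> i j (Suc d) * ((u + 1) ^ Suc d - 1 - of_nat (Suc d) * u))
      - u^2 * (u + 1) * (\<kappa> i j (Suc d) * ((u + 1) ^ Suc d - u ^ Suc d - of_nat (Suc d) * u ^ d))
      + u^2 * (\<phi> d * (u ^ d - 1))
      + u^2 * (u + 1) * (\<Sum>p<d. \<gamma> i j p * \<kappa> i j (d - 1 - p) * (u ^ p - u ^ (d - 1 - p))
          - \<phi> p * \<kappa> i j (d - 1 - p) * ((u + 1) ^ (d - 1 - p) - (u + 1) ^ (d - 1 - p) * u ^ p)) = 0"
begin

definition gt :: "nat \<Rightarrow> nat \<Rightarrow> nat \<Rightarrow> lie" where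
  "gt i j m = cscale (\<gamma> i j m) (tm i j m)"

definition Gt :: "nat \<Rightarrow> lie" where
  "Gt m = (\<Sum>(j,l)\<in>upairs A. gt j l m)"

text \<open>Indexed by the exponent of \<open>x\<close> in \<open>\<phi>\<close>, so that
  \<open>Dl m\<close> has degree \<open>m + 2\<close> just like \<open>Gt m\<close>.\<close>

definition Dl :: "nat \<Rightarrow> lie" where
  "Dl m = (if even m \<and> m \<ge> 2 then cscale (\<phi> m) (dl (m div 2)) else 0)"

text \<open>The part of degree \<open>N\<close> of \<open>2\<pi>i\<close> times \<open>Deltabar\<close>.\<close>
definition Dc :: "nat \<Rightarrow> lie" where
  "Dc N = (if N = 0 then - D0 else if N \<ge> 2 then Gt (N - 2) - Dl (N - 2) else 0)"

text \<open>Differentiation in \<open>x\<close> reverses parity: \<open>gt\<close> is symmetric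
  where \<open>kt\<close> is antisymmetric. This is what makes sums over unordered pairs independent
  of the chosen order.\<close>

lemma gt_swap:
  assumes "i \<noteq> j" "i \<in> A" "j \<in> A"
  shows "gt j i m = gt i j m"
proof -
  have "(-1) ^ m * (-1) ^ m = (1::complex)" by (simp add: power_mult_distrib[symmetric])
  then have "\<gamma> j i m * (-1) ^ m = \<gamma> i j m"
    using gamma_kappa[of i j m] gamma_kappa[of j i m] kappa_sym[of i j "Suc m"] assms
    by (simp add: mult.assoc mult.left_commute)
  then show ?thesis
    using tm_swap[of j i m] assms by (simp add: gt_def)
qed

lemma Gt_split:
  assumes "i \<in> A"
  shows "Gt m = (\<Sum>j\<in>A - {i}. gt i j m) + (\<Sum>(j,l)\<in>upairs (A - {i}). gt j l m)"
  unfolding Gt_def using finite_A assms by (intro sum_upairs_remove) (auto intro: gt_swap)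

lemma gt_kt_disj:
  assumes "distinct [i,j,k,l]" "i \<in> A" "j \<in> A" "k \<in> A" "l \<in> A"
  shows "br (gt i j p) (kt k l q) = 0"
  using tm_disj[OF assms] by (simp add: kt_def gt_def br_scale_left br_scale_right)

text \<open>Pairs containing \<open>i\<close> meet every \<open>kt i l\<close>. A pair
  \<open>j, l\<close> without \<open>i\<close> meets only \<open>kt i j\<close> and
  \<open>kt i l\<close>, all other brackets being on disjoint indices.\<close>

lemma br_Gt_Kt:
  assumes i: "i \<in> A"
  shows "br (Gt p) (Kt i q) = (\<Sum>j\<in>A - {i}. br (gt i j p) (kt i j q))
    + (\<Sum>(j,l)\<in>upairs (A - {i}). br (gt i j p) (kt i l q) + br (gt i l p) (kt i j q)
        + br (gt j l p) (kt i j q) + br (gt j l p) (kt i l q))"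
proof -
  let ?B = "A - {i}"
  have fin: "finite ?B" using finite_A by simp
  have "br (\<Sum>j\<in>?B. gt i j p) (Kt i q) = (\<Sum>j\<in>?B. \<Sum>l\<in>?B. br (gt i j p) (kt i l q))"
    by (simp only: Kt_def br_sum_left br_sum_right) (rule sum.swap)
  also have "\<dots> = (\<Sum>j\<in>?B. br (gt i j p) (kt i j q) + (\<Sum>l\<in>?B - {j}. br (gt i j p) (kt i l q)))"
    using fin by (intro sum.cong refl sum.remove) auto
  also have "\<dots> = (\<Sum>j\<in>?B. br (gt i j p) (kt i j q))
     + (\<Sum>(j,l)\<in>upairs ?B. br (gt i j p) (kt i l q) + br (gt i l p) (kt i j q))"
    unfolding sum.distrib sum_upairs[OF fin] by simp
  finally have 1: "br (\<Sum>j\<in>?B. gt i j p) (Kt i q) = \<dots>" .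
  have 2: "br (gt j l p) (Kt i q) = br (gt j l p) (kt i j q) + br (gt j l p) (kt i l q)"
    if "(j, l) \<in> upairs ?B" for j l
  proof -
    have jl: "j \<in> ?B" "l \<in> ?B" "j \<noteq> l" using that by (auto simp: upairs_def)
    then have "?B = insert j (insert l (?B - {j,l}))" by auto
    then have "Kt i q = kt i j q + (kt i l q + (\<Sum>k\<in>?B - {j,l}. kt i k q))"
      using jl fin unfolding Kt_def by (metis (no_types, lifting) Diff_iff finite_Diff finite_insert insertCI insertE singletonD sum.insert)
    moreover have "(\<Sum>k\<in>?B - {j,l}. br (gt j l p) (kt i k q)) = 0"
      using jl i by (intro sum.neutral ballI gt_kt_disj) auto
    ultimately show ?thesis by (simp add: br_add_right br_sum_right)
  qed
  have "br (\<Sum>(j,l)\<in>upairs ?B. gt j l p) (Kt i q)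
      = (\<Sum>(j,l)\<in>upairs ?B. br (gt j l p) (kt i j q) + br (gt j l p) (kt i l q))"
    unfolding br_sum_left by (intro sum.cong refl) (auto simp: 2)
  then show ?thesis
    unfolding Gt_split[OF i] br_add_left 1 by (simp add: sum.distrib case_prod_beta add.assoc)
qed

text \<open>The derivation commutes with \<open>ad (x i)\<close>, so its value on
  \<open>t i j\<close> decides.\<close>

lemma Dl_tm:
  assumes "i \<noteq> j" "i \<in> A" "j \<in> A"
  shows "br (Dl p) (tm i j q) = cscale (\<phi> p) (E2 i j (p + q) (S ^ q))"
proof (cases "even p \<and> p \<ge> 2")
  case True
  then have "p div 2 \<ge> 1" "2 * (p div 2) = p" by auto
  then have "br (dl (p div 2)) (tm i j q) = adp (x i) q (br (tm i j 0) (tm i j p))"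
    using dl_x[of "p div 2" i] dl_t[of "p div 2" i j] assms
    unfolding tm_def by (subst br_adp_comm) auto
  then show ?thesis
    using True E2_mono[of i q j 0 p] by (simp add: Dl_def br_scale_left add.commute)
next
  case False
  then have "\<phi> p = 0" using phi_0 phi_odd[of p] by (cases "p = 0") (auto simp: not_le less_2_cases_iff)
  with False show ?thesis by (simp add: Dl_def)
qed

lemma Dl_y:
  assumes "i \<in> A"
  shows "br (Dl d) (y i) = (\<Sum>j\<in>A - {i}. cscale (\<phi> d / 2)
     (E2 i j (d - 1) (\<Sum>p<d. Polynomial.smult ((-1) ^ (d - 1 - p)) (U ^ p))))"
proof (cases "even d \<and> d \<ge> 2")
  case True
  then have d: "d div 2 \<ge> 1" "2 * (d div 2) = d" "{0..d - 1} = {..<d}" by auto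
  have "br (adp (x i) p (t i j)) (cscale ((-1) ^ (d - 1 - p)) (adp (x i) (d - 1 - p) (t i j)))
      = cscale ((-1) ^ (d - 1 - p)) (E2 i j (d - 1) (U ^ p))" if "p < d" for p j
    using E2_mono[of i 0 j p "d - 1 - p"] that by (simp add: br_scale_right tm_def)
  then show ?thesis
    using True d assms dl_y[of "d div 2" i]
    by (simp add: Dl_def br_scale_left E2_sum E2_smult cvec.scale_sum_right)
next
  case False
  then have "\<phi> d = 0" using phi_0 phi_odd[of d] by (cases "d = 0") (auto simp: not_le less_2_cases_iff)
  with False show ?thesis by (simp add: Dl_def)
qed

text \<open>The weighted geometric sum over \<open>Suc c * a^(d-1-c) * b^c\<close> equals
  \<open>(a^(d+1) - b^(d+1) - (d+1) * b^d * (a-b)) / (a-b)^2\<close>. Here \<open>a = u + 1\<close>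
  and \<open>b = u\<close>, so the denominator is 1; \<open>sum_S'\<close> is the case
  \<open>b = 1\<close>. The weights are those of \<open>D0_tm\<close>.\<close>

lemma sum_SU': "(\<Sum>c<d. of_nat (Suc c) * ((u + 1) ^ (d - 1 - c) * u ^ c))
   = (u + 1) ^ Suc d - u ^ Suc d - of_nat (Suc d) * (u::complex) ^ d"
proof (induction d)
  case (Suc d)
  have "(\<Sum>c<Suc d. of_nat (Suc c) * ((u + 1) ^ (Suc d - 1 - c) * u ^ c))
    = (u + 1) * (\<Sum>c<d. of_nat (Suc c) * ((u + 1) ^ (d - 1 - c) * u ^ c)) + of_nat (Suc d) * u ^ d"
  proof -
    have "(\<Sum>c<d. of_nat (Suc c) * ((u + 1) ^ (d - c) * u ^ c))
       = (u + 1) * (\<Sum>c<d. of_nat (Suc c) * ((u + 1) ^ (d - 1 - c) * u ^ c))"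
      unfolding sum_distrib_left
    proof (intro sum.cong refl)
      fix c assume "c \<in> {..<d}"
      then have "d - c = Suc (d - 1 - c)" by auto
      then have "(u + 1) ^ (d - c) = (u + 1) * (u + 1) ^ (d - 1 - c)" by simp
      then show "of_nat (Suc c) * ((u + 1) ^ (d - c) * u ^ c) = (u + 1) * (of_nat (Suc c) * ((u + 1) ^ (d - 1 - c) * u ^ c))"
        by (simp only: mult_ac)
    qed
    then show ?thesis by simp
  qed
  also have "\<dots> = (u + 1) ^ Suc (Suc d) - u ^ Suc (Suc d) - of_nat (Suc (Suc d)) * u ^ Suc d"
    unfolding Suc.IH by (simp add: algebra_simps)
  finally show ?case .
qed simp

lemma sum_S': "u\<^sup>2 * (\<Sum>c<d. of_nat (Suc c) * (u + 1) ^ (d - 1 - c))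
   = (u + 1) ^ Suc d - 1 - of_nat (Suc d) * (u::complex)"
proof (induction d)
  case (Suc d)
  have "(\<Sum>c<Suc d. of_nat (Suc c) * (u + 1) ^ (Suc d - 1 - c))
    = (u + 1) * (\<Sum>c<d. of_nat (Suc c) * (u + 1) ^ (d - 1 - c)) + of_nat (Suc d)"
  proof -
    have "(\<Sum>c<d. of_nat (Suc c) * (u + 1) ^ (d - c))
       = (u + 1) * (\<Sum>c<d. of_nat (Suc c) * (u + 1) ^ (d - 1 - c))"
      unfolding sum_distrib_left
    proof (intro sum.cong refl)
      fix c assume "c \<in> {..<d}"
      then have "d - c = Suc (d - 1 - c)" by auto
      then have "(u + 1) ^ (d - c) = (u + 1) * (u + 1) ^ (d - 1 - c)" by simp
      then show "of_nat (Suc c) * (u + 1) ^ (d - c) = (u + 1) * (of_nat (Suc c) * (u + 1) ^ (d - 1 - c))"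
        by (simp only: mult_ac)
    qed
    then show ?thesis by simp
  qed
  then have "u\<^sup>2 * (\<Sum>c<Suc d. of_nat (Suc c) * (u + 1) ^ (Suc d - 1 - c))
    = (u + 1) * (u\<^sup>2 * (\<Sum>c<d. of_nat (Suc c) * (u + 1) ^ (d - 1 - c))) + u\<^sup>2 * of_nat (Suc d)"
    by (simp only: distrib_left mult_ac)
  also have "\<dots> = (u + 1) ^ Suc (Suc d) - 1 - of_nat (Suc (Suc d)) * u"
    unfolding Suc.IH by (simp add: algebra_simps power2_eq_square)
  finally show ?case .
qed simp

text \<open>The first two sums are the commutators with \<open>t i l\<close> and
  \<open>t i j\<close> left by \<open>D0_tm\<close>. As in \<open>triple_zero\<close> all terms are
  values of \<open>E i j l (d - 1)\<close>; here \<open>u^2 * (u + 1) * poly P u\<close> is the left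
  side of \<open>fay'\<close>.\<close>

lemma triple_zero':
  assumes "distinct [i,j,l]" "i \<in> A" "j \<in> A" "l \<in> A"
  shows "cscale (\<kappa> i j (Suc d)) (\<Sum>c<d. cscale (of_nat (Suc c)) (adp (x i) (d - 1 - c) (br (t i l) (tm i j c))))
    + cscale (\<kappa> i l (Suc d)) (\<Sum>c<d. cscale (of_nat (Suc c)) (adp (x i) (d - 1 - c) (br (t i j) (tm i l c))))
    + br (y i) (gt j l d)
    + (\<Sum>p<d. br (gt i j p) (kt i l (d - 1 - p)) + br (gt i l p) (kt i j (d - 1 - p))
        + br (gt j l p) (kt i j (d - 1 - p)) + br (gt j l p) (kt i l (d - 1 - p))) = 0"
proof -
  define P where "P = Polynomial.smult (\<kappa> i j (Suc d)) (\<Sum>c<d. Polynomial.smult (of_nat (Suc c)) (S ^ (d - 1 - c) * U ^ c))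
     - Polynomial.smult (\<kappa> i l (Suc d)) (\<Sum>c<d. Polynomial.smult (of_nat (Suc c)) (S ^ (d - 1 - c)))
     - Polynomial.smult (\<gamma> j l d) (\<Sum>p<d. Polynomial.smult ((-1) ^ p) (U ^ p))
     + (\<Sum>p<d. Polynomial.smult (\<gamma> i l p * \<kappa> i j (d - 1 - p)) (U ^ (d - 1 - p))
          - Polynomial.smult (\<gamma> i j p * \<kappa> i l (d - 1 - p)) (U ^ p)
          - Polynomial.smult (\<gamma> j l p * \<kappa> i j (d - 1 - p)) (S ^ (d - 1 - p))
          + Polynomial.smult (\<gamma> j l p * \<kappa> i l (d - 1 - p) * (-1) ^ p) (S ^ (d - 1 - p) * U ^ p))"
  have "P = 0"
  proof (rule poly_zeroI_cofinite[of "{0, -1}"])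
    fix u :: complex assume u: "u \<notin> {0, -1}"
    have "poly P u = \<kappa> i j (Suc d) * (\<Sum>c<d. of_nat (Suc c) * ((u + 1) ^ (d - 1 - c) * u ^ c))
      - \<kappa> i l (Suc d) * (\<Sum>c<d. of_nat (Suc c) * (u + 1) ^ (d - 1 - c)) - \<gamma> j l d * (\<Sum>p<d. (-1) ^ p * u ^ p)
      + (\<Sum>p<d. \<gamma> i l p * \<kappa> i j (d - 1 - p) * u ^ (d - 1 - p)
          - \<gamma> i j p * \<kappa> i l (d - 1 - p) * u ^ p
          - \<gamma> j l p * \<kappa> i j (d - 1 - p) * (u + 1) ^ (d - 1 - p)
          + \<gamma> j l p * \<kappa> i l (d - 1 - p) * (-1) ^ p * ((u + 1) ^ (d - 1 - p) * u ^ p))"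
      unfolding P_def by (simp add: poly_sum add.commute[of 1])
    then have "u^2 * (u + 1) * poly P u = 
      u^2 * (u + 1) * (\<kappa> i j (Suc d) * (\<Sum>c<d. of_nat (Suc c) * ((u + 1) ^ (d - 1 - c) * u ^ c)))
      - (u + 1) * (\<kappa> i l (Suc d) * (u^2 * (\<Sum>c<d. of_nat (Suc c) * (u + 1) ^ (d - 1 - c))))
      - u^2 * (\<gamma> j l d * ((u + 1) * (\<Sum>p<d. (-1) ^ p * u ^ p)))
      + u^2 * (u + 1) * (\<Sum>p<d. \<gamma> i l p * \<kappa> i j (d - 1 - p) * u ^ (d - 1 - p)
          - \<gamma> i j p * \<kappa> i l (d - 1 - p) * u ^ p
          - \<gamma> j l p * \<kappa> i j (d - 1 - p) * (u + 1) ^ (d - 1 - p)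
          + \<gamma> j l p * \<kappa> i l (d - 1 - p) * (-1) ^ p * ((u + 1) ^ (d - 1 - p) * u ^ p))"
      by algebra
    also have "\<dots> = 0"
      unfolding sum_SU' sum_S' sum_U using assms by (intro fay') auto
    finally show "poly P u = 0" using u by (auto simp: eq_neg_iff_add_eq_0)
  qed simp
  moreover have "E i j l (d - 1) P = cscale (\<kappa> i j (Suc d)) (\<Sum>c<d. cscale (of_nat (Suc c)) (adp (x i) (d - 1 - c) (br (t i l) (tm i j c))))
    + cscale (\<kappa> i l (Suc d)) (\<Sum>c<d. cscale (of_nat (Suc c)) (adp (x i) (d - 1 - c) (br (t i j) (tm i l c))))
    + br (y i) (gt j l d)
    + (\<Sum>p<d. br (gt i j p) (kt i l (d - 1 - p)) + br (gt i l p) (kt i j (d - 1 - p))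
        + br (gt j l p) (kt i j (d - 1 - p)) + br (gt j l p) (kt i l (d - 1 - p)))"
  proof -
    have 1: "br (gt i j p) (kt i l (d - 1 - p)) + br (gt i l p) (kt i j (d - 1 - p))
        + br (gt j l p) (kt i j (d - 1 - p)) + br (gt j l p) (kt i l (d - 1 - p)) =
      E i j l (d - 1) (Polynomial.smult (\<gamma> i l p * \<kappa> i j (d - 1 - p)) (U ^ (d - 1 - p))
          - Polynomial.smult (\<gamma> i j p * \<kappa> i l (d - 1 - p)) (U ^ p)
          - Polynomial.smult (\<gamma> j l p * \<kappa> i j (d - 1 - p)) (S ^ (d - 1 - p))
          + Polynomial.smult (\<gamma> j l p * \<kappa> i l (d - 1 - p) * (-1) ^ p) (S ^ (d - 1 - p) * U ^ p))"
      if "p < d" for p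
    proof -
      have a: "d - 1 - p + p = d - 1" "p + (d - 1 - p) = d - 1" using that by auto
      have e: "br (tm i j p) (tm i l (d - 1 - p)) = - E i j l (d - 1) (U ^ p)"
         "br (tm j l p) (tm i j (d - 1 - p)) = - E i j l (d - 1) (S ^ (d - 1 - p))"
         "br (tm j l p) (tm i l (d - 1 - p)) = cscale ((-1) ^ p) (E i j l (d - 1) (S ^ (d - 1 - p) * U ^ p))"
         "br (tm i l p) (tm i j (d - 1 - p)) = E i j l (d - 1) (U ^ (d - 1 - p))"
        using br_il_ij[OF assms, of "d - 1 - p" p] br_antisym[of "tm i j p" "tm i l (d - 1 - p)"]
          br_ij_jl[OF assms, of "d - 1 - p" p] br_antisym[of "tm j l p" "tm i j (d - 1 - p)"]
          br_il_jl[OF assms, of "d - 1 - p" p] br_antisym[of "tm j l p" "tm i l (d - 1 - p)"]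
          br_il_ij[OF assms, of p "d - 1 - p"]
        unfolding a by simp_all
      show ?thesis
        unfolding gt_def kt_def br_scale_left br_scale_right e
        by (simp add: E_diff E_add E_smult mult.commute mult.left_commute)
    qed
    have 2: "(\<Sum>c<d. cscale (of_nat (Suc c)) (adp (x i) (d - 1 - c) (br (t i l) (tm i j c))))
       = (\<Sum>c<d. cscale (of_nat (Suc c)) (E i j l (d - 1) (S ^ (d - 1 - c) * U ^ c)))"
      by (intro sum.cong refl) (simp add: x_br_til_tij[OF assms])
    have 3: "(\<Sum>c<d. cscale (of_nat (Suc c)) (adp (x i) (d - 1 - c) (br (t i j) (tm i l c))))
       = - (\<Sum>c<d. cscale (of_nat (Suc c)) (E i j l (d - 1) (S ^ (d - 1 - c))))"
      unfolding sum_negf[symmetric] by (intro sum.cong refl) (simp add: x_br_tij_til[OF assms])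
    have 4: "(\<Sum>p<d. br (gt i j p) (kt i l (d - 1 - p)) + br (gt i l p) (kt i j (d - 1 - p))
        + br (gt j l p) (kt i j (d - 1 - p)) + br (gt j l p) (kt i l (d - 1 - p))) =
      (\<Sum>p<d. E i j l (d - 1) (Polynomial.smult (\<gamma> i l p * \<kappa> i j (d - 1 - p)) (U ^ (d - 1 - p))
          - Polynomial.smult (\<gamma> i j p * \<kappa> i l (d - 1 - p)) (U ^ p)
          - Polynomial.smult (\<gamma> j l p * \<kappa> i j (d - 1 - p)) (S ^ (d - 1 - p))
          + Polynomial.smult (\<gamma> j l p * \<kappa> i l (d - 1 - p) * (-1) ^ p) (S ^ (d - 1 - p) * U ^ p)))"
      by (intro sum.cong refl 1) simp
    show ?thesis
      unfolding 2 3 4 P_def E_add E_diff E_smult E_sum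
      by (simp add: gt_def br_scale_right y_tm_jl[OF assms])
  qed
  ultimately show ?thesis by simp
qed

text \<open>The element is \<open>E2\<close> of \<open>?P\<close> and, by \<open>E2_mirror\<close>,
  minus \<open>E2\<close> of the mirror polynomial \<open>?Q\<close>. The assumption
  \<open>weierstrass\<close> says that \<open>?P = ?Q\<close>, so the element equals its own
  negative.\<close>

lemma pair_zero:
  assumes ij: "i \<noteq> j" "i \<in> A" "j \<in> A"
  shows "cscale (\<kappa> i j (Suc d)) (\<Sum>c<d. cscale (of_nat (Suc c)) (adp (x i) (d - 1 - c) (br (t i j) (tm i j c))))
    + cscale (\<phi> d / 2) (E2 i j (d - 1) (\<Sum>p<d. Polynomial.smult ((-1) ^ (d - 1 - p)) (U ^ p)))
    + (\<Sum>p<d. br (gt i j p) (kt i j (d - 1 - p)) - br (Dl p) (kt i j (d - 1 - p))) = 0"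
    (is "?Z = 0")
proof -
  \<comment> \<open>\<open>f\<close> selects one of two mirror exponents of \<open>U\<close> in
    every term: the first projection gives the polynomial of the element, the second its mirror
    image. The argument \<open>g\<close> is a dummy.\<close>
  define P where "P f g = Polynomial.smult (\<kappa> i j (Suc d)) (\<Sum>c<d. Polynomial.smult (of_nat (Suc c)) (S ^ (d - 1 - c) * U ^ f 0 c))
    + Polynomial.smult (\<phi> d / 2) (\<Sum>p<d. Polynomial.smult ((-1) ^ (d - 1 - p)) (U ^ f p (d - 1 - p)))
    + (\<Sum>p<d. Polynomial.smult (\<gamma> i j p * \<kappa> i j (d - 1 - p)) (U ^ f p (d - 1 - p))
        - Polynomial.smult (\<phi> p * \<kappa> i j (d - 1 - p)) (S ^ (d - 1 - p) * U ^ f 0 p))"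
    for f :: "nat \<Rightarrow> nat \<Rightarrow> nat" and g :: unit
  let ?P = "P (\<lambda>a b. a) ()" and ?Q = "P (\<lambda>a b. b) ()"
  have Z: "?Z = E2 i j (d - 1) ?P"
  proof -
    have 1: "adp (x i) (d - 1 - c) (br (t i j) (tm i j c)) = E2 i j (d - 1) (S ^ (d - 1 - c))" if "c < d" for c
      using E2_mono[of i "d - 1 - c" j 0 c] that by simp
    have 2: "br (tm i j p) (tm i j (d - 1 - p)) = E2 i j (d - 1) (U ^ p)" if "p < d" for p
      using E2_mono[of i 0 j p "d - 1 - p"] that by simp
    have 3: "(\<Sum>c<d. cscale (of_nat (Suc c)) (adp (x i) (d - 1 - c) (br (t i j) (tm i j c))))
        = (\<Sum>c<d. cscale (of_nat (Suc c)) (E2 i j (d - 1) (S ^ (d - 1 - c))))"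
      by (intro sum.cong refl) (simp only: 1 lessThan_iff)
    have 4: "br (gt i j p) (kt i j (d - 1 - p)) - br (Dl p) (kt i j (d - 1 - p))
        = cscale (\<gamma> i j p * \<kappa> i j (d - 1 - p)) (E2 i j (d - 1) (U ^ p))
          - cscale (\<phi> p * \<kappa> i j (d - 1 - p)) (E2 i j (d - 1) (S ^ (d - 1 - p)))" if "p < d" for p
    proof -
      have "p + (d - 1 - p) = d - 1" using that by simp
      then have "br (Dl p) (tm i j (d - 1 - p)) = cscale (\<phi> p) (E2 i j (d - 1) (S ^ (d - 1 - p)))"
        using Dl_tm[OF ij, of p "d - 1 - p"] by simp
      with 2[OF that] show ?thesis
        unfolding gt_def kt_def br_scale_left br_scale_right by (simp add: mult.commute)
    qed
    have 5: "(\<Sum>p<d. br (gt i j p) (kt i j (d - 1 - p)) - br (Dl p) (kt i j (d - 1 - p)))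
        = (\<Sum>p<d. cscale (\<gamma> i j p * \<kappa> i j (d - 1 - p)) (E2 i j (d - 1) (U ^ p))
          - cscale (\<phi> p * \<kappa> i j (d - 1 - p)) (E2 i j (d - 1) (S ^ (d - 1 - p))))"
      by (intro sum.cong refl 4) simp
    show ?thesis
      unfolding 3 5 P_def E2_add E2_smult E2_sum E2_diff by simp
  qed
  have M: "E2 i j (d - 1) ?P = - E2 i j (d - 1) ?Q"
  proof -
    have 1: "E2 i j (d - 1) (S ^ (d - 1 - c)) = - E2 i j (d - 1) (S ^ (d - 1 - c) * U ^ c)" if "c < d" for c
      using E2_mirror[of i j "d - 1 - c" 0 c] that by simp
    have 2: "E2 i j (d - 1) (U ^ p) = - E2 i j (d - 1) (U ^ (d - 1 - p))" if "p < d" for p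
      using E2_mirror[of i j 0 p "d - 1 - p"] that by simp
    have "(\<Sum>c<d. cscale (of_nat (Suc c)) (E2 i j (d - 1) (S ^ (d - 1 - c))))
       = - (\<Sum>c<d. cscale (of_nat (Suc c)) (E2 i j (d - 1) (S ^ (d - 1 - c) * U ^ c)))"
      unfolding sum_negf[symmetric] by (intro sum.cong refl) (subst 1, auto)
    moreover have "(\<Sum>p<d. cscale ((-1) ^ (d - 1 - p)) (E2 i j (d - 1) (U ^ p)))
       = - (\<Sum>p<d. cscale ((-1) ^ (d - 1 - p)) (E2 i j (d - 1) (U ^ (d - 1 - p))))"
      unfolding sum_negf[symmetric] by (intro sum.cong refl) (subst 2, auto)
    moreover have "(\<Sum>p<d. cscale (\<gamma> i j p * \<kappa> i j (d - 1 - p)) (E2 i j (d - 1) (U ^ p))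
        - cscale (\<phi> p * \<kappa> i j (d - 1 - p)) (E2 i j (d - 1) (S ^ (d - 1 - p))))
      = - (\<Sum>p<d. cscale (\<gamma> i j p * \<kappa> i j (d - 1 - p)) (E2 i j (d - 1) (U ^ (d - 1 - p)))
        - cscale (\<phi> p * \<kappa> i j (d - 1 - p)) (E2 i j (d - 1) (S ^ (d - 1 - p) * U ^ p)))"
      unfolding sum_negf[symmetric] by (intro sum.cong refl) (subst 1, simp, subst 2, auto)
    ultimately show ?thesis
      unfolding P_def E2_add E2_smult E2_sum E2_diff by simp
  qed
  have "?P - ?Q = 0"
  proof (rule poly_zeroI_cofinite[of "{0, -1}"])
    fix u :: complex assume u: "u \<notin> {0, -1}"
    define a where "a = (\<Sum>p<d. (-1) ^ (d - 1 - p) * u ^ p)"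
    define b where "b = (\<Sum>p<d. (-1) ^ (d - 1 - p) * u ^ (d - 1 - p))"
    have b: "(u + 1) * b = 1 - (- u) ^ d"
      unfolding b_def sum_U[symmetric]
      using sum.nat_diff_reindex[of "\<lambda>p. (-1) ^ p * u ^ p" d] by simp
    \<comment> \<open>For odd \<open>d\<close> the factor \<open>\<phi> d\<close> vanishes. For even
      \<open>d\<close> the parities of \<open>p\<close> and \<open>d - 1 - p\<close> differ, so
      \<open>a\<close> is minus the geometric sum \<open>b\<close>.\<close>
    have ab: "\<phi> d * ((u + 1) * (a - b)) = 2 * (\<phi> d * (u ^ d - 1))"
    proof (cases "odd d")
      case False
      have "a = - (\<Sum>p<d. (-1) ^ p * u ^ p)"
        unfolding a_def sum_negf[symmetric]
      proof (intro sum.cong refl)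
        fix p assume "p \<in> {..<d}"
        with False have "even (d - 1 - p) = odd p" by auto
        then show "(-1) ^ (d - 1 - p) * u ^ p = - ((-1) ^ p * u ^ p)" by (auto simp: minus_one_power_iff)
      qed
      then have "(u + 1) * a = - (1 - (- u) ^ d)" using sum_U[of u d] by (simp only: mult_minus_right)
      with b False show ?thesis by (simp add: right_diff_distrib)
    qed (use phi_odd in simp)
    have "poly (?P - ?Q) u = \<kappa> i j (Suc d) * ((\<Sum>c<d. of_nat (Suc c) * (u + 1) ^ (d - 1 - c))
       - (\<Sum>c<d. of_nat (Suc c) * ((u + 1) ^ (d - 1 - c) * u ^ c)))
      + \<phi> d / 2 * (a - b)
      + (\<Sum>p<d. \<gamma> i j p * \<kappa> i j (d - 1 - p) * (u ^ p - u ^ (d - 1 - p))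
          - \<phi> p * \<kappa> i j (d - 1 - p) * ((u + 1) ^ (d - 1 - p) - (u + 1) ^ (d - 1 - p) * u ^ p))"
      unfolding P_def a_def b_def
      by (simp add: poly_sum add.commute[of 1] right_diff_distrib sum_subtractf)
    then have "u^2 * (u + 1) * poly (?P - ?Q) u =
      (u + 1) * (\<kappa> i j (Suc d) * (u^2 * (\<Sum>c<d. of_nat (Suc c) * (u + 1) ^ (d - 1 - c))))
      - u^2 * (u + 1) * (\<kappa> i j (Suc d) * (\<Sum>c<d. of_nat (Suc c) * ((u + 1) ^ (d - 1 - c) * u ^ c)))
      + u^2 * (\<phi> d * ((u + 1) * (a - b))) / 2
      + u^2 * (u + 1) * (\<Sum>p<d. \<gamma> i j p * \<kappa> i j (d - 1 - p) * (u ^ p - u ^ (d - 1 - p))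
          - \<phi> p * \<kappa> i j (d - 1 - p) * ((u + 1) ^ (d - 1 - p) - (u + 1) ^ (d - 1 - p) * u ^ p))"
      by (rule scaled_combination)
    also have "\<dots> = 0"
      unfolding ab sum_SU' sum_S' using ij weierstrass[of i j u d] by simp
    finally show "poly (?P - ?Q) u = 0" using u by (auto simp: eq_neg_iff_add_eq_0)
  qed simp
  then show ?thesis using M lie_eq_neg[of ?Z] unfolding Z by simp
qed

theorem Dc_flat:
  assumes i: "i \<in> A"
  shows "(\<Sum>p\<le>N. br (Dc p) (Kc i (N - p))) = 0"
proof -
  have "N = 0 \<or> N = 1 \<or> N = 2 \<or> (\<exists>d. N = d + 3)" by presburger
  then consider "N = 0" | "N = 1" | "N = 2" | d where "N = d + 3" by blast
  then show ?thesis
  proof cases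
    case 2
    then show ?thesis using D0_y i by (simp add: Dc_def Kc_def br_minus_left br_minus_right)
  next
    case 3
    have "br D0 (Kt i 0) = 0"
      unfolding Kt_def br_sum_right using D0_t i by (intro sum.neutral) (auto simp: kt_def br_scale_right)
    then show ?thesis using 3 by (simp add: Dc_def Kc_def br_minus_left numeral_2_eq_2)
  next
    \<comment> \<open>Total degree \<open>d + 3\<close> again: \<open>D0\<close> of degree 0 meets
      \<open>Kt i (Suc d)\<close>, \<open>y i\<close> meets \<open>Gt d - Dl d\<close>, and the
      remaining pairs have \<open>p + q = d - 1\<close>.\<close>
    case (4 d)
    let ?B = "A - {i}"
    \<comment> \<open>\<open>F\<close> collects the commutators produced by \<open>D0_tm\<close>,
      \<open>G\<close> and \<open>H\<close> the products with two and with three indices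
      (\<open>G\<close> including those with \<open>Dl\<close>), and \<open>L\<close> the brackets
      of \<open>Dl\<close> with \<open>y i\<close>.\<close>
    define F where "F j l = cscale (\<kappa> i j (Suc d)) (\<Sum>c<d. cscale (of_nat (Suc c)) (adp (x i) (d - 1 - c) (br (t i l) (tm i j c))))" for j l
    define G where "G j = (\<Sum>p<d. br (gt i j p) (kt i j (d - 1 - p)) - br (Dl p) (kt i j (d - 1 - p)))" for j
    define H where "H j l = (\<Sum>p<d. br (gt i j p) (kt i l (d - 1 - p)) + br (gt i l p) (kt i j (d - 1 - p))
        + br (gt j l p) (kt i j (d - 1 - p)) + br (gt j l p) (kt i l (d - 1 - p)))" for j l
    define L where "L j = cscale (\<phi> d / 2) (E2 i j (d - 1) (\<Sum>p<d. Polynomial.smult ((-1) ^ (d - 1 - p)) (U ^ p)))" for j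
    have fin: "finite ?B" using finite_A by simp
    have "(\<Sum>p\<le>N. br (Dc p) (Kc i (N - p)))
      = - br D0 (Kt i (Suc d)) + (\<Sum>p<d. br (Gt p - Dl p) (Kt i (d - 1 - p))) + br (y i) (Gt d - Dl d)"
    proof -
      have "(\<Sum>p<d. br (Dc (p + 2)) (Kc i (d + 3 - (p + 2)))) = (\<Sum>p<d. br (Gt p - Dl p) (Kt i (d - 1 - p)))"
        by (intro sum.cong refl) (auto simp: Kc_def Dc_def intro!: arg_cong2[of _ _ _ _ br] arg_cong[of _ _ "Kt i"])
      then show ?thesis
        unfolding 4 conv_split
        by (simp add: Kc_def Dc_def br_minus_left br_minus_right br_antisym[of "Gt d - Dl d"] Suc_diff_Suc numeral_3_eq_3)
    qed
    \<comment> \<open>Since \<open>\<gamma> i j d\<close> is \<open>Suc d\<close> times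
      \<open>\<kappa> i j (Suc d)\<close>, the leading term of \<open>D0_tm\<close> is
      \<open>br (y i) (gt i j d)\<close>. It cancels against the bracket of \<open>y i\<close> with
      \<open>Gt d\<close>.\<close>
    also have "- br D0 (Kt i (Suc d)) = - (\<Sum>j\<in>?B. br (y i) (gt i j d)) + (\<Sum>j\<in>?B. F j j) + (\<Sum>(j,l)\<in>upairs ?B. F j l + F l j)"
    proof -
      have "- br D0 (kt i j (Suc d)) = - br (y i) (gt i j d) + F j j + (\<Sum>l\<in>?B - {j}. F j l)" if "j \<in> ?B" for j
      proof -
        have "(\<Sum>c<d. cscale (of_nat (Suc c)) (adp (x i) (d - 1 - c) (br (\<Sum>l\<in>?B. t i l) (tm i j c))))
          = (\<Sum>l\<in>?B. \<Sum>c<d. cscale (of_nat (Suc c)) (adp (x i) (d - 1 - c) (br (t i l) (tm i j c))))"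
          unfolding br_sum_left adp_sum cvec.scale_sum_right by (rule sum.swap)
        then have "- br D0 (kt i j (Suc d)) = - br (y i) (gt i j d) + (\<Sum>l\<in>?B. F j l)"
          using that i gamma_kappa[of i j d] unfolding kt_def gt_def F_def br_scale_right
          by (subst D0_tm) (auto simp: cvec.scale_right_diff_distrib cvec.scale_sum_right mult.commute)
        then show ?thesis using that fin by (simp add: sum.remove add.assoc)
      qed
      then show ?thesis
        unfolding Kt_def br_sum_right sum_negf[symmetric]
        by (simp add: sum.distrib sum_negf sum_subtractf sum_upairs[OF fin] case_prod_beta)
    qed
    also have "br (y i) (Gt d - Dl d) = (\<Sum>j\<in>?B. br (y i) (gt i j d)) + (\<Sum>(j,l)\<in>upairs ?B. br (y i) (gt j l d)) + (\<Sum>j\<in>?B. L j)"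
      using Dl_y[OF i, of d] unfolding Gt_split[OF i] L_def
      by (simp add: br_diff_right br_add_right br_sum_right br_antisym[of "y i" "Dl d"] case_prod_beta)
    also have "(\<Sum>p<d. br (Gt p - Dl p) (Kt i (d - 1 - p))) = (\<Sum>j\<in>?B. G j) + (\<Sum>(j,l)\<in>upairs ?B. H j l)"
    proof -
      have "(\<Sum>p<d. br (Gt p - Dl p) (Kt i (d - 1 - p))) =
        (\<Sum>p<d. \<Sum>j\<in>?B. br (gt i j p) (kt i j (d - 1 - p)) - br (Dl p) (kt i j (d - 1 - p)))
        + (\<Sum>p<d. \<Sum>(j,l)\<in>upairs ?B. br (gt i j p) (kt i l (d - 1 - p)) + br (gt i l p) (kt i j (d - 1 - p))
        + br (gt j l p) (kt i j (d - 1 - p)) + br (gt j l p) (kt i l (d - 1 - p)))"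
        unfolding br_diff_left br_Gt_Kt[OF i]
        by (simp add: Kt_def br_sum_right sum.distrib sum_subtractf)
      then show ?thesis
        unfolding G_def H_def case_prod_beta by (simp add: sum.swap[of _ _ "{..<d}"])
    qed
    finally have "(\<Sum>p\<le>N. br (Dc p) (Kc i (N - p)))
      = (\<Sum>j\<in>?B. F j j + L j + G j) + (\<Sum>(j,l)\<in>upairs ?B. F j l + F l j + br (y i) (gt j l d) + H j l)"
      by (simp add: sum.distrib case_prod_beta algebra_simps)
    also have "(\<Sum>j\<in>?B. F j j + L j + G j) = 0"
      using i pair_zero[of i _ d] unfolding F_def G_def L_def by (intro sum.neutral) auto
    also have "(\<Sum>(j,l)\<in>upairs ?B. F j l + F l j + br (y i) (gt j l d) + H j l) = 0"
      using i triple_zero'[of i _ _ d] unfolding F_def H_def upairs_def by (intro sum.neutral) auto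
    finally show ?thesis by simp
  qed (simp add: Kc_def)
qed

end

section \<open>The shift by \<tau> on homogeneous components\<close>

context kzb_algebra
begin

text \<open>\<open>Gt\<close> with free coefficients, needed for the shifted point and for
  derivatives in \<open>z\<close>.\<close>

definition Gg :: "(nat \<Rightarrow> nat \<Rightarrow> nat \<Rightarrow> complex) \<Rightarrow> nat \<Rightarrow> lie" where
  "Gg c m = (\<Sum>(j,l)\<in>upairs A. cscale (c j l m) (tm j l m))"

lemma Gg_split:
  assumes i: "i \<in> A"
    and c: "\<And>j. j \<in> A \<Longrightarrow> j \<noteq> i \<Longrightarrow> c j i m = (-1) ^ m * c i j m"
  shows "Gg c m = (\<Sum>j\<in>A - {i}. cscale (c i j m) (tm i j m))
    + (\<Sum>(j,l)\<in>upairs (A - {i}). cscale (c j l m) (tm j l m))"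
proof -
  have "cscale (c j i m) (tm j i m) = cscale (c i j m) (tm i j m)" if "j \<in> A" "j \<noteq> i" for j
  proof -
    have "(-1) ^ m * (-1) ^ m = (1::complex)" by (simp add: power_mult_distrib[symmetric])
    then have "(-1) ^ m * c i j m * (-1) ^ m = c i j m" by (simp add: mult.assoc mult.left_commute)
    then show ?thesis using tm_swap[of j i m] that i c[OF that] by simp
  qed
  then show ?thesis unfolding Gg_def using finite_A i by (intro sum_upairs_remove) auto
qed

lemma adp_y: "i \<in> A \<Longrightarrow> adp (x i) (Suc m) (y i) = - (\<Sum>j\<in>A - {i}. tm i j m)"
  by (simp add: adp_Suc2 x_yi adp_minus adp_sum tm_def)

text \<open>\<open>ad (x i)\<close> takes \<open>D0\<close> to \<open>- y i\<close> and then to a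
  sum of \<open>t i j\<close>. Through these, the lowest parts of the connection forms reach every
  higher degree under \<open>exp (ad (x i))\<close>.\<close>

lemma adp_D0:
  assumes "i \<in> A"
  shows "adp (x i) (Suc 0) D0 = - y i" "adp (x i) (Suc (Suc m)) D0 = (\<Sum>j\<in>A - {i}. tm i j m)"
proof -
  have 1: "br (x i) D0 = - y i" using D0_x[of i] br_antisym[of "x i" D0] assms by simp
  then show "adp (x i) (Suc 0) D0 = - y i" by (simp add: adp_Suc)
  show "adp (x i) (Suc (Suc m)) D0 = (\<Sum>j\<in>A - {i}. tm i j m)"
    using adp_y[OF assms, of m] by (simp add: adp_Suc2[of _ "Suc m"] 1 adp_minus)
qed

end

context kzb_tau
begin

lemma Gt_Gg: "Gt m = Gg \<gamma> m"
  by (simp add: Gt_def Gg_def gt_def)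

lemma adp_Gt:
  assumes i: "i \<in> A" and m: "m \<le> d"
  shows "adp (x i) m (Gt (d - m)) = (\<Sum>j\<in>A - {i}. cscale (\<gamma> i j (d - m)) (tm i j d))
     + (if m = 0 then (\<Sum>(j,l)\<in>upairs (A - {i}). gt j l d) else 0)"
proof -
  have "adp (x i) m (\<Sum>(j,l)\<in>upairs (A - {i}). gt j l (d - m)) =
      (if m = 0 then (\<Sum>(j,l)\<in>upairs (A - {i}). gt j l d) else 0)"
  proof (cases m)
    case (Suc k)
    have "br (x i) (gt j l (d - m)) = 0" if "(j, l) \<in> upairs (A - {i})" for j l
      using that i x_tm[of j l i "d - m"] by (auto simp: upairs_def gt_def br_scale_right)
    then have "br (x i) (\<Sum>(j,l)\<in>upairs (A - {i}). gt j l (d - m)) = 0"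
      unfolding br_sum_right by (intro sum.neutral) auto
    with Suc show ?thesis by (simp add: adp_Suc2)
  qed simp
  then show ?thesis
    using m by (simp add: Gt_split[OF i] adp_plus adp_sum gt_def adp_scale adp_tm)
qed

lemma adp_Dl:
  assumes "i \<in> A"
  shows "adp (x i) m (Dl k) = (if m = 0 then Dl k else 0)"
proof (cases m)
  case (Suc k')
  have "br (x i) (Dl k) = 0"
    using dl_x[of "k div 2" i] assms by (auto simp: Dl_def br_scale_right br_scale_left br_zero_sym[of "x i"])
  with Suc show ?thesis by (simp add: adp_Suc2)
qed simp

text \<open>With \<open>c = -2 pi i\<close>, the combination of \<open>Dc\<close> and
  \<open>c\<close> times \<open>Kc\<close> is \<open>2 pi i\<close> times the difference of Delta
  and \<open>K\<close>. Pairs without \<open>i\<close> and the \<open>Dl\<close> are killed by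
  \<open>x i\<close> and enter only at \<open>m = 0\<close>. The last two terms of
  \<open>shift\<close> come from \<open>- c y i\<close> and \<open>- D0\<close>, which
  \<open>d + 1\<close> and \<open>d + 2\<close> brackets with \<open>x i\<close> turn into multiples
  of the sum of the \<open>tm i j d\<close>.\<close>

lemma Dc_shift:
  assumes i: "i \<in> A"
    and sym: "\<And>j m. j \<in> A \<Longrightarrow> j \<noteq> i \<Longrightarrow> \<gamma>' j i m = (-1) ^ m * \<gamma>' i j m"
    and same: "\<And>j l m. j \<noteq> i \<Longrightarrow> l \<noteq> i \<Longrightarrow> \<gamma>' j l m = \<gamma> j l m"
    and shift: "\<And>j d. j \<in> A \<Longrightarrow> j \<noteq> i \<Longrightarrow> \<gamma>' i j d =
      (\<Sum>m\<le>d. c ^ m / fact m * (\<gamma> i j (d - m) + c * \<kappa> i j (d - m)))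
      + c ^ (d + 2) / fact (d + 1) - c ^ (d + 2) / fact (d + 2)"
  shows "(if N = 0 then - D0 else if N \<ge> 2 then Gg \<gamma>' (N - 2) - Dl (N - 2) else 0) =
    (\<Sum>m\<le>N. cscale (c ^ m / fact m) (adp (x i) m (Dc (N - m) + cscale c (Kc i (N - m)))))"
proof -
  have "N = 0 \<or> N = 1 \<or> (\<exists>d. N = d + 2)" by presburger
  then consider "N = 0" | "N = 1" | d where "N = d + 2" by blast
  then show ?thesis
  proof cases
    case 1
    then show ?thesis by (simp add: Dc_def Kc_def)
  next
    case 2
    then show ?thesis using adp_D0(1)[OF i]
      by (simp add: Dc_def Kc_def adp_minus cvec.scale_minus_right)
  next
    case (3 d)
    let ?B = "A - {i}"
    let ?R = "\<Sum>j\<in>?B. tm i j d"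
    let ?W = "\<Sum>(j,l)\<in>upairs ?B. gt j l d"
    have "(\<Sum>m\<le>d + 2. cscale (c ^ m / fact m) (adp (x i) m (Dc (d + 2 - m) + cscale c (Kc i (d + 2 - m)))))
      = (\<Sum>m\<le>d. cscale (c ^ m / fact m) (adp (x i) m (Gt (d - m) - Dl (d - m) + cscale c (Kt i (d - m)))))
      + cscale (c ^ (d + 1) / fact (d + 1)) (adp (x i) (Suc d) (cscale c (- y i)))
      + cscale (c ^ (d + 2) / fact (d + 2)) (adp (x i) (Suc (Suc d)) (- D0))"
    proof -
      have "(\<Sum>m\<le>d. cscale (c ^ m / fact m) (adp (x i) m (Dc (d + 2 - m) + cscale c (Kc i (d + 2 - m)))))
        = (\<Sum>m\<le>d. cscale (c ^ m / fact m) (adp (x i) m (Gt (d - m) - Dl (d - m) + cscale c (Kt i (d - m)))))"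
      proof (intro sum.cong refl)
        fix m assume "m \<in> {..d}"
        then obtain k where k: "d = m + k" by (auto simp: le_iff_add)
        show "cscale (c ^ m / fact m) (adp (x i) m (Dc (d + 2 - m) + cscale c (Kc i (d + 2 - m))))
          = cscale (c ^ m / fact m) (adp (x i) m (Gt (d - m) - Dl (d - m) + cscale c (Kt i (d - m))))"
          by (simp add: k Dc_def Kc_def)
      qed
      moreover have "d + 2 = Suc (Suc d)" by simp
      ultimately show ?thesis by (simp add: Dc_def Kc_def del: fact_Suc)
    qed
    also have "cscale (c ^ (d + 1) / fact (d + 1)) (adp (x i) (Suc d) (cscale c (- y i)))
       = cscale (c ^ (d + 2) / fact (d + 1)) ?R"
      using adp_y[OF i, of d] by (simp add: adp_scale adp_minus del: fact_Suc)
    also have "cscale (c ^ (d + 2) / fact (d + 2)) (adp (x i) (Suc (Suc d)) (- D0))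
       = - cscale (c ^ (d + 2) / fact (d + 2)) ?R"
      using adp_D0(2)[OF i, of d] by (simp add: adp_minus del: fact_Suc)
    also have "(\<Sum>m\<le>d. cscale (c ^ m / fact m) (adp (x i) m (Gt (d - m) - Dl (d - m) + cscale c (Kt i (d - m)))))
       = (\<Sum>j\<in>?B. cscale (\<Sum>m\<le>d. c ^ m / fact m * (\<gamma> i j (d - m) + c * \<kappa> i j (d - m))) (tm i j d)) + ?W - Dl d"
    proof -
      have a: "cscale (c ^ m / fact m) (adp (x i) m (Gt (d - m) - Dl (d - m) + cscale c (Kt i (d - m))))
         = (\<Sum>j\<in>?B. cscale (c ^ m / fact m * (\<gamma> i j (d - m) + c * \<kappa> i j (d - m))) (tm i j d))
           + (if m = 0 then ?W - Dl d else 0)" if "m \<le> d" for m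
      proof -
        have "adp (x i) m (cscale c (Kt i (d - m))) = (\<Sum>j\<in>?B. cscale (c * \<kappa> i j (d - m)) (tm i j d))"
          using that by (simp add: Kt_def kt_def adp_scale adp_sum adp_tm cvec.scale_sum_right)
        then have "adp (x i) m (Gt (d - m) - Dl (d - m) + cscale c (Kt i (d - m)))
          = (\<Sum>j\<in>?B. cscale (\<gamma> i j (d - m) + c * \<kappa> i j (d - m)) (tm i j d))
           + (if m = 0 then ?W - Dl d else 0)"
          using adp_Gt[OF i that] adp_Dl[OF i, of m "d - m"]
          by (simp add: adp_plus adp_diff cvec.scale_left_distrib sum.distrib)
        then show ?thesis by (simp add: cvec.scale_right_distrib cvec.scale_sum_right)
      qed
      have "(\<Sum>m\<le>d. cscale (c ^ m / fact m) (adp (x i) m (Gt (d - m) - Dl (d - m) + cscale c (Kt i (d - m)))))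
        = (\<Sum>m\<le>d. (\<Sum>j\<in>?B. cscale (c ^ m / fact m * (\<gamma> i j (d - m) + c * \<kappa> i j (d - m))) (tm i j d))
           + (if m = 0 then ?W - Dl d else 0))"
        by (intro sum.cong refl a) simp
      also have "\<dots> = (\<Sum>j\<in>?B. \<Sum>m\<le>d. cscale (c ^ m / fact m * (\<gamma> i j (d - m) + c * \<kappa> i j (d - m))) (tm i j d))
           + (?W - Dl d)"
        unfolding sum.distrib by (subst sum.swap) (simp add: sum.delta)
      finally show ?thesis by (simp add: cvec.scale_sum_left)
    qed
    also have "(\<Sum>j\<in>?B. cscale (\<Sum>m\<le>d. c ^ m / fact m * (\<gamma> i j (d - m) + c * \<kappa> i j (d - m))) (tm i j d)) + ?W - Dl d
       + cscale (c ^ (d + 2) / fact (d + 1)) ?R + - cscale (c ^ (d + 2) / fact (d + 2)) ?R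
      = (\<Sum>j\<in>?B. cscale (\<gamma>' i j d) (tm i j d)) + ?W - Dl d"
    proof -
      have "(\<Sum>j\<in>?B. cscale (\<gamma>' i j d) (tm i j d)) =
        (\<Sum>j\<in>?B. cscale (\<Sum>m\<le>d. c ^ m / fact m * (\<gamma> i j (d - m) + c * \<kappa> i j (d - m))) (tm i j d)
         + cscale (c ^ (d + 2) / fact (d + 1)) (tm i j d) - cscale (c ^ (d + 2) / fact (d + 2)) (tm i j d))"
      proof (intro sum.cong refl)
        fix j assume "j \<in> ?B"
        then have "j \<in> A" "j \<noteq> i" by auto
        then show "cscale (\<gamma>' i j d) (tm i j d) =
          cscale (\<Sum>m\<le>d. c ^ m / fact m * (\<gamma> i j (d - m) + c * \<kappa> i j (d - m))) (tm i j d)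
          + cscale (c ^ (d + 2) / fact (d + 1)) (tm i j d) - cscale (c ^ (d + 2) / fact (d + 2)) (tm i j d)"
          unfolding shift[OF \<open>j \<in> A\<close> \<open>j \<noteq> i\<close>]
          by (simp only: cvec.scale_left_distrib cvec.scale_left_diff_distrib)
      qed
      then show ?thesis
        by (simp add: sum.distrib sum_subtractf cvec.scale_sum_right del: fact_Suc)
    qed
    also have "?W = (\<Sum>(j,l)\<in>upairs ?B. cscale (\<gamma>' j l d) (tm j l d))"
      unfolding gt_def by (intro sum.cong refl) (auto simp: upairs_def same)
    also have "(\<Sum>j\<in>?B. cscale (\<gamma>' i j d) (tm i j d)) + \<dots> = Gg \<gamma>' d"
      using i sym by (intro Gg_split[symmetric]) auto
    finally show ?thesis using 3 by simp
  qed
qed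

end

section \<open>Interpretation in the quotient\<close>

lemma LieP_ad_pow: "a \<in> LieP n \<Longrightarrow> b \<in> LieP n \<Longrightarrow> ad_pow a m b \<in> LieP n"
  by (induction m) (auto simp: ad_pow_def intro: LieP.brk)

lemma inL_ad_pow: "a \<in> LieP n \<Longrightarrow> b \<in> LieP n \<Longrightarrow> inL n (ad_pow a m b) = adp (inL n a) m (inL n b)"
proof (induction m)
  case (Suc m)
  then show ?case using LieP_ad_pow[of a n b m] by (simp add: ad_pow_def inL_br adp_Suc)
qed (simp add: ad_pow_def)

lemma gen_in_LieP:
  "i \<in> {1..n} \<Longrightarrow> xx i \<in> LieP n" "i \<in> {1..n} \<Longrightarrow> yy i \<in> LieP n"
  "i \<in> {1..n} \<Longrightarrow> j \<in> {1..n} \<Longrightarrow> i \<noteq> j \<Longrightarrow> tt i j \<in> LieP n"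
  "sD0 \<in> LieP n" "m \<ge> 1 \<Longrightarrow> sdel m \<in> LieP n"
  by (auto intro!: LieP.gen)

lemma rel_zero: "r \<in> rels n \<Longrightarrow> r \<in> LieP n \<Longrightarrow> inL n r = 0"
  by (rule inL_ideal) (auto intro: lideal.rel)

lemmas LieP_simps = LieP_closed gen_in_LieP LieP_fin LieP_ad_pow
lemmas inL_simps = inL_add inL_sub inL_neg inL_scale inL_br inL_fin inL_ad_pow LieP_simps

lemma eq_if_rel: "ssub a b \<in> rels n \<Longrightarrow> a \<in> LieP n \<Longrightarrow> b \<in> LieP n \<Longrightarrow> inL n a = inL n b"
  using rel_zero[of "ssub a b" n] by (simp add: inL_sub LieP_sub)

lemma rels_intros:
  "distinct [i,j] \<Longrightarrow> set [i,j] \<subseteq> {1..n} \<Longrightarrow> ssub (tt i j) (tt j i) \<in> rels n"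
  "distinct [i,j,k] \<Longrightarrow> set [i,j,k] \<subseteq> {1..n} \<Longrightarrow> sbr (tt i j) (sadd (tt i k) (tt j k)) \<in> rels n"
  "distinct [i,j,k,l] \<Longrightarrow> set [i,j,k,l] \<subseteq> {1..n} \<Longrightarrow> sbr (tt i j) (tt k l) \<in> rels n"
  "distinct [i,j] \<Longrightarrow> set [i,j] \<subseteq> {1..n} \<Longrightarrow> ssub (sbr (xx i) (yy j)) (tt i j) \<in> rels n"
  "distinct [i,j] \<Longrightarrow> set [i,j] \<subseteq> {1..n} \<Longrightarrow> sbr (xx i) (xx j) \<in> rels n"
  "distinct [i,j] \<Longrightarrow> set [i,j] \<subseteq> {1..n} \<Longrightarrow> sbr (yy i) (yy j) \<in> rels n"
  "i \<in> {1..n} \<Longrightarrow> sadd (sbr (xx i) (yy i)) (sfin (\<lambda>j. tt i j) ({1..n} - {i})) \<in> rels n"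
  "distinct [i,j,k] \<Longrightarrow> set [i,j,k] \<subseteq> {1..n} \<Longrightarrow> sbr (xx i) (tt j k) \<in> rels n"
  "distinct [i,j,k] \<Longrightarrow> set [i,j,k] \<subseteq> {1..n} \<Longrightarrow> sbr (yy i) (tt j k) \<in> rels n"
  "distinct [i,j] \<Longrightarrow> set [i,j] \<subseteq> {1..n} \<Longrightarrow> sbr (sadd (xx i) (xx j)) (tt i j) \<in> rels n"
  "distinct [i,j] \<Longrightarrow> set [i,j] \<subseteq> {1..n} \<Longrightarrow> sbr (sadd (yy i) (yy j)) (tt i j) \<in> rels n"
  "i \<in> {1..n} \<Longrightarrow> ssub (sbr sD0 (xx i)) (yy i) \<in> rels n"
  "i \<in> {1..n} \<Longrightarrow> sbr sD0 (yy i) \<in> rels n"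
  "distinct [i,j] \<Longrightarrow> set [i,j] \<subseteq> {1..n} \<Longrightarrow> sbr sD0 (tt i j) \<in> rels n"
  "m \<ge> 1 \<Longrightarrow> i \<in> {1..n} \<Longrightarrow> sbr (sdel m) (xx i) \<in> rels n"
  "m \<ge> 1 \<Longrightarrow> distinct [i,j] \<Longrightarrow> set [i,j] \<subseteq> {1..n} \<Longrightarrow>
     ssub (sbr (sdel m) (tt i j)) (sbr (tt i j) (ad_pow (xx i) (2*m) (tt i j))) \<in> rels n"
  "m \<ge> 1 \<Longrightarrow> i \<in> {1..n} \<Longrightarrow> ssub (sbr (sdel m) (yy i)) (delta_y n m i) \<in> rels n"
  unfolding rels_def
  by ((rule UnI2, intro CollectI exI conjI, rule refl, assumption+)
    | rule UnI1
    | (intro CollectI exI conjI, rule refl, assumption+))+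

lemma kzb_algebra_inL:
  "kzb_algebra {1..n} (\<lambda>i. inL n (xx i)) (\<lambda>i. inL n (yy i)) (\<lambda>i j. inL n (tt i j))
     (inL n sD0) (\<lambda>m. inL n (sdel m))"
proof
  fix i j k l m :: nat
  show "finite {1..n}" by simp
  show "inL n (tt i j) = inL n (tt j i)" if "distinct [i,j]" "{i,j} \<subseteq> {1..n}"
    using eq_if_rel[OF rels_intros(1)[of i j n]] that by (simp add: inL_simps)
  show "br (inL n (tt i j)) (inL n (tt i k) + inL n (tt j k)) = 0" if "distinct [i,j,k]" "{i,j,k} \<subseteq> {1..n}"
    using rel_zero[OF rels_intros(2)[of i j k n]] that by (simp add: inL_simps)
  show "br (inL n (tt i j)) (inL n (tt k l)) = 0" if "distinct [i,j,k,l]" "{i,j,k,l} \<subseteq> {1..n}"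
    using rel_zero[OF rels_intros(3)[of i j k l n]] that by (simp add: inL_simps)
  show "br (inL n (xx i)) (inL n (yy j)) = inL n (tt i j)" if "distinct [i,j]" "{i,j} \<subseteq> {1..n}"
    using eq_if_rel[OF rels_intros(4)[of i j n]] that by (simp add: inL_simps)
  show "br (inL n (xx i)) (inL n (xx j)) = 0" if "{i,j} \<subseteq> {1..n}"
  proof (cases "i = j")
    case False
    with that rel_zero[OF rels_intros(5)[of i j n]] show ?thesis by (simp add: inL_simps)
  qed simp
  show "br (inL n (yy i)) (inL n (yy j)) = 0" if "{i,j} \<subseteq> {1..n}"
  proof (cases "i = j")
    case False
    with that rel_zero[OF rels_intros(6)[of i j n]] show ?thesis by (simp add: inL_simps)
  qed simp
  show "br (inL n (xx i)) (inL n (yy i)) = - (\<Sum>j\<in>{1..n} - {i}. inL n (tt i j))" if "i \<in> {1..n}"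
  proof -
    have "inL n (sadd (sbr (xx i) (yy i)) (sfin (\<lambda>j. tt i j) ({1..n} - {i}))) = 0"
      using that by (intro rel_zero rels_intros LieP_closed LieP_fin gen_in_LieP) auto
    moreover have t: "tt i j \<in> LieP n" if "j \<in> {1..n} - {i}" for j
      using that \<open>i \<in> {1..n}\<close> gen_in_LieP(3)[of i n j] by auto
    have "inL n (sadd (sbr (xx i) (yy i)) (sfin (\<lambda>j. tt i j) ({1..n} - {i})))
       = inL n (sbr (xx i) (yy i)) + inL n (sfin (\<lambda>j. tt i j) ({1..n} - {i}))"
      using that by (intro inL_add LieP.brk LieP_fin gen_in_LieP t)
    moreover have "inL n (sfin (\<lambda>j. tt i j) ({1..n} - {i})) = (\<Sum>j\<in>{1..n} - {i}. inL n (tt i j))"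
      by (rule inL_fin) (rule t)
    moreover have "inL n (sbr (xx i) (yy i)) = br (inL n (xx i)) (inL n (yy i))"
      using that by (intro inL_br gen_in_LieP)
    ultimately show ?thesis by (simp only: eq_neg_iff_add_eq_0)
  qed
  show "br (inL n (xx i)) (inL n (tt j k)) = 0" if "distinct [i,j,k]" "{i,j,k} \<subseteq> {1..n}"
    using rel_zero[OF rels_intros(8)[of i j k n]] that by (simp add: inL_simps)
  show "br (inL n (yy i)) (inL n (tt j k)) = 0" if "distinct [i,j,k]" "{i,j,k} \<subseteq> {1..n}"
    using rel_zero[OF rels_intros(9)[of i j k n]] that by (simp add: inL_simps)
  show "br (inL n (xx i) + inL n (xx j)) (inL n (tt i j)) = 0" if "distinct [i,j]" "{i,j} \<subseteq> {1..n}"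
    using rel_zero[OF rels_intros(10)[of i j n]] that by (simp add: inL_simps)
  show "br (inL n (yy i) + inL n (yy j)) (inL n (tt i j)) = 0" if "distinct [i,j]" "{i,j} \<subseteq> {1..n}"
    using rel_zero[OF rels_intros(11)[of i j n]] that by (simp add: inL_simps)
  show "br (inL n sD0) (inL n (xx i)) = inL n (yy i)" if "i \<in> {1..n}"
    using eq_if_rel[OF rels_intros(12)[of i n]] that by (simp add: inL_simps)
  show "br (inL n sD0) (inL n (yy i)) = 0" if "i \<in> {1..n}"
    using rel_zero[OF rels_intros(13)[of i n]] that by (simp add: inL_simps)
  show "br (inL n sD0) (inL n (tt i j)) = 0" if "distinct [i,j]" "{i,j} \<subseteq> {1..n}"
    using rel_zero[OF rels_intros(14)[of i j n]] that by (simp add: inL_simps)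
  show "br (inL n (sdel m)) (inL n (xx i)) = 0" if "1 \<le> m" "i \<in> {1..n}"
    using rel_zero[OF rels_intros(15)[of m i n]] that by (simp add: inL_simps)
  show "br (inL n (sdel m)) (inL n (tt i j)) = br (inL n (tt i j)) (adp (inL n (xx i)) (2 * m) (inL n (tt i j)))"
    if "1 \<le> m" "distinct [i,j]" "{i,j} \<subseteq> {1..n}"
    using eq_if_rel[OF rels_intros(16)[of m i j n]] that by (simp add: inL_simps)
  show "br (inL n (sdel m)) (inL n (yy i)) =
        (\<Sum>j\<in>{1..n} - {i}. cscale (1/2) (\<Sum>p\<in>{0..2*m-1}.
           br (adp (inL n (xx i)) p (inL n (tt i j))) (cscale ((-1) ^ (2*m-1-p)) (adp (inL n (xx i)) (2*m-1-p) (inL n (tt i j))))))"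
    if "1 \<le> m" "i \<in> {1..n}"
  proof -
    have t: "tt i j \<in> LieP n" if "j \<in> {1..n} - {i}" for j using that \<open>i \<in> {1..n}\<close> gen_in_LieP(3)[of i n j] by auto
    have d: "delta_y n m i \<in> LieP n" unfolding delta_y_def
      using that t by (intro LieP_fin LieP_closed LieP_ad_pow gen_in_LieP) auto
    have "inL n (sbr (sdel m) (yy i)) = inL n (delta_y n m i)"
      using that d by (intro eq_if_rel rels_intros) (auto simp: LieP_simps)
    moreover have "inL n (delta_y n m i) = (\<Sum>j\<in>{1..n} - {i}. cscale (1/2) (\<Sum>p\<in>{0..2*m-1}.
           br (adp (inL n (xx i)) p (inL n (tt i j))) (cscale ((-1) ^ (2*m-1-p)) (adp (inL n (xx i)) (2*m-1-p) (inL n (tt i j))))))"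
      unfolding delta_y_def
    proof (subst inL_fin)
      fix j assume j: "j \<in> {1..n} - {i}"
      show "sscale (1/2) (sfin (\<lambda>p. sbr (ad_pow (xx i) p (tt i j))
          (sscale ((-1) ^ (2*m - 1 - p)) (ad_pow (xx i) (2*m - 1 - p) (tt i j)))) {0..2*m - 1}) \<in> LieP n"
        using that t[OF j] by (intro LieP_fin LieP_closed LieP_ad_pow gen_in_LieP(1))
    next
      show "(\<Sum>j\<in>{1..n} - {i}. inL n (sscale (1/2) (sfin (\<lambda>p. sbr (ad_pow (xx i) p (tt i j))
          (sscale ((-1) ^ (2*m - 1 - p)) (ad_pow (xx i) (2*m - 1 - p) (tt i j)))) {0..2*m - 1}))) =
        (\<Sum>j\<in>{1..n} - {i}. cscale (1/2) (\<Sum>p\<in>{0..2*m-1}.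
           br (adp (inL n (xx i)) p (inL n (tt i j))) (cscale ((-1) ^ (2*m-1-p)) (adp (inL n (xx i)) (2*m-1-p) (inL n (tt i j))))))"
      proof (intro sum.cong refl)
        fix j assume j: "j \<in> {1..n} - {i}"
        show "inL n (sscale (1/2) (sfin (\<lambda>p. sbr (ad_pow (xx i) p (tt i j))
          (sscale ((-1) ^ (2*m - 1 - p)) (ad_pow (xx i) (2*m - 1 - p) (tt i j)))) {0..2*m - 1})) =
          cscale (1/2) (\<Sum>p\<in>{0..2*m-1}.
           br (adp (inL n (xx i)) p (inL n (tt i j))) (cscale ((-1) ^ (2*m-1-p)) (adp (inL n (xx i)) (2*m-1-p) (inL n (tt i j)))))"
          using that t[OF j] by (simp add: inL_simps)
      qed
    qed
    ultimately show ?thesis using that by (simp add: inL_simps)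
  qed
qed


section \<open>The connection forms as graded families\<close>

lemma rep_x_br:
  assumes "i \<in> {1..n}" "rep n B b"
  shows "rep n (sbr (xx i) B) (\<lambda>N. if N \<ge> 1 then br (inL n (xx i)) (b (N - 1)) else 0)"
proof (rule rep_cong[OF rep_br[OF rep_gen assms(2)]])
  show "valid_gen n (Gx i)" using assms(1) by simp
  fix N
  have "(\<Sum>p\<le>N. br (if p = gdeg (Gx i) then inL n (xx i) else 0) (b (N - p)))
     = (\<Sum>p\<le>N. if p = 1 then br (inL n (xx i)) (b (N - 1)) else 0)"
    by (intro sum.cong) auto
  then show "(\<Sum>p\<le>N. br (if p = gdeg (Gx i) then inL n (xx i) else 0) (b (N - p)))
     = (if N \<ge> 1 then br (inL n (xx i)) (b (N - 1)) else 0)"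
    by (simp add: sum.delta)
qed

lemma rep_ad_pow:
  assumes "i \<in> {1..n}" "rep n B b"
  shows "rep n (ad_pow (xx i) m B) (\<lambda>N. if m \<le> N then adp (inL n (xx i)) m (b (N - m)) else 0)"
proof (induction m)
  case 0
  then show ?case using assms(2) by (simp add: ad_pow_def)
next
  case (Suc m)
  have "ad_pow (xx i) (Suc m) B = sbr (xx i) (ad_pow (xx i) m B)" by (simp add: ad_pow_def)
  then show ?case
    using rep_x_br[OF assms(1) Suc] by (auto elim!: rep_cong simp: adp_Suc)
qed

lemma vanishes_below_ad_pow_t: "vanishes_below m (sscale c (ad_pow (xx i) m (tt i j)))"
  using vanishes_below_ad_pow[of "xx i" 2 "tt i j" m] vanishes_below_gen[of "Gx i"] vanishes_below_gen[of "Gt i j"]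
  by (intro vanishes_below_scale) (auto elim: vanishes_below_mono)

lemma vanishes_below_ad_pow_any: "vanishes_below m (sscale c (ad_pow (xx i) m B))"
  using vanishes_below_ad_pow[of "xx i" 0 B m] vanishes_below_gen[of "Gx i"]
  by (intro vanishes_below_scale) (auto simp: vanishes_below_def)

definition tser :: "(nat \<Rightarrow> complex) \<Rightarrow> nat \<Rightarrow> nat \<Rightarrow> ser" where
  "tser c i j = ssuminf (\<lambda>m. sscale (c m) (ad_pow (xx i) m (tt i j)))"

lemma rep_tser:
  assumes "i \<in> {1..n}" "j \<in> {1..n}" "i \<noteq> j"
  shows "rep n (tser c i j) (\<lambda>N. if N \<ge> 2
    then cscale (c (N - 2)) (adp (inL n (xx i)) (N - 2) (inL n (tt i j))) else 0)"
  unfolding tser_def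
proof (rule rep_cong[OF rep_suminf[OF rep_scale[OF rep_ad_pow[OF assms(1) rep_gen]] vanishes_below_ad_pow_t]])
  show "valid_gen n (Gt i j)" using assms by simp
  fix N
  have "(\<Sum>m\<le>N. cscale (c m) (if m \<le> N then adp (inL n (xx i)) m (if N - m = gdeg (Gt i j) then inL n (tt i j) else 0) else 0))
    = (\<Sum>m\<le>N. if m = N - 2 \<and> N \<ge> 2 then cscale (c (N - 2)) (adp (inL n (xx i)) (N - 2) (inL n (tt i j))) else 0)"
    by (intro sum.cong) auto
  also have "\<dots> = (if N \<ge> 2 then cscale (c (N - 2)) (adp (inL n (xx i)) (N - 2) (inL n (tt i j))) else 0)"
    by (cases "N \<ge> 2") (auto simp: sum.delta)
  finally show "(\<Sum>m\<le>N. cscale (c m) (if m \<le> N then adp (inL n (xx i)) m (if N - m = gdeg (Gt i j) then inL n (tt i j) else 0) else 0)) = \<dots>" .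
qed

text \<open>The coefficient of a fixed word is a finite sum, which can be differentiated term by
  term.\<close>

lemma tser_word: "tser c i j w = (\<Sum>m\<le>wdeg w. c m * ad_pow (xx i) m (tt i j) w)"
  unfolding tser_def by (subst vanishes_below_suminf[OF vanishes_below_ad_pow_t]) (simp add: sscale_def)

lemma rep_exp_ad:
  assumes "i \<in> {1..n}" "rep n B b"
  shows "rep n (exp_ad c (xx i) B)
    (\<lambda>N. \<Sum>m\<le>N. cscale (c ^ m / fact m) (adp (inL n (xx i)) m (b (N - m))))"
  unfolding exp_ad_def
  by (rule rep_cong[OF rep_suminf[OF rep_scale[OF rep_ad_pow[OF assms]] vanishes_below_ad_pow_any]])
    (intro sum.cong, auto)

lemma rep_delser:
  "rep n (ssuminf (\<lambda>m. sscale (b (Suc m)) (sdel (Suc m))))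
    (\<lambda>N. if even N \<and> N \<ge> 4 then cscale (b ((N - 2) div 2)) (inL n (sdel ((N - 2) div 2))) else 0)"
proof (rule rep_cong[OF rep_suminf[OF rep_scale[OF rep_gen]]])
  show "valid_gen n (Gdel (Suc m))" for m by simp
  show "vanishes_below m (sscale (b (Suc m)) (sdel (Suc m)))" for m
    using vanishes_below_gen[of "Gdel (Suc m)"] by (intro vanishes_below_scale) (auto elim: vanishes_below_mono)
  fix N
  \<comment> \<open>\<open>sdel (Suc m)\<close> has degree \<open>2 * m + 4\<close>, so degree
    \<open>N\<close> selects \<open>m = (N - 4) div 2\<close>, that is the generator with index
    \<open>(N - 2) div 2\<close>.\<close>
  have "(\<Sum>m\<le>N. cscale (b (Suc m)) (if N = gdeg (Gdel (Suc m)) then inL n (sdel (Suc m)) else 0))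
     = (\<Sum>m\<le>N. if m = (N - 4) div 2 \<and> even N \<and> N \<ge> 4 then cscale (b ((N - 2) div 2)) (inL n (sdel ((N - 2) div 2))) else 0)"
    (is "sum ?f _ = sum ?g _")
  proof (intro sum.cong refl)
    fix m
    show "?f m = ?g m"
    proof (cases "N = 2 * m + 4")
      case False
      then have "\<not> (m = (N - 4) div 2 \<and> even N \<and> N \<ge> 4)" by auto
      with False show ?thesis by auto
    qed auto
  qed
  also have "\<dots> = (if even N \<and> N \<ge> 4 then cscale (b ((N - 2) div 2)) (inL n (sdel ((N - 2) div 2))) else 0)"
    by (cases "even N \<and> N \<ge> 4") (auto simp: sum.delta)
  finally show "(\<Sum>m\<le>N. cscale (b (Suc m)) (if N = gdeg (Gdel (Suc m)) then inL n (sdel (Suc m)) else 0)) = \<dots>" .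
qed

section \<open>The theta series\<close>

definition freq :: "nat \<Rightarrow> complex" where
  "freq n = of_nat (2 * n + 1) * (of_real pi * \<i>)"

text \<open>In this form a derivative in \<open>z\<close> multiplies by \<open>freq n\<close> and
  one in \<tau> by \<open>freq n ^ 2 / (4 pi i)\<close>, so each term satisfies the heat
  equation.\<close>

definition theta_term :: "nat \<Rightarrow> complex \<Rightarrow> complex \<Rightarrow> complex" where
  "theta_term n z \<tau> = (-1) ^ n * exp (freq n ^ 2 * \<tau> / (4 * of_real pi * \<i>) + freq n * z)"

lemma freq_square: "freq n ^ 2 * \<tau> / (4 * of_real pi * \<i>) = of_nat ((2 * n + 1) ^ 2) * (of_real pi * \<i>) * \<tau> / 4"
proof -
  have "freq n ^ 2 = of_nat ((2 * n + 1) ^ 2) * (of_real pi * \<i>) * (of_real pi * \<i>)"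
    unfolding freq_def power_mult_distrib of_nat_power by (simp only: power2_eq_square mult_ac)
  then show ?thesis by (simp add: field_simps)
qed

lemma theta_term_eq: "theta_term n z \<tau> =
  (-1) ^ n * exp (of_real pi * \<i> * ((2 * of_nat n + 1) ^ 2 * \<tau> / 4 + (2 * of_nat n + 1) * z))"
  unfolding theta_term_def freq_square by (simp add: freq_def field_simps)

lemma norm_freq: "norm (freq n) = real (2 * n + 1) * pi"
  unfolding freq_def norm_mult norm_of_nat by simp

text \<open>Gaussian decay, locally uniform in both variables and with a power of
  \<open>freq n\<close> included. The same bound thus serves convergence and differentiation in
  \<open>z\<close> and in \<tau>.\<close>

lemma theta_term_bound:
  assumes "\<epsilon> > 0"
  obtains C where "C \<ge> 0" "\<And>n z \<tau>. Im \<tau> \<ge> \<epsilon> \<Longrightarrow> norm z \<le> R \<Longrightarrow>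
    norm (freq n ^ j * theta_term n z \<tau>) \<le> C * exp (-1) ^ n"
proof -
  \<comment> \<open>\<open>a\<close> is the rate of the Gaussian decay in the frequency, and
    \<open>b\<close> the linear growth from \<open>z\<close> together with the \<open>pi\<close>
    spent on bounding \<open>freq n ^ j\<close>. \<open>K\<close> is the maximum of
    \<open>(b + 1) * m - a * m ^ 2\<close>; the extra 1 buys the geometric factor.\<close>
  define a where "a = pi * \<epsilon> / 4"
  define b where "b = pi * \<bar>R\<bar> + pi"
  define K where "K = (b + 1) ^ 2 / (4 * a)"
  have a: "a > 0" using assms by (simp add: a_def)
  have "norm (freq n ^ j * theta_term n z \<tau>) \<le> (fact j * exp K) * exp (-1) ^ n"
    if *: "Im \<tau> \<ge> \<epsilon>" "norm z \<le> R" for n z \<tau>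
  proof -
    define m where "m = real (2 * n + 1)"
    have m: "m \<ge> 1" "m \<ge> real n" by (auto simp: m_def)
    have 1: "norm (freq n ^ j) \<le> fact j * exp (m * pi)"
    proof -
      have "(m * pi) ^ j / fact j \<le> exp (m * pi)"
      proof -
        have s: "summable (\<lambda>n. (m * pi) ^ n /\<^sub>R fact n)" by (rule summable_exp_generic)
        have "(\<Sum>k\<in>{j}. (m * pi) ^ k /\<^sub>R fact k) \<le> (\<Sum>k. (m * pi) ^ k /\<^sub>R fact k)"
          using m by (intro sum_le_suminf[OF s]) auto
        then show ?thesis by (simp add: exp_def field_simps)
      qed
      then show ?thesis by (simp add: norm_power norm_freq m_def field_simps)
    qed
    have "norm (theta_term n z \<tau>) = exp (Re (freq n ^ 2 * \<tau> / (4 * of_real pi * \<i>) + freq n * z))"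
      by (simp add: theta_term_def norm_mult norm_power)
    also have "Re (freq n ^ 2 * \<tau> / (4 * of_real pi * \<i>) + freq n * z) \<le> - (m ^ 2 * a) + m * pi * \<bar>R\<bar>"
    proof -
      have "Re (freq n ^ 2 * \<tau> / (4 * of_real pi * \<i>)) = - (m ^ 2 * pi * Im \<tau> / 4)"
        unfolding freq_square by (simp add: m_def)
      also have "\<dots> \<le> - (m ^ 2 * a)"
        using mult_right_mono[OF *(1), of "m ^ 2"] by (simp add: a_def field_simps)
      finally have "Re (freq n ^ 2 * \<tau> / (4 * of_real pi * \<i>)) \<le> - (m ^ 2 * a)" .
      moreover have "Re (freq n * z) \<le> m * pi * \<bar>R\<bar>"
      proof -
        have "Re (freq n * z) \<le> norm (freq n) * norm z"
          by (metis complex_Re_le_cmod norm_mult)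
        also have "\<dots> \<le> m * pi * \<bar>R\<bar>"
          unfolding norm_freq m_def using * by (intro mult_left_mono) auto
        finally show ?thesis .
      qed
      ultimately show ?thesis by simp
    qed
    finally have 2: "norm (theta_term n z \<tau>) \<le> exp (- (m ^ 2 * a) + m * pi * \<bar>R\<bar>)" by simp
    have "m * pi + (- (m ^ 2 * a) + m * pi * \<bar>R\<bar>) \<le> K - m"
    proof -
      have "0 \<le> a * (m - (b + 1) / (2 * a)) ^ 2" using a by simp
      also have "\<dots> = a * m ^ 2 - (b + 1) * m + K"
        using a by (simp add: K_def power2_eq_square field_simps)
      finally show ?thesis by (simp add: b_def algebra_simps)
    qed
    then have "m * pi + (- (m ^ 2 * a) + m * pi * \<bar>R\<bar>) \<le> K - real n" using m by linarith
    then have 3: "exp (m * pi) * exp (- (m ^ 2 * a) + m * pi * \<bar>R\<bar>) \<le> exp K * exp (-1) ^ n"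
    proof -
      have "exp (m * pi) * exp (- (m ^ 2 * a) + m * pi * \<bar>R\<bar>) = exp (m * pi + (- (m ^ 2 * a) + m * pi * \<bar>R\<bar>))"
        by (rule exp_add[symmetric])
      also have "\<dots> \<le> exp (K + real n * (-1))"
        using \<open>m * pi + (- (m ^ 2 * a) + m * pi * \<bar>R\<bar>) \<le> K - real n\<close> unfolding exp_le_cancel_iff by simp
      also have "\<dots> = exp K * exp (-1) ^ n"
        by (simp only: exp_add exp_of_nat_mult)
      finally show ?thesis .
    qed
    have "norm (freq n ^ j * theta_term n z \<tau>) \<le> (fact j * exp (m * pi)) * exp (- (m ^ 2 * a) + m * pi * \<bar>R\<bar>)"
      unfolding norm_mult by (intro mult_mono 1 2) auto
    also have "\<dots> = fact j * (exp (m * pi) * exp (- (m ^ 2 * a) + m * pi * \<bar>R\<bar>))"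
      by (rule mult.assoc)
    also have "\<dots> \<le> fact j * (exp K * exp (-1) ^ n)"
      by (rule mult_left_mono[OF 3]) simp
    finally show ?thesis by (simp add: mult.assoc)
  qed
  then show ?thesis by (intro that[of "fact j * exp K"]) auto
qed

lemma summable_geom_exp: "summable (\<lambda>n. C * exp (-1) ^ n :: real)"
  by (intro summable_mult summable_geometric) simp

lemma summable_theta_term:
  assumes "Im \<tau> > 0"
  shows "summable (\<lambda>n. freq n ^ j * theta_term n z \<tau>)"
proof -
  obtain C where C: "\<And>n. norm (freq n ^ j * theta_term n z \<tau>) \<le> C * exp (-1) ^ n"
    using theta_term_bound[OF assms, of "norm z" j] by (metis order_refl)
  show ?thesis
    by (rule summable_comparison_test'[OF summable_geom_exp[of C]]) (use C in auto)
qed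

text \<open>The theta series runs over all odd multiples of \<open>\<pi>i\<close>; \<open>half_theta\<close> sums the positive ones,
  \<open>Theta\<close> adds the negative ones. The index \<open>j\<close> counts
  \<open>z\<close>-derivatives.\<close>
definition half_theta :: "nat \<Rightarrow> complex \<Rightarrow> complex \<Rightarrow> complex" where
  "half_theta j z \<tau> = (\<Sum>n. freq n ^ j * theta_term n z \<tau>)"

lemma half_theta_deriv:
  assumes \<tau>: "Im \<tau> > 0"
  shows "((\<lambda>z. half_theta j z \<tau>) has_field_derivative half_theta (Suc j) z \<tau>) (at z)"
proof -
  have "\<exists>g g'. \<forall>x\<in>UNIV. ((\<lambda>n. freq n ^ j * theta_term n x \<tau>) sums g x) \<and>
      ((\<lambda>n. freq n ^ Suc j * theta_term n x \<tau>) sums g' x) \<and> (g has_field_derivative g' x) (at x)"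
  proof (rule series_and_derivative_comparison_complex)
    show "((\<lambda>x. freq n ^ j * theta_term n x \<tau>) has_field_derivative freq n ^ Suc j * theta_term n x \<tau>) (at x)" for n x
      unfolding theta_term_def by (auto intro!: derivative_eq_intros)
    fix x :: complex
    obtain C where C: "C \<ge> 0" "\<And>n y. norm y \<le> norm x + 1 \<Longrightarrow> norm (freq n ^ j * theta_term n y \<tau>) \<le> C * exp (-1) ^ n"
      using theta_term_bound[OF \<tau>, of "norm x + 1" j] by (metis order_refl)
    have nb: "norm y \<le> norm x + 1" if "y \<in> ball x 1" for y
    proof -
      have "norm y \<le> norm x + norm (y - x)" by (metis add.commute diff_add_cancel norm_triangle_ineq)
      with that show ?thesis by (simp add: dist_norm norm_minus_commute)
    qed
    show "\<exists>d h. 0 < d \<and> summable h \<and> range h \<subseteq> \<real>\<^sub>\<ge>\<^sub>0 \<and> (\<forall>\<^sub>F n in sequentially. \<forall>y\<in>ball x d \<inter> UNIV. cmod (freq n ^ j * theta_term n y \<tau>) \<le> cmod (h n))"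
      using C nb by (intro exI[of _ 1] exI[of _ "\<lambda>n. of_real (C * exp (-1) ^ n)"])
        (auto simp: summable_of_real_iff summable_geom_exp simp del: of_real_mult of_real_power intro!: always_eventually)
  qed simp
  then obtain g g' where g: "\<And>x. (\<lambda>n. freq n ^ j * theta_term n x \<tau>) sums g x"
      "\<And>x. (\<lambda>n. freq n ^ Suc j * theta_term n x \<tau>) sums g' x" "\<And>x. (g has_field_derivative g' x) (at x)"
    by blast
  have "g = (\<lambda>x. half_theta j x \<tau>)" "g' z = half_theta (Suc j) z \<tau>"
    using g(1,2) by (auto simp: half_theta_def sums_unique)
  with g(3)[of z] show ?thesis by simp
qed

lemma half_theta_deriv_tau:
  assumes \<tau>: "Im \<tau> > 0"
  shows "((\<lambda>\<sigma>. half_theta j z \<sigma>) has_field_derivative half_theta (j + 2) z \<tau> / (4 * of_real pi * \<i>)) (at \<tau>)"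
proof -
  let ?H = "{\<sigma>. Im \<sigma> > 0}" and ?c = "4 * of_real pi * \<i>"
  have H: "open ?H" by (simp add: open_halfspace_Im_gt)
  have "\<exists>g g'. \<forall>\<sigma>\<in>?H. ((\<lambda>n. freq n ^ j * theta_term n z \<sigma>) sums g \<sigma>) \<and>
      ((\<lambda>n. freq n ^ (j + 2) * theta_term n z \<sigma> / ?c) sums g' \<sigma>) \<and> (g has_field_derivative g' \<sigma>) (at \<sigma>)"
  proof (rule series_and_derivative_comparison_complex[OF H])
    show "((\<lambda>\<sigma>. freq n ^ j * theta_term n z \<sigma>) has_field_derivative freq n ^ (j + 2) * theta_term n z \<sigma> / ?c) (at \<sigma>)" for n \<sigma>
    proof -
      have "((\<lambda>\<sigma>. freq n ^ j * ((-1) ^ n * exp (freq n ^ 2 * \<sigma> / c + freq n * z))) has_field_derivative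
         freq n ^ j * ((-1) ^ n * (exp (freq n ^ 2 * \<sigma> / c + freq n * z) * (freq n ^ 2 / c)))) (at \<sigma>)" if "c \<noteq> 0" for c
        using that by (auto intro!: derivative_eq_intros)
      moreover have "?c \<noteq> 0" by simp
      ultimately show ?thesis
        unfolding theta_term_def by (simp only: power_add mult_ac times_divide_eq_right times_divide_eq_left) metis
    qed
    fix \<sigma> assume "\<sigma> \<in> ?H"
    \<comment> \<open>On the ball of radius \<open>Im \<sigma> / 2\<close> imaginary parts stay
      above \<open>Im \<sigma> / 2\<close>, which is the uniformity that
      \<open>theta_term_bound\<close> asks for.\<close>
    then have \<sigma>: "Im \<sigma> / 2 > 0" by simp
    obtain C where C: "C \<ge> 0" "\<And>n \<sigma>'. Im \<sigma>' \<ge> Im \<sigma> / 2 \<Longrightarrow> norm (freq n ^ j * theta_term n z \<sigma>') \<le> C * exp (-1) ^ n"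
      using theta_term_bound[OF \<sigma>, of "norm z" j] by (metis order_refl)
    have nb: "Im y \<ge> Im \<sigma> / 2" if "y \<in> ball \<sigma> (Im \<sigma> / 2)" for y
      using abs_Im_le_cmod[of "\<sigma> - y"] that by (auto simp: dist_norm)
    show "\<exists>d h. 0 < d \<and> summable h \<and> range h \<subseteq> \<real>\<^sub>\<ge>\<^sub>0 \<and> (\<forall>\<^sub>F n in sequentially. \<forall>y\<in>ball \<sigma> d \<inter> ?H. cmod (freq n ^ j * theta_term n z y) \<le> cmod (h n))"
      using C nb \<sigma> by (intro exI[of _ "Im \<sigma> / 2"] exI[of _ "\<lambda>n. of_real (C * exp (-1) ^ n)"])
        (auto simp: summable_of_real_iff summable_geom_exp simp del: of_real_mult of_real_power intro!: always_eventually)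
  qed
  then obtain g g' where g: "\<And>\<sigma>. \<sigma> \<in> ?H \<Longrightarrow> (\<lambda>n. freq n ^ j * theta_term n z \<sigma>) sums g \<sigma>"
      "\<And>\<sigma>. \<sigma> \<in> ?H \<Longrightarrow> (\<lambda>n. freq n ^ (j + 2) * theta_term n z \<sigma> / ?c) sums g' \<sigma>"
      "\<And>\<sigma>. \<sigma> \<in> ?H \<Longrightarrow> (g has_field_derivative g' \<sigma>) (at \<sigma>)"
    by blast
  have eq: "g \<sigma> = half_theta j z \<sigma>" if "\<sigma> \<in> ?H" for \<sigma>
    using g(1)[OF that] by (simp add: half_theta_def sums_unique)
  have "(\<lambda>n. freq n ^ (j + 2) * theta_term n z \<tau> / ?c) sums (half_theta (j + 2) z \<tau> / ?c)"
    unfolding half_theta_def using summable_theta_term[OF \<tau>] by (intro sums_divide summable_sums)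
  with g(2)[of \<tau>] \<tau> have g': "g' \<tau> = half_theta (j + 2) z \<tau> / ?c" by (auto dest: sums_unique2)
  show ?thesis
    unfolding g'[symmetric]
    by (rule has_field_derivative_transform_within_open[OF g(3) H _ eq]) (use \<tau> in auto)
qed

lemma half_theta_0: "half_theta 0 z \<tau> = (\<Sum>n. theta_term n z \<tau>)"
  by (simp add: half_theta_def)

definition Theta :: "nat \<Rightarrow> complex \<Rightarrow> complex \<Rightarrow> complex" where
  "Theta j z \<tau> = half_theta j z \<tau> - (-1) ^ j * half_theta j (- z) \<tau>"

lemma Theta_deriv:
  assumes "Im \<tau> > 0"
  shows "((\<lambda>z. Theta j z \<tau>) has_field_derivative Theta (Suc j) z \<tau>) (at z)"
  unfolding Theta_def
  by (auto intro!: derivative_eq_intros DERIV_chain'[OF _ half_theta_deriv[OF assms]] half_theta_deriv[OF assms])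

lemma Theta_deriv_tau:
  assumes "Im \<tau> > 0"
  shows "((\<lambda>\<sigma>. Theta j z \<sigma>) has_field_derivative Theta (j + 2) z \<tau> / (4 * of_real pi * \<i>)) (at \<tau>)"
  unfolding Theta_def
  by (auto intro!: derivative_eq_intros half_theta_deriv_tau[OF assms] simp: field_simps)

lemma exp_odd_pi: "exp (of_nat (2 * n + 1) * (of_real pi * \<i>)) = -1"
proof -
  have "exp (of_nat (2 * n + 1) * (of_real pi * \<i>)) = exp (of_real pi * \<i>) ^ (2 * n + 1)"
    by (rule exp_of_nat_mult)
  then show ?thesis by simp
qed

lemma theta_term_add1: "theta_term n (z + 1) \<tau> = - theta_term n z \<tau>"
  "theta_term n (- (z + 1)) \<tau> = - theta_term n (- z) \<tau>"
proof -
  have 1: "exp (freq n) = -1" unfolding freq_def by (rule exp_odd_pi)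
  then have 2: "exp (- freq n) = -1" by (simp add: exp_minus)
  show "theta_term n (z + 1) \<tau> = - theta_term n z \<tau>"
    "theta_term n (- (z + 1)) \<tau> = - theta_term n (- z) \<tau>"
    using 1 2 unfolding theta_term_def
    by (simp_all only: minus_add_distrib distrib_left exp_add) simp_all
qed

lemma Theta_per1:
  assumes "Im \<tau> > 0"
  shows "Theta 0 (z + 1) \<tau> = - Theta 0 z \<tau>"
  using summable_theta_term[OF assms, of 0]
  unfolding Theta_def half_theta_0 theta_term_add1 by (simp add: suminf_minus)

text \<open>Up to the multiplier the shift moves the index up by one in the positive half and down
  by one in the negative half. The lowest term of the negative half crosses over and becomes the
  lowest term of the positive half.\<close>

lemma Theta_pertau:
  assumes \<tau>: "Im \<tau> > 0"
  shows "Theta 0 (z + \<tau>) \<tau> = - exp (- of_real pi * \<i> * \<tau>) * exp (- 2 * of_real pi * \<i> * z) * Theta 0 z \<tau>"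
proof -
  define \<mu> where "\<mu> = exp (of_real pi * \<i> * (- \<tau> - 2 * z))"
  have sm: "summable (\<lambda>n. theta_term n z \<tau>)" for z
    using summable_theta_term[OF \<tau>, of 0 z] by simp
  have e: "exp a = \<mu> * exp b" if "a = of_real pi * \<i> * (- \<tau> - 2 * z) + b" for a b
    unfolding that exp_add \<mu>_def ..
  have 1: "theta_term n (z + \<tau>) \<tau> = - \<mu> * theta_term (Suc n) z \<tau>" for n
  proof -
    have "exp (of_real pi * \<i> * ((2 * of_nat (n) + 1) ^ 2 * \<tau> / 4 + (2 * of_nat (n) + 1) * (z + \<tau>)))
        = \<mu> * exp (of_real pi * \<i> * ((2 * of_nat (Suc n) + 1) ^ 2 * \<tau> / 4 + (2 * of_nat (Suc n) + 1) * (z)))"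
      by (rule e) (simp add: field_simps power2_eq_square)
    then show ?thesis unfolding theta_term_eq by (simp only: power_Suc mult_ac mult_minus_left mult_minus_right minus_minus mult_1)
  qed
  have 2: "theta_term (Suc n) (- (z + \<tau>)) \<tau> = - \<mu> * theta_term n (- z) \<tau>" for n
  proof -
    have "exp (of_real pi * \<i> * ((2 * of_nat (Suc n) + 1) ^ 2 * \<tau> / 4 + (2 * of_nat (Suc n) + 1) * (- (z + \<tau>))))
        = \<mu> * exp (of_real pi * \<i> * ((2 * of_nat (n) + 1) ^ 2 * \<tau> / 4 + (2 * of_nat (n) + 1) * (- z)))"
      by (rule e) (simp add: field_simps power2_eq_square)
    then show ?thesis unfolding theta_term_eq by (simp only: power_Suc mult_ac mult_minus_left mult_minus_right minus_minus mult_1)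
  qed
  have 3: "theta_term 0 (- (z + \<tau>)) \<tau> = \<mu> * theta_term 0 z \<tau>"
  proof -
    have "exp (of_real pi * \<i> * ((2 * of_nat (0) + 1) ^ 2 * \<tau> / 4 + (2 * of_nat (0) + 1) * (- (z + \<tau>))))
        = \<mu> * exp (of_real pi * \<i> * ((2 * of_nat (0) + 1) ^ 2 * \<tau> / 4 + (2 * of_nat (0) + 1) * (z)))"
      by (rule e) (simp add: field_simps power2_eq_square)
    then show ?thesis unfolding theta_term_eq by (simp only: power_Suc mult_ac mult_minus_left mult_minus_right minus_minus mult_1)
  qed
  have "half_theta 0 (z + \<tau>) \<tau> = - \<mu> * (half_theta 0 z \<tau> - theta_term 0 z \<tau>)"
  proof -
    have "half_theta 0 (z + \<tau>) \<tau> = (\<Sum>n. - \<mu> * theta_term (Suc n) z \<tau>)"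
      unfolding half_theta_0 1 ..
    also have "\<dots> = - \<mu> * (\<Sum>n. theta_term (Suc n) z \<tau>)"
      by (rule suminf_mult) (rule summable_Suc_iff[THEN iffD2, OF sm])
    also have "(\<Sum>n. theta_term (Suc n) z \<tau>) = half_theta 0 z \<tau> - theta_term 0 z \<tau>"
      unfolding half_theta_0 using suminf_split_head[OF sm[of z]] by simp
    finally show ?thesis .
  qed
  moreover have "half_theta 0 (- (z + \<tau>)) \<tau> = \<mu> * theta_term 0 z \<tau> - \<mu> * half_theta 0 (- z) \<tau>"
  proof -
    have "half_theta 0 (- (z + \<tau>)) \<tau> = theta_term 0 (- (z + \<tau>)) \<tau> + (\<Sum>n. theta_term (Suc n) (- (z + \<tau>)) \<tau>)"
      unfolding half_theta_0 using suminf_split_head[OF sm[of "- (z + \<tau>)"]] by simp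
    also have "(\<Sum>n. theta_term (Suc n) (- (z + \<tau>)) \<tau>) = - \<mu> * half_theta 0 (- z) \<tau>"
      unfolding 2 half_theta_0 using sm by (intro suminf_mult)
    finally show ?thesis using 3 by simp
  qed
  ultimately show ?thesis
    unfolding Theta_def by (simp add: \<mu>_def exp_add[symmetric] algebra_simps)
qed

text \<open>With \<open>x = exp (2 pi i z)\<close> the half series is
  \<open>exp (pi i z) * G x\<close> for an entire \<open>G\<close>. If \<open>Theta 0\<close>
  vanished, the symmetry under \<open>z\<close> to \<open>- z\<close> would give
  \<open>x * G x = G (inverse x)\<close>. Then \<open>x * G x\<close> is bounded, hence constant by
  Liouville, hence 0; but \<open>G 0\<close> is an exponential up to sign.\<close>

lemma Theta_nonzero:
  assumes \<tau>: "Im \<tau> > 0"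
  shows "\<exists>z. Theta 0 z \<tau> \<noteq> 0"
proof (rule ccontr)
  assume "\<not> (\<exists>z. Theta 0 z \<tau> \<noteq> 0)"
  then have zero: "half_theta 0 z \<tau> = half_theta 0 (- z) \<tau>" for z
    by (simp add: Theta_def)
  define a where "a n = (-1) ^ n * exp (freq n ^ 2 * \<tau> / (4 * of_real pi * \<i>))" for n
  define G where "G x = (\<Sum>n. a n * x ^ n)" for x
  have ta: "theta_term n z \<tau> = exp (of_real pi * \<i> * z) * (a n * exp (2 * of_real pi * \<i> * z) ^ n)" for n z
  proof -
    have "exp (freq n ^ 2 * \<tau> / (4 * of_real pi * \<i>) + freq n * z) = exp (of_real pi * \<i> * z)
       * (exp (freq n ^ 2 * \<tau> / (4 * of_real pi * \<i>)) * exp (of_nat n * (2 * of_real pi * \<i> * z)))"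
      unfolding exp_add[symmetric] by (rule arg_cong[of _ _ exp]) (simp add: freq_def algebra_simps)
    then show ?thesis
      unfolding theta_term_def a_def exp_of_nat_mult by (simp only: mult_ac)
  qed
  have ln: "\<exists>z. x = exp (2 * of_real pi * \<i> * z)" if "x \<noteq> 0" for x :: complex
    using that by (intro exI[of _ "Ln x / (2 * of_real pi * \<i>)"]) simp
  have sm: "summable (\<lambda>n. a n * x ^ n)" for x
  proof (cases "x = 0")
    case True
    have "summable (\<lambda>n. if n = 0 then a 0 else 0)" by (rule summable_single)
    then show ?thesis by (rule summable_cong[THEN iffD1, rotated]) (auto simp: True intro: always_eventually)
  next
    case False
    then obtain z where z: "x = exp (2 * of_real pi * \<i> * z)" using ln by blast
    have "summable (\<lambda>n. theta_term n z \<tau>)" using summable_theta_term[OF \<tau>, of 0 z] by simp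
    then show ?thesis unfolding ta z[symmetric] by (simp add: summable_cmult_iff)
  qed
  have hG: "half_theta 0 z \<tau> = exp (of_real pi * \<i> * z) * G (exp (2 * of_real pi * \<i> * z))" for z
    unfolding half_theta_0 ta G_def by (rule suminf_mult) (rule sm)
  have dG: "(G has_field_derivative (\<Sum>n. diffs a n * x ^ n)) (at x)" for x
    unfolding G_def by (rule termdiffs_strong_converges_everywhere) (rule sm)
  have cG: "isCont G x" for x using dG DERIV_isCont by blast
  have inv: "x * G x = G (inverse x)" if x: "x \<noteq> 0" for x
  proof -
    obtain z where z: "x = exp (2 * of_real pi * \<i> * z)" using ln x by blast
    define e where "e = exp (of_real pi * \<i> * z)"
    have e: "e \<noteq> 0" "x = e * e" "exp (of_real pi * \<i> * (- z)) = inverse e"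
      "exp (2 * of_real pi * \<i> * (- z)) = inverse x"
      by (simp_all add: e_def z exp_minus[symmetric] exp_add[symmetric] algebra_simps)
    have "e * G x = inverse e * G (inverse x)"
      using zero[of z] unfolding hG e(3,4) z[symmetric] by (simp add: e_def)
    then have "e * (e * G x) = G (inverse x)" using e(1) by simp
    then show ?thesis by (simp add: e(2) mult.assoc)
  qed
  have "(\<lambda>x. x * G x) constant_on UNIV"
  proof (rule Liouville_theorem)
    have "G holomorphic_on UNIV" using dG holomorphic_on_def field_differentiable_def by blast
    then show "(\<lambda>x. x * G x) holomorphic_on UNIV" by (intro holomorphic_intros)
    have "continuous_on (cball 0 1) G" using cG by (simp add: continuous_at_imp_continuous_on)
    then have "bounded (G ` cball 0 1)"
      by (intro compact_imp_bounded compact_continuous_image) auto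
    then obtain B where B: "\<And>x. norm x \<le> 1 \<Longrightarrow> norm (G x) \<le> B"
      unfolding bounded_iff by (metis image_eqI mem_cball_0)
    have "norm (x * G x) \<le> B" for x
    proof (cases "norm x \<le> 1")
      case True
      have "norm (x * G x) \<le> 1 * norm (G x)" unfolding norm_mult using True by (intro mult_right_mono) auto
      with B[OF True] show ?thesis by simp
    next
      case False
      then have "x \<noteq> 0" "norm (inverse x) \<le> 1" by (auto simp: norm_inverse inverse_le_1_iff)
      with B[of "inverse x"] inv[of x] show ?thesis by simp
    qed
    then show "bounded (range (\<lambda>x. x * G x))" by (auto simp: bounded_iff)
  qed
  then have "x * G x = 0 * G 0" for x by (metis UNIV_I constant_on_def)
  then have "G x = 0" if "x \<noteq> 0" for x using that by (metis mult_eq_0_iff)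
  then have "eventually (\<lambda>x. G x = 0) (at 0)" by (simp add: eventually_at_filter)
  then have "(G \<longlongrightarrow> 0) (at 0)" by (rule tendsto_eventually)
  with cG[of 0] have "G 0 = 0" by (auto simp: isCont_def dest: tendsto_unique[OF trivial_limit_at])
  moreover have "G 0 = a 0" unfolding G_def by (rule powser_zero)
  ultimately show False by (simp add: a_def)
qed

section \<open>Elliptic identities\<close>

lemma lattice_iff: "v \<in> lattice \<tau> \<longleftrightarrow> (\<exists>a b. v = of_int a + of_int b * \<tau>)"
  by (auto simp: lattice_def)

text \<open>Every point is congruent to one in the compact period parallelogram \<open>Q\<close>, so
  the function is bounded and Liouville applies.\<close>

lemma doubly_periodic_entire_constant:
  assumes \<tau>: "Im \<tau> > 0" and f: "f holomorphic_on UNIV"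
    and p1: "\<And>v. f (v + 1) = f v" and p2: "\<And>v. f (v + \<tau>) = f v"
  shows "f v = f w"
proof -
  have int: "f (v + of_int a * p) = f v" if p: "\<And>v. f (v + p) = f v" for a :: int and v p
  proof -
    have nat: "f (v + of_nat k * p) = f v" for k v
    proof (induction k)
      case (Suc k)
      have "v + of_nat (Suc k) * p = (v + of_nat k * p) + p" by (simp add: algebra_simps)
      then show ?case using p[of "v + of_nat k * p"] Suc by metis
    qed simp
    show ?thesis
    proof (cases a rule: int_cases2)
      case (nonneg k) then show ?thesis using nat[of v k] by simp
    next
      case (nonpos k)
      have "f (v - of_nat k * p + of_nat k * p) = f (v - of_nat k * p)" by (rule nat)
      then have "f v = f (v - of_nat k * p)" by (simp only: diff_add_cancel)
      moreover have "v + of_int a * p = v - of_nat k * p" unfolding nonpos by simp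
      ultimately show ?thesis by metis
    qed
  qed
  define Q where "Q = (\<lambda>(a, b). of_real a + of_real b * \<tau>) ` (cbox (0, 0) (1, 1) :: (real \<times> real) set)"
  have "compact Q"
    unfolding Q_def by (intro compact_continuous_image compact_cbox)
      (auto simp: case_prod_beta intro!: continuous_intros)
  moreover have "continuous_on Q f" using f holomorphic_on_imp_continuous_on continuous_on_subset by blast
  ultimately have bd: "bounded (f ` Q)" by (intro compact_imp_bounded compact_continuous_image)
  have "f u \<in> f ` Q" for u
  proof -
    define b where "b = Im u / Im \<tau>"
    define a where "a = Re u - b * Re \<tau>"
    have u: "u = of_real a + of_real b * \<tau>"
      using \<tau> by (simp add: complex_eq_iff a_def b_def)
    have "f u = f (of_real (frac a) + of_real (frac b) * \<tau>)"
    proof -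
      have "u = of_real (frac a) + of_real (frac b) * \<tau> + of_int \<lfloor>b\<rfloor> * \<tau> + of_int \<lfloor>a\<rfloor> * 1"
        unfolding u frac_def by (simp add: algebra_simps)
      then show ?thesis using int[OF p1] int[OF p2] by simp
    qed
    moreover have "of_real (frac a) + of_real (frac b) * \<tau> \<in> Q"
      unfolding Q_def by (rule image_eqI[of _ _ "(frac a, frac b)"])
        (auto simp: frac_ge_0 less_imp_le[OF frac_lt_1])
    ultimately show ?thesis by simp
  qed
  then have "range f \<subseteq> f ` Q" by auto
  with bd have "bounded (range f)" by (rule bounded_subset)
  with f have "f constant_on UNIV" by (rule Liouville_theorem)
  then show ?thesis by (auto simp: constant_on_def)
qed

lemma holomorphic_shift:
  fixes f :: "complex \<Rightarrow> complex"
  assumes "f holomorphic_on UNIV"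
  shows "(\<lambda>v. f (v + p)) holomorphic_on UNIV"
proof -
  have "(\<lambda>v. v + p) holomorphic_on UNIV" by (intro holomorphic_intros)
  then have "f \<circ> (\<lambda>v. v + p) holomorphic_on UNIV"
    by (rule holomorphic_on_compose) (rule holomorphic_on_subset[OF assms], simp)
  then show ?thesis by (simp add: o_def)
qed

text \<open>Cancels a factor that has zeros: the two functions agree on the nonempty open set where
  \<open>g\<close> does not vanish, and the identity theorem does the rest.\<close>

lemma entire_cancel:
  assumes "f holomorphic_on UNIV" "f' holomorphic_on UNIV" "g holomorphic_on UNIV"
    and "\<And>v. f v * g v = f' v * g v" and "g w \<noteq> 0"
  shows "f v = f' v"
proof -
  have "open (g -` (- {0}))"
    using assms(3) holomorphic_on_imp_continuous_on by (intro open_vimage) auto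
  then show ?thesis
  proof (rule analytic_continuation_open[of "g -` (- {0})" UNIV f f'])
    show "g -` (- {0}) \<noteq> {}" using assms(5) by auto
    show "f z = f' z" if "z \<in> g -` (- {0})" for z
      using that assms(4)[of z] by simp
  qed (use assms(1,2) in \<open>simp_all add: connected_UNIV\<close>)
qed

section \<open>Theta functions for one fixed \<tau>, up to the Fay identity\<close>

locale theta_fun =
  fixes \<tau> :: complex and \<theta> :: "complex \<Rightarrow> complex"
  assumes tau: "Im \<tau> > 0"
    and hol: "\<theta> holomorphic_on UNIV"
    and zeros: "\<And>v. \<theta> v = 0 \<longleftrightarrow> v \<in> lattice \<tau>"
    and per1: "\<And>v. \<theta> (v + 1) = - \<theta> v"
    and odd: "\<And>v. \<theta> (- v) = - \<theta> v"
    and pertau: "\<And>v. \<theta> (v + \<tau>) = - exp (- of_real pi * \<i> * \<tau>) * exp (- 2 * of_real pi * \<i> * v) * \<theta> v"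
    and norm: "deriv \<theta> 0 = 1"
begin

lemma theta_0 [simp]: "\<theta> 0 = 0"
proof -
  have "\<theta> 0 = - \<theta> 0" using odd[of 0] by (simp only: minus_zero)
  then have "\<theta> 0 + \<theta> 0 = 0" by (metis add.right_inverse)
  then have "2 * \<theta> 0 = 0" by (simp only: mult_2)
  then show ?thesis by simp
qed

lemma hol' [holomorphic_intros]: "f holomorphic_on B \<Longrightarrow> (\<lambda>v. \<theta> (f v)) holomorphic_on B"
  using holomorphic_on_compose[of f B \<theta>] holomorphic_on_subset[OF hol, of "f ` B"] by (simp add: o_def)

lemma theta_deriv: "(\<theta> has_field_derivative deriv \<theta> v) (at v)"
  using hol holomorphic_derivI[of \<theta> UNIV v] by auto

text \<open>All zeros are simple. At a zero, differentiating the quasi-periodicity leaves only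
  multiplier times derivative, so nonvanishing spreads from 0, where the derivative is 1, over the
  lattice.\<close>

lemma deriv_at_lattice_nonzero:
  assumes "v \<in> lattice \<tau>"
  shows "deriv \<theta> v \<noteq> 0"
proof -
  have p: "deriv \<theta> (v + p) = m v * deriv \<theta> v"
    if eq: "\<And>v. \<theta> (v + p) = m v * \<theta> v" and "\<theta> v = 0" and m: "m holomorphic_on UNIV" for p m v
  proof -
    have "((\<lambda>v. \<theta> (v + p)) has_field_derivative deriv \<theta> (v + p)) (at v)"
      using DERIV_shift[of \<theta> _ v p] theta_deriv[of "v + p"] by simp
    moreover have "((\<lambda>v. m v * \<theta> v) has_field_derivative deriv m v * \<theta> v + deriv \<theta> v * m v) (at v)"
      using m by (intro DERIV_mult theta_deriv holomorphic_derivI[of m UNIV]) auto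
    ultimately show ?thesis using that(2) unfolding eq by (auto dest: DERIV_unique simp: mult.commute)
  qed
  have step: "deriv \<theta> (v + of_int a * p) \<noteq> 0" if "deriv \<theta> v \<noteq> 0" "v \<in> lattice \<tau>"
    and sh: "\<And>v. v \<in> lattice \<tau> \<Longrightarrow> v + p \<in> lattice \<tau> \<and> v - p \<in> lattice \<tau>"
    and eq: "\<And>v. \<theta> (v + p) = m v * \<theta> v" and m: "m holomorphic_on UNIV" and nz: "\<And>v. m v \<noteq> 0" for v p m and a :: int
  proof -
    have iff: "deriv \<theta> (v + p) \<noteq> 0 \<longleftrightarrow> deriv \<theta> v \<noteq> 0" if "v \<in> lattice \<tau>" for v
      using p[of p m v] eq m nz that zeros by auto
    have "v + of_int a * p \<in> lattice \<tau> \<and> deriv \<theta> (v + of_int a * p) \<noteq> 0"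
    proof (induction a rule: int_induct[where k = 0])
      case base then show ?case using that by simp
    next
      case (step1 i)
      then show ?case using sh[of "v + of_int i * p"] iff[of "v + of_int i * p"] by (simp add: algebra_simps)
    next
      case (step2 i)
      then show ?case using sh[of "v + of_int i * p"] iff[of "v + of_int (i - 1) * p"] by (simp add: algebra_simps)
    qed
    then show ?thesis by simp
  qed
  obtain a b where v: "v = of_int a + of_int b * \<tau>" using assms by (auto simp: lattice_iff)
  have "deriv \<theta> (0 + of_int a * 1) \<noteq> 0"
  proof (rule step[where m = "\<lambda>_. -1"])
    fix v assume "v \<in> lattice \<tau>"
    then obtain a b where "v = of_int a + of_int b * \<tau>" by (auto simp: lattice_iff)
    then have "v + 1 = of_int (a + 1) + of_int b * \<tau>" "v - 1 = of_int (a - 1) + of_int b * \<tau>" by auto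
    then show "v + 1 \<in> lattice \<tau> \<and> v - 1 \<in> lattice \<tau>" unfolding lattice_iff by blast
  qed (use norm per1 zeros[of 0] in simp_all)
  then have "deriv \<theta> (of_int a + of_int b * \<tau>) \<noteq> 0"
  proof (intro step[where m = "\<lambda>v. - exp (- of_real pi * \<i> * \<tau>) * exp (- 2 * of_real pi * \<i> * v)"])
    have "of_int a = of_int a + of_int 0 * \<tau>" by simp
    then show "of_int a \<in> lattice \<tau>" unfolding lattice_iff by blast
    fix v assume "v \<in> lattice \<tau>"
    then obtain a b where "v = of_int a + of_int b * \<tau>" by (auto simp: lattice_iff)
    then have "v + \<tau> = of_int a + of_int (b + 1) * \<tau>" "v - \<tau> = of_int a + of_int (b - 1) * \<tau>"
      by (auto simp: algebra_simps)
    then show "v + \<tau> \<in> lattice \<tau> \<and> v - \<tau> \<in> lattice \<tau>" unfolding lattice_iff by blast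
  next
    show "\<theta> (v + \<tau>) = - exp (- of_real pi * \<i> * \<tau>) * exp (- 2 * of_real pi * \<i> * v) * \<theta> v" for v
      by (rule pertau)
    show "(\<lambda>v. - exp (- of_real pi * \<i> * \<tau>) * exp (- 2 * of_real pi * \<i> * v)) holomorphic_on UNIV"
      by (intro holomorphic_intros)
  qed simp_all
  then show ?thesis by (simp add: v)
qed

text \<open>The zeros of \<open>\<theta>\<close> are simple, so a zero of \<open>h\<close> at each
  of them makes the quotient entire.\<close>

lemma theta_divides:
  assumes h: "h holomorphic_on UNIV" and z: "\<And>v. v - p \<in> lattice \<tau> \<Longrightarrow> h v = 0"
  obtains f where "f holomorphic_on UNIV" "\<And>v. h v = f v * \<theta> (v - p)"
proof -
  define g where "g v = \<theta> (v - p)" for v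
  have g: "g holomorphic_on UNIV" unfolding g_def by (intro holomorphic_intros)
  have dg: "deriv g v = deriv \<theta> (v - p)" for v
    unfolding g_def using DERIV_shift[of \<theta> "deriv \<theta> (v - p)" v "- p"] theta_deriv[of "v - p"]
    by (intro DERIV_imp_deriv) simp
  define f where "f v = (if g v = 0 then deriv h v / deriv g v else h v / g v)" for v
  have z': "h v = 0" "deriv g v \<noteq> 0" if "g v = 0" for v
    using that z[of v] deriv_at_lattice_nonzero[of "v - p"] zeros by (auto simp: g_def dg)
  have "f field_differentiable (at c)" for c
  proof (cases "g c = 0")
    case False
    have o: "open (g -` (- {0}))"
      using g holomorphic_on_imp_continuous_on by (intro open_vimage) auto
    have "(\<lambda>v. h v / g v) holomorphic_on (g -` (- {0}))"
      by (intro holomorphic_on_divide holomorphic_on_subset[OF h] holomorphic_on_subset[OF g]) auto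
    then have "f holomorphic_on (g -` (- {0}))"
      by (rule holomorphic_transform) (auto simp: f_def)
    with False o show ?thesis by (auto simp: holomorphic_on_open field_differentiable_def)
  next
    case True
    \<comment> \<open>Near the zero \<open>c\<close> the quotient equals that of the difference
      quotients of \<open>h\<close> and \<open>g\<close>, which are entire, and \<open>g1\<close>
      does not vanish at \<open>c\<close>.\<close>
    define h1 where "h1 v = (if v = c then deriv h c else (h v - h c) / (v - c))" for v
    define g1 where "g1 v = (if v = c then deriv g c else (g v - g c) / (v - c))" for v
    have h1: "h1 holomorphic_on UNIV" and g1: "g1 holomorphic_on UNIV"
      unfolding h1_def g1_def using h g by (auto intro: pole_lemma)
    have "g1 c \<noteq> 0" using z' True by (simp add: g1_def)
    moreover have o: "open (g1 -` (- {0}))"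
      using g1 holomorphic_on_imp_continuous_on by (intro open_vimage) auto
    moreover have "(\<lambda>v. h1 v / g1 v) holomorphic_on (g1 -` (- {0}))"
      by (intro holomorphic_on_divide holomorphic_on_subset[OF h1] holomorphic_on_subset[OF g1]) auto
    moreover have "h1 v / g1 v = f v" if "v \<in> g1 -` (- {0})" for v
      using that True z'[of c] by (auto simp: f_def h1_def g1_def)
    ultimately show ?thesis
      using holomorphic_transform[of "\<lambda>v. h1 v / g1 v" "g1 -` (- {0})" f]
      by (auto simp: holomorphic_on_open field_differentiable_def)
  qed
  then have "f holomorphic_on UNIV" by (simp add: holomorphic_on_def field_differentiable_at_within)
  moreover have "h v = f v * \<theta> (v - p)" for v
    using z'[of v] by (auto simp: f_def g_def[symmetric])
  ultimately show ?thesis by (rule that)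
qed

lemma lattice_multiple:
  assumes hm: "\<And>v. h (v + w) = m v * h v" and h0: "h p = 0" "\<And>v. m v \<noteq> 0"
  shows "h (p + of_int a * w) = (0::complex)"
proof (induction a rule: int_induct[where k = 0])
  case base then show ?case using h0 by simp
next
  case (step1 i)
  then show ?case using hm[of "p + of_int i * w"] by (simp add: algebra_simps)
next
  case (step2 i)
  then show ?case using hm[of "p + of_int (i - 1) * w"] h0(2) by (simp add: algebra_simps)
qed

text \<open>Nonvanishing multipliers carry a zero to its whole coset, which is what
  \<open>theta_divides\<close> requires.\<close>

lemma quasi_zero:
  assumes "h p = 0" "\<And>v. h (v + 1) = m1 v * h v" "\<And>v. h (v + \<tau>) = m2 v * h v"
    "\<And>v. m1 v \<noteq> 0" "\<And>v. m2 v \<noteq> 0" "v - p \<in> lattice \<tau>"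
  shows "h v = (0::complex)"
proof -
  obtain a b where "v - p = of_int a + of_int b * \<tau>" using assms(6) by (auto simp: lattice_iff)
  then have v: "v = (p + of_int a * 1) + of_int b * \<tau>" by (simp add: algebra_simps)
  have "h (p + of_int a * 1) = 0"
    by (rule lattice_multiple[of h 1 m1, OF assms(2,1,4)])
  then show ?thesis unfolding v
    by (rule lattice_multiple[of h \<tau> m2, OF assms(3) _ assms(5)])
qed

lemma theta_nonzero: "\<theta> (1/2) \<noteq> 0"
proof
  assume "\<theta> (1/2) = 0"
  then obtain a b where ab: "1/2 = of_int a + of_int b * \<tau>" unfolding zeros lattice_iff by blast
  from arg_cong[OF ab, of Im] have "of_int b * Im \<tau> = 0" by simp
  then have "b = 0" using tau by simp
  with arg_cong[OF ab, of Re] have "1/2 = (of_int a :: real)" by simp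
  then have "of_int (2 * a) = (of_int 1 :: real)" by simp
  then have "2 * a = 1" unfolding of_int_eq_iff .
  then show False by presburger
qed

text \<open>The quotient by \<open>\<theta>\<close> is entire and doubly periodic.\<close>

lemma constant_multiple:
  assumes h: "h holomorphic_on UNIV" and h0: "h 0 = 0"
    and h1: "\<And>v. h (v + 1) = - h v"
    and ht: "\<And>v. h (v + \<tau>) = - exp (- of_real pi * \<i> * \<tau>) * exp (- 2 * of_real pi * \<i> * v) * h v"
  shows "\<exists>c. \<forall>v. h v = c * \<theta> v"
proof -
  have "h v = 0" if "v - 0 \<in> lattice \<tau>" for v
    by (rule quasi_zero[of h 0 "\<lambda>_. -1" "\<lambda>v. - exp (- of_real pi * \<i> * \<tau>) * exp (- 2 * of_real pi * \<i> * v)"])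
      (use that h0 h1 ht in auto)
  then obtain f where f: "f holomorphic_on UNIV" "\<And>v. h v = f v * \<theta> (v - 0)"
    using theta_divides[OF h, of 0] by blast
  have f1: "(\<lambda>v. f (v + 1)) holomorphic_on UNIV" "(\<lambda>v. f (v + \<tau>)) holomorphic_on UNIV"
    by (rule holomorphic_shift[OF f(1)])+
  have p1: "f (v + 1) = f v" for v
  proof (rule entire_cancel[OF f1(1) f(1) hol _ theta_nonzero])
    show "f (v + 1) * \<theta> v = f v * \<theta> v" for v using h1[of v] f(2)[of v] f(2)[of "v + 1"] per1[of v] by simp
  qed
  have p2: "f (v + \<tau>) = f v" for v
  proof (rule entire_cancel[OF f1(2) f(1) hol _ theta_nonzero])
    show "f (v + \<tau>) * \<theta> v = f v * \<theta> v" for v using ht[of v] f(2)[of v] f(2)[of "v + \<tau>"] pertau[of v] by simp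
  qed
  have "f v = f 0" for v by (rule doubly_periodic_entire_constant[OF tau f(1) p1 p2])
  with f(2) show ?thesis by (metis diff_zero)
qed

lemma lattice_diff:
  assumes "v \<in> lattice \<tau>" "w \<in> lattice \<tau>"
  shows "v - w \<in> lattice \<tau>"
proof -
  from assms obtain a b c d where "v = of_int a + of_int b * \<tau>" "w = of_int c + of_int d * \<tau>"
    by (auto simp: lattice_iff)
  then have "v - w = of_int (a - c) + of_int (b - d) * \<tau>" by (simp add: algebra_simps)
  then show ?thesis unfolding lattice_iff by blast
qed

lemma pair_shift:
  fixes a b v :: complex
  defines "G \<equiv> \<lambda>v. \<theta> (v + a) * \<theta> (v + b)"
  shows "G (v + 1) = G v"
    "G (v + \<tau>) = exp (- 2 * of_real pi * \<i> * (\<tau> + 2 * v + (a + b))) * G v"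
proof -
  have "v + 1 + a = (v + a) + 1" "v + 1 + b = (v + b) + 1" "v + \<tau> + a = (v + a) + \<tau>" "v + \<tau> + b = (v + b) + \<tau>"
    by simp_all
  note e = this
  show "G (v + 1) = G v" unfolding G_def e per1 by simp
  have "exp (- of_real pi * \<i> * \<tau>) * exp (- 2 * of_real pi * \<i> * (v + a)) *
      (exp (- of_real pi * \<i> * \<tau>) * exp (- 2 * of_real pi * \<i> * (v + b))) =
      exp (- 2 * of_real pi * \<i> * (\<tau> + 2 * v + (a + b)))"
    unfolding exp_add[symmetric] by (rule arg_cong[of _ _ exp]) (simp add: algebra_simps)
  then show "G (v + \<tau>) = exp (- 2 * of_real pi * \<i> * (\<tau> + 2 * v + (a + b))) * G v"
    unfolding G_def e pertau by (simp only: mult_ac mult_minus_left mult_minus_right minus_minus)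
qed

text \<open>\<open>W\<close> is the difference of the two sides as a function of \<open>z1\<close>.
  In each product the two shifts add up to \<open>p - z2\<close>, so all share the multiplier
  \<open>M\<close>. As \<open>W\<close> vanishes at 0 and at \<open>z2 - p\<close>, it is an entire
  doubly periodic, hence constant, multiple of \<open>\<theta> v * \<theta> (v + p - z2)\<close>.
  That product is nonzero at \<open>z2\<close>, where \<open>W\<close> vanishes, so the constant is
  0.\<close>

lemma fay_theta:
  assumes z2: "z2 \<notin> lattice \<tau>" and p: "p \<notin> lattice \<tau>" and zp: "z2 - p \<notin> lattice \<tau>"
  shows "\<theta> (z1 + p) * \<theta> (z2 + r) * \<theta> (p + r) * \<theta> (z2 - z1) =
    \<theta> (z1 + p + r) * \<theta> (z2 - z1 + r) * \<theta> z2 * \<theta> p - \<theta> (z2 + p + r) * \<theta> (z1 - z2 + p) * \<theta> z1 * \<theta> r"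
proof -
  define G where "G a b v = \<theta> (v + a) * \<theta> (v + b)" for a b v
  define c1 where "c1 = - (\<theta> (z2 + r) * \<theta> (p + r))"
  define c2 where "c2 = \<theta> z2 * \<theta> p"
  define c3 where "c3 = \<theta> (z2 + p + r) * \<theta> r"
  define W where "W v = c1 * G p (- z2) v + c2 * G (p + r) (- z2 - r) v + c3 * G 0 (p - z2) v" for v
  define M where "M v = exp (- 2 * of_real pi * \<i> * (\<tau> + 2 * v + (p - z2)))" for v
  have holG: "G a b holomorphic_on UNIV" for a b unfolding G_def by (intro holomorphic_intros)
  have holW: "W holomorphic_on UNIV" unfolding W_def using holG by (intro holomorphic_intros)
  have G1: "G a b (v + 1) = 1 * G a b v" for a b v unfolding G_def using pair_shift(1)[of v a b] by simp
  have Gt: "G a b (v + \<tau>) = M v * G a b v" if "a + b = p - z2" for a b v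
    unfolding G_def M_def using pair_shift(2)[of v a b] that by simp
  have W1: "W (v + 1) = 1 * W v" for v unfolding W_def G1 by simp
  have Wt: "W (v + \<tau>) = M v * W v" for v
    unfolding W_def using Gt[of p "- z2" v] Gt[of "p + r" "- z2 - r" v] Gt[of 0 "p - z2" v]
    by (simp add: algebra_simps)
  have M0: "M v \<noteq> 0" for v by (simp add: M_def)
  have odd': "\<theta> (a - b) = - \<theta> (b - a)" for a b using odd[of "b - a"] by simp
  have W_0: "W 0 = 0"
    using odd[of z2] odd'[of "- z2" r] odd[of "z2 + r"]
    by (simp add: W_def G_def c1_def c2_def add.commute)
  have W_p: "W (z2 - p) = 0"
    using odd[of p] odd[of "p + r"] odd'[of "- p" r] by (simp add: W_def G_def c1_def c2_def add.commute)
  have W_z2: "W z2 = 0"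
    using odd[of r] by (simp add: W_def G_def c2_def c3_def add_ac)
  have "W v = 0" if "v - 0 \<in> lattice \<tau>" for v
    by (rule quasi_zero[of W 0 "\<lambda>_. 1" M, OF W_0 W1 Wt _ M0 that]) simp
  then obtain f1 where f1: "f1 holomorphic_on UNIV" "\<And>v. W v = f1 v * \<theta> (v - 0)"
    using theta_divides[OF holW, of 0] by blast
  have "f1 v = 0" if v: "v - (z2 - p) \<in> lattice \<tau>" for v
  proof -
    have "W v = 0" by (rule quasi_zero[of W "z2 - p" "\<lambda>_. 1" M, OF W_p W1 Wt _ M0 v]) simp
    moreover have "\<theta> v \<noteq> 0"
    proof
      assume "\<theta> v = 0"
      then have "v - (v - (z2 - p)) \<in> lattice \<tau>" using lattice_diff[OF _ v] zeros[of v] by blast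
      then show False using zp by simp
    qed
    ultimately show ?thesis using f1(2)[of v] by simp
  qed
  then obtain f2 where f2: "f2 holomorphic_on UNIV" "\<And>v. f1 v = f2 v * \<theta> (v - (z2 - p))"
    using theta_divides[OF f1(1), of "z2 - p"] by blast
  have Wf: "W v = f2 v * G 0 (p - z2) v" for v
    using f1(2)[of v] f2(2)[of v] by (simp add: G_def algebra_simps)
  have g0: "G 0 (p - z2) z2 \<noteq> 0" using z2 p zeros by (simp add: G_def)
  have p1: "f2 (v + 1) = f2 v" for v
  proof (rule entire_cancel[OF holomorphic_shift[OF f2(1)] f2(1) holG _ g0])
    show "f2 (v + 1) * G 0 (p - z2) v = f2 v * G 0 (p - z2) v" for v
      using W1[of v] G1[of 0 "p - z2" v] unfolding Wf by simp
  qed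
  have p2: "f2 (v + \<tau>) = f2 v" for v
  proof (rule entire_cancel[OF holomorphic_shift[OF f2(1)] f2(1) holG _ g0])
    show "f2 (v + \<tau>) * G 0 (p - z2) v = f2 v * G 0 (p - z2) v" for v
      using Wt[of v] Gt[of 0 "p - z2" v] M0[of v] unfolding Wf by simp
  qed
  have "f2 z2 = 0" using Wf[of z2] W_z2 g0 by simp
  then have "W z1 = 0"
    using doubly_periodic_entire_constant[OF tau f2(1) p1 p2, of z1 z2] Wf[of z1] by simp
  then show ?thesis
    using odd'[of z1 z2] odd'[of z1 "z2 + r"] odd'[of "z1 - r" z2]
    by (simp add: W_def G_def c1_def c2_def c3_def algebra_simps)
qed

definition D :: "nat \<Rightarrow> complex \<Rightarrow> complex" where "D j = (deriv ^^ j) \<theta>"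

lemma D_0: "D 0 = \<theta>" by (simp add: D_def)

lemma D_deriv: "(D j has_field_derivative D (Suc j) v) (at v)"
  using has_field_derivative_higher_deriv[OF hol, of v j] by (simp add: D_def)

lemma D_parity: "D j (- v) = (-1) ^ Suc j * D j v"
proof (induction j arbitrary: v)
  case 0 then show ?case by (simp add: D_0 odd)
next
  case (Suc j)
  have "((\<lambda>v. D j (- v)) has_field_derivative D (Suc j) (- v) * (- 1)) (at v)"
    by (rule DERIV_chain2[OF D_deriv]) (auto intro!: derivative_eq_intros)
  moreover have "((\<lambda>v. (-1) ^ Suc j * D j v) has_field_derivative (-1) ^ Suc j * D (Suc j) v) (at v)"
    by (rule DERIV_cmult[OF D_deriv])
  ultimately show ?case unfolding Suc by (auto dest: DERIV_unique)
qed

lemma D_at_0: "D 0 0 = 0" "D (Suc 0) 0 = 1" "D 2 0 = 0"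
proof -
  show "D 0 0 = 0" "D (Suc 0) 0 = 1" using norm by (simp_all add: D_def)
  have "D 2 0 = - D 2 0" using D_parity[of 2 0] by simp
  then have "D 2 0 + D 2 0 = 0" by (metis add.right_inverse)
  then have "2 * D 2 0 = 0" by (simp only: mult_2)
  then show "D 2 0 = 0" by simp
qed

lemma D_deriv_chain [derivative_intros]:
  "(g has_field_derivative g') (at x within B) \<Longrightarrow>
    ((\<lambda>x. D j (g x)) has_field_derivative D (Suc j) (g x) * g') (at x within B)"
  by (rule DERIV_chain2[OF D_deriv])

text \<open>The derivative of \<open>fay_theta\<close> along \<open>z1\<close> at \<open>z1 = z2 = z\<close>.\<close>
lemma fay_theta_diagonal:
  assumes "z \<notin> lattice \<tau>" "p \<notin> lattice \<tau>" "z - p \<notin> lattice \<tau>"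
  shows "D 0 (z + p) * D 0 (z + r) * D 0 (p + r) =
    D 0 (z + p + r) * (D 1 r * D 0 z * D 0 p + D 0 r * D 1 p * D 0 z + D 0 r * D 0 p * D 1 z)
    - D 1 (z + p + r) * D 0 r * D 0 z * D 0 p"
proof -
  have eq: "(\<lambda>v. D 0 (v + p) * D 0 (z + r) * D 0 (p + r) * D 0 (z - v)) =
    (\<lambda>v. D 0 (v + p + r) * D 0 (z - v + r) * D 0 z * D 0 p - D 0 (z + p + r) * D 0 (v - z + p) * D 0 v * D 0 r)"
    unfolding D_0 by (rule ext, rule fay_theta[OF assms])
  have "((\<lambda>v. D 0 (v + p) * D 0 (z + r) * D 0 (p + r) * D 0 (z - v)) has_field_derivative
     - (D 0 (z + p) * D 0 (z + r) * D 0 (p + r))) (at z)"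
    by (auto intro!: derivative_eq_intros simp: D_at_0)
  moreover have "((\<lambda>v. D 0 (v + p + r) * D 0 (z - v + r) * D 0 z * D 0 p - D 0 (z + p + r) * D 0 (v - z + p) * D 0 v * D 0 r)
     has_field_derivative (D 1 (z + p + r) * D 0 r - D 0 (z + p + r) * D 1 r) * D 0 z * D 0 p
       - D 0 (z + p + r) * (D 1 p * D 0 z + D 0 p * D 1 z) * D 0 r) (at z)"
    by (auto intro!: derivative_eq_intros simp: D_at_0 algebra_simps)
  ultimately have "- (D 0 (z + p) * D 0 (z + r) * D 0 (p + r)) =
     (D 1 (z + p + r) * D 0 r - D 0 (z + p + r) * D 1 r) * D 0 z * D 0 p
       - D 0 (z + p + r) * (D 1 p * D 0 z + D 0 p * D 1 z) * D 0 r"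
    unfolding eq by (rule DERIV_unique)
  then show ?thesis by algebra
qed

text \<open>Two more derivatives, now in \<open>w\<close> at \<open>r = w - z - p\<close>, \<open>w = 0\<close>.\<close>
lemma theta_addition:
  assumes "z \<notin> lattice \<tau>" "p \<notin> lattice \<tau>" "z - p \<notin> lattice \<tau>"
  shows "D 0 (z + p) * (D 2 p * D 0 z + 2 * D 1 p * D 1 z + D 0 p * D 2 z)
     + D 2 (z + p) * D 0 z * D 0 p - 2 * D 1 (z + p) * (D 1 z * D 0 p + D 0 z * D 1 p)
     = D 3 0 * D 0 p * D 0 z * D 0 (z + p)"
proof -
  define s where "s = z + p"
  define L where "L w = D 0 s * D 0 (w - p) * D 0 (w - z)" for w
  define L1 where "L1 w = D 0 s * (D 1 (w - p) * D 0 (w - z) + D 0 (w - p) * D 1 (w - z))" for w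
  define a where "a = D 0 z * D 0 p"
  define b where "b = D 1 p * D 0 z + D 0 p * D 1 z"
  define R where "R w = D 0 w * (D 1 (w - s) * a + D 0 (w - s) * b) - D 1 w * D 0 (w - s) * a" for w
  define R1 where "R1 w = D 0 w * (D 2 (w - s) * a + D 1 (w - s) * b) + D 1 w * (D 1 (w - s) * a + D 0 (w - s) * b)
     - D 2 w * D 0 (w - s) * a - D 1 w * D 1 (w - s) * a" for w
  have LR: "L = R"
  proof
    fix w
    have e: "z + (w - s) = w - p" "p + (w - s) = w - z" "s + (w - s) = w" by (simp_all add: s_def)
    show "L w = R w"
      using fay_theta_diagonal[OF assms, of "w - s"]
      unfolding e s_def[symmetric] L_def R_def a_def b_def by algebra
  qed
  have "(L has_field_derivative L1 w) (at w)" for w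
    unfolding L_def L1_def by (auto intro!: derivative_eq_intros simp: algebra_simps numeral_2_eq_2)
  moreover have "(R has_field_derivative R1 w) (at w)" for w
    unfolding R_def R1_def by (auto intro!: derivative_eq_intros simp: algebra_simps numeral_2_eq_2)
  ultimately have LR1: "L1 = R1" unfolding LR by (auto intro: DERIV_unique)
  have "(L1 has_field_derivative D 0 s * (D 2 (0 - p) * D 0 (0 - z) + 2 * D 1 (0 - p) * D 1 (0 - z) + D 0 (0 - p) * D 2 (0 - z))) (at 0)"
    unfolding L1_def by (auto intro!: derivative_eq_intros simp: algebra_simps numeral_2_eq_2)
  \<comment> \<open>The factor \<open>D 2 w\<close> in \<open>R1\<close> is the source of the
    constant \<open>D 3 0\<close>, which later cancels the same constant in the heat
    equation.\<close>
  moreover have "(R1 has_field_derivative 2 * (D 2 (0 - s) * a + D 1 (0 - s) * b) - D 3 0 * D 0 (0 - s) * a - D 2 (0 - s) * a) (at 0)"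
    unfolding R1_def using D_at_0 by (auto intro!: derivative_eq_intros simp: algebra_simps numeral_2_eq_2 numeral_3_eq_3)
  ultimately have "D 0 s * (D 2 (0 - p) * D 0 (0 - z) + 2 * D 1 (0 - p) * D 1 (0 - z) + D 0 (0 - p) * D 2 (0 - z))
     = 2 * (D 2 (0 - s) * a + D 1 (0 - s) * b) - D 3 0 * D 0 (0 - s) * a - D 2 (0 - s) * a"
    unfolding LR1 by (rule DERIV_unique)
  then have "D 0 s * (D 2 p * D 0 z + 2 * D 1 p * D 1 z + D 0 p * D 2 z)
     = 2 * (- D 2 s * a + D 1 s * b) + D 3 0 * D 0 s * a + D 2 s * a"
    using D_parity[of 0] D_parity[of 1] D_parity[of 2] by simp
  then show ?thesis unfolding s_def a_def b_def by algebra
qed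

end

section \<open>The Fay identities as identities of power series\<close>

lemma fps_eqI_punctured:
  fixes f g :: "complex \<Rightarrow> complex"
  assumes f: "f has_fps_expansion F" and g: "g has_fps_expansion G"
    and eq: "eventually (\<lambda>x. f x = g x) (at 0)"
  shows "F = G"
proof -
  have "(f \<longlongrightarrow> f 0) (at 0)" "(g \<longlongrightarrow> g 0) (at 0)"
    using has_fps_expansion_imp_continuous[OF f, of UNIV] has_fps_expansion_imp_continuous[OF g, of UNIV]
    by (simp_all add: continuous_within)
  moreover have "(f \<longlongrightarrow> g 0) (at 0)"
    using calculation(2) tendsto_cong[OF eq] by simp
  \<comment> \<open>Identities with \<open>\<theta>\<close> in a denominator hold only off 0;
    continuity of both sides adds the missing point.\<close>
  ultimately have "f 0 = g 0" by (auto intro: tendsto_unique[OF trivial_limit_at])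
  with eq have "eventually (\<lambda>x. f x = g x) (nhds 0)"
    unfolding eventually_at_filter by (auto elim: eventually_mono)
  then have "f has_fps_expansion G" using has_fps_expansion_cong[of f g G G] g by simp
  with f show ?thesis by (rule fps_expansion_unique_complex)
qed

text \<open>\<open>taylor0\<close> fills a removable singularity with the limit; \<open>h\<close> is
  the function already extended over 0.\<close>

lemma taylor0_eqI:
  assumes h: "h has_fps_expansion H" and eq: "eventually (\<lambda>x. f x = h x) (at 0)"
  shows "taylor0 f m = fps_nth H m"
proof -
  have "(h \<longlongrightarrow> h 0) (at 0)"
    using has_fps_expansion_imp_continuous[OF h, of UNIV] by (simp add: continuous_within)
  then have "(f \<longlongrightarrow> h 0) (at 0)" using tendsto_cong[OF eq] by simp
  then have L: "Lim (at 0) f = h 0" by (intro tendsto_Lim) auto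
  have "eventually (\<lambda>x. (if x = 0 then Lim (at 0) f else f x) = h x) (nhds 0)"
    using eq unfolding eventually_at_filter by eventually_elim (auto simp: L)
  then have "(\<lambda>x. if x = 0 then Lim (at 0) f else f x) has_fps_expansion H"
    using has_fps_expansion_cong[of "\<lambda>x. if x = 0 then Lim (at 0) f else f x" h H H] h by simp
  then show ?thesis unfolding taylor0_def by (rule fps_nth_fps_expansion[symmetric])
qed

text \<open>The substitution of \<open>c X\<close> for \<open>X\<close>. With scalings
  \<open>c\<close> and \<open>c + 1\<close> it restricts an identity in two arguments to the line
  \<open>(c t, t)\<close>.\<close>

definition sc :: "complex \<Rightarrow> complex fps \<Rightarrow> complex fps" where
  "sc c A = Abs_fps (\<lambda>n. c ^ n * fps_nth A n)"

lemma sc_nth [simp]: "fps_nth (sc c A) n = c ^ n * fps_nth A n"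
  by (simp add: sc_def)

lemma sc_expansion:
  assumes "f has_fps_expansion A"
  shows "(\<lambda>x. f (c * x)) has_fps_expansion sc c A"
proof -
  have "(\<lambda>x. c * x) has_fps_expansion fps_const c * fps_X"
    by (intro fps_expansion_intros)
  then have "(f \<circ> (\<lambda>x. c * x)) has_fps_expansion fps_compose A (fps_const c * fps_X)"
    using assms by (intro has_fps_expansion_compose) auto
  then show ?thesis unfolding fps_compose_linear sc_def by (simp add: o_def)
qed

lemma sc_one_plus: "sc c (1 + fps_X * A) = 1 + fps_const c * (fps_X * sc c A)"
proof (rule fps_ext)
  show "fps_nth (sc c (1 + fps_X * A)) n = fps_nth (1 + fps_const c * (fps_X * sc c A)) n" for n
    by (cases n) auto
qed

lemma sc_add: "sc c (A + B) = sc c A + sc c B"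
  by (rule fps_ext) (simp add: distrib_left)

lemma sc_X: "sc c (fps_X * A) = fps_const c * (fps_X * sc c A)"
proof (rule fps_ext)
  show "fps_nth (sc c (fps_X * A)) n = fps_nth (fps_const c * (fps_X * sc c A)) n" for n
    by (cases n) auto
qed

lemma X_mult_nth:
  fixes A B :: "complex fps"
  shows "fps_nth (fps_X * (A * B)) d = (\<Sum>p<d. fps_nth A p * fps_nth B (d - 1 - p))"
proof (cases d)
  case (Suc e)
  show ?thesis
    by (subst fps_X_mult_nth) (simp add: Suc fps_mult_nth lessThan_Suc_atMost atMost_atLeast0)
qed simp

lemma X_mult_nth_Suc: "fps_nth (fps_X * A) (Suc d) = fps_nth (A :: complex fps) d"
  by simp

text \<open>\<open>C\<close> stands for \<open>c\<close> and \<open>x\<close> for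
  \<open>fps_X\<close>; the suffixes \<open>u\<close> and \<open>s\<close> mark the arguments
  \<open>c x\<close> and \<open>(c + 1) x\<close>, while \<open>kh\<close> and \<open>kmu\<close>
  belong to \<open>z2 - z1\<close> and \<open>z1 - z2\<close>. The multipliers \<open>C\<close> and
  \<open>1 - C\<close> in the proof are chosen so that the undifferentiated \<open>kh\<close> and
  \<open>kmu\<close> cancel.\<close>

lemma fay_ring_identity:
  fixes x C k1u k1s k2 k2s kh kmu g1u g2 gh gmu :: "'a::idom"
  assumes 1: "(C + 1) * ((1 + C * (x * k1u)) * (1 + x * k2)) =
    C * ((1 + (C + 1) * (x * k1s)) * (1 + x * kh)) + (1 + (C + 1) * (x * k2s)) * (1 + C * (x * kmu))"
    (is "?L1 = ?R1")
    and 2: "(C + 1) * (x * ((1 + C * (x * k1u)) * (k2 + x * g2) - (k1u + C * (x * g1u)) * (1 + x * k2))) =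
    (1 + (C + 1) * (x * k1s)) * (C * (x * (kh + x * gh)) - (1 + x * kh))
    + (1 + (C + 1) * (x * k2s)) * (1 + C * (x * kmu) - x * (kmu + C * (x * gmu)))"
    (is "?L2 = ?R2")
  shows "x * ((C + 1) * (k2 - C * C * k1u + C * C * k1s - k2s)
   + (C + 1) * (x * (C * g2 - C * C * g1u)) - C * C * (x * (gh - gmu))
   + C * C * (C + 1) * (x * (x * (k1u * g2) - x * (g1u * k2) - x * (k1s * gh) + x * (k2s * gmu)))) = 0"
    (is "?Z = 0")
proof -
  have "?Z = C * (?L2 - ?R2) + (1 - C) * (?L1 - ?R1)" by algebra
  then show ?thesis unfolding 1 2 by simp
qed

context theta_fun
begin

definition T :: "complex \<Rightarrow> complex fps" where
  "T z = Abs_fps (\<lambda>j. D j z / fact j)"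

lemma T_nth: "fps_nth (T z) j = D j z / fact j"
  by (simp add: T_def)

lemma T_expansion: "(\<lambda>x. \<theta> (z + x)) has_fps_expansion T z"
proof -
  have h: "(deriv ^^ j) (\<lambda>x. \<theta> (z + x)) = (\<lambda>x. D j (z + x))" for j
  proof (induction j)
    case (Suc j)
    have "((\<lambda>x. D j (z + x)) has_field_derivative D (Suc j) (z + x)) (at x)" for x
      by (auto intro!: derivative_eq_intros)
    then have "deriv (\<lambda>x. D j (z + x)) = (\<lambda>x. D (Suc j) (z + x))"
      by (intro ext DERIV_imp_deriv)
    then show ?case by (simp add: Suc)
  qed (simp add: D_0)
  have "(\<lambda>x. \<theta> (z + x)) has_fps_expansion fps_expansion (\<lambda>x. \<theta> (z + x)) 0"
    by (rule has_fps_expansion_fps_expansion[of UNIV]) (auto intro!: holomorphic_intros)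
  also have "fps_expansion (\<lambda>x. \<theta> (z + x)) 0 = T z"
    unfolding fps_expansion_def h T_def by simp
  finally show ?thesis .
qed

definition Uf :: "complex fps" where "Uf = fps_shift 1 (T 0)"
definition u :: "complex \<Rightarrow> complex" where "u x = (if x = 0 then 1 else \<theta> x / x)"

lemma T_0: "T 0 = fps_X * Uf"
  by (rule fps_ext) (auto simp: Uf_def T_nth D_at_0)

lemma Uf_0: "fps_nth Uf 0 = 1"
  using D_at_0 by (simp add: Uf_def T_nth)

lemma u_expansion: "u has_fps_expansion Uf"
proof -
  have "T 0 \<noteq> 0" using Uf_0 T_0 by auto
  then have "1 \<le> subdegree (T 0)"
    by (intro subdegree_geI) (auto simp: T_nth D_at_0)
  then have "(\<lambda>x. if x = 0 then 1 else \<theta> (0 + x) / x ^ 1) has_fps_expansion fps_shift 1 (T 0)"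
    using D_at_0 by (intro has_fps_expansion_shift T_expansion) (auto simp: T_nth)
  also have "(\<lambda>x. if x = 0 then 1 else \<theta> (0 + x) / x ^ 1) = u"
    by (auto simp: u_def fun_eq_iff)
  finally show ?thesis by (simp add: Uf_def)
qed

lemma theta_u: "\<theta> x = x * u x"
  by (simp add: u_def)

text \<open>\<open>m z x = x \<theta>(z + x) / (\<theta>(z) \<theta>(x))\<close> without the removable singularity at 0, so \<open>K z\<close> is the
  expansion of \<open>k(z, x)\<close> in \<open>x\<close>.\<close>
definition m :: "complex \<Rightarrow> complex \<Rightarrow> complex" where
  "m z x = \<theta> (z + x) / (\<theta> z * u x)"

definition M :: "complex \<Rightarrow> complex fps" where
  "M z = T z / (fps_const (\<theta> z) * Uf)"

definition K :: "complex \<Rightarrow> complex fps" where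
  "K z = fps_shift 1 (M z)"

lemma M_expansion: "\<theta> z \<noteq> 0 \<Longrightarrow> m z has_fps_expansion M z"
  unfolding m_def[abs_def] M_def
  by (intro has_fps_expansion_divide' T_expansion fps_expansion_intros u_expansion) (simp add: Uf_0)

lemma M_0: "\<theta> z \<noteq> 0 \<Longrightarrow> fps_nth (M z) 0 = 1"
  using has_fps_expansion_imp_0_eq_fps_nth_0[OF M_expansion, of z] by (simp add: m_def u_def)

lemma M_K: "\<theta> z \<noteq> 0 \<Longrightarrow> M z = 1 + fps_X * K z"
  by (rule fps_ext) (auto simp: K_def M_0)

lemma M_mult: "\<theta> z \<noteq> 0 \<Longrightarrow> M z * (fps_const (\<theta> z) * Uf) = T z"
  by (simp add: M_def fps_divide_unit Uf_0 mult.assoc inverse_mult_eq_1)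

lemma m_eq: "x \<noteq> 0 \<Longrightarrow> m z x = x * \<theta> (z + x) / (\<theta> z * \<theta> x)"
  by (simp add: m_def u_def)

lemma m_parity: "m (- z) (- x) = m z x"
proof -
  have "- z + - x = - (z + x)" "u (- x) = u x" by (simp_all add: u_def odd)
  then show ?thesis unfolding m_def by (simp only: odd) simp
qed

lemma M_parity: "\<theta> z \<noteq> 0 \<Longrightarrow> M (- z) = sc (-1) (M z)"
proof -
  assume z: "\<theta> z \<noteq> 0"
  have "m (- z) has_fps_expansion M (- z)" using z by (intro M_expansion) (simp add: odd)
  moreover have "(\<lambda>x. m z ((-1) * x)) has_fps_expansion sc (-1) (M z)"
    by (intro sc_expansion M_expansion z)
  moreover have "(\<lambda>x. m z ((-1) * x)) = m (- z)"     by (intro ext) (metis m_parity minus_minus mult_minus1)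
  ultimately show ?thesis using fps_expansion_unique_complex by metis
qed

lemma K_parity: "\<theta> z \<noteq> 0 \<Longrightarrow> fps_nth (K (- z)) n = - ((-1) ^ n) * fps_nth (K z) n"
  by (simp add: K_def M_parity)

lemma theta_small_nonzero:
  assumes "c \<noteq> 0"
  shows "eventually (\<lambda>t. \<theta> (c * t) \<noteq> 0) (at 0)"
proof -
  have "(\<lambda>t. u (c * t)) has_fps_expansion sc c Uf" by (intro sc_expansion u_expansion)
  then have "((\<lambda>t. u (c * t)) \<longlongrightarrow> 1) (nhds 0)"
    using has_fps_expansion_imp_tendsto_0 Uf_0 by fastforce
  then have "eventually (\<lambda>t. u (c * t) \<noteq> 0) (nhds 0)"
    by (rule tendsto_imp_eventually_ne) simp
  then show ?thesis
    unfolding eventually_at_filter by eventually_elim (use assms in \<open>auto simp: theta_u[of "c * _"]\<close>)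
qed

lemma theta_near_nonzero:
  assumes "\<theta> z \<noteq> 0"
  shows "eventually (\<lambda>t. \<theta> (z + c * t) \<noteq> 0) (at 0)"
proof -
  have "isCont \<theta> z" using theta_deriv DERIV_isCont by blast
  then have "((\<lambda>t. \<theta> (z + c * t)) \<longlongrightarrow> \<theta> (z + c * 0)) (at 0)"
    by (intro isCont_tendsto_compose[of _ \<theta>] tendsto_intros) simp
  then show ?thesis using assms by (intro tendsto_imp_eventually_ne[of _ "\<theta> z"]) auto
qed

lemma m_deriv:
  assumes "\<theta> x \<noteq> 0"
  shows "(m z has_field_derivative deriv (m z) x) (at x)"
proof -
  have o: "open {x. \<theta> x \<noteq> 0}"
  proof -
    have "continuous_on UNIV \<theta>" using hol by (rule holomorphic_on_imp_continuous_on)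
    then have "open (\<theta> -` (- {0}))" by (intro open_vimage) auto
    then show ?thesis by (simp add: vimage_def)
  qed
  have "(\<lambda>x. \<theta> (z + x) / (\<theta> z) * (x / \<theta> x)) holomorphic_on {x. \<theta> x \<noteq> 0}"
  proof (cases "\<theta> z = 0")
    case False
    then show ?thesis by (intro holomorphic_intros) auto
  qed simp
  then have "m z holomorphic_on {x. \<theta> x \<noteq> 0}"
    by (rule holomorphic_transform) (auto simp: m_def u_def)
  with o assms show ?thesis by (intro holomorphic_derivI) auto
qed

lemma m_deriv_chain:
  "(g has_field_derivative g') (at x) \<Longrightarrow> \<theta> (g x) \<noteq> 0 \<Longrightarrow>
    ((\<lambda>x. m z (g x)) has_field_derivative deriv (m z) (g x) * g') (at x)"
  by (rule DERIV_chain2[OF m_deriv])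

text \<open>\<open>m z x / x\<close> is the Kronecker function
  \<open>\<theta>(z + x)/(\<theta>(z)\<theta>(x))\<close>. Clearing the poles \<open>p\<close>,
  \<open>r\<close> and \<open>p + r\<close> from its Fay identity gives this form, which can be
  expanded at 0.\<close>

lemma fay_m:
  assumes "\<theta> z1 \<noteq> 0" "\<theta> z2 \<noteq> 0" "\<theta> (z2 - z1) \<noteq> 0"
    and "\<theta> p \<noteq> 0" "\<theta> r \<noteq> 0" "\<theta> (p + r) \<noteq> 0" "\<theta> (z2 - p) \<noteq> 0"
  shows "(p + r) * (m z1 p * m z2 r) = p * (m z1 (p + r) * m (z2 - z1) r) + r * (m z2 (p + r) * m (z1 - z2) p)"
proof -
  have nz: "p \<noteq> 0" "r \<noteq> 0" "p + r \<noteq> 0" using assms(4-6) theta_0 by (metis, metis, metis)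
  have o: "\<theta> (z1 - z2) = - \<theta> (z2 - z1)" using odd[of "z2 - z1"] by simp
  have "\<theta> (z1 + p) * \<theta> (z2 + r) * \<theta> (p + r) * \<theta> (z2 - z1) =
    \<theta> (z1 + p + r) * \<theta> (z2 - z1 + r) * \<theta> z2 * \<theta> p - \<theta> (z2 + p + r) * \<theta> (z1 - z2 + p) * \<theta> z1 * \<theta> r"
    using assms zeros by (intro fay_theta) auto
  then show ?thesis
    using assms unfolding m_eq[OF nz(1)] m_eq[OF nz(2)] m_eq[OF nz(3)] o add.assoc[symmetric]
    by (simp add: divide_simps) algebra
qed

text \<open>The derivative of \<open>fay_m\<close> at \<open>e = 0\<close> along
  \<open>(p - e, r + e)\<close>, a direction in which \<open>p + r\<close> does not move.
  \<open>B\<close> is an open set of \<open>e\<close> on which \<open>fay_m\<close> applies.\<close>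

lemma fay_m_deriv:
  assumes "\<theta> z1 \<noteq> 0" "\<theta> z2 \<noteq> 0" "\<theta> (z2 - z1) \<noteq> 0"
    and "\<theta> p \<noteq> 0" "\<theta> r \<noteq> 0" "\<theta> (p + r) \<noteq> 0" "\<theta> (z2 - p) \<noteq> 0"
  shows "(p + r) * (m z1 p * deriv (m z2) r - deriv (m z1) p * m z2 r)
    = m z1 (p + r) * (p * deriv (m (z2 - z1)) r - m (z2 - z1) r)
    + m z2 (p + r) * (m (z1 - z2) p - r * deriv (m (z1 - z2)) p)"
proof -
  define B where "B = {e. \<theta> (p - e) \<noteq> 0} \<inter> {e. \<theta> (r + e) \<noteq> 0} \<inter> {e. \<theta> (z2 - (p - e)) \<noteq> 0}"
  have c: "open {e. \<theta> (a + b * e) \<noteq> 0}" for a b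
  proof -
    have "(\<lambda>e. \<theta> (a + b * e)) holomorphic_on UNIV" by (intro holomorphic_intros)
    then have "continuous_on UNIV (\<lambda>e. \<theta> (a + b * e))" by (rule holomorphic_on_imp_continuous_on)
    then have "open ((\<lambda>e. \<theta> (a + b * e)) -` (- {0}))" by (intro open_vimage) auto
    then show ?thesis by (simp add: vimage_def)
  qed
  have oB: "open B" unfolding B_def using c[of p "-1"] c[of r 1] c[of "z2 - p" 1]
    by (intro open_Int) (simp_all add: algebra_simps)
  have B0: "0 \<in> B" using assms by (simp add: B_def)
  define L where "L e = (p + r) * (m z1 (p - e) * m z2 (r + e))" for e
  define R where "R e = (p - e) * (m z1 (p + r) * m (z2 - z1) (r + e)) + (r + e) * (m z2 (p + r) * m (z1 - z2) (p - e))" for e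
  have LR: "L e = R e" if "e \<in> B" for e
    using fay_m[of z1 z2 "p - e" "r + e"] that assms by (simp add: L_def R_def B_def)
  have "(L has_field_derivative (p + r) * (m z1 p * deriv (m z2) r - deriv (m z1) p * m z2 r)) (at 0)"
    unfolding L_def using assms
    by (auto intro!: derivative_eq_intros m_deriv_chain simp: algebra_simps)
  then have "(R has_field_derivative (p + r) * (m z1 p * deriv (m z2) r - deriv (m z1) p * m z2 r)) (at 0)"
    by (rule has_field_derivative_transform_within_open[OF _ oB B0 LR])
  moreover have "(R has_field_derivative m z1 (p + r) * (p * deriv (m (z2 - z1)) r - m (z2 - z1) r)
    + m z2 (p + r) * (m (z1 - z2) p - r * deriv (m (z1 - z2)) p)) (at 0)"
    unfolding R_def using assms
    by (auto intro!: derivative_eq_intros m_deriv_chain simp: algebra_simps)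
  ultimately show ?thesis by (rule DERIV_unique)
qed

context
  fixes z1 z2 c :: complex
  assumes nz: "\<theta> z1 \<noteq> 0" "\<theta> z2 \<noteq> 0" "\<theta> (z2 - z1) \<noteq> 0" and c: "c \<noteq> 0" "c + 1 \<noteq> 0"
begin

lemma small_args: "eventually (\<lambda>t. t \<noteq> 0 \<and> \<theta> (c * t) \<noteq> 0 \<and> \<theta> t \<noteq> 0 \<and> \<theta> (c * t + t) \<noteq> 0 \<and> \<theta> (z2 - c * t) \<noteq> 0) (at 0)"
proof -
  have "eventually (\<lambda>t. \<theta> (1 * t) \<noteq> 0) (at 0)" "eventually (\<lambda>t. \<theta> ((c + 1) * t) \<noteq> 0) (at 0)"
    "eventually (\<lambda>t. \<theta> (z2 + (- c) * t) \<noteq> 0) (at 0)" "eventually (\<lambda>t. \<theta> (c * t) \<noteq> 0) (at 0)"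
    using c nz by (intro theta_small_nonzero theta_near_nonzero; simp)+
  moreover have "eventually (\<lambda>t::complex. t \<noteq> 0) (at 0)" by (simp add: eventually_at_filter)
  ultimately show ?thesis by eventually_elim (simp add: distrib_right)
qed

lemma nz': "\<theta> (z1 - z2) \<noteq> 0"
  using nz(3) odd[of "z2 - z1"] by simp

text \<open>\<open>fay_m\<close> on the line \<open>p = c t\<close>, \<open>r = t\<close>, with the
  common factor \<open>t\<close> cancelled.\<close>

lemma fay_fps: "fps_const (c + 1) * (sc c (M z1) * M z2) =
  fps_const c * (sc (c + 1) (M z1) * M (z2 - z1)) + sc (c + 1) (M z2) * sc c (M (z1 - z2))"
proof (rule fps_eqI_punctured)
  show "(\<lambda>t. (c + 1) * (m z1 (c * t) * m z2 t)) has_fps_expansion fps_const (c + 1) * (sc c (M z1) * M z2)"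
    using nz by (intro fps_expansion_intros sc_expansion M_expansion)
  show "(\<lambda>t. c * (m z1 ((c + 1) * t) * m (z2 - z1) t) + m z2 ((c + 1) * t) * m (z1 - z2) (c * t)) has_fps_expansion
    fps_const c * (sc (c + 1) (M z1) * M (z2 - z1)) + sc (c + 1) (M z2) * sc c (M (z1 - z2))"
    using nz nz' by (intro fps_expansion_intros sc_expansion M_expansion)
  show "eventually (\<lambda>t. (c + 1) * (m z1 (c * t) * m z2 t) =
     c * (m z1 ((c + 1) * t) * m (z2 - z1) t) + m z2 ((c + 1) * t) * m (z1 - z2) (c * t)) (at 0)"
    using small_args
  proof eventually_elim
    case (elim t)
    have e: "c * t + t = (c + 1) * t" by (simp add: distrib_right)
    have "t * ((c + 1) * (m z1 (c * t) * m z2 t)) =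
      t * (c * (m z1 ((c + 1) * t) * m (z2 - z1) t) + m z2 ((c + 1) * t) * m (z1 - z2) (c * t))"
      using fay_m[of z1 z2 "c * t" t] nz elim unfolding e by (simp add: algebra_simps)
    then show ?case using elim by simp
  qed
qed

lemma fay_fps_deriv: "fps_const (c + 1) * (fps_X * (sc c (M z1) * fps_deriv (M z2) - sc c (fps_deriv (M z1)) * M z2)) =
  sc (c + 1) (M z1) * (fps_const c * (fps_X * fps_deriv (M (z2 - z1))) - M (z2 - z1))
  + sc (c + 1) (M z2) * (sc c (M (z1 - z2)) - fps_X * sc c (fps_deriv (M (z1 - z2))))"
proof (rule fps_eqI_punctured)
  show "(\<lambda>t. (c + 1) * (t * (m z1 (c * t) * deriv (m z2) t - deriv (m z1) (c * t) * m z2 t))) has_fps_expansion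
    fps_const (c + 1) * (fps_X * (sc c (M z1) * fps_deriv (M z2) - sc c (fps_deriv (M z1)) * M z2))"
    using nz by (intro fps_expansion_intros sc_expansion M_expansion)
  show "(\<lambda>t. m z1 ((c + 1) * t) * (c * (t * deriv (m (z2 - z1)) t) - m (z2 - z1) t)
      + m z2 ((c + 1) * t) * (m (z1 - z2) (c * t) - t * deriv (m (z1 - z2)) (c * t))) has_fps_expansion
    sc (c + 1) (M z1) * (fps_const c * (fps_X * fps_deriv (M (z2 - z1))) - M (z2 - z1))
  + sc (c + 1) (M z2) * (sc c (M (z1 - z2)) - fps_X * sc c (fps_deriv (M (z1 - z2))))"
    using nz nz' by (intro fps_expansion_intros sc_expansion M_expansion)
  show "eventually (\<lambda>t. (c + 1) * (t * (m z1 (c * t) * deriv (m z2) t - deriv (m z1) (c * t) * m z2 t)) =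
    m z1 ((c + 1) * t) * (c * (t * deriv (m (z2 - z1)) t) - m (z2 - z1) t)
      + m z2 ((c + 1) * t) * (m (z1 - z2) (c * t) - t * deriv (m (z1 - z2)) (c * t))) (at 0)"
    using small_args
  proof eventually_elim
    case (elim t)
    have e: "c * t + t = (c + 1) * t" by (simp add: distrib_right)
    show ?case using fay_m_deriv[of z1 z2 "c * t" t] nz elim unfolding e by (simp add: mult.assoc)
  qed
qed

text \<open>After the substitution \<open>M = 1 + X K\<close> the constants cancel, because both
  sides begin with \<open>c + 1\<close>, and one factor \<open>X\<close> divides out.\<close>

lemma K_fay_aux:
  "fps_const (c + 1) * (fps_const c * sc c (K z1) + K z2)
   - fps_const (c * (c + 1)) * sc (c + 1) (K z1) - fps_const c * K (z2 - z1)
   - fps_const (c + 1) * sc (c + 1) (K z2) - fps_const c * sc c (K (z1 - z2))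
   + fps_const (c * (c + 1)) * (fps_X * (sc c (K z1) * K z2) - fps_X * (sc (c + 1) (K z1) * K (z2 - z1))
       - fps_X * (sc (c + 1) (K z2) * sc c (K (z1 - z2)))) = 0" (is "?Z = 0")
proof -
  have "fps_X * ?Z = 0"
    using fay_fps nz nz'
    by (simp add: M_K sc_one_plus fps_const_add[symmetric] fps_const_mult[symmetric] algebra_simps del: fps_const_add fps_const_mult)
  then show ?thesis by simp
qed

lemma K_fay_deriv_aux:
  "fps_const (c + 1) * (K z2 - fps_const (c^2) * sc c (K z1) + fps_const (c^2) * sc (c + 1) (K z1) - sc (c + 1) (K z2))
   + fps_const (c + 1) * (fps_X * (fps_const c * fps_deriv (K z2) - fps_const (c^2) * sc c (fps_deriv (K z1))))
   - fps_const (c^2) * (fps_X * (fps_deriv (K (z2 - z1)) - sc c (fps_deriv (K (z1 - z2)))))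
   + fps_const (c^2 * (c + 1)) * (fps_X * (fps_X * (sc c (K z1) * fps_deriv (K z2)) - fps_X * (sc c (fps_deriv (K z1)) * K z2)
        - fps_X * (sc (c + 1) (K z1) * fps_deriv (K (z2 - z1))) + fps_X * (sc (c + 1) (K z2) * sc c (fps_deriv (K (z1 - z2)))))) = 0" (is "?Z = 0")
proof -
  have e: "fps_const (c + 1) = fps_const c + 1" "fps_const (c^2) = fps_const c * fps_const c"
    "fps_const (c^2 * (c + 1)) = fps_const c * fps_const c * (fps_const c + 1)"
    by (simp_all add: fps_const_add[symmetric] power2_eq_square fps_const_mult[symmetric] del: fps_const_add fps_const_mult)
  have d: "fps_deriv (1 + fps_X * K z) = K z + fps_X * fps_deriv (K z)"
    "sc c (K z + fps_X * fps_deriv (K z)) = sc c (K z) + fps_const c * (fps_X * sc c (fps_deriv (K z)))" for z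
    by (simp_all add: sc_add sc_X)
  note M = M_K[OF nz(1)] M_K[OF nz(2)] M_K[OF nz(3)] M_K[OF nz']
  have "fps_X * ?Z = 0"
    unfolding e by (rule fay_ring_identity[OF fay_fps[unfolded M sc_one_plus e] fay_fps_deriv[unfolded M sc_one_plus d e]])
  then show ?thesis by simp
qed

end

lemma neg_one_power_mult: "(-1) ^ p * c ^ p = (- c :: complex) ^ p"
  by (simp add: power_mult_distrib[symmetric])

lemma K_fay:
  assumes nz: "\<theta> z1 \<noteq> 0" "\<theta> z2 \<noteq> 0" "\<theta> (z2 - z1) \<noteq> 0"
  shows "c * (c + 1) * (fps_nth (K z1) d * ((c + 1) ^ d - c ^ d))
      + (c + 1) * (fps_nth (K z2) d * ((c + 1) ^ d - 1)) + c * (fps_nth (K (z2 - z1)) d * (1 - (- c) ^ d))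
      + c * (c + 1) * (\<Sum>p<d. fps_nth (K z1) p * fps_nth (K (z2 - z1)) (d - 1 - p) * (c + 1) ^ p
          - fps_nth (K z2) p * fps_nth (K z1) (d - 1 - p) * c ^ (d - 1 - p)
          - fps_nth (K z2) p * fps_nth (K (z2 - z1)) (d - 1 - p) * (-1) ^ (d - 1 - p) * ((c + 1) ^ p * c ^ (d - 1 - p))) = 0"
\<comment> \<open>The expansions require \<open>c\<close> and \<open>c + 1\<close> to be nonzero; at
  the two excluded values the identity is trivial.\<close>
proof (cases "c = 0 \<or> c + 1 = 0")
  case True
  then show ?thesis by (auto simp: eq_neg_iff_add_eq_0[symmetric])
next
  case False
  have mm: "fps_nth (K (z1 - z2)) n = - ((-1) ^ n) * fps_nth (K (z2 - z1)) n" for n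
    using K_parity[OF nz(3), of n] by simp
  \<comment> \<open>\<open>X_mult_nth\<close> gives the index \<open>p\<close> to the first factor;
    the exchange makes the sum come out with \<open>p\<close> attached to \<open>K z2\<close>, as in
    the claim.\<close>
  have com: "fps_X * (sc c (K z1) * K z2) = fps_X * (K z2 * sc c (K z1))" by (simp add: mult.commute)
  have E: "(c + 1) * (c * (c ^ d * fps_nth (K z1) d) + fps_nth (K z2) d)
     - c * (c + 1) * ((c + 1) ^ d * fps_nth (K z1) d) - c * fps_nth (K (z2 - z1)) d
     - (c + 1) * ((c + 1) ^ d * fps_nth (K z2) d) - c * (c ^ d * fps_nth (K (z1 - z2)) d)
     + c * (c + 1) * ((\<Sum>p<d. fps_nth (K z2) p * (c ^ (d - 1 - p) * fps_nth (K z1) (d - 1 - p)))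
       - (\<Sum>p<d. (c + 1) ^ p * fps_nth (K z1) p * fps_nth (K (z2 - z1)) (d - 1 - p))
       - (\<Sum>p<d. (c + 1) ^ p * fps_nth (K z2) p * (c ^ (d - 1 - p) * fps_nth (K (z1 - z2)) (d - 1 - p)))) = 0" (is "?E = 0")
    using arg_cong[OF K_fay_aux[OF nz, of c], of "\<lambda>A. fps_nth A d"] False unfolding com
    by (simp add: X_mult_nth del: fps_X_mult_nth)
  have "c * (c + 1) * (fps_nth (K z1) d * ((c + 1) ^ d - c ^ d))
      + (c + 1) * (fps_nth (K z2) d * ((c + 1) ^ d - 1)) + c * (fps_nth (K (z2 - z1)) d * (1 - (- c) ^ d))
      + c * (c + 1) * (\<Sum>p<d. fps_nth (K z1) p * fps_nth (K (z2 - z1)) (d - 1 - p) * (c + 1) ^ p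
          - fps_nth (K z2) p * fps_nth (K z1) (d - 1 - p) * c ^ (d - 1 - p)
          - fps_nth (K z2) p * fps_nth (K (z2 - z1)) (d - 1 - p) * (-1) ^ (d - 1 - p) * ((c + 1) ^ p * c ^ (d - 1 - p))) = - ?E"
    by (simp add: mm neg_one_power_mult[of _ c, symmetric] sum_subtractf sum.distrib sum_negf algebra_simps)
  then show ?thesis unfolding E by simp
qed

lemma K_fay_deriv:
  assumes nz: "\<theta> z1 \<noteq> 0" "\<theta> z2 \<noteq> 0" "\<theta> (z2 - z1) \<noteq> 0"
  defines "G \<equiv> \<lambda>z n. of_nat (Suc n) * fps_nth (K z) (Suc n)"
  shows "c^2 * (c + 1) * (fps_nth (K z1) (Suc d) * ((c + 1) ^ Suc d - c ^ Suc d - of_nat (Suc d) * c ^ d))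
      - (c + 1) * (fps_nth (K z2) (Suc d) * ((c + 1) ^ Suc d - 1 - of_nat (Suc d) * c))
      - c^2 * (G (z2 - z1) d * (1 - (- c) ^ d))
      + c^2 * (c + 1) * (\<Sum>p<d. G z2 p * fps_nth (K z1) (d - 1 - p) * c ^ (d - 1 - p)
          - G z1 p * fps_nth (K z2) (d - 1 - p) * c ^ p
          - G (z2 - z1) p * fps_nth (K z1) (d - 1 - p) * (c + 1) ^ (d - 1 - p)
          + G (z2 - z1) p * fps_nth (K z2) (d - 1 - p) * (-1) ^ p * ((c + 1) ^ (d - 1 - p) * c ^ p)) = 0"
proof (cases "c = 0 \<or> c + 1 = 0")
  case True
  then show ?thesis by (auto simp: eq_neg_iff_add_eq_0[symmetric])
next
  case False
  have G: "fps_nth (fps_deriv (K z)) n = G z n" for z n by (simp add: G_def)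
  have mm: "G (z1 - z2) n = (-1) ^ n * G (z2 - z1) n" for n
    using K_parity[OF nz(3), of "Suc n"] by (simp add: G_def)
  have K': "of_nat (Suc d) * fps_nth (K z) (Suc d) = G z d" for z by (simp add: G_def)
  have "0 = fps_nth (fps_const (c + 1) * (K z2 - fps_const (c^2) * sc c (K z1) + fps_const (c^2) * sc (c + 1) (K z1) - sc (c + 1) (K z2))
   + fps_const (c + 1) * (fps_X * (fps_const c * fps_deriv (K z2) - fps_const (c^2) * sc c (fps_deriv (K z1))))
   - fps_const (c^2) * (fps_X * (fps_deriv (K (z2 - z1)) - sc c (fps_deriv (K (z1 - z2)))))
   + fps_const (c^2 * (c + 1)) * (fps_X * (fps_X * (fps_deriv (K z2) * sc c (K z1)) - fps_X * (sc c (fps_deriv (K z1)) * K z2)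
        - fps_X * (fps_deriv (K (z2 - z1)) * sc (c + 1) (K z1)) + fps_X * (sc c (fps_deriv (K (z1 - z2))) * sc (c + 1) (K z2))))) (Suc d)"
    using K_fay_deriv_aux[OF nz, of c] False by (simp only: mult.commute[of "fps_deriv _" "sc _ _"] mult.commute[of "sc _ (fps_deriv _)" "sc _ (K _)"]) simp
  also have "\<dots> = (c + 1) * (fps_nth (K z2) (Suc d) - c^2 * (c ^ Suc d * fps_nth (K z1) (Suc d))
      + c^2 * ((c + 1) ^ Suc d * fps_nth (K z1) (Suc d)) - (c + 1) ^ Suc d * fps_nth (K z2) (Suc d))
    + (c + 1) * (c * G z2 d - c^2 * (c ^ d * G z1 d)) - c^2 * (G (z2 - z1) d - c ^ d * G (z1 - z2) d)
    + c^2 * (c + 1) * ((\<Sum>p<d. G z2 p * (c ^ (d - 1 - p) * fps_nth (K z1) (d - 1 - p)))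
      - (\<Sum>p<d. c ^ p * G z1 p * fps_nth (K z2) (d - 1 - p))
      - (\<Sum>p<d. G (z2 - z1) p * ((c + 1) ^ (d - 1 - p) * fps_nth (K z1) (d - 1 - p)))
      + (\<Sum>p<d. c ^ p * G (z1 - z2) p * ((c + 1) ^ (d - 1 - p) * fps_nth (K z2) (d - 1 - p))))"
    by (simp add: G X_mult_nth X_mult_nth_Suc del: fps_deriv_nth fps_X_mult_nth)
  finally have E: "\<dots> = 0" by (rule sym)
  have K'': "fps_nth (K z) (Suc d) * (a - b - of_nat (Suc d) * e) = fps_nth (K z) (Suc d) * (a - b) - G z d * e" for z a b e
    by (simp add: G_def algebra_simps)
  show ?thesis
    using E unfolding K'' mm
    by (simp add: neg_one_power_mult[of _ c, symmetric] sum_subtractf sum.distrib algebra_simps)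
qed

end

text \<open>The zero series is treated apart because its subdegree is 0 by convention.\<close>

lemma has_fps_expansion_shift_gen:
  fixes f :: "complex \<Rightarrow> complex"
  assumes f: "f has_fps_expansion F" and z: "\<And>i. i < n \<Longrightarrow> fps_nth F i = 0"
  shows "(\<lambda>x. if x = 0 then fps_nth F n else f x / x ^ n) has_fps_expansion fps_shift n F"
proof (cases "F = 0")
  case True
  have "eventually (\<lambda>x. f x = 0) (nhds 0)" using f True by (simp add: has_fps_expansion_0_iff)
  then have "eventually (\<lambda>x. (if x = 0 then fps_nth F n else f x / x ^ n) = 0) (nhds 0)"
    by eventually_elim (simp add: True)
  then show ?thesis using True by (simp add: has_fps_expansion_0_iff)
next
  case False
  then show ?thesis using z by (intro has_fps_expansion_shift f subdegree_geI) auto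
qed

text \<open>\<open>k\<close>, \<open>ku\<close>, \<open>ks\<close> are \<open>K z\<close> at
  \<open>x\<close>, \<open>c x\<close> and \<open>(c + 1) x\<close>; \<open>p\<close> and
  \<open>pu\<close> are the expansion of \<open>psi\<close> at \<open>x\<close> and
  \<open>c x\<close>. After \<open>M = 1 + x K\<close> an overall factor \<open>x\<close> can be
  split off.\<close>

lemma weierstrass_ring_identity:
  fixes x C k ku ks g gu p pu :: "'a::idom"
  assumes 1: "(C + 1) * (C * (x * ((1 + C * (x * ku)) * (k + x * g) - (ku + C * (x * gu)) * (1 + x * k))))
      + (1 - C * C) * ((1 + C * (x * ku)) * (1 + x * k))
    = (1 + (C + 1) * (x * ks)) * ((1 - C * C) + C * C * (x * (x * (pu - p))))" (is "?L = ?R")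
  shows "x * ((C + 1) * (k - C * C * ku) - (C + 1) * (1 - C * C) * ks
    + x * ((C + 1) * (C * g - C * C * gu) - C * C * (pu - p))
    + C * C * (C + 1) * (x * (x * (g * ku) - x * (gu * k) - x * ((pu - p) * ks)))) = 0" (is "?Z = 0")
proof -
  have "?Z = ?L - ?R" by algebra
  then show ?thesis unfolding 1 by simp
qed

section \<open>Taylor coefficients, quasi-periodicity and the Weierstrass-type identity\<close>

context theta_fun
begin

lemma kfun_expansion:
  assumes "\<theta> z \<noteq> 0"
  shows "(\<lambda>x. if x = 0 then fps_nth (K z) 0 else (m z x - 1) / x) has_fps_expansion K z"
proof -
  have "(\<lambda>x. m z x - 1) has_fps_expansion M z - 1"
    by (intro fps_expansion_intros M_expansion assms)
  then have "(\<lambda>x. if x = 0 then fps_nth (M z - 1) 1 else (m z x - 1) / x ^ 1) has_fps_expansion fps_shift 1 (M z - 1)"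
    by (rule has_fps_expansion_shift_gen) (simp add: M_0 assms)
  moreover have "fps_shift 1 (M z - 1) = K z" by (rule fps_ext) (simp add: K_def)
  moreover have "(\<lambda>x. if x = 0 then fps_nth (M z - 1) 1 else (m z x - 1) / x ^ 1)
      = (\<lambda>x. if x = 0 then fps_nth (K z) 0 else (m z x - 1) / x)" by (auto simp: K_def fun_eq_iff)
  ultimately show ?thesis by simp
qed

lemma kfun_m: "x \<noteq> 0 \<Longrightarrow> \<theta> (z + x) / (\<theta> z * \<theta> x) - 1 / x = (m z x - 1) / x"
  by (simp add: m_def u_def diff_divide_distrib)

lemma taylor_kfun:
  assumes "\<theta> z \<noteq> 0"
  shows "taylor0 (\<lambda>x. \<theta> (z + x) / (\<theta> z * \<theta> x) - 1 / x) n = fps_nth (K z) n"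
  by (rule taylor0_eqI[OF kfun_expansion[OF assms]]) (auto simp: eventually_at_filter kfun_m)

lemma taylor_gfun:
  assumes "\<theta> z \<noteq> 0"
  shows "taylor0 (\<lambda>x. deriv (\<lambda>x. \<theta> (z + x) / (\<theta> z * \<theta> x) - 1 / x) x) n = of_nat (Suc n) * fps_nth (K z) (Suc n)"
proof -
  have "taylor0 (\<lambda>x. deriv (\<lambda>x. \<theta> (z + x) / (\<theta> z * \<theta> x) - 1 / x) x) n = fps_nth (fps_deriv (K z)) n"
  proof (rule taylor0_eqI[OF has_fps_expansion_deriv[OF kfun_expansion[OF assms]]])
    have "deriv (\<lambda>x. \<theta> (z + x) / (\<theta> z * \<theta> x) - 1 / x) x =
      deriv (\<lambda>x. if x = 0 then fps_nth (K z) 0 else (m z x - 1) / x) x" if "x \<noteq> 0" for x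
    proof (rule deriv_cong_ev)
      have "eventually (\<lambda>y. y \<noteq> 0) (nhds x)" using that by (rule t1_space_nhds)
      then show "eventually (\<lambda>y. \<theta> (z + y) / (\<theta> z * \<theta> y) - 1 / y =
          (if y = 0 then fps_nth (K z) 0 else (m z y - 1) / y)) (nhds x)"
        by eventually_elim (simp add: kfun_m)
    qed simp
    then show "eventually (\<lambda>x. deriv (\<lambda>x. \<theta> (z + x) / (\<theta> z * \<theta> x) - 1 / x) x =
      deriv (\<lambda>x. if x = 0 then fps_nth (K z) 0 else (m z x - 1) / x) x) (at 0)"
      by (auto simp: eventually_at_filter)
  qed
  then show ?thesis by simp
qed

lemma M_shift_1: "M (z + 1) = M z" if "\<theta> z \<noteq> 0"
proof -
  have "m (z + 1) = m z"
  proof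
    fix x
    have "\<theta> (z + 1 + x) = - \<theta> (z + x)" using per1[of "z + x"] by (simp add: add_ac)
    then show "m (z + 1) x = m z x" by (simp add: m_def per1)
  qed
  moreover have "m (z + 1) has_fps_expansion M (z + 1)" using that by (intro M_expansion) (simp add: per1)
  ultimately show ?thesis using M_expansion[OF that] fps_expansion_unique_complex by metis
qed

text \<open>In the quotient of \<open>\<theta> (z + x)\<close> by \<open>\<theta> z\<close> the
  multipliers differ only by \<open>exp (- 2 pi i x)\<close>.\<close>

lemma M_shift_tau:
  assumes z: "\<theta> z \<noteq> 0"
  shows "M (z + \<tau>) = fps_exp (- 2 * of_real pi * \<i>) * M z"
proof -
  have nz: "\<theta> (z + \<tau>) \<noteq> 0" using z by (simp add: pertau)
  have "m (z + \<tau>) x = exp (- 2 * of_real pi * \<i> * x) * m z x" for x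
  proof -
    have e: "z + \<tau> + x = (z + x) + \<tau>" by simp
    have "\<theta> (z + \<tau> + x) = - exp (- of_real pi * \<i> * \<tau>) * exp (- 2 * of_real pi * \<i> * (z + x)) * \<theta> (z + x)"
      unfolding e by (rule pertau)
    moreover have "exp (- 2 * of_real pi * \<i> * (z + x)) = exp (- 2 * of_real pi * \<i> * z) * exp (- 2 * of_real pi * \<i> * x)"
      unfolding exp_add[symmetric] by (simp add: algebra_simps)
    ultimately show ?thesis unfolding m_def pertau by simp
  qed
  moreover have "(\<lambda>x. exp (- 2 * of_real pi * \<i> * x) * m z x) has_fps_expansion fps_exp (- 2 * of_real pi * \<i>) * M z"
    by (intro fps_expansion_intros M_expansion z)
  ultimately have "m (z + \<tau>) has_fps_expansion fps_exp (- 2 * of_real pi * \<i>) * M z" by (metis (no_types, lifting) ext)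
  with M_expansion[OF nz] show ?thesis by (rule fps_expansion_unique_complex)
qed

text \<open>With \<open>M = 1 + X K\<close> the rule for \<open>M\<close> becomes
  \<open>K (z + \<tau>) = e^(cX) K z + (e^(cX) - 1)/X\<close>. The last two terms are the
  coefficient of the derivative of \<open>(e^(cX) - 1)/X\<close>.\<close>

lemma K_shift_tau:
  assumes z: "\<theta> z \<noteq> 0"
  defines "c \<equiv> - 2 * of_real pi * \<i>" and "G \<equiv> \<lambda>z n. of_nat (Suc n) * fps_nth (K z) (Suc n)"
  shows "G (z + \<tau>) d = (\<Sum>i\<le>d. c ^ i / fact i * (G z (d - i) + c * fps_nth (K z) (d - i)))
      + c ^ (d + 2) / fact (d + 1) - c ^ (d + 2) / fact (d + 2)"
proof -
  have nz: "\<theta> (z + \<tau>) \<noteq> 0" using z by (simp add: pertau)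
  have "fps_X * K (z + \<tau>) = fps_exp c * (1 + fps_X * K z) - 1"
    using M_shift_tau[OF z] M_K[OF z] M_K[OF nz] by (simp add: c_def algebra_simps)
  also have "\<dots> = fps_X * (fps_exp c * K z) + (fps_exp c - 1)" by (simp add: algebra_simps)
  also have "fps_exp c - 1 = fps_X * fps_shift 1 (fps_exp c)" 
    by (rule fps_ext) (auto simp: gr0_conv_Suc)
  finally have "fps_X * K (z + \<tau>) = fps_X * (fps_exp c * K z + fps_shift 1 (fps_exp c))" by (simp add: algebra_simps)
  then have K': "K (z + \<tau>) = fps_exp c * K z + fps_shift 1 (fps_exp c)" by simp
  have "fps_deriv (K (z + \<tau>)) = fps_exp c * (fps_deriv (K z) + fps_const c * K z) + fps_deriv (fps_shift 1 (fps_exp c))"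
    unfolding K' by (simp add: algebra_simps)
  then have "fps_nth (fps_deriv (K (z + \<tau>))) d = fps_nth (fps_exp c * (fps_deriv (K z) + fps_const c * K z)) d
     + fps_nth (fps_deriv (fps_shift 1 (fps_exp c))) d" by simp
  moreover have "fps_nth (fps_deriv (fps_shift 1 (fps_exp c))) d = c ^ (d + 2) / fact (d + 1) - c ^ (d + 2) / fact (d + 2)"
  proof -
    have f: "fact (d + 2) = ((of_nat (d + 1) + 1) * fact (d + 1) :: complex)"
      using fact_Suc[of "d + 1"] by (simp add: add_ac)
    have "of_nat (Suc (d + 1)) \<noteq> (0 :: complex)" by (simp only: of_nat_eq_0_iff)
    then have n: "of_nat (d + 1) + 1 \<noteq> (0 :: complex)" by (simp add: add_ac)
    have gen: "N * (e / ((N + 1) * F)) = e / F - e / ((N + 1) * F)" if "N + 1 \<noteq> 0" "F \<noteq> 0" for N e F :: complex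
    proof -
      have "e / F = ((N + 1) * e) / ((N + 1) * F)" using that(1) by simp
      then show ?thesis
        by (simp only: times_divide_eq_right diff_divide_distrib[symmetric] distrib_right mult_1 add_diff_cancel_right')
    qed
    have "fps_nth (fps_deriv (fps_shift 1 (fps_exp c))) d = of_nat (d + 1) * (c ^ (d + 2) / fact (d + 2))"
      by (simp del: fact_Suc)
    then show ?thesis unfolding f using gen[OF n fact_nonzero] by (simp only:)
  qed
  moreover have "fps_nth (fps_exp c * (fps_deriv (K z) + fps_const c * K z)) d
      = (\<Sum>i\<le>d. c ^ i / fact i * (G z (d - i) + c * fps_nth (K z) (d - i)))"
    by (subst fps_mult_nth) (simp add: G_def atMost_atLeast0)
  moreover have "G (z + \<tau>) d = fps_nth (fps_deriv (K (z + \<tau>))) d" by (simp add: G_def)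
  ultimately show ?thesis by (simp only: add_diff_eq)
qed

subsection \<open>The function \<open>\<phi>\<close>\<close>

definition rho where "rho x = D 1 x / \<theta> x"
definition rho' where "rho' x = (D 2 x * \<theta> x - D 1 x ^ 2) / \<theta> x ^ 2"

lemma rho_deriv: "\<theta> x \<noteq> 0 \<Longrightarrow> (rho has_field_derivative rho' x) (at x)"
proof -
  assume "\<theta> x \<noteq> 0"
  moreover have "(\<theta> has_field_derivative D 1 x) (at x)" using D_deriv[of 0 x] by (simp add: D_0)
  moreover have "(D 1 has_field_derivative D 2 x) (at x)" using D_deriv[of 1 x] by (simp add: numeral_2_eq_2)
  ultimately have "((\<lambda>x. D 1 x / \<theta> x) has_field_derivative (D 2 x * \<theta> x - D 1 x * D 1 x) / (\<theta> x * \<theta> x)) (at x)"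
    by (intro DERIV_divide)
  then show ?thesis by (simp add: rho_def[abs_def] rho'_def power2_eq_square)
qed

lemma rho'_even: "rho' (- x) = rho' x"
  using D_parity[of 2 x] D_parity[of 1 x] by (simp add: rho'_def odd)

text \<open>\<open>Q\<close> expands \<open>q(x) = x \<theta>'(x)/\<theta>(x)\<close>, which is
  regular at 0. From \<open>x^2 rho' = x q' - q\<close> it follows that \<open>P\<close> expands
  \<open>psi\<close>.\<close>

definition Q where "Q = fps_deriv (T 0) / Uf"
definition P where "P = - fps_shift 2 (fps_X * fps_deriv Q - Q + 1)"
text \<open>This is \<open>\<phi>\<close> without its additive constant. Only differences
  \<open>psi (c t) - psi t\<close> enter the identity, so the constant may be left out here.\<close>

definition psi where "psi x = - 1 / x^2 - rho' x"

lemma psi_expansion: "(\<lambda>x. if x = 0 then fps_nth P 0 else psi x) has_fps_expansion P"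
proof -
  have D1: "D 1 has_fps_expansion fps_deriv (T 0)"
  proof -
    have "deriv \<theta> has_fps_expansion fps_deriv (T 0)"
      using has_fps_expansion_deriv[OF T_expansion[of 0]] by simp
    then show ?thesis by (simp add: D_def)
  qed
  define q where "q x = D 1 x / u x" for x
  have q: "q has_fps_expansion Q"
    unfolding q_def[abs_def] Q_def by (intro has_fps_expansion_divide' D1 u_expansion) (simp add: Uf_0)
  have Q0: "fps_nth Q 0 = 1"
    using has_fps_expansion_imp_0_eq_fps_nth_0[OF q] D_at_0 by (simp add: q_def u_def)
  have e: "(\<lambda>x. x * deriv q x - q x + 1) has_fps_expansion fps_X * fps_deriv Q - Q + 1"
    by (intro fps_expansion_intros q)
  have "(\<lambda>x. if x = 0 then fps_nth (fps_X * fps_deriv Q - Q + 1) 2 else (x * deriv q x - q x + 1) / x ^ 2)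
     has_fps_expansion fps_shift 2 (fps_X * fps_deriv Q - Q + 1)"
    by (rule has_fps_expansion_shift_gen[OF e]) (auto simp: Q0 numeral_2_eq_2 less_Suc_eq)
  then have "(\<lambda>x. - (if x = 0 then fps_nth (fps_X * fps_deriv Q - Q + 1) 2 else (x * deriv q x - q x + 1) / x ^ 2))
     has_fps_expansion P"
    unfolding P_def by (rule has_fps_expansion_minus)
  moreover have "eventually (\<lambda>x. - (if x = 0 then fps_nth (fps_X * fps_deriv Q - Q + 1) 2 else (x * deriv q x - q x + 1) / x ^ 2)
     = (if x = 0 then fps_nth P 0 else psi x)) (nhds 0)"
  proof -
    have "eventually (\<lambda>x. \<theta> x \<noteq> 0) (at 0)" using theta_small_nonzero[of 1] by simp
    then show ?thesis
      unfolding eventually_at_filter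
    proof eventually_elim
      case (elim x)
      show ?case
      proof (cases "x = 0")
        case False
        with elim have nz: "\<theta> x \<noteq> 0" by simp
        have "eventually (\<lambda>y. y \<noteq> 0) (nhds x)" using False by (rule t1_space_nhds)
        then have "eventually (\<lambda>y. q y = y * rho y) (nhds x)"
          by eventually_elim (simp add: q_def rho_def u_def)
        then have "deriv q x = deriv (\<lambda>y. y * rho y) x" by (intro deriv_cong_ev) auto
        also have "\<dots> = rho x + x * rho' x"
          by (rule DERIV_imp_deriv) (auto intro!: derivative_eq_intros rho_deriv nz)
        finally have "x * deriv q x - q x + 1 = x^2 * rho' x + 1"
          using False by (simp add: q_def rho_def u_def power2_eq_square algebra_simps)
        then show ?thesis using False by (simp add: psi_def field_simps)
      qed (simp add: P_def numeral_2_eq_2)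
    qed
  qed
  ultimately show ?thesis by (rule has_fps_expansion_cong[OF _ refl, THEN iffD1, rotated])
qed

lemma P_odd: "odd n \<Longrightarrow> fps_nth P n = 0"
proof -
  assume n: "odd n"
  have "(\<lambda>x. (\<lambda>x. if x = 0 then fps_nth P 0 else psi x) ((-1) * x)) has_fps_expansion sc (-1) P"
    by (rule sc_expansion[OF psi_expansion])
  moreover have "(\<lambda>x. (\<lambda>x. if x = 0 then fps_nth P 0 else psi x) ((-1) * x)) = (\<lambda>x. if x = 0 then fps_nth P 0 else psi x)"
    by (auto simp: fun_eq_iff psi_def rho'_even)
  ultimately have "sc (-1) P = P" using psi_expansion fps_expansion_unique_complex by metis
  then have "fps_nth (sc (-1) P) n = fps_nth P n" by simp
  then have "- fps_nth P n = fps_nth P n" using n by simp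
  then have "2 * fps_nth P n = 0" by (simp only: mult_2) (metis add.right_inverse)
  then show ?thesis by simp
qed

text \<open>The second inner summand depends on \<open>p\<close> and \<open>r\<close> only through
  \<open>p + r\<close>, so it behaves as a constant along \<open>(p - e, r + e)\<close>.\<close>

lemma fay_diag_m:
  assumes z: "\<theta> z \<noteq> 0" and nz: "\<theta> p \<noteq> 0" "\<theta> r \<noteq> 0" "\<theta> (p + r) \<noteq> 0" "\<theta> (z - p) \<noteq> 0"
  shows "(p + r) * (m z p * m z r) = p * r * (m z (p + r) * (rho p + rho r)
     + (m z (p + r) * (D 1 z / \<theta> z) - (p + r) * D 1 (z + (p + r)) / (\<theta> z * \<theta> (p + r))))"
proof -
  have x: "p \<noteq> 0" "r \<noteq> 0" "p + r \<noteq> 0" using nz theta_0 by (metis, metis, metis)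
  have "D 0 (z + p) * D 0 (z + r) * D 0 (p + r) =
    D 0 (z + p + r) * (D 1 r * D 0 z * D 0 p + D 0 r * D 1 p * D 0 z + D 0 r * D 0 p * D 1 z)
    - D 1 (z + p + r) * D 0 r * D 0 z * D 0 p"
    using z nz zeros by (intro fay_theta_diagonal) auto
  then show ?thesis
    using z nz x unfolding m_eq[OF x(1)] m_eq[OF x(2)] m_eq[OF x(3)] rho_def add.assoc[symmetric] D_0
    by (simp add: divide_simps) algebra
qed

text \<open>In terms of \<open>F(x) = m z x / x\<close> this is
  \<open>F(p) F'(r) - F'(p) F(r) = F(p + r) (rho'(r) - rho'(p))\<close>, cleared of poles. Since
  \<open>rho'\<close> is minus the Weierstrass function up to a constant, it is an addition
  theorem.\<close>

lemma fay_diag_m_deriv: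
  assumes z: "\<theta> z \<noteq> 0" and nz: "\<theta> p \<noteq> 0" "\<theta> r \<noteq> 0" "\<theta> (p + r) \<noteq> 0" "\<theta> (z - p) \<noteq> 0"
  shows "p * r * (p + r) * (m z p * deriv (m z) r - deriv (m z) p * m z r) =
    (p - r) * (p + r) * (m z p * m z r) + (p * r)^2 * m z (p + r) * (rho' r - rho' p)"
proof -
  define B where "B = {e. \<theta> (p - e) \<noteq> 0} \<inter> {e. \<theta> (r + e) \<noteq> 0} \<inter> {e. \<theta> (z - (p - e)) \<noteq> 0}"
  have c: "open {e. \<theta> (a + b * e) \<noteq> 0}" for a b
  proof -
    have "(\<lambda>e. \<theta> (a + b * e)) holomorphic_on UNIV" by (intro holomorphic_intros)
    then have "continuous_on UNIV (\<lambda>e. \<theta> (a + b * e))" by (rule holomorphic_on_imp_continuous_on)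
    then have "open ((\<lambda>e. \<theta> (a + b * e)) -` (- {0}))" by (intro open_vimage) auto
    then show ?thesis by (simp add: vimage_def)
  qed
  have oB: "open B" unfolding B_def using c[of p "-1"] c[of r 1] c[of "z - p" 1]
    by (intro open_Int) (simp_all add: algebra_simps)
  have B0: "0 \<in> B" using assms by (simp add: B_def)
  define V where "V = m z (p + r) * (D 1 z / \<theta> z) - (p + r) * D 1 (z + (p + r)) / (\<theta> z * \<theta> (p + r))"
  define L where "L e = (p + r) * (m z (p - e) * m z (r + e))" for e
  define R where "R e = (p - e) * (r + e) * (m z (p + r) * (rho (p - e) + rho (r + e)) + V)" for e
  have LR: "L e = R e" if "e \<in> B" for e
    using fay_diag_m[of z "p - e" "r + e"] that assms by (simp add: L_def R_def B_def V_def)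
  have rc: "(g has_field_derivative g') (at x) \<Longrightarrow> \<theta> (g x) \<noteq> 0 \<Longrightarrow>
    ((\<lambda>x. rho (g x)) has_field_derivative rho' (g x) * g') (at x)" for g g' x
    by (rule DERIV_chain2[OF rho_deriv])
  have "(L has_field_derivative (p + r) * (m z p * deriv (m z) r - deriv (m z) p * m z r)) (at 0)"
    unfolding L_def using assms
    by (auto intro!: derivative_eq_intros m_deriv_chain simp: algebra_simps)
  then have "(R has_field_derivative (p + r) * (m z p * deriv (m z) r - deriv (m z) p * m z r)) (at 0)"
    by (rule has_field_derivative_transform_within_open[OF _ oB B0 LR])
  moreover have "(R has_field_derivative (p - r) * (m z (p + r) * (rho p + rho r) + V)
      + p * r * (m z (p + r) * (rho' r - rho' p))) (at 0)"
    unfolding R_def using assms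
    by (auto intro!: derivative_eq_intros rc simp: algebra_simps)
  ultimately have 1: "(p + r) * (m z p * deriv (m z) r - deriv (m z) p * m z r) =
     (p - r) * (m z (p + r) * (rho p + rho r) + V) + p * r * (m z (p + r) * (rho' r - rho' p))"
    by (rule DERIV_unique)
  have 2: "(p + r) * (m z p * m z r) = p * r * (m z (p + r) * (rho p + rho r) + V)"
    unfolding V_def using assms by (rule fay_diag_m)
  show ?thesis using 1 2 by algebra
qed

lemma weierstrass_fps:
  assumes z: "\<theta> z \<noteq> 0" and c: "c \<noteq> 0" "c + 1 \<noteq> 0"
  shows "fps_const (c + 1) * (fps_const c * (fps_X * (sc c (M z) * fps_deriv (M z) - sc c (fps_deriv (M z)) * M z)))
    + fps_const (1 - c^2) * (sc c (M z) * M z) =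
    sc (c + 1) (M z) * (fps_const (1 - c^2) + fps_const (c^2) * (fps_X * (fps_X * (sc c P - P))))"
proof (rule fps_eqI_punctured)
  let ?p = "\<lambda>x. if x = 0 then fps_nth P 0 else psi x"
  show "(\<lambda>t. (c + 1) * (c * (t * (m z (c * t) * deriv (m z) t - deriv (m z) (c * t) * m z t)))
    + (1 - c^2) * (m z (c * t) * m z t)) has_fps_expansion
    fps_const (c + 1) * (fps_const c * (fps_X * (sc c (M z) * fps_deriv (M z) - sc c (fps_deriv (M z)) * M z)))
    + fps_const (1 - c^2) * (sc c (M z) * M z)"
    by (intro fps_expansion_intros sc_expansion M_expansion z)
  show "(\<lambda>t. m z ((c + 1) * t) * ((1 - c^2) + c^2 * (t * (t * (?p (c * t) - ?p t))))) has_fps_expansion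
    sc (c + 1) (M z) * (fps_const (1 - c^2) + fps_const (c^2) * (fps_X * (fps_X * (sc c P - P))))"
    by (intro fps_expansion_intros sc_expansion M_expansion z psi_expansion)
  have "eventually (\<lambda>t. \<theta> (1 * t) \<noteq> 0) (at 0)" "eventually (\<lambda>t. \<theta> ((c + 1) * t) \<noteq> 0) (at 0)"
    "eventually (\<lambda>t. \<theta> (z + (- c) * t) \<noteq> 0) (at 0)" "eventually (\<lambda>t. \<theta> (c * t) \<noteq> 0) (at 0)"
    using c z by (intro theta_small_nonzero theta_near_nonzero; simp)+
  moreover have "eventually (\<lambda>t::complex. t \<noteq> 0) (at 0)" by (simp add: eventually_at_filter)
  ultimately show "eventually (\<lambda>t. (c + 1) * (c * (t * (m z (c * t) * deriv (m z) t - deriv (m z) (c * t) * m z t)))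
    + (1 - c^2) * (m z (c * t) * m z t) =
    m z ((c + 1) * t) * ((1 - c^2) + c^2 * (t * (t * (?p (c * t) - ?p t))))) (at 0)"
  proof eventually_elim
    case (elim t)
    have e: "c * t + t = (c + 1) * t" by (simp add: distrib_right)
    have 1: "c * t * t * ((c + 1) * t) * (m z (c * t) * deriv (m z) t - deriv (m z) (c * t) * m z t) =
      (c * t - t) * ((c + 1) * t) * (m z (c * t) * m z t) + (c * t * t)^2 * m z ((c + 1) * t) * (rho' t - rho' (c * t))"
      using fay_diag_m_deriv[OF z, of "c * t" t] elim unfolding e by simp
    have p: "?p (c * t) = - 1 / (c * t)^2 - rho' (c * t)" "?p t = - 1 / t^2 - rho' t"
      using elim c by (simp_all add: psi_def)
    \<comment> \<open>The double poles in \<open>psi\<close> contribute \<open>c^2 - 1\<close>,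
      which the constant \<open>1 - c^2\<close> of the statement compensates.\<close>
    have "c^2 * (t * (t * (?p (c * t) - ?p t))) = c^2 * t^2 * (rho' t - rho' (c * t)) + (c^2 - 1)"
      unfolding p using elim c by (simp add: field_simps power2_eq_square)
    then have q: "(1 - c^2) + c^2 * (t * (t * (?p (c * t) - ?p t))) = c^2 * t^2 * (rho' t - rho' (c * t))" by simp
    have "t^2 * ((c + 1) * (c * (t * (m z (c * t) * deriv (m z) t - deriv (m z) (c * t) * m z t)))
    + (1 - c^2) * (m z (c * t) * m z t)) = t^2 * (m z ((c + 1) * t) * (c^2 * t^2 * (rho' t - rho' (c * t))))"
      using 1 by algebra
    then show ?case unfolding q using elim by simp
  qed
qed

lemma K_weierstrass:
  assumes z: "\<theta> z \<noteq> 0"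
  defines "G \<equiv> \<lambda>n. of_nat (Suc n) * fps_nth (K z) (Suc n)" and "ph \<equiv> \<lambda>n. if n = 0 then 0 else fps_nth P n"
  shows "(c + 1) * (fps_nth (K z) (Suc d) * ((c + 1) ^ Suc d - 1 - of_nat (Suc d) * c))
      - c^2 * (c + 1) * (fps_nth (K z) (Suc d) * ((c + 1) ^ Suc d - c ^ Suc d - of_nat (Suc d) * c ^ d))
      + c^2 * (ph d * (c ^ d - 1))
      + c^2 * (c + 1) * (\<Sum>p<d. G p * fps_nth (K z) (d - 1 - p) * (c ^ p - c ^ (d - 1 - p))
          - ph p * fps_nth (K z) (d - 1 - p) * ((c + 1) ^ (d - 1 - p) - (c + 1) ^ (d - 1 - p) * c ^ p)) = 0"
proof (cases "c = 0 \<or> c + 1 = 0")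
  case True
  \<comment> \<open>At \<open>c = -1\<close> only the \<open>ph d\<close> term is left, and it
    vanishes because \<open>P\<close> is even.\<close>
  have "ph d * ((-1) ^ d - 1) = 0" using P_odd[of d] by (cases "odd d") (auto simp: ph_def)
  with True show ?thesis by (auto simp: eq_neg_iff_add_eq_0[symmetric])
next
  case False
  have G: "fps_nth (fps_deriv (K z)) n = G n" for n by (simp add: G_def)
  have e: "fps_const (c + 1) = fps_const c + 1" "fps_const (c^2) = fps_const c * fps_const c"
    "fps_const (1 - c^2) = 1 - fps_const c * fps_const c"
    by (simp_all add: fps_const_add[symmetric] fps_const_sub[symmetric] power2_eq_square fps_const_mult[symmetric]
        del: fps_const_add fps_const_mult fps_const_sub)
  have d: "fps_deriv (1 + fps_X * K z) = K z + fps_X * fps_deriv (K z)"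
    "sc c (K z + fps_X * fps_deriv (K z)) = sc c (K z) + fps_const c * (fps_X * sc c (fps_deriv (K z)))"
    by (simp_all add: sc_add sc_X)
  have "fps_const (c + 1) * (K z - fps_const (c^2) * sc c (K z)) - fps_const (c + 1) * fps_const (1 - c^2) * sc (c + 1) (K z)
    + fps_X * (fps_const (c + 1) * (fps_const c * fps_deriv (K z) - fps_const (c^2) * sc c (fps_deriv (K z))) - fps_const (c^2) * (sc c P - P))
    + fps_const (c^2) * fps_const (c + 1) * (fps_X * (fps_X * (fps_deriv (K z) * sc c (K z)) - fps_X * (sc c (fps_deriv (K z)) * K z)
        - fps_X * ((sc c P - P) * sc (c + 1) (K z)))) = 0" (is "?Z = 0")
  proof -
    have "fps_X * ?Z = 0"
      unfolding e
      using weierstrass_ring_identity[OF weierstrass_fps[OF z, of c, unfolded M_K[OF z] sc_one_plus d e]] False by simp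
    then show ?thesis by simp
  qed
  then have E0: "fps_nth ?Z (Suc d) = 0" by (simp only: fps_zero_nth)
  \<comment> \<open>\<open>P\<close> and \<open>ph\<close> differ only in the coefficient of index
    0, where \<open>c ^ p - 1\<close> vanishes.\<close>
  have ph: "(c ^ p - 1) * fps_nth P p = (c ^ p - 1) * ph p" for p by (simp add: ph_def)
  have E: "(c + 1) * (fps_nth (K z) (Suc d) - c^2 * (c ^ Suc d * fps_nth (K z) (Suc d)))
     - (c + 1) * (1 - c^2) * ((c + 1) ^ Suc d * fps_nth (K z) (Suc d))
     + ((c + 1) * (c * G d - c^2 * (c ^ d * G d)) - c^2 * ((c ^ d - 1) * ph d))
     + c^2 * (c + 1) * ((\<Sum>p<d. G p * (c ^ (d - 1 - p) * fps_nth (K z) (d - 1 - p)))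
       - (\<Sum>p<d. c ^ p * G p * fps_nth (K z) (d - 1 - p))
       - (\<Sum>p<d. (c ^ p - 1) * ph p * ((c + 1) ^ (d - 1 - p) * fps_nth (K z) (d - 1 - p)))) = 0" (is "?E = 0")
  proof -
    have sp: "c ^ p * fps_nth P p - fps_nth P p = (c ^ p - 1) * ph p" for p
      using ph[of p] by (simp add: left_diff_distrib)
    have "fps_nth ?Z (Suc d) = ?E"
      by (simp add: G X_mult_nth X_mult_nth_Suc sp del: fps_deriv_nth fps_X_mult_nth)
    with E0 show ?thesis by simp
  qed
  have K'': "fps_nth (K z) (Suc d) * (a - b - of_nat (Suc d) * e) = fps_nth (K z) (Suc d) * (a - b) - G d * e" for a b e
    by (simp add: G_def algebra_simps)
  have "(c + 1) * (fps_nth (K z) (Suc d) * ((c + 1) ^ Suc d - 1 - of_nat (Suc d) * c))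
      - c^2 * (c + 1) * (fps_nth (K z) (Suc d) * ((c + 1) ^ Suc d - c ^ Suc d - of_nat (Suc d) * c ^ d))
      + c^2 * (ph d * (c ^ d - 1))
      + c^2 * (c + 1) * (\<Sum>p<d. G p * fps_nth (K z) (d - 1 - p) * (c ^ p - c ^ (d - 1 - p))
          - ph p * fps_nth (K z) (d - 1 - p) * ((c + 1) ^ (d - 1 - p) - (c + 1) ^ (d - 1 - p) * c ^ p)) = - ?E"
    unfolding K'' by (simp add: sum_subtractf sum.distrib sum_negf algebra_simps)
  then show ?thesis unfolding E by simp
qed

text \<open>The limit in the definition of \<open>\<phi>\<close> is minus the constant coefficient
  of \<open>P\<close>, so adding it removes exactly the coefficient of index 0.\<close>

lemma taylor_phi:
  defines "L \<equiv> \<lambda>x. deriv (\<lambda>w. deriv \<theta> w / \<theta> w) x"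
  shows "taylor0 (\<lambda>x. - 1 / x^2 - L x + Lim (at 0) (\<lambda>y. 1 / y^2 + L y)) n = (if n = 0 then 0 else fps_nth P n)"
proof -
  let ?p = "\<lambda>x. if x = 0 then fps_nth P 0 else psi x"
  have "rho = (\<lambda>w. deriv \<theta> w / \<theta> w)" by (auto simp: rho_def D_def)
  then have L: "L x = rho' x" if "\<theta> x \<noteq> 0" for x
    unfolding L_def using rho_deriv[OF that] by (metis DERIV_imp_deriv)
  have nz: "eventually (\<lambda>x. \<theta> x \<noteq> 0 \<and> x \<noteq> 0) (at 0)"
    using theta_small_nonzero[of 1] by (simp add: eventually_at_filter)
  have "(?p \<longlongrightarrow> ?p 0) (at 0)"
    using has_fps_expansion_imp_continuous[OF psi_expansion, of UNIV] by (simp add: continuous_within)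
  then have "((\<lambda>x. - ?p x) \<longlongrightarrow> - fps_nth P 0) (at 0)" by (intro tendsto_minus) simp
  moreover have "eventually (\<lambda>y. - ?p y = 1 / y^2 + L y) (at 0)"
    using nz by eventually_elim (simp add: L psi_def)
  ultimately have "((\<lambda>y. 1 / y^2 + L y) \<longlongrightarrow> - fps_nth P 0) (at 0)" by (rule Lim_transform_eventually)
  then have lim: "Lim (at 0) (\<lambda>y. 1 / y^2 + L y) = - fps_nth P 0" by (intro tendsto_Lim) auto
  have "(\<lambda>x. ?p x - fps_nth P 0) has_fps_expansion P - fps_const (fps_nth P 0)"
    by (intro fps_expansion_intros psi_expansion)
  then have "taylor0 (\<lambda>x. - 1 / x^2 - L x + Lim (at 0) (\<lambda>y. 1 / y^2 + L y)) n = fps_nth (P - fps_const (fps_nth P 0)) n"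
    by (rule taylor0_eqI) (use nz in \<open>eventually_elim, simp add: lim L psi_def\<close>)
  then show ?thesis by simp
qed

lemma D_expansion: "(\<lambda>x. D j (z + x)) has_fps_expansion (fps_deriv ^^ j) (T z)"
proof (induction j)
  case 0 then show ?case using T_expansion by (simp add: D_0)
next
  case (Suc j)
  have "((\<lambda>x. D j (z + x)) has_field_derivative D (Suc j) (z + x)) (at x)" for x
    by (auto intro!: derivative_eq_intros)
  then have "deriv (\<lambda>x. D j (z + x)) = (\<lambda>x. D (Suc j) (z + x))"
    by (intro ext DERIV_imp_deriv)
  with has_fps_expansion_deriv[OF Suc] show ?case by simp
qed

lemma theta_addition_fps:
  assumes z: "\<theta> z \<noteq> 0"
  shows "T z * (fps_deriv (fps_deriv (T 0)) * fps_const (D 0 z) + 2 * fps_deriv (T 0) * fps_const (D 1 z) + T 0 * fps_const (D 2 z))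
     + fps_deriv (fps_deriv (T z)) * fps_const (D 0 z) * T 0
     - 2 * fps_deriv (T z) * (fps_const (D 1 z) * T 0 + fps_const (D 0 z) * fps_deriv (T 0))
     = fps_const (D 3 0) * T 0 * fps_const (D 0 z) * T z"
proof (rule fps_eqI_punctured)
  have e: "(\<lambda>x. D 0 (w + x)) has_fps_expansion T w" "(\<lambda>x. D 1 (w + x)) has_fps_expansion fps_deriv (T w)"
    "(\<lambda>x. D 2 (w + x)) has_fps_expansion fps_deriv (fps_deriv (T w))" for w
    using D_expansion[of 0 w] D_expansion[of 1 w] D_expansion[of 2 w] by (simp_all add: numeral_2_eq_2)
  show "(\<lambda>x. D 0 (z + x) * (D 2 (0 + x) * D 0 z + 2 * D 1 (0 + x) * D 1 z + D 0 (0 + x) * D 2 z)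
     + D 2 (z + x) * D 0 z * D 0 (0 + x) - 2 * D 1 (z + x) * (D 1 z * D 0 (0 + x) + D 0 z * D 1 (0 + x))) has_fps_expansion
    T z * (fps_deriv (fps_deriv (T 0)) * fps_const (D 0 z) + 2 * fps_deriv (T 0) * fps_const (D 1 z) + T 0 * fps_const (D 2 z))
     + fps_deriv (fps_deriv (T z)) * fps_const (D 0 z) * T 0
     - 2 * fps_deriv (T z) * (fps_const (D 1 z) * T 0 + fps_const (D 0 z) * fps_deriv (T 0))"
    by (intro fps_expansion_intros e)
  show "(\<lambda>x. D 3 0 * D 0 (0 + x) * D 0 z * D 0 (z + x)) has_fps_expansion fps_const (D 3 0) * T 0 * fps_const (D 0 z) * T z"
    by (intro fps_expansion_intros e)
  have "eventually (\<lambda>x. \<theta> (1 * x) \<noteq> 0) (at 0)" "eventually (\<lambda>x. \<theta> (z + (-1) * x) \<noteq> 0) (at 0)"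
    using z by (intro theta_small_nonzero theta_near_nonzero; simp)+
  then show "eventually (\<lambda>x. D 0 (z + x) * (D 2 (0 + x) * D 0 z + 2 * D 1 (0 + x) * D 1 z + D 0 (0 + x) * D 2 z)
     + D 2 (z + x) * D 0 z * D 0 (0 + x) - 2 * D 1 (z + x) * (D 1 z * D 0 (0 + x) + D 0 z * D 1 (0 + x)) =
     D 3 0 * D 0 (0 + x) * D 0 z * D 0 (z + x)) (at 0)"
    by eventually_elim (use theta_addition[of z] z zeros in simp)
qed

end

section \<open>Differentiating families of power series\<close>

lemma DERIV_transfer_nhds:
  assumes "(f has_field_derivative d) (at x)" "eventually (\<lambda>x. f x = g x) (nhds x)"
  shows "(g has_field_derivative d) (at x)"
  using assms(1) by (rule DERIV_cong_ev[OF refl assms(2) refl, THEN iffD1])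

definition has_fps_coeff_derivative :: "(complex \<Rightarrow> complex fps) \<Rightarrow> complex fps \<Rightarrow> complex \<Rightarrow> bool" where
  "has_fps_coeff_derivative F F' s \<longleftrightarrow>
    (\<forall>n. ((\<lambda>s. fps_nth (F s) n) has_field_derivative fps_nth F' n) (at s))"

lemma fps_coeff_derivative_mult:
  assumes "has_fps_coeff_derivative F F' s" "has_fps_coeff_derivative G G' s"
  shows "has_fps_coeff_derivative (\<lambda>s. F s * G s) (F' * G s + F s * G') s"
  unfolding has_fps_coeff_derivative_def
proof
  fix n
  have "((\<lambda>s. \<Sum>i=0..n. fps_nth (F s) i * fps_nth (G s) (n - i)) has_field_derivative
     (\<Sum>i=0..n. fps_nth (F s) i * fps_nth G' (n - i) + fps_nth F' i * fps_nth (G s) (n - i))) (at s)"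
    using assms unfolding has_fps_coeff_derivative_def by (intro DERIV_sum DERIV_mult') auto
  then show "((\<lambda>s. fps_nth (F s * G s) n) has_field_derivative fps_nth (F' * G s + F s * G') n) (at s)"
    by (simp add: fps_mult_nth sum.distrib add.commute)
qed

lemma fps_coeff_derivative_unique:
  "has_fps_coeff_derivative F F' s \<Longrightarrow> has_fps_coeff_derivative F F'' s \<Longrightarrow> F' = F''"
  unfolding has_fps_coeff_derivative_def fps_eq_iff by (blast intro: DERIV_unique)

lemma fps_coeff_derivative_cong:
  assumes "has_fps_coeff_derivative F F' s" "eventually (\<lambda>s. F s = G s) (nhds s)"
  shows "has_fps_coeff_derivative G F' s"
  unfolding has_fps_coeff_derivative_def
proof
  fix n
  have "eventually (\<lambda>s. fps_nth (F s) n = fps_nth (G s) n) (nhds s)"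
    using assms(2) by eventually_elim simp
  moreover have "((\<lambda>s. fps_nth (F s) n) has_field_derivative fps_nth F' n) (at s)"
    using assms(1) by (simp add: has_fps_coeff_derivative_def)
  ultimately show "((\<lambda>s. fps_nth (G s) n) has_field_derivative fps_nth F' n) (at s)"
    by (rule DERIV_transfer_nhds[rotated])
qed

text \<open>From \<open>M * B = W\<close> the coefficient of index \<open>n\<close> of
  \<open>M\<close> is a rational expression in earlier ones, with denominator the constant
  coefficient of \<open>B\<close>. Differentiability follows by induction, and the product rule then
  determines the derivative.\<close>

lemma fps_coeff_derivative_quotient:
  assumes B: "has_fps_coeff_derivative B B' s" and W: "has_fps_coeff_derivative W W' s"
    and eq: "eventually (\<lambda>s. M s * B s = W s \<and> fps_nth (B s) 0 \<noteq> 0) (nhds s)"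
  obtains M' where "has_fps_coeff_derivative M M' s" "M' * B s + M s * B' = W'"
proof -
  have nz: "fps_nth (B s) 0 \<noteq> 0" using eventually_nhds_x_imp_x[OF eq] by simp
  have "\<exists>d. ((\<lambda>s. fps_nth (M s) n) has_field_derivative d) (at s)" for n
  proof (induction n rule: less_induct)
    case (less n)
    then obtain d where d: "\<And>i. i < n \<Longrightarrow> ((\<lambda>s. fps_nth (M s) i) has_field_derivative d i) (at s)" by metis
    let ?f = "\<lambda>s. (fps_nth (W s) n - (\<Sum>i<n. fps_nth (M s) i * fps_nth (B s) (n - i))) / fps_nth (B s) 0"
    have "?f field_differentiable (at s)"
    proof (intro field_differentiable_divide field_differentiable_diff field_differentiable_sum field_differentiable_mult nz)
      show "(\<lambda>s. fps_nth (W s) n) field_differentiable (at s)"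
        using W unfolding has_fps_coeff_derivative_def field_differentiable_def by blast
      show "(\<lambda>s. fps_nth (M s) i) field_differentiable (at s)" if "i \<in> {..<n}" for i
        using d that unfolding field_differentiable_def by blast
      show "(\<lambda>s. fps_nth (B s) (n - i)) field_differentiable (at s)" for i
        using B unfolding has_fps_coeff_derivative_def field_differentiable_def by blast
      show "(\<lambda>s. fps_nth (B s) 0) field_differentiable (at s)"
        using B unfolding has_fps_coeff_derivative_def field_differentiable_def by blast
    qed
    then have "\<exists>d. (?f has_field_derivative d) (at s)" by (simp only: field_differentiable_def)
    then obtain e where e: "(?f has_field_derivative e) (at s)" by blast
    have "eventually (\<lambda>s. ?f s = fps_nth (M s) n) (nhds s)"
      using eq
    proof eventually_elim
      case (elim s)
      then have "fps_nth (W s) n = (\<Sum>i\<le>n. fps_nth (M s) i * fps_nth (B s) (n - i))"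
        by (simp add: fps_mult_nth atMost_atLeast0 flip: elim[THEN conjunct1])
      also have "\<dots> = (\<Sum>i<n. fps_nth (M s) i * fps_nth (B s) (n - i)) + fps_nth (M s) n * fps_nth (B s) 0"
        by (simp add: lessThan_Suc_atMost[symmetric])
      finally show ?case using elim by simp
    qed
    then have "((\<lambda>s. fps_nth (M s) n) has_field_derivative e) (at s)" by (rule DERIV_transfer_nhds[OF e])
    then show ?case by blast
  qed
  then obtain d where d: "\<And>n. ((\<lambda>s. fps_nth (M s) n) has_field_derivative d n) (at s)" by metis
  have M: "has_fps_coeff_derivative M (Abs_fps d) s" using d by (simp add: has_fps_coeff_derivative_def)
  have "has_fps_coeff_derivative W (Abs_fps d * B s + M s * B') s"
    by (rule fps_coeff_derivative_cong[OF fps_coeff_derivative_mult[OF M B]]) (use eq in \<open>eventually_elim, simp\<close>)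
  with W have "Abs_fps d * B s + M s * B' = W'" by (intro fps_coeff_derivative_unique)
  with M show ?thesis by (rule that)
qed

text \<open>Here \<open>a = \<theta>(z)\<close>, \<open>t = \<theta>(x)\<close>,
  \<open>w = \<theta>(z + x)\<close>, \<open>c = \<theta>'''(0)\<close>, \<open>f = 4 pi i\<close>
  and \<open>M = x w/(a t)\<close>. Primes are derivatives in \<open>x\<close>, while
  \<open>a1\<close> and \<open>a2\<close> are the derivatives of \<open>a\<close>. \<open>e1\<close>
  and \<open>e2\<close> are the derivatives of \<open>e0\<close> in \<open>z\<close> and \<tau>, the
  latter by the heat equation, and \<open>B\<close> is the addition theorem. For
  \<open>k = (M - 1)/x\<close> the conclusion is the mixed heat equation.\<close>

lemma heat_ring_identity:
  fixes x M M' Mz Mz' Mt w w' w'' t t' t'' a a1 a2 c f :: "'a::idom"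
  assumes e0: "M * (a * t) = x * w" and e1: "Mz * (a * t) + M * (a1 * t) = x * w'"
    and e2: "f * Mt * (a * t) + M * ((a2 - c * a) * t + a * (t'' - c * t)) = x * (w'' - c * w)"
    and e0': "M' * (a * t) + M * (a * t') = w + x * w'"
    and e1': "Mz' * (a * t) + Mz * (a * t') + M' * (a1 * t) + M * (a1 * t') = w' + x * w''"
    and B: "w * (t'' * a + 2 * t' * a1 + t * a2) + w'' * a * t - 2 * w' * (a1 * t + a * t') = c * t * a * w"
    and q: "a * t \<noteq> 0"
  shows "f * (x * Mt) = 2 * (x * Mz' - Mz)"
proof -
  let ?Z = "f * (x * Mt) - 2 * (x * Mz' - Mz)"
  have "?Z * (a * t) = x * (f * Mt * (a * t)) - 2 * x * (Mz' * (a * t)) + 2 * (Mz * (a * t))"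
    by algebra
  also have "\<dots> = x * (x * (w'' - c * w) - M * ((a2 - c * a) * t + a * (t'' - c * t)))
    - 2 * x * (w' + x * w'' - Mz * (a * t') - M' * (a1 * t) - M * (a1 * t')) + 2 * (x * w' - M * (a1 * t))"
  proof -
    have "f * Mt * (a * t) = x * (w'' - c * w) - M * ((a2 - c * a) * t + a * (t'' - c * t))" using e2 by (simp add: algebra_simps)
    moreover have "Mz' * (a * t) = w' + x * w'' - Mz * (a * t') - M' * (a1 * t) - M * (a1 * t')" using e1' by (simp add: algebra_simps)
    moreover have "Mz * (a * t) = x * w' - M * (a1 * t)" using e1 by (simp add: algebra_simps)
    ultimately show ?thesis by simp
  qed
  finally have 1: "?Z * (a * t) = \<dots>" .
  have "?Z * (a * t) * (a * t) = x * (x * (w'' - c * w) * (a * t) - (M * (a * t)) * ((a2 - c * a) * t + a * (t'' - c * t)))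
    - 2 * x * ((w' + x * w'') * (a * t) - (Mz * (a * t)) * (a * t') - (M' * (a * t)) * (a1 * t) - (M * (a * t)) * (a1 * t'))
    + 2 * (x * w' * (a * t) - (M * (a * t)) * (a1 * t))"
    unfolding 1 by algebra
  also have "\<dots> = x * (x * (w'' - c * w) * (a * t) - (x * w) * ((a2 - c * a) * t + a * (t'' - c * t)))
    - 2 * x * ((w' + x * w'') * (a * t) - (x * w' - M * (a1 * t)) * (a * t') - (w + x * w' - M * (a * t')) * (a1 * t) - (x * w) * (a1 * t'))
    + 2 * (x * w' * (a * t) - (x * w) * (a1 * t))"
  proof -
    have "Mz * (a * t) = x * w' - M * (a1 * t)" using e1 by (simp add: algebra_simps)
    moreover have "M' * (a * t) = w + x * w' - M * (a * t')" using e0' by (simp add: algebra_simps)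
    ultimately show ?thesis unfolding e0 by simp
  qed
  also have "\<dots> = x * x * (c * t * a * w - (w * (t'' * a + 2 * t' * a1 + t * a2) + w'' * a * t - 2 * w' * (a1 * t + a * t')))
    + 4 * x * (x * w - M * (a * t)) * (a1 * t')"
    by algebra
  also have "\<dots> = 0" unfolding B e0 by simp
  finally have "?Z = 0" using q by (simp only: mult_eq_0_iff) blast
  then show ?thesis by simp
qed

section \<open>The functions \<open>\<theta>\<close> for varying \<open>\<tau>\<close>\<close>

locale kzb_theta =
  fixes \<theta> :: "complex \<Rightarrow> complex \<Rightarrow> complex"
  assumes theta_hol_z: "\<And>\<sigma>. Im \<sigma> > 0 \<Longrightarrow> (\<lambda>v. \<theta> v \<sigma>) holomorphic_on UNIV"
    and theta_hol_tau: "\<And>v. (\<lambda>\<sigma>. \<theta> v \<sigma>) holomorphic_on {\<sigma>. Im \<sigma> > 0}"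
    and theta_zeros: "\<And>v \<sigma>. Im \<sigma> > 0 \<Longrightarrow> (\<theta> v \<sigma> = 0 \<longleftrightarrow> v \<in> lattice \<sigma>)"
    and theta_per1: "\<And>v \<sigma>. Im \<sigma> > 0 \<Longrightarrow> \<theta> (v + 1) \<sigma> = - \<theta> v \<sigma>"
    and theta_odd: "\<And>v \<sigma>. Im \<sigma> > 0 \<Longrightarrow> \<theta> (- v) \<sigma> = - \<theta> v \<sigma>"
    and theta_pertau: "\<And>v \<sigma>. Im \<sigma> > 0 \<Longrightarrow>
          \<theta> (v + \<sigma>) \<sigma> = - exp (- of_real pi * \<i> * \<sigma>) * exp (- 2 * of_real pi * \<i> * v) * \<theta> v \<sigma>"
    and theta_norm: "\<And>\<sigma>. Im \<sigma> > 0 \<Longrightarrow> deriv (\<lambda>v. \<theta> v \<sigma>) 0 = 1"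
begin

lemma theta_fun_at: "Im \<sigma> > 0 \<Longrightarrow> theta_fun \<sigma> (\<lambda>v. \<theta> v \<sigma>)"
  using theta_hol_z theta_zeros theta_per1 theta_odd theta_pertau theta_norm
  by unfold_locales auto

definition th :: "nat \<Rightarrow> complex \<Rightarrow> complex \<Rightarrow> complex" where
  "th j v \<sigma> = theta_fun.D (\<lambda>v. \<theta> v \<sigma>) j v"

text \<open>\<open>Theta 0\<close> has the same quasi-periods and the zero at 0, so
  \<open>constant_multiple\<close> applies; the normalisation of \<open>\<theta>\<close> identifies
  the constant.\<close>

lemma th_Theta:
  assumes \<sigma>: "Im \<sigma> > 0"
  shows "Theta 1 0 \<sigma> \<noteq> 0" "th j v \<sigma> = Theta j v \<sigma> / Theta 1 0 \<sigma>"
proof -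
  interpret theta_fun \<sigma> "\<lambda>v. \<theta> v \<sigma>" using \<sigma> by (rule theta_fun_at)
  have "\<exists>c. \<forall>v. Theta 0 v \<sigma> = c * \<theta> v \<sigma>"
  proof (rule constant_multiple)
    show "(\<lambda>v. Theta 0 v \<sigma>) holomorphic_on UNIV"
      using Theta_deriv[OF \<sigma>] holomorphic_on_def field_differentiable_def by blast
    show "Theta 0 0 \<sigma> = 0" by (simp add: Theta_def)
  qed (use Theta_per1[OF \<sigma>] Theta_pertau[OF \<sigma>] in auto)
  then obtain c where c: "\<And>v. Theta 0 v \<sigma> = c * \<theta> v \<sigma>" by blast
  have "c \<noteq> 0" using Theta_nonzero[OF \<sigma>] c by auto
  have D: "Theta j v \<sigma> = c * D j v" for j v
  proof (induction j arbitrary: v)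
    case 0 then show ?case by (simp add: c D_0)
  next
    case (Suc j)
    have "((\<lambda>v. c * D j v) has_field_derivative c * D (Suc j) v) (at v)"
      by (rule DERIV_cmult[OF D_deriv])
    moreover have "((\<lambda>v. c * D j v) has_field_derivative Theta (Suc j) v \<sigma>) (at v)"
      using Theta_deriv[OF \<sigma>, of j v] unfolding Suc .
    ultimately show ?case by (rule DERIV_unique[symmetric])
  qed
  then have "Theta 1 0 \<sigma> = c" using D_at_0 by simp
  then show "Theta 1 0 \<sigma> \<noteq> 0" "th j v \<sigma> = Theta j v \<sigma> / Theta 1 0 \<sigma>"
    using \<open>c \<noteq> 0\<close> by (simp_all add: D th_def)
qed

text \<open>The series satisfies the classical heat equation; the term with \<open>th 3 0\<close>
  comes from differentiating the normalising denominator \<open>Theta 1 0\<close>.\<close>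

lemma th_deriv_tau:
  assumes \<tau>: "Im \<tau> > 0"
  shows "((\<lambda>\<sigma>. th j v \<sigma>) has_field_derivative
     (th (j + 2) v \<tau> - th 3 0 \<tau> * th j v \<tau>) / (4 * of_real pi * \<i>)) (at \<tau>)"
proof -
  let ?c = "4 * of_real pi * \<i>"
  have nz: "Theta 1 0 \<tau> \<noteq> 0" using th_Theta[OF \<tau>] by simp
  have "((\<lambda>\<sigma>. Theta j v \<sigma> / Theta 1 0 \<sigma>) has_field_derivative
     (Theta (j + 2) v \<tau> / ?c * Theta 1 0 \<tau> - Theta j v \<tau> * (Theta (1 + 2) 0 \<tau> / ?c)) / (Theta 1 0 \<tau> * Theta 1 0 \<tau>)) (at \<tau>)"
    by (intro DERIV_divide Theta_deriv_tau \<tau> nz)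
  also have "(Theta (j + 2) v \<tau> / ?c * Theta 1 0 \<tau> - Theta j v \<tau> * (Theta (1 + 2) 0 \<tau> / ?c)) / (Theta 1 0 \<tau> * Theta 1 0 \<tau>)
    = (th (j + 2) v \<tau> - th 3 0 \<tau> * th j v \<tau>) / ?c"
  proof -
    have "(p / e * q - r * (s / e)) / (q * q) = (p / q - s / q * (r / q)) / e" if "q \<noteq> 0" "e \<noteq> 0" for p q r s e :: complex
      using that by (simp add: field_simps)
    moreover have "1 + 2 = (3::nat)" "?c \<noteq> 0" by simp_all
    ultimately show ?thesis unfolding th_Theta(2)[OF \<tau>] using nz by metis
  qed
  finally have d: "((\<lambda>\<sigma>. Theta j v \<sigma> / Theta 1 0 \<sigma>) has_field_derivative (th (j + 2) v \<tau> - th 3 0 \<tau> * th j v \<tau>) / ?c) (at \<tau>)" .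
  have H: "open {\<sigma>. Im \<sigma> > 0}" by (simp add: open_halfspace_Im_gt)
  show ?thesis
    by (rule has_field_derivative_transform_within_open[OF d H]) (use \<tau> th_Theta in auto)
qed

definition Ts where "Ts \<sigma> z = theta_fun.T (\<lambda>v. \<theta> v \<sigma>) z"
definition Us where "Us \<sigma> = theta_fun.Uf (\<lambda>v. \<theta> v \<sigma>)"
definition Ms where "Ms \<sigma> z = theta_fun.M (\<lambda>v. \<theta> v \<sigma>) z"
definition Ks where "Ks \<sigma> z = theta_fun.K (\<lambda>v. \<theta> v \<sigma>) z"

lemma Ts_nth: "Im \<sigma> > 0 \<Longrightarrow> fps_nth (Ts \<sigma> z) n = th n z \<sigma> / fact n"
  unfolding Ts_def th_def by (rule theta_fun.T_nth) (rule theta_fun_at)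

lemma Us_nth: "Im \<sigma> > 0 \<Longrightarrow> fps_nth (Us \<sigma>) n = th (Suc n) 0 \<sigma> / fact (Suc n)"
  unfolding Us_def th_def
  by (simp add: theta_fun.Uf_def[OF theta_fun_at] theta_fun.T_nth[OF theta_fun_at])

lemma th_0: "Im \<sigma> > 0 \<Longrightarrow> th 0 v \<sigma> = \<theta> v \<sigma>"
  unfolding th_def using theta_fun.D_0[OF theta_fun_at] by metis

lemma theta_nz_eventually:
  assumes "Im \<tau> > 0" "\<theta> z \<tau> \<noteq> 0"
  shows "eventually (\<lambda>\<sigma>. Im \<sigma> > 0 \<and> \<theta> z \<sigma> \<noteq> 0) (nhds \<tau>)"
proof -
  have H: "open {\<sigma>. Im \<sigma> > 0}" by (simp add: open_halfspace_Im_gt)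
  have "continuous_on {\<sigma>. Im \<sigma> > 0} (\<lambda>\<sigma>. \<theta> z \<sigma>)" using theta_hol_tau by (rule holomorphic_on_imp_continuous_on)
  then have "open ({\<sigma>. Im \<sigma> > 0} \<inter> (\<lambda>\<sigma>. \<theta> z \<sigma>) -` (- {0}))"
    using H by (intro continuous_open_preimage) auto
  then have "eventually (\<lambda>\<sigma>. \<sigma> \<in> {\<sigma>. Im \<sigma> > 0} \<inter> (\<lambda>\<sigma>. \<theta> z \<sigma>) -` (- {0})) (nhds \<tau>)"
    using assms by (intro eventually_nhds_in_open) auto
  then show ?thesis by eventually_elim auto
qed

theorem mixed_heat:
  assumes \<tau>: "Im \<tau> > 0" and z: "\<theta> z \<tau> \<noteq> 0"
  obtains kz kt where "\<And>n. ((\<lambda>v. fps_nth (Ks \<tau> v) n) has_field_derivative kz n) (at z)"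
    and "\<And>n. ((\<lambda>\<sigma>. fps_nth (Ks \<sigma> z) n) has_field_derivative kt n) (at \<tau>)"
    and "\<And>n. 2 * of_real pi * \<i> * kt n = of_nat (Suc n) * kz (Suc n)"
proof -
  interpret theta_fun \<tau> "\<lambda>v. \<theta> v \<tau>" using \<tau> by (rule theta_fun_at)
  let ?e = "4 * of_real pi * \<i> :: complex"
  have e: "?e \<noteq> 0" by simp
  have ec: "?e * (v / ?e / r) = v / r" for v r :: complex by simp
  have D: "D j v = th j v \<tau>" for j v by (simp add: th_def)
  let ?a = "\<theta> z \<tau>" and ?a1 = "th 1 z \<tau>" and ?a2 = "th 2 z \<tau>" and ?c = "th 3 0 \<tau>"
  let ?w = "Ts \<tau> z" and ?t = "Ts \<tau> 0"
  have dfps: "fps_nth (fps_deriv (Ts \<tau> v)) n = th (Suc n) v \<tau> / fact n"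
    "fps_nth (fps_deriv (fps_deriv (Ts \<tau> v))) n = th (n + 2) v \<tau> / fact n" for v n
    using \<tau> by (simp_all add: Ts_nth field_simps del: of_nat_Suc)
  have T0: "?t = fps_X * Us \<tau>" unfolding Ts_def Us_def by (rule T_0)
  have Mm: "Ms \<sigma> v * (fps_const (\<theta> v \<sigma>) * Us \<sigma>) = Ts \<sigma> v \<and> fps_nth (fps_const (\<theta> v \<sigma>) * Us \<sigma>) 0 \<noteq> 0"
    if "Im \<sigma> > 0" "\<theta> v \<sigma> \<noteq> 0" for \<sigma> v
    using theta_fun.M_mult[OF theta_fun_at[OF that(1)], of v] theta_fun.Uf_0[OF theta_fun_at[OF that(1)]] that
    by (simp add: Ms_def Ts_def Us_def)
  have MK: "fps_nth (Ks \<sigma> v) n = fps_nth (Ms \<sigma> v) (Suc n)" if "Im \<sigma> > 0" for \<sigma> v n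
    using theta_fun.K_def[OF theta_fun_at[OF that]] by (simp add: Ks_def Ms_def)
  have Bz: "has_fps_coeff_derivative (\<lambda>v. fps_const (\<theta> v \<tau>) * Us \<tau>) (fps_const ?a1 * Us \<tau>) z"
  proof -
    have "((\<lambda>v. \<theta> v \<tau>) has_field_derivative ?a1) (at z)" using D_deriv[of 0 z] by (simp add: D_0 D[symmetric])
    then show ?thesis unfolding has_fps_coeff_derivative_def by (auto intro!: derivative_eq_intros)
  qed
  have Wz: "has_fps_coeff_derivative (\<lambda>v. Ts \<tau> v) (fps_deriv ?w) z"
    unfolding has_fps_coeff_derivative_def dfps Ts_nth[OF \<tau>] using D_deriv unfolding D
    by (auto intro!: DERIV_cdivide)
  have "eventually (\<lambda>v. \<theta> v \<tau> \<noteq> 0) (nhds z)"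
    using theta_near_nonzero[OF z, of 1] theta_deriv[of z] DERIV_isCont z
    by (intro tendsto_imp_eventually_ne[of _ "\<theta> z \<tau>"]) (auto simp: isCont_def tendsto_at_iff_tendsto_nhds)
  then have "eventually (\<lambda>v. Ms \<tau> v * (fps_const (\<theta> v \<tau>) * Us \<tau>) = Ts \<tau> v \<and> fps_nth (fps_const (\<theta> v \<tau>) * Us \<tau>) 0 \<noteq> 0) (nhds z)"
    by eventually_elim (use Mm[OF \<tau>] in blast)
  from fps_coeff_derivative_quotient[OF Bz Wz this] obtain Mz where
    Mz: "has_fps_coeff_derivative (\<lambda>v. Ms \<tau> v) Mz z" "Mz * (fps_const ?a * Us \<tau>) + Ms \<tau> z * (fps_const ?a1 * Us \<tau>) = fps_deriv ?w" .
  \<comment> \<open>The coefficients prescribed by \<open>th_deriv_tau\<close>, with index shifted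
    by one because \<open>Us\<close> expands \<open>\<theta>(x)/x\<close>.\<close>
  define U' where "U' = Abs_fps (\<lambda>n. (th (Suc n + 2) 0 \<tau> - ?c * th (Suc n) 0 \<tau>) / ?e / fact (Suc n))"
  have XU': "fps_const ?e * (fps_X * U') = fps_deriv (fps_deriv ?t) - fps_const ?c * ?t"
  proof (rule fps_ext)
    fix n
    show "fps_nth (fps_const ?e * (fps_X * U')) n = fps_nth (fps_deriv (fps_deriv ?t) - fps_const ?c * ?t) n"
    proof (cases n)
      case 0
      have "th 0 0 \<tau> = 0" "th 2 0 \<tau> = 0" using D_at_0(1,3) by (simp_all add: D)
      then show ?thesis unfolding 0 fps_sub_nth fps_mult_left_const_nth dfps Ts_nth[OF \<tau>] by (simp add: numeral_2_eq_2)
    next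
      case (Suc k)
      show ?thesis
        unfolding Suc fps_sub_nth fps_mult_left_const_nth dfps Ts_nth[OF \<tau>] U'_def
        by (simp only: fps_X_mult_nth fps_nth_Abs_fps ec nat.simps if_False diff_Suc_1) (simp only: diff_divide_distrib times_divide_eq_right)
    qed
  qed
  have evH: "eventually (\<lambda>\<sigma>. Im \<sigma> > 0 \<and> \<theta> z \<sigma> \<noteq> 0) (nhds \<tau>)" using \<tau> z by (rule theta_nz_eventually)
  have U: "has_fps_coeff_derivative Us U' \<tau>"
    unfolding has_fps_coeff_derivative_def
  proof
    fix n
    have d: "((\<lambda>\<sigma>. th (Suc n) 0 \<sigma> / fact (Suc n)) has_field_derivative fps_nth U' n) (at \<tau>)"
      unfolding U'_def fps_nth_Abs_fps by (intro DERIV_cdivide th_deriv_tau \<tau>)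
    have "eventually (\<lambda>\<sigma>. th (Suc n) 0 \<sigma> / fact (Suc n) = fps_nth (Us \<sigma>) n) (nhds \<tau>)"
      using evH by eventually_elim (simp add: Us_nth del: fact_Suc)
    with d show "((\<lambda>\<sigma>. fps_nth (Us \<sigma>) n) has_field_derivative fps_nth U' n) (at \<tau>)"
      by (rule DERIV_transfer_nhds)
  qed
  have C: "has_fps_coeff_derivative (\<lambda>\<sigma>. fps_const (\<theta> z \<sigma>)) (fps_const ((?a2 - ?c * ?a) / ?e)) \<tau>"
  proof -
    have "eventually (\<lambda>\<sigma>. th 0 z \<sigma> = \<theta> z \<sigma>) (nhds \<tau>)" using evH by eventually_elim (simp add: th_0)
    moreover have "((\<lambda>\<sigma>. th 0 z \<sigma>) has_field_derivative (?a2 - ?c * ?a) / ?e) (at \<tau>)"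
      using th_deriv_tau[OF \<tau>, of 0 z] by (simp add: th_0 \<tau> numeral_2_eq_2)
    ultimately have "((\<lambda>\<sigma>. \<theta> z \<sigma>) has_field_derivative (?a2 - ?c * ?a) / ?e) (at \<tau>)" by (rule DERIV_transfer_nhds[rotated])
    then show ?thesis by (auto simp: has_fps_coeff_derivative_def)
  qed
  define w' where "w' = Abs_fps (\<lambda>n. (th (n + 2) z \<tau> - ?c * th n z \<tau>) / ?e / fact n)"
  have w': "fps_const ?e * w' = fps_deriv (fps_deriv ?w) - fps_const ?c * ?w"
    by (intro fps_ext) (simp only: dfps Ts_nth[OF \<tau>] w'_def fps_mult_left_const_nth fps_nth_Abs_fps ec fps_sub_nth, simp only: diff_divide_distrib times_divide_eq_right)
  have Wt: "has_fps_coeff_derivative (\<lambda>\<sigma>. Ts \<sigma> z) w' \<tau>"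
    unfolding has_fps_coeff_derivative_def
  proof
    fix n
    have d: "((\<lambda>\<sigma>. th n z \<sigma> / fact n) has_field_derivative fps_nth w' n) (at \<tau>)"
      unfolding w'_def fps_nth_Abs_fps by (intro DERIV_cdivide th_deriv_tau \<tau>)
    have "eventually (\<lambda>\<sigma>. th n z \<sigma> / fact n = fps_nth (Ts \<sigma> z) n) (nhds \<tau>)"
      using evH by eventually_elim (simp add: Ts_nth)
    with d show "((\<lambda>\<sigma>. fps_nth (Ts \<sigma> z) n) has_field_derivative fps_nth w' n) (at \<tau>)"
      by (rule DERIV_transfer_nhds)
  qed
  have "eventually (\<lambda>\<sigma>. Ms \<sigma> z * (fps_const (\<theta> z \<sigma>) * Us \<sigma>) = Ts \<sigma> z \<and> fps_nth (fps_const (\<theta> z \<sigma>) * Us \<sigma>) 0 \<noteq> 0) (nhds \<tau>)"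
    using evH by eventually_elim (use Mm in blast)
  from fps_coeff_derivative_quotient[OF fps_coeff_derivative_mult[OF C U] Wt this] obtain Mt where
    Mt: "has_fps_coeff_derivative (\<lambda>\<sigma>. Ms \<sigma> z) Mt \<tau>"
      "Mt * (fps_const ?a * Us \<tau>) + Ms \<tau> z * (fps_const ((?a2 - ?c * ?a) / ?e) * Us \<tau> + fps_const ?a * U') = w'" .
  have "fps_const ?e * (fps_X * Mt) = 2 * (fps_X * fps_deriv Mz - Mz)"
  proof (rule heat_ring_identity[where M = "Ms \<tau> z" and M' = "fps_deriv (Ms \<tau> z)" and w = ?w and w' = "fps_deriv ?w"
      and w'' = "fps_deriv (fps_deriv ?w)" and t = ?t and t' = "fps_deriv ?t" and t'' = "fps_deriv (fps_deriv ?t)"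
      and a = "fps_const ?a" and ?a1.0 = "fps_const ?a1" and ?a2.0 = "fps_const ?a2" and c = "fps_const ?c"])
    show e0: "Ms \<tau> z * (fps_const ?a * ?t) = fps_X * ?w"
      unfolding T0 using Mm[OF \<tau> z] by (metis mult.left_commute)
    show e1: "Mz * (fps_const ?a * ?t) + Ms \<tau> z * (fps_const ?a1 * ?t) = fps_X * fps_deriv ?w"
      unfolding T0 Mz(2)[symmetric] by (simp add: algebra_simps)
    have f: "fps_const ?a2 - fps_const ?c * fps_const ?a = fps_const ?e * fps_const ((?a2 - ?c * ?a) / ?e)"
      using e by (simp add: fps_const_mult fps_const_sub)
    show "fps_const ?e * Mt * (fps_const ?a * ?t) + Ms \<tau> z * ((fps_const ?a2 - fps_const ?c * fps_const ?a) * ?t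
        + fps_const ?a * (fps_deriv (fps_deriv ?t) - fps_const ?c * ?t)) = fps_X * (fps_deriv (fps_deriv ?w) - fps_const ?c * ?w)"
      unfolding XU'[symmetric] w'[symmetric] Mt(2)[symmetric] f
      unfolding T0 by (simp only: algebra_simps)
    have "fps_deriv (Ms \<tau> z * (fps_const ?a * ?t)) = fps_deriv (fps_X * ?w)" using e0 by simp
    then show "fps_deriv (Ms \<tau> z) * (fps_const ?a * ?t) + Ms \<tau> z * (fps_const ?a * fps_deriv ?t) = ?w + fps_X * fps_deriv ?w"
      by (simp add: algebra_simps)
    have "fps_deriv (Mz * (fps_const ?a * ?t) + Ms \<tau> z * (fps_const ?a1 * ?t)) = fps_deriv (fps_X * fps_deriv ?w)" using e1 by simp
    then show "fps_deriv Mz * (fps_const ?a * ?t) + Mz * (fps_const ?a * fps_deriv ?t) + fps_deriv (Ms \<tau> z) * (fps_const ?a1 * ?t)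
        + Ms \<tau> z * (fps_const ?a1 * fps_deriv ?t) = fps_deriv ?w + fps_X * fps_deriv (fps_deriv ?w)"
      by (simp add: algebra_simps)
    show "?w * (fps_deriv (fps_deriv ?t) * fps_const ?a + 2 * fps_deriv ?t * fps_const ?a1 + ?t * fps_const ?a2)
       + fps_deriv (fps_deriv ?w) * fps_const ?a * ?t - 2 * fps_deriv ?w * (fps_const ?a1 * ?t + fps_const ?a * fps_deriv ?t)
       = fps_const ?c * ?t * fps_const ?a * ?w"
      using theta_addition_fps[OF z] unfolding D th_0[OF \<tau>] Ts_def .
    have "fps_nth (Us \<tau>) 0 = 1" unfolding Us_def by (rule Uf_0)
    then show "fps_const ?a * ?t \<noteq> 0" unfolding T0 using z by auto
  qed
  \<comment> \<open>The coefficient of index \<open>n + 2\<close>: on the right \<open>X\<close>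
    times the derivative contributes \<open>n + 2\<close> and \<open>- Mz\<close> subtracts 1, which
    gives the factor \<open>Suc n\<close>.\<close>
  then have main: "?e * fps_nth Mt (Suc n) = 2 * (of_nat (Suc n) * fps_nth Mz (Suc (Suc n)))" for n
    using arg_cong[of "fps_const ?e * (fps_X * Mt)" "2 * (fps_X * fps_deriv Mz - Mz)" "\<lambda>A. fps_nth A (Suc (Suc n))"]
    by (simp add: fps_numeral_fps_const algebra_simps)
  show ?thesis
  proof (rule that[of "\<lambda>n. fps_nth Mz (Suc n)" "\<lambda>n. fps_nth Mt (Suc n)"])
    show "((\<lambda>v. fps_nth (Ks \<tau> v) n) has_field_derivative fps_nth Mz (Suc n)) (at z)" for n
      using Mz(1) unfolding MK[OF \<tau>] has_fps_coeff_derivative_def by blast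
    have "eventually (\<lambda>\<sigma>. fps_nth (Ms \<sigma> z) (Suc n) = fps_nth (Ks \<sigma> z) n) (nhds \<tau>)" for n
      using evH by eventually_elim (simp add: MK)
    moreover have "((\<lambda>\<sigma>. fps_nth (Ms \<sigma> z) (Suc n)) has_field_derivative fps_nth Mt (Suc n)) (at \<tau>)" for n
      using Mt(1) by (simp add: has_fps_coeff_derivative_def)
    ultimately show "((\<lambda>\<sigma>. fps_nth (Ks \<sigma> z) n) has_field_derivative fps_nth Mt (Suc n)) (at \<tau>)" for n
      by (rule DERIV_transfer_nhds[rotated])
    show "2 * of_real pi * \<i> * fps_nth Mt (Suc n) = of_nat (Suc n) * fps_nth Mz (Suc (Suc n))" for n
      using main[of n] by (simp add: mult_ac)
  qed
qed

end

section \<open>The connection\<close>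

lemma DERIV_reflect:
  fixes f :: "complex \<Rightarrow> complex"
  assumes "(f has_field_derivative d) (at (c - z))"
  shows "((\<lambda>v. f (c - v)) has_field_derivative - d) (at z)"
proof -
  have "((\<lambda>v. c - v) has_field_derivative - 1) (at z)" by (auto intro!: derivative_eq_intros)
  from DERIV_chain2[of f d "\<lambda>v. c - v", OF assms this] show ?thesis by simp
qed

lemma DERIV_translate:
  fixes f :: "complex \<Rightarrow> complex"
  assumes "(f has_field_derivative d) (at (z - c))"
  shows "((\<lambda>v. f (v - c)) has_field_derivative d) (at z)"
proof -
  have "((\<lambda>v. v - c) has_field_derivative 1) (at z)" by (auto intro!: derivative_eq_intros)
  from DERIV_chain2[of f d "\<lambda>v. v - c", OF assms this] show ?thesis by simp
qed

context kzb_theta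
begin

definition dzK :: "complex \<Rightarrow> complex \<Rightarrow> nat \<Rightarrow> complex" where
  "dzK \<tau> z n = deriv (\<lambda>v. fps_nth (Ks \<tau> v) n) z"

definition dtK :: "complex \<Rightarrow> complex \<Rightarrow> nat \<Rightarrow> complex" where
  "dtK \<tau> z n = deriv (\<lambda>\<sigma>. fps_nth (Ks \<sigma> z) n) \<tau>"

lemma Ks_derivs:
  assumes "Im \<tau> > 0" "\<theta> z \<tau> \<noteq> 0"
  shows "((\<lambda>v. fps_nth (Ks \<tau> v) n) has_field_derivative dzK \<tau> z n) (at z)"
    and "((\<lambda>\<sigma>. fps_nth (Ks \<sigma> z) n) has_field_derivative dtK \<tau> z n) (at \<tau>)"
    and "2 * of_real pi * \<i> * dtK \<tau> z n = of_nat (Suc n) * dzK \<tau> z (Suc n)"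
proof -
  obtain kz kt where k: "\<And>n. ((\<lambda>v. fps_nth (Ks \<tau> v) n) has_field_derivative kz n) (at z)"
    "\<And>n. ((\<lambda>\<sigma>. fps_nth (Ks \<sigma> z) n) has_field_derivative kt n) (at \<tau>)"
    "\<And>n. 2 * of_real pi * \<i> * kt n = of_nat (Suc n) * kz (Suc n)"
    using mixed_heat[OF assms] by blast
  have "dzK \<tau> z m = kz m" "dtK \<tau> z m = kt m" for m
    unfolding dzK_def dtK_def by (rule DERIV_imp_deriv, rule k)+
  with k show "((\<lambda>v. fps_nth (Ks \<tau> v) n) has_field_derivative dzK \<tau> z n) (at z)"
    "((\<lambda>\<sigma>. fps_nth (Ks \<sigma> z) n) has_field_derivative dtK \<tau> z n) (at \<tau>)"
    "2 * of_real pi * \<i> * dtK \<tau> z n = of_nat (Suc n) * dzK \<tau> z (Suc n)" by simp_all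
qed

lemma Ks_parity:
  assumes "Im \<tau> > 0" "\<theta> z \<tau> \<noteq> 0"
  shows "fps_nth (Ks \<tau> (- z)) n = - ((-1) ^ n) * fps_nth (Ks \<tau> z) n"
  unfolding Ks_def by (rule theta_fun.K_parity[OF theta_fun_at[OF assms(1)] assms(2)])

lemma theta_uminus_nz: "Im \<tau> > 0 \<Longrightarrow> \<theta> z \<tau> \<noteq> 0 \<Longrightarrow> \<theta> (- z) \<tau> \<noteq> 0"
  using theta_odd by simp

lemma theta_nz_nhds:
  assumes "Im \<tau> > 0" "\<theta> z \<tau> \<noteq> 0"
  shows "eventually (\<lambda>v. \<theta> v \<tau> \<noteq> 0) (nhds z)"
proof -
  have "continuous_on UNIV (\<lambda>v. \<theta> v \<tau>)"
    using theta_hol_z[OF assms(1)] by (rule holomorphic_on_imp_continuous_on)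
  then have "isCont (\<lambda>v. \<theta> v \<tau>) z" by (simp add: continuous_on_eq_continuous_at)
  then have "((\<lambda>v. \<theta> v \<tau>) \<longlongrightarrow> \<theta> z \<tau>) (nhds z)" using tendsto_at_iff_tendsto_nhds[of "\<lambda>v. \<theta> v \<tau>" z] by (simp only: isCont_def)
  then show ?thesis using assms(2) by (rule tendsto_imp_eventually_ne)
qed

lemma dzK_parity:
  assumes \<tau>: "Im \<tau> > 0" and z: "\<theta> z \<tau> \<noteq> 0"
  shows "dzK \<tau> (- z) n = (-1) ^ n * dzK \<tau> z n"
proof -
  have "((\<lambda>v. fps_nth (Ks \<tau> (- v)) n) has_field_derivative - dzK \<tau> (- z) n) (at z)"
    using DERIV_reflect[of "\<lambda>v. fps_nth (Ks \<tau> v) n" _ 0 z] Ks_derivs(1)[OF \<tau> theta_uminus_nz[OF \<tau> z]] by simp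
  moreover have "((\<lambda>v. - ((-1) ^ n) * fps_nth (Ks \<tau> v) n) has_field_derivative - ((-1) ^ n) * dzK \<tau> z n) (at z)"
    by (rule DERIV_cmult[OF Ks_derivs(1)[OF \<tau> z]])
  moreover have "eventually (\<lambda>v. - ((-1) ^ n) * fps_nth (Ks \<tau> v) n = fps_nth (Ks \<tau> (- v)) n) (nhds z)"
    using theta_nz_nhds[OF \<tau> z] by eventually_elim (simp add: Ks_parity[OF \<tau>])
  ultimately have "- dzK \<tau> (- z) n = - ((-1) ^ n) * dzK \<tau> z n"
    by (blast intro: DERIV_unique DERIV_transfer_nhds)
  then show ?thesis by simp
qed

lemma kcoef_Ks:
  assumes "Im \<sigma> > 0" "\<theta> z \<sigma> \<noteq> 0"
  shows "kcoef \<theta> m z \<sigma> = fps_nth (Ks \<sigma> z) m"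
  unfolding kcoef_def kfun_def Ks_def by (rule theta_fun.taylor_kfun[OF theta_fun_at[OF assms(1)] assms(2)])

lemma gcoef_Ks:
  assumes "Im \<sigma> > 0" "\<theta> z \<sigma> \<noteq> 0"
  shows "gcoef \<theta> m z \<sigma> = of_nat (Suc m) * fps_nth (Ks \<sigma> z) (Suc m)"
  unfolding gcoef_def kfun_def Ks_def by (rule theta_fun.taylor_gfun[OF theta_fun_at[OF assms(1)] assms(2)])

definition phicoef :: "complex \<Rightarrow> nat \<Rightarrow> complex" where
  "phicoef \<sigma> m = (if m = 0 then 0 else fps_nth (theta_fun.P (\<lambda>v. \<theta> v \<sigma>)) m)"

lemma bcoef_phicoef: "Im \<sigma> > 0 \<Longrightarrow> bcoef \<theta> m \<sigma> = phicoef \<sigma> (2 * m)"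
  unfolding bcoef_def phi_def logder2_def phicoef_def by (rule theta_fun.taylor_phi[OF theta_fun_at])

lemma kcoef_deriv_z:
  assumes "Im \<tau> > 0" "\<theta> z \<tau> \<noteq> 0"
  shows "((\<lambda>v. kcoef \<theta> m v \<tau>) has_field_derivative dzK \<tau> z m) (at z)"
  by (rule DERIV_transfer_nhds[OF Ks_derivs(1)[OF assms]])
    (use theta_nz_nhds[OF assms] in \<open>eventually_elim, simp add: kcoef_Ks assms(1)\<close>)

lemma gcoef_deriv_z:
  assumes "Im \<tau> > 0" "\<theta> z \<tau> \<noteq> 0"
  shows "((\<lambda>v. gcoef \<theta> m v \<tau>) has_field_derivative of_nat (Suc m) * dzK \<tau> z (Suc m)) (at z)"
  by (rule DERIV_transfer_nhds[OF DERIV_cmult[OF Ks_derivs(1)[OF assms]]])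
    (use theta_nz_nhds[OF assms] in \<open>eventually_elim, simp add: gcoef_Ks assms(1)\<close>)

lemma kcoef_deriv_tau:
  assumes "Im \<tau> > 0" "\<theta> z \<tau> \<noteq> 0"
  shows "((\<lambda>\<sigma>. kcoef \<theta> m z \<sigma>) has_field_derivative dtK \<tau> z m) (at \<tau>)"
  by (rule DERIV_transfer_nhds[OF Ks_derivs(2)[OF assms]])
    (use theta_nz_eventually[OF assms] in \<open>eventually_elim, simp add: kcoef_Ks\<close>)

lemma gcoef_parity:
  assumes "Im \<tau> > 0" "\<theta> z \<tau> \<noteq> 0"
  shows "gcoef \<theta> m (- z) \<tau> = (-1) ^ m * gcoef \<theta> m z \<tau>"
  using Ks_parity[OF assms, of "Suc m"] by (simp add: gcoef_Ks theta_uminus_nz assms)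

lemma gcoef_shift_1:
  assumes "Im \<tau> > 0" "\<theta> z \<tau> \<noteq> 0"
  shows "gcoef \<theta> m (z + 1) \<tau> = gcoef \<theta> m z \<tau>"
proof -
  interpret t: theta_fun \<tau> "\<lambda>v. \<theta> v \<tau>" using assms(1) by (rule theta_fun_at)
  have "t.K (z + 1) = t.K z" using t.M_shift_1[OF assms(2)] by (simp add: t.K_def)
  then show ?thesis using assms theta_per1 by (simp add: gcoef_Ks Ks_def)
qed

lemma gcoef_shift_tau:
  assumes "Im \<tau> > 0" "\<theta> z \<tau> \<noteq> 0"
  defines "c \<equiv> - 2 * of_real pi * \<i>"
  shows "gcoef \<theta> d (z + \<tau>) \<tau> = (\<Sum>i\<le>d. c ^ i / fact i * (gcoef \<theta> (d - i) z \<tau> + c * kcoef \<theta> (d - i) z \<tau>))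
      + c ^ (d + 2) / fact (d + 1) - c ^ (d + 2) / fact (d + 2)"
proof -
  have "\<theta> (z + \<tau>) \<tau> \<noteq> 0" using theta_pertau assms by simp
  then show ?thesis
    using theta_fun.K_shift_tau[OF theta_fun_at[OF assms(1)] assms(2), of d]
    by (simp only: gcoef_Ks kcoef_Ks assms(1,2) Ks_def c_def not_False_eq_True)
qed

end

section \<open>The connection forms at a given point\<close>

lemma Kbar_word:
  "Kbar \<theta> n i z \<tau> w = - yy i w +
     (\<Sum>j\<in>{1..n} - {i}. \<Sum>m\<le>wdeg w. kcoef \<theta> m (z i - z j) \<tau> * ad_pow (xx i) m (tt i j) w)"
  unfolding Kbar_def tser_def[symmetric] by (simp add: sadd_def sneg_def sfin_def tser_word)

lemma Deltabar_word:
  "Deltabar \<theta> n z \<tau> w =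
     - 1 / (2 * of_real pi * \<i>) * (sD0 w + ssuminf (\<lambda>m. sscale (bcoef \<theta> (Suc m) \<tau>) (sdel (Suc m))) w)
     + 1 / (2 * of_real pi * \<i>) * (\<Sum>(j,l)\<in>upairs {1..n}. \<Sum>m\<le>wdeg w. gcoef \<theta> m (z j - z l) \<tau> * ad_pow (xx j) m (tt j l) w)"
  unfolding Deltabar_def gsum_def tser_def[symmetric] upairs_def[symmetric]
  by (simp add: sadd_def sscale_def sfin_def tser_word case_prod_beta del: sum.insert)

text \<open>Keeps the simplifier from turning \<open>{1..n}\<close> into \<open>{Suc 0..n}\<close>, which no longer matches the
  interpretation below.\<close>
declare One_nat_def [simp del]

locale kzb_point = kzb_theta +
  fixes n :: nat and z :: "nat \<Rightarrow> complex" and \<tau> :: complex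
  assumes tau_pos: "Im \<tau> > 0"
    and off_diag: "\<forall>i\<in>{1..n}. \<forall>j\<in>{1..n}. i \<noteq> j \<longrightarrow> z i - z j \<notin> lattice \<tau>"
begin

lemma theta_nz: "i \<in> {1..n} \<Longrightarrow> j \<in> {1..n} \<Longrightarrow> i \<noteq> j \<Longrightarrow> \<theta> (z i - z j) \<tau> \<noteq> 0"
  using off_diag theta_zeros[OF tau_pos] by blast

sublocale alg: kzb_tau "{1..n}" "\<lambda>i. inL n (xx i)" "\<lambda>i. inL n (yy i)" "\<lambda>i j. inL n (tt i j)"
  "inL n sD0" "\<lambda>m. inL n (sdel m)"
  "\<lambda>i j m. kcoef \<theta> m (z i - z j) \<tau>" "phicoef \<tau>" "\<lambda>i j m. gcoef \<theta> m (z i - z j) \<tau>"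
proof -
  interpret t: theta_fun \<tau> "\<lambda>v. \<theta> v \<tau>" using tau_pos by (rule theta_fun_at)
  note co = kcoef_Ks[OF tau_pos] gcoef_Ks[OF tau_pos]
  show "kzb_tau {1..n} (\<lambda>i. inL n (xx i)) (\<lambda>i. inL n (yy i)) (\<lambda>i j. inL n (tt i j)) (inL n sD0)
     (\<lambda>m. inL n (sdel m)) (\<lambda>i j m. kcoef \<theta> m (z i - z j) \<tau>) (phicoef \<tau>) (\<lambda>i j m. gcoef \<theta> m (z i - z j) \<tau>)"
  proof (intro kzb_tau.intro kzb_flat.intro kzb_algebra_inL kzb_flat_axioms.intro kzb_tau_axioms.intro)
    fix i j l m d :: nat and u :: complex
    show "kcoef \<theta> m (z j - z i) \<tau> = - ((-1) ^ m) * kcoef \<theta> m (z i - z j) \<tau>"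
      if "distinct [i,j]" "{i,j} \<subseteq> {1..n}"
      using that theta_nz[of i j] theta_nz[of j i] Ks_parity[OF tau_pos, of "z i - z j" m] by (simp add: co)
    show "gcoef \<theta> m (z i - z j) \<tau> = of_nat (Suc m) * kcoef \<theta> (Suc m) (z i - z j) \<tau>"
      if "distinct [i,j]" "{i,j} \<subseteq> {1..n}"
      using that theta_nz[of i j] by (simp add: co)
    show "phicoef \<tau> 0 = 0" by (simp add: phicoef_def)
    show "phicoef \<tau> m = 0" if "odd m" using t.P_odd[OF that] by (simp add: phicoef_def)
    note nz = theta_nz[of i j] theta_nz[of i l] theta_nz[of j l]
    \<comment> \<open>The identities are taken at \<open>z1 = z i - z j\<close> and
      \<open>z2 = z i - z l\<close>, so that \<open>z2 - z1\<close> belongs to the pair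
      \<open>j, l\<close>.\<close>
    have e: "(z i - z l) - (z i - z j) = z j - z l" by simp
    show "u * (u + 1) * (kcoef \<theta> d (z i - z j) \<tau> * ((u + 1) ^ d - u ^ d)) +
       (u + 1) * (kcoef \<theta> d (z i - z l) \<tau> * ((u + 1) ^ d - 1)) +
       u * (kcoef \<theta> d (z j - z l) \<tau> * (1 - (- u) ^ d)) +
       u * (u + 1) * (\<Sum>p<d. kcoef \<theta> p (z i - z j) \<tau> * kcoef \<theta> (d - 1 - p) (z j - z l) \<tau> * (u + 1) ^ p -
           kcoef \<theta> p (z i - z l) \<tau> * kcoef \<theta> (d - 1 - p) (z i - z j) \<tau> * u ^ (d - 1 - p) -
           kcoef \<theta> p (z i - z l) \<tau> * kcoef \<theta> (d - 1 - p) (z j - z l) \<tau> * (-1) ^ (d - 1 - p) * ((u + 1) ^ p * u ^ (d - 1 - p))) = 0"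
      if "distinct [i,j,l]" "{i,j,l} \<subseteq> {1..n}"
    proof -
      have "\<theta> (z i - z j) \<tau> \<noteq> 0" "\<theta> (z i - z l) \<tau> \<noteq> 0" "\<theta> (z j - z l) \<tau> \<noteq> 0" using nz that by simp_all
      with t.K_fay[of "z i - z j" "z i - z l" u d] show ?thesis unfolding e by (simp only: co Ks_def not_False_eq_True simp_thms)
    qed
    show "u^2 * (u + 1) * (kcoef \<theta> (Suc d) (z i - z j) \<tau> * ((u + 1) ^ Suc d - u ^ Suc d - of_nat (Suc d) * u ^ d)) -
       (u + 1) * (kcoef \<theta> (Suc d) (z i - z l) \<tau> * ((u + 1) ^ Suc d - 1 - of_nat (Suc d) * u)) -
       u^2 * (gcoef \<theta> d (z j - z l) \<tau> * (1 - (- u) ^ d)) +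
       u^2 * (u + 1) * (\<Sum>p<d. gcoef \<theta> p (z i - z l) \<tau> * kcoef \<theta> (d - 1 - p) (z i - z j) \<tau> * u ^ (d - 1 - p) -
           gcoef \<theta> p (z i - z j) \<tau> * kcoef \<theta> (d - 1 - p) (z i - z l) \<tau> * u ^ p -
           gcoef \<theta> p (z j - z l) \<tau> * kcoef \<theta> (d - 1 - p) (z i - z j) \<tau> * (u + 1) ^ (d - 1 - p) +
           gcoef \<theta> p (z j - z l) \<tau> * kcoef \<theta> (d - 1 - p) (z i - z l) \<tau> * (-1) ^ p * ((u + 1) ^ (d - 1 - p) * u ^ p)) = 0"
      if "distinct [i,j,l]" "{i,j,l} \<subseteq> {1..n}"
    proof -
      have "\<theta> (z i - z j) \<tau> \<noteq> 0" "\<theta> (z i - z l) \<tau> \<noteq> 0" "\<theta> (z j - z l) \<tau> \<noteq> 0" using nz that by simp_all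
      with t.K_fay_deriv[of "z i - z j" "z i - z l" u d] show ?thesis unfolding e by (simp only: co Ks_def not_False_eq_True simp_thms)
    qed
    show "(u + 1) * (kcoef \<theta> (Suc d) (z i - z j) \<tau> * ((u + 1) ^ Suc d - 1 - of_nat (Suc d) * u)) -
       u^2 * (u + 1) * (kcoef \<theta> (Suc d) (z i - z j) \<tau> * ((u + 1) ^ Suc d - u ^ Suc d - of_nat (Suc d) * u ^ d)) +
       u^2 * (phicoef \<tau> d * (u ^ d - 1)) +
       u^2 * (u + 1) * (\<Sum>p<d. gcoef \<theta> p (z i - z j) \<tau> * kcoef \<theta> (d - 1 - p) (z i - z j) \<tau> * (u ^ p - u ^ (d - 1 - p)) -
           phicoef \<tau> p * kcoef \<theta> (d - 1 - p) (z i - z j) \<tau> * ((u + 1) ^ (d - 1 - p) - (u + 1) ^ (d - 1 - p) * u ^ p)) = 0"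
      if "distinct [i,j]" "{i,j} \<subseteq> {1..n}"
    proof -
      have "\<theta> (z i - z j) \<tau> \<noteq> 0" using nz that by simp
      with t.K_weierstrass[of "z i - z j" u d] show ?thesis by (simp only: co Ks_def phicoef_def not_False_eq_True simp_thms)
    qed
  qed
qed

lemma rep_tser_sum:
  assumes "i \<in> {1..n}"
  shows "rep n (sfin (\<lambda>j. tser (c j) i j) ({1..n} - {i}))
    (\<lambda>N. if N \<ge> 2 then \<Sum>j\<in>{1..n} - {i}. cscale (c j (N - 2)) (alg.tm i j (N - 2)) else 0)"
proof (rule rep_cong[OF rep_fin])
  show "rep n (tser (c j) i j) (\<lambda>N. if N \<ge> 2 then cscale (c j (N - 2)) (alg.tm i j (N - 2)) else 0)"
    if "j \<in> {1..n} - {i}" for j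
    unfolding alg.tm_def using assms that by (intro rep_tser) auto
qed auto

lemma rep_tser_pairs:
  "rep n (sfin (\<lambda>(j,l). tser (c j l) j l) (upairs {1..n})) (\<lambda>N. if N \<ge> 2 then alg.Gg c (N - 2) else 0)"
proof (rule rep_cong[OF rep_fin])
  show "rep n (case jl of (j,l) \<Rightarrow> tser (c j l) j l)
      (\<lambda>N. case jl of (j,l) \<Rightarrow> if N \<ge> 2 then cscale (c j l (N - 2)) (alg.tm j l (N - 2)) else 0)"
    if "jl \<in> upairs {1..n}" for jl
    unfolding alg.tm_def using that by (cases jl) (auto simp: upairs_def intro!: rep_tser)
qed (auto simp: alg.Gg_def)

lemma rep_Kbar:
  assumes "i \<in> {1..n}"
  shows "rep n (Kbar \<theta> n i z \<tau>) (alg.Kc i)"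
  unfolding Kbar_def tser_def[symmetric]
proof (rule rep_cong[OF rep_add[OF rep_neg[OF rep_gen] rep_tser_sum[OF assms]]])
  show "valid_gen n (Gy i)" using assms by simp
qed (auto simp: alg.Kc_def alg.Kt_def alg.kt_def)

text \<open>\<open>z'\<close> is arbitrary because the shifted point is needed as well; the parts
  with \<open>D0\<close> and \<open>Dl\<close> depend on \<tau> alone.\<close>

lemma rep_Deltabar:
  "rep n (Deltabar \<theta> n z' \<tau>) (\<lambda>N. cscale (1 / (2 * of_real pi * \<i>))
     (if N = 0 then - inL n sD0 else if N \<ge> 2 then alg.Gg (\<lambda>j l m. gcoef \<theta> m (z' j - z' l) \<tau>) (N - 2) - alg.Dl (N - 2) else 0))"
  unfolding Deltabar_def gsum_def tser_def[symmetric] upairs_def[symmetric]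
proof (rule rep_cong[OF rep_add[OF rep_scale[OF rep_add[OF rep_gen rep_delser]] rep_scale[OF rep_tser_pairs]]])
  show "valid_gen n GD0" by simp
  fix N
  have 1: "cscale (- 1 / (2 * of_real pi * \<i>)) v = cscale (1 / (2 * of_real pi * \<i>)) (- v)" for v
    by (simp add: cvec.scale_minus_right cvec.scale_minus_left[symmetric] del: cvec.scale_minus_left)
  show "cscale (- 1 / (2 * of_real pi * \<i>)) ((if N = gdeg GD0 then inL n sD0 else 0)
       + (if even N \<and> N \<ge> 4 then cscale (bcoef \<theta> ((N - 2) div 2) \<tau>) (inL n (sdel ((N - 2) div 2))) else 0))
     + cscale (1 / (2 * of_real pi * \<i>)) (if N \<ge> 2 then alg.Gg (\<lambda>j l m. gcoef \<theta> m (z' j - z' l) \<tau>) (N - 2) else 0)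
    = cscale (1 / (2 * of_real pi * \<i>)) (if N = 0 then - inL n sD0 else if N \<ge> 2 then
         alg.Gg (\<lambda>j l m. gcoef \<theta> m (z' j - z' l) \<tau>) (N - 2) - alg.Dl (N - 2) else 0)"
    unfolding 1 cvec.scale_right_distrib[symmetric]
    by (rule arg_cong[where f = "cscale (1 / (2 * of_real pi * \<i>))"]) (auto simp: alg.Dl_def bcoef_phicoef[OF tau_pos])
qed

lemma rep_Deltabar': "rep n (Deltabar \<theta> n z \<tau>) (\<lambda>N. cscale (1 / (2 * of_real pi * \<i>)) (alg.Dc N))"
  by (rule rep_cong[OF rep_Deltabar]) (simp add: alg.Dc_def alg.Gt_Gg)

lemma dtau_Kbar:
  assumes "i \<in> {1..n}"
  shows "dtau (Kbar \<theta> n i) z \<tau> = sfin (\<lambda>j. tser (dtK \<tau> (z i - z j)) i j) ({1..n} - {i})"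
proof
  fix w
  have "((\<lambda>\<sigma>. Kbar \<theta> n i z \<sigma> w) has_field_derivative
     0 + (\<Sum>j\<in>{1..n} - {i}. \<Sum>m\<le>wdeg w. dtK \<tau> (z i - z j) m * ad_pow (xx i) m (tt i j) w)) (at \<tau>)"
    unfolding Kbar_word
    by (intro DERIV_add DERIV_sum DERIV_cmult_right DERIV_const kcoef_deriv_tau tau_pos theta_nz assms) auto
  then show "dtau (Kbar \<theta> n i) z \<tau> w = sfin (\<lambda>j. tser (dtK \<tau> (z i - z j)) i j) ({1..n} - {i}) w"
    unfolding dtau_def by (simp add: DERIV_imp_deriv sfin_def tser_word)
qed

lemma dz_Kbar:
  assumes ij: "i \<in> {1..n}" "j \<in> {1..n}" "i \<noteq> j"
  shows "dz j (Kbar \<theta> n i) z \<tau> = sfin (\<lambda>l. tser (\<lambda>m. if l = j then - dzK \<tau> (z i - z j) m else 0) i l) ({1..n} - {i})"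
proof
  fix w
  have "((\<lambda>v. kcoef \<theta> m ((z(j := v)) i - (z(j := v)) l) \<tau>) has_field_derivative (if l = j then - dzK \<tau> (z i - z j) m else 0)) (at (z j))"
    for l m
  proof (cases "l = j")
    case True
    have "((\<lambda>v. kcoef \<theta> m (z i - v) \<tau>) has_field_derivative - dzK \<tau> (z i - z j) m) (at (z j))"
      by (rule DERIV_reflect[OF kcoef_deriv_z[OF tau_pos theta_nz[OF ij]]])
    with True ij show ?thesis by simp
  qed (use ij in simp)
  then have "((\<lambda>v. Kbar \<theta> n i (z(j := v)) \<tau> w) has_field_derivative
     0 + (\<Sum>l\<in>{1..n} - {i}. \<Sum>m\<le>wdeg w. (if l = j then - dzK \<tau> (z i - z j) m else 0) * ad_pow (xx i) m (tt i l) w)) (at (z j))"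
    unfolding Kbar_word by (intro DERIV_add DERIV_sum DERIV_cmult_right DERIV_const)
  then show "dz j (Kbar \<theta> n i) z \<tau> w = sfin (\<lambda>l. tser (\<lambda>m. if l = j then - dzK \<tau> (z i - z j) m else 0) i l) ({1..n} - {i}) w"
    unfolding dz_def by (simp only: DERIV_imp_deriv sfin_def tser_word add_0_left)
qed

lemma rep_dz_Kbar:
  assumes ij: "i \<in> {1..n}" "j \<in> {1..n}" "i \<noteq> j"
  shows "rep n (dz j (Kbar \<theta> n i) z \<tau>)
    (\<lambda>N. if N \<ge> 2 then - cscale (dzK \<tau> (z i - z j) (N - 2)) (alg.tm i j (N - 2)) else 0)"
  unfolding dz_Kbar[OF ij]
proof (rule rep_cong[OF rep_tser_sum[OF ij(1)]])
  fix N
  have "(\<Sum>l\<in>{1..n} - {i}. cscale (if l = j then - dzK \<tau> (z i - z j) (N - 2) else 0) (alg.tm i l (N - 2)))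
    = (\<Sum>l\<in>{1..n} - {i}. if l = j then - cscale (dzK \<tau> (z i - z j) (N - 2)) (alg.tm i j (N - 2)) else 0)"
    by (intro sum.cong) auto
  then show "(if N \<ge> 2 then \<Sum>l\<in>{1..n} - {i}. cscale (if l = j then - dzK \<tau> (z i - z j) (N - 2) else 0) (alg.tm i l (N - 2)) else 0)
    = (if N \<ge> 2 then - cscale (dzK \<tau> (z i - z j) (N - 2)) (alg.tm i j (N - 2)) else 0)"
    using ij by (simp add: sum.delta)
qed

definition dG :: "nat \<Rightarrow> nat \<Rightarrow> nat \<Rightarrow> nat \<Rightarrow> complex" where
  "dG i j l m = (if j = i then of_nat (Suc m) * dzK \<tau> (z j - z l) (Suc m)
     else if l = i then - (of_nat (Suc m) * dzK \<tau> (z j - z l) (Suc m)) else 0)"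

lemma dz_Deltabar:
  assumes i: "i \<in> {1..n}"
  shows "dz i (Deltabar \<theta> n) z \<tau> =
    sscale (1 / (2 * of_real pi * \<i>)) (sfin (\<lambda>(j,l). tser (dG i j l) j l) (upairs {1..n}))"
proof
  fix w
  have *: "((\<lambda>v. gcoef \<theta> m ((z(i := v)) j - (z(i := v)) l) \<tau>) has_field_derivative dG i j l m) (at (z i))"
    if "(j,l) \<in> upairs {1..n}" for j l m
  proof -
    have jl: "j \<in> {1..n}" "l \<in> {1..n}" "j \<noteq> l" using that by (auto simp: upairs_def)
    consider "j = i" | "j \<noteq> i" "l = i" | "j \<noteq> i" "l \<noteq> i" by blast
    then show ?thesis
    proof cases
      case 1
      have "((\<lambda>v. gcoef \<theta> m (v - z l) \<tau>) has_field_derivative of_nat (Suc m) * dzK \<tau> (z j - z l) (Suc m)) (at (z j))"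
        by (rule DERIV_translate[OF gcoef_deriv_z[OF tau_pos theta_nz[OF jl]]])
      with 1 jl show ?thesis by (simp add: dG_def)
    next
      case 2
      have "((\<lambda>v. gcoef \<theta> m (z j - v) \<tau>) has_field_derivative - (of_nat (Suc m) * dzK \<tau> (z j - z l) (Suc m))) (at (z l))"
        by (rule DERIV_reflect[OF gcoef_deriv_z[OF tau_pos theta_nz[OF jl]]])
      with 2 jl show ?thesis by (simp add: dG_def)
    qed (simp add: dG_def)
  qed
  have "((\<lambda>v. Deltabar \<theta> n (z(i := v)) \<tau> w) has_field_derivative
     0 + 1 / (2 * of_real pi * \<i>) * (\<Sum>p\<in>upairs {1..n}. \<Sum>m\<le>wdeg w. dG i (fst p) (snd p) m * ad_pow (xx (fst p)) m (tt (fst p) (snd p)) w)) (at (z i))"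
    unfolding Deltabar_word case_prod_beta
    by (intro DERIV_add DERIV_sum DERIV_cmult_right DERIV_cmult DERIV_const *) simp
  then show "dz i (Deltabar \<theta> n) z \<tau> w =
    sscale (1 / (2 * of_real pi * \<i>)) (sfin (\<lambda>(j,l). tser (dG i j l) j l) (upairs {1..n})) w"
    unfolding dz_def by (simp only: DERIV_imp_deriv sscale_def sfin_def tser_word add_0_left case_prod_beta)
qed

text \<open>Parity collects all pairs containing \<open>i\<close> into the form
  \<open>(i, j)\<close>; the mixed heat equation then matches the derivative of Delta in
  \<open>z i\<close> with that of \<open>K\<close> in \<tau>.\<close>

lemma Gg_dG:
  assumes i: "i \<in> {1..n}"
  shows "alg.Gg (dG i) m = cscale (2 * of_real pi * \<i>) (\<Sum>j\<in>{1..n} - {i}. cscale (dtK \<tau> (z i - z j) m) (alg.tm i j m))"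
proof -
  have "alg.Gg (dG i) m = (\<Sum>j\<in>{1..n} - {i}. cscale (dG i i j m) (alg.tm i j m))
    + (\<Sum>(j,l)\<in>upairs ({1..n} - {i}). cscale (dG i j l m) (alg.tm j l m))"
  proof (rule alg.Gg_split[OF i])
    fix j assume j: "j \<in> {1..n}" "j \<noteq> i"
    have "dzK \<tau> (z j - z i) (Suc m) = (-1) ^ Suc m * dzK \<tau> (z i - z j) (Suc m)"
      using dzK_parity[OF tau_pos theta_nz[OF i j(1)], of "Suc m"] j by simp
    with j show "dG i j i m = (-1) ^ m * dG i i j m" by (simp add: dG_def)
  qed
  also have "(\<Sum>(j,l)\<in>upairs ({1..n} - {i}). cscale (dG i j l m) (alg.tm j l m)) = 0"
    by (intro sum.neutral) (auto simp: upairs_def dG_def)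
  also have "(\<Sum>j\<in>{1..n} - {i}. cscale (dG i i j m) (alg.tm i j m))
    = (\<Sum>j\<in>{1..n} - {i}. cscale (2 * of_real pi * \<i>) (cscale (dtK \<tau> (z i - z j) m) (alg.tm i j m)))"
  proof (intro sum.cong refl)
    fix j assume "j \<in> {1..n} - {i}"
    then have "\<theta> (z i - z j) \<tau> \<noteq> 0" using theta_nz[OF i] by auto
    from Ks_derivs(3)[OF tau_pos this, of m] have "dG i i j m = 2 * of_real pi * \<i> * dtK \<tau> (z i - z j) m"
      by (simp add: dG_def)
    then show "cscale (dG i i j m) (alg.tm i j m) = cscale (2 * of_real pi * \<i>) (cscale (dtK \<tau> (z i - z j) m) (alg.tm i j m))"
      by (simp only: cvec.scale_scale)
  qed
  finally show ?thesis by (simp add: cvec.scale_sum_right)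
qed

theorem flat_tau:
  assumes i: "i \<in> {1..n}"
  shows "lzero n (sadd (ssub (dz i (Deltabar \<theta> n) z \<tau>) (dtau (Kbar \<theta> n i) z \<tau>))
                      (sbr (Deltabar \<theta> n z \<tau>) (Kbar \<theta> n i z \<tau>)))"
proof (rule rep_lzero, rule rep_cong)
  show "rep n (sadd (ssub (dz i (Deltabar \<theta> n) z \<tau>) (dtau (Kbar \<theta> n i) z \<tau>))
                      (sbr (Deltabar \<theta> n z \<tau>) (Kbar \<theta> n i z \<tau>)))
    (\<lambda>N. cscale (1 / (2 * of_real pi * \<i>)) (if N \<ge> 2 then alg.Gg (dG i) (N - 2) else 0)
       - (if N \<ge> 2 then \<Sum>j\<in>{1..n} - {i}. cscale (dtK \<tau> (z i - z j) (N - 2)) (alg.tm i j (N - 2)) else 0)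
       + (\<Sum>p\<le>N. br (cscale (1 / (2 * of_real pi * \<i>)) (alg.Dc p)) (alg.Kc i (N - p))))"
    unfolding dz_Deltabar[OF i] dtau_Kbar[OF i]
    by (intro rep_add rep_sub rep_br rep_scale rep_tser_pairs rep_tser_sum rep_Deltabar' rep_Kbar i)
  show "cscale (1 / (2 * of_real pi * \<i>)) (if N \<ge> 2 then alg.Gg (dG i) (N - 2) else 0)
       - (if N \<ge> 2 then \<Sum>j\<in>{1..n} - {i}. cscale (dtK \<tau> (z i - z j) (N - 2)) (alg.tm i j (N - 2)) else 0)
       + (\<Sum>p\<le>N. br (cscale (1 / (2 * of_real pi * \<i>)) (alg.Dc p)) (alg.Kc i (N - p))) = 0" for N
    \<comment> \<open>\<open>Gg_dG\<close> cancels the two derivative terms, and the convolution of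
      brackets vanishes by itself.\<close>
    using alg.Dc_flat[OF i, of N] by (simp add: Gg_dG[OF i] br_scale_left cvec.scale_sum_right[symmetric])
qed

theorem flat_z:
  assumes i: "i \<in> {1..n}" and j: "j \<in> {1..n}"
  shows "lzero n (sadd (ssub (dz j (Kbar \<theta> n i) z \<tau>) (dz i (Kbar \<theta> n j) z \<tau>))
                      (sbr (Kbar \<theta> n i z \<tau>) (Kbar \<theta> n j z \<tau>)))"
proof (cases "i = j")
  case True
  then have "sadd (ssub (dz j (Kbar \<theta> n i) z \<tau>) (dz i (Kbar \<theta> n j) z \<tau>)) (sbr (Kbar \<theta> n i z \<tau>) (Kbar \<theta> n j z \<tau>)) = (\<lambda>w. 0)"
    by (simp add: sbr_self ssub_def sadd_def)
  then show ?thesis by (simp add: lzero_def lideal.zero)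
next
  case ne: False
  \<comment> \<open>The sign \<open>(-1) ^ m\<close> from the parity of the derivative meets the
    same sign from \<open>tm_swap\<close>, so the two derivative terms are equal.\<close>
  have tm: "cscale (dzK \<tau> (z j - z i) m) (alg.tm j i m) = cscale (dzK \<tau> (z i - z j) m) (alg.tm i j m)" for m
  proof -
    have "dzK \<tau> (z j - z i) m = (-1) ^ m * dzK \<tau> (z i - z j) m"
      using dzK_parity[OF tau_pos theta_nz[OF i j ne], of m] by simp
    moreover have "(-1) ^ m * (-1) ^ m = (1::complex)" by (simp add: power_mult_distrib[symmetric])
    then have "(-1) ^ m * dzK \<tau> (z i - z j) m * (-1) ^ m = dzK \<tau> (z i - z j) m" by (simp add: mult.assoc mult.left_commute)
    ultimately show ?thesis using alg.tm_swap[OF ne[symmetric] j i] by simp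
  qed
  show ?thesis
  proof (rule rep_lzero, rule rep_cong)
    show "rep n (sadd (ssub (dz j (Kbar \<theta> n i) z \<tau>) (dz i (Kbar \<theta> n j) z \<tau>)) (sbr (Kbar \<theta> n i z \<tau>) (Kbar \<theta> n j z \<tau>)))
     (\<lambda>N. (if N \<ge> 2 then - cscale (dzK \<tau> (z i - z j) (N - 2)) (alg.tm i j (N - 2)) else 0)
        - (if N \<ge> 2 then - cscale (dzK \<tau> (z j - z i) (N - 2)) (alg.tm j i (N - 2)) else 0)
        + (\<Sum>p\<le>N. br (alg.Kc i p) (alg.Kc j (N - p))))"
      by (intro rep_add rep_sub rep_br rep_Kbar rep_dz_Kbar i j ne ne[symmetric])
    show "(if N \<ge> 2 then - cscale (dzK \<tau> (z i - z j) (N - 2)) (alg.tm i j (N - 2)) else 0)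
        - (if N \<ge> 2 then - cscale (dzK \<tau> (z j - z i) (N - 2)) (alg.tm j i (N - 2)) else 0)
        + (\<Sum>p\<le>N. br (alg.Kc i p) (alg.Kc j (N - p))) = 0" for N
      by (simp only: tm alg.Kc_flat[OF i j] diff_self add_0_left)
  qed
qed

lemma leq_refl: "leq n a a"
  by (simp add: leq_def ssub_def lzero_def lideal.zero)

lemma Deltabar_shift_1:
  assumes "i \<in> {1..n}"
  shows "Deltabar \<theta> n (z(i := z i + 1)) \<tau> = Deltabar \<theta> n z \<tau>"
proof
  fix w
  have "gcoef \<theta> m ((z(i := z i + 1)) j - (z(i := z i + 1)) l) \<tau> = gcoef \<theta> m (z j - z l) \<tau>"
    if "(j,l) \<in> upairs {1..n}" for j l m
  proof -
    have jl: "j \<in> {1..n}" "l \<in> {1..n}" "j \<noteq> l" using that by (auto simp: upairs_def)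
    note nz = theta_nz[OF jl] theta_nz[OF jl(2,1) jl(3)[symmetric]]
    consider "j = i" | "j \<noteq> i" "l = i" | "j \<noteq> i" "l \<noteq> i" by blast
    then show ?thesis
    proof cases
      case 1
      then have "(z(i := z i + 1)) j - (z(i := z i + 1)) l = (z j - z l) + 1" using jl by simp
      then show ?thesis using gcoef_shift_1[OF tau_pos nz(1)] by metis
    next
      case 2
      \<comment> \<open>In this case the difference decreases by 1, so periodicity is applied at the
        shifted difference.\<close>
      have "z j - z l = (z j - z l - 1) + 1" by simp
      moreover have "\<theta> (z j - z l - 1) \<tau> \<noteq> 0" using nz(1) theta_per1[OF tau_pos, of "z j - z l - 1"] by simp
      ultimately have "gcoef \<theta> m (z j - z l) \<tau> = gcoef \<theta> m (z j - z l - 1) \<tau>"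
        using gcoef_shift_1[OF tau_pos] by metis
      with 2 jl show ?thesis by (simp add: diff_diff_eq)
    qed simp
  qed
  then show "Deltabar \<theta> n (z(i := z i + 1)) \<tau> w = Deltabar \<theta> n z \<tau> w"
    unfolding Deltabar_word by (intro arg_cong2[where f = "(+)"] arg_cong2[where f = "(*)"] refl sum.cong) auto
qed

lemma Deltabar_shift_tau:
  assumes i: "i \<in> {1..n}"
  shows "leq n (Deltabar \<theta> n (z(i := z i + \<tau>)) \<tau>)
             (exp_ad (- 2 * of_real pi * \<i>) (xx i) (ssub (Deltabar \<theta> n z \<tau>) (Kbar \<theta> n i z \<tau>)))"
proof -
  let ?p = "2 * of_real pi * \<i> :: complex"
  define c where "c = - 2 * of_real pi * \<i>"
  define z' where "z' = z(i := z i + \<tau>)"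
  define \<gamma>' where "\<gamma>' = (\<lambda>j l m. gcoef \<theta> m (z' j - z' l) \<tau>)"
  have r: "rep n (ssub (Deltabar \<theta> n z' \<tau>) (exp_ad c (xx i) (ssub (Deltabar \<theta> n z \<tau>) (Kbar \<theta> n i z \<tau>))))
    (\<lambda>N. cscale (1 / ?p) (if N = 0 then - inL n sD0 else if N \<ge> 2 then alg.Gg \<gamma>' (N - 2) - alg.Dl (N - 2) else 0)
      - (\<Sum>m\<le>N. cscale (c ^ m / fact m) (adp (inL n (xx i)) m (cscale (1 / ?p) (alg.Dc (N - m)) - alg.Kc i (N - m)))))"
    unfolding \<gamma>'_def by (intro rep_sub rep_Deltabar rep_exp_ad rep_Deltabar' rep_Kbar i)
  have "(if N = 0 then - inL n sD0 else if N \<ge> 2 then alg.Gg \<gamma>' (N - 2) - alg.Dl (N - 2) else 0)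
    = (\<Sum>m\<le>N. cscale (c ^ m / fact m) (adp (inL n (xx i)) m (alg.Dc (N - m) + cscale c (alg.Kc i (N - m)))))" for N
  proof (rule alg.Dc_shift[OF i])
    fix j m
    show "\<gamma>' j l m = gcoef \<theta> m (z j - z l) \<tau>" if "j \<noteq> i" "l \<noteq> i" for l
      using that by (simp add: \<gamma>'_def z'_def)
    assume j: "j \<in> {1..n}" "j \<noteq> i"
    note nz = theta_nz[OF i j(1) j(2)[symmetric]]
    have e: "z' i - z' j = (z i - z j) + \<tau>" using j by (simp add: z'_def)
    have nz': "\<theta> (z' i - z' j) \<tau> \<noteq> 0" unfolding e using nz theta_pertau[OF tau_pos] by simp
    show "\<gamma>' j i m = (-1) ^ m * \<gamma>' i j m"
      using gcoef_parity[OF tau_pos nz', of m] by (simp add: \<gamma>'_def)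
    show "\<gamma>' i j m = (\<Sum>k\<le>m. c ^ k / fact k * (gcoef \<theta> (m - k) (z i - z j) \<tau> + c * kcoef \<theta> (m - k) (z i - z j) \<tau>))
      + c ^ (m + 2) / fact (m + 1) - c ^ (m + 2) / fact (m + 2)"
      unfolding \<gamma>'_def e c_def by (rule gcoef_shift_tau[OF tau_pos nz])
  qed
  moreover have "cscale (1 / ?p) (\<Sum>m\<le>N. cscale (c ^ m / fact m) (adp (inL n (xx i)) m (alg.Dc (N - m) + cscale c (alg.Kc i (N - m)))))
    = (\<Sum>m\<le>N. cscale (c ^ m / fact m) (adp (inL n (xx i)) m (cscale (1 / ?p) (alg.Dc (N - m)) - alg.Kc i (N - m))))" for N
  proof -
    \<comment> \<open>This sign turns the added multiple of \<open>Kc\<close> in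
      \<open>Dc_shift\<close> into the subtracted \<open>K\<close> of the claim.\<close>
    have "1 / ?p * c = -1" by (simp add: c_def)
    then have "cscale (1 / ?p) (a + cscale c b) = cscale (1 / ?p) a - b" for a b
      by (simp only: cvec.scale_right_distrib cvec.scale_scale) simp
    moreover have "cscale s (cscale q (adp a m b)) = cscale q (adp a m (cscale s b))" for s q a m b
      by (simp add: adp_scale mult.commute)
    ultimately show ?thesis by (simp only: cvec.scale_sum_right)
  qed
  ultimately have "lzero n (ssub (Deltabar \<theta> n z' \<tau>) (exp_ad c (xx i) (ssub (Deltabar \<theta> n z \<tau>) (Kbar \<theta> n i z \<tau>))))"
    by (intro rep_lzero rep_cong[OF r]) simp
  then show ?thesis unfolding leq_def c_def z'_def .
qed

end

theorem mainTheorem7: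
  fixes \<theta> :: "complex \<Rightarrow> complex \<Rightarrow> complex"
    and n :: nat and z :: "nat \<Rightarrow> complex" and \<tau> :: complex
  assumes theta_hol_z: "\<And>\<sigma>. Im \<sigma> > 0 \<Longrightarrow> (\<lambda>v. \<theta> v \<sigma>) holomorphic_on UNIV"
    and theta_hol_tau: "\<And>v. (\<lambda>\<sigma>. \<theta> v \<sigma>) holomorphic_on {\<sigma>. Im \<sigma> > 0}"
    and theta_zeros: "\<And>v \<sigma>. Im \<sigma> > 0 \<Longrightarrow> (\<theta> v \<sigma> = 0 \<longleftrightarrow> v \<in> lattice \<sigma>)"
    and theta_per1: "\<And>v \<sigma>. Im \<sigma> > 0 \<Longrightarrow> \<theta> (v + 1) \<sigma> = - \<theta> v \<sigma>"
    and theta_odd: "\<And>v \<sigma>. Im \<sigma> > 0 \<Longrightarrow> \<theta> (- v) \<sigma> = - \<theta> v \<sigma>"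
    and theta_pertau: "\<And>v \<sigma>. Im \<sigma> > 0 \<Longrightarrow>
          \<theta> (v + \<sigma>) \<sigma> = - exp (- of_real pi * \<i> * \<sigma>) * exp (- 2 * of_real pi * \<i> * v) * \<theta> v \<sigma>"
    and theta_norm: "\<And>\<sigma>. Im \<sigma> > 0 \<Longrightarrow> deriv (\<lambda>v. \<theta> v \<sigma>) 0 = 1"
    and tau_pos: "Im \<tau> > 0"
    and off_diag: "\<forall>i\<in>{1..n}. \<forall>j\<in>{1..n}. i \<noteq> j \<longrightarrow> z i - z j \<notin> lattice \<tau>"
  shows
    "(\<forall>i\<in>{1..n}.
        lzero n (sadd (ssub (dz i (Deltabar \<theta> n) z \<tau>) (dtau (Kbar \<theta> n i) z \<tau>))
                      (sbr (Deltabar \<theta> n z \<tau>) (Kbar \<theta> n i z \<tau>))))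
   \<and> (\<forall>i\<in>{1..n}. \<forall>j\<in>{1..n}.
        lzero n (sadd (ssub (dz j (Kbar \<theta> n i) z \<tau>) (dz i (Kbar \<theta> n j) z \<tau>))
                      (sbr (Kbar \<theta> n i z \<tau>) (Kbar \<theta> n j z \<tau>))))
   \<and> (\<forall>i\<in>{1..n}. \<forall>u::complex.
        leq n (Deltabar \<theta> n (z(i := z i + 1)) \<tau>) (Deltabar \<theta> n z \<tau>)
      \<and> leq n (Deltabar \<theta> n (\<lambda>j. z j + u) \<tau>) (Deltabar \<theta> n z \<tau>)
      \<and> leq n (Deltabar \<theta> n (z(i := z i + \<tau>)) \<tau>)
             (exp_ad (- 2 * of_real pi * \<i>) (xx i) (ssub (Deltabar \<theta> n z \<tau>) (Kbar \<theta> n i z \<tau>))))"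
proof -
  interpret kzb_point \<theta> n z \<tau>
    by unfold_locales (use assms in auto)
  have "Deltabar \<theta> n (\<lambda>j. z j + u) \<tau> = Deltabar \<theta> n z \<tau>" for u
    by (simp add: Deltabar_def gsum_def)
  then show ?thesis
    using flat_tau flat_z Deltabar_shift_tau by (auto simp: Deltabar_shift_1 leq_refl)
qed

end
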